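(* For every finite set $P$ in $\mathbb{R}^2$ there exists a path reporting distance oracle $\mathcal{D}$ which can be constructed in $O(|P|\log|P|)$ time and using $O(|P|)$ space. The basic structure of $\mathcal{D}$ is a union of two trees on $P$. For every subsequent query, consisting of points $a,b\in P$, the data structure $\mathcal{D}$ outputs a path $\pi_{a,b}$ of stretch $4\sqrt{26}$ in time $O(|\pi_{a,b}|)$, where $|\pi_{a,b}|$ is the number of edges in $\pi_{a,b}$.
   Context: A path reporting distance oracle for a finite $P\subset\mathbb{R}^2$ is a data structure, obtained by preprocessing $P$ (in the centralized sequential model), that, given a query of two points $a,b\in P$, outputs a path between $a$ and $b$ whose length approximates the Euclidean distance $\|a-b\|$. A path from $a$ to $b$ has stretch $t$ if its length (sum of Euclidean lengths of its edges) is at most $t\cdot\|a-b\|$. "Union of two trees" means two spanning trees with vertex set $P$ and Euclidean edge weights, augmented with additional information of total size $O(|P|)$; output paths are paths in one of these trees. *)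

theory Defs
  imports "HOL-Analysis.Analysis" "HOL-Library.Landau_Symbols"
begin

section \<open>Paths and trees\<close>

text \<open>
  An undirected simple graph on a vertex set \<open>V\<close> is given by its set \<open>E\<close> of edges, each a
  two-element subset of \<open>V\<close>.  A path or cycle is the list of its vertices in order of traversal.
\<close>

definition is_path :: "'a set \<Rightarrow> 'a set set \<Rightarrow> 'a \<Rightarrow> 'a list \<Rightarrow> 'a \<Rightarrow> bool" where
  "is_path V E a \<pi> b \<longleftrightarrow>
     \<pi> \<noteq> [] \<and> hd \<pi> = a \<and> last \<pi> = b \<and> set \<pi> \<subseteq> V \<and> distinct \<pi> \<and>
     successively (\<lambda>u v. {u, v} \<in> E) \<pi>"

definition is_cycle :: "'a set set \<Rightarrow> 'a list \<Rightarrow> bool" where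
  "is_cycle E c \<longleftrightarrow>
     3 \<le> length c \<and> distinct c \<and> successively (\<lambda>u v. {u, v} \<in> E) c \<and> {last c, hd c} \<in> E"

text \<open>The graph with no vertices counts as a tree, so that the empty point set is not excluded.\<close>

definition spanning_tree :: "'a set \<Rightarrow> 'a set set \<Rightarrow> bool" where
  "spanning_tree V E \<longleftrightarrow>
     E \<subseteq> {{u, v} | u v. u \<in> V \<and> v \<in> V \<and> u \<noteq> v} \<and>
     (\<forall>u\<in>V. \<forall>v\<in>V. \<exists>\<pi>. is_path V E u \<pi> v) \<and>
     (\<nexists>c. is_cycle E c)"

definition num_edges :: "'a list \<Rightarrow> nat" where
  "num_edges \<pi> = length \<pi> - 1"

definition path_length :: "'a::metric_space list \<Rightarrow> real" where
  "path_length \<pi> = (\<Sum>(u, v)\<leftarrow>zip \<pi> (tl \<pi>). dist u v)"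

definition has_stretch :: "real \<Rightarrow> 'a::metric_space \<Rightarrow> 'a list \<Rightarrow> 'a \<Rightarrow> bool" where
  "has_stretch t a \<pi> b \<longleftrightarrow> path_length \<pi> \<le> t * dist a b"


section \<open>The real RAM\<close>

text \<open>
  The sequential model is the unit-cost real RAM of computational geometry: exact arithmetic and
  comparisons on reals and indirect addressing by natural numbers, together with the usual optional
  primitives square root, exponential, logarithm and floor (the last being customary for
  grids and quadtrees).  Programs are structured.  A program mentions only finitely many registers;
  these are not counted as memory.  The only constants are integers, so that a program
  cannot hide an infinite amount of information in a real constant.
\<close>

datatype binop = Add | Sub | Mul | Div

datatype unop = Sqrt | Exp | Ln | Floor

datatype test = Less nat nat | Equal nat nat

datatype com =
    Skip
  | Const nat int
  | Move nat nat
  | Binary binop nat nat nat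
  | Unary unop nat nat
  | Load nat nat
  | Store nat nat
  | Seq com com
  | If test com com
  | While test com

text \<open>An operation applied outside its domain has no result: the machine is stuck.\<close>

fun binop_val :: "binop \<Rightarrow> real \<Rightarrow> real \<Rightarrow> real option" where
  "binop_val Add x y = Some (x + y)"
| "binop_val Sub x y = Some (x - y)"
| "binop_val Mul x y = Some (x * y)"
| "binop_val Div x y = (if y = 0 then None else Some (x / y))"

fun unop_val :: "unop \<Rightarrow> real \<Rightarrow> real option" where
  "unop_val Sqrt x = (if x < 0 then None else Some (sqrt x))"
| "unop_val Exp x = Some (exp x)"
| "unop_val Ln x = (if x \<le> 0 then None else Some (ln x))"
| "unop_val Floor x = Some (of_int \<lfloor>x\<rfloor>)"

fun test_val :: "test \<Rightarrow> (nat \<Rightarrow> real) \<Rightarrow> bool" where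
  "test_val (Less i j) r \<longleftrightarrow> r i < r j"
| "test_val (Equal i j) r \<longleftrightarrow> r i = r j"

text \<open>A state consists of the contents of the registers and of the memory cells.\<close>

type_synonym state = "(nat \<Rightarrow> real) \<times> (nat \<Rightarrow> real)"

text \<open>
  \<open>exec M c s t s'\<close>: on a machine whose memory consists of the cells \<open>0, \<dots>, M - 1\<close>, program \<open>c\<close>
  started in \<open>s\<close> halts in \<open>s'\<close> after exactly \<open>t\<close> unit-cost steps.  There is no derivation if \<open>c\<close>
  diverges, applies an operation outside its domain, or uses as an address anything
  but a natural number below \<open>M\<close>.
\<close>

inductive exec :: "nat \<Rightarrow> com \<Rightarrow> state \<Rightarrow> nat \<Rightarrow> state \<Rightarrow> bool" for M :: nat where
  Skip: "exec M Skip s 1 s"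
| Const: "exec M (Const i k) (r, h) 1 (r(i := of_int k), h)"
| Move: "exec M (Move i j) (r, h) 1 (r(i := r j), h)"
| Binary: "binop_val f (r j) (r k) = Some x \<Longrightarrow> exec M (Binary f i j k) (r, h) 1 (r(i := x), h)"
| Unary: "unop_val f (r j) = Some x \<Longrightarrow> exec M (Unary f i j) (r, h) 1 (r(i := x), h)"
| Load: "r j = real a \<Longrightarrow> a < M \<Longrightarrow> exec M (Load i j) (r, h) 1 (r(i := h a), h)"
| Store: "r i = real a \<Longrightarrow> a < M \<Longrightarrow> exec M (Store i j) (r, h) 1 (r, h(a := r j))"
| Seq: "exec M c1 s t1 s1 \<Longrightarrow> exec M c2 s1 t2 s2 \<Longrightarrow> exec M (Seq c1 c2) s (t1 + t2) s2"
| IfTrue: "test_val b (fst s) \<Longrightarrow> exec M c1 s t s' \<Longrightarrow> exec M (If b c1 c2) s (t + 1) s'"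
| IfFalse: "\<not> test_val b (fst s) \<Longrightarrow> exec M c2 s t s' \<Longrightarrow> exec M (If b c1 c2) s (t + 1) s'"
| WhileFalse: "\<not> test_val b (fst s) \<Longrightarrow> exec M (While b c) s 1 s"
| WhileTrue: "test_val b (fst s) \<Longrightarrow> exec M c s t1 s1 \<Longrightarrow> exec M (While b c) s1 t2 s2 \<Longrightarrow>
    exec M (While b c) s (t1 + t2 + 1) s2"

inductive_cases exec_SkipE: "exec M Skip s t s'"
  and exec_ConstE: "exec M (Const i k) s t s'"
  and exec_MoveE: "exec M (Move i j) s t s'"
  and exec_BinaryE: "exec M (Binary f i j k) s t s'"
  and exec_UnaryE: "exec M (Unary f i j) s t s'"
  and exec_LoadE: "exec M (Load i j) s t s'"
  and exec_StoreE: "exec M (Store i j) s t s'"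
  and exec_SeqE: "exec M (Seq c1 c2) s t s'"
  and exec_IfE: "exec M (If b c1 c2) s t s'"
  and exec_WhileE: "exec M (While b c) s t s'"

text \<open>Programs are deterministic, so the existence of a halting execution pins down the result
  and the running time.\<close>

lemma exec_deterministic:
  "exec M c s t s' \<Longrightarrow> exec M c s u s'' \<Longrightarrow> u = t \<and> s'' = s'"
proof (induction arbitrary: u s'' rule: exec.induct)
  case (Skip s)
  then show ?case by (auto elim: exec_SkipE)
next
  case (Const i k r h)
  then show ?case by (auto elim: exec_ConstE)
next
  case (Move i j r h)
  then show ?case by (auto elim: exec_MoveE)
next
  case (Binary f r j k x i h)
  from Binary.prems Binary.hyps show ?case by (auto elim!: exec_BinaryE)
next
  case (Unary f r j x i h)
  from Unary.prems Unary.hyps show ?case by (auto elim!: exec_UnaryE)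
next
  case (Load r j a i h)
  from Load.prems Load.hyps show ?case by (auto elim!: exec_LoadE)
next
  case (Store r i a j h)
  from Store.prems Store.hyps show ?case by (auto elim!: exec_StoreE)
next
  case (Seq c1 s t1 s1 c2 t2 s2)
  from Seq.prems obtain u1 v u2
    where "exec M c1 s u1 v" "exec M c2 v u2 s''" "u = u1 + u2"
    by (rule exec_SeqE)
  with Seq.IH show ?case by metis
next
  case (IfTrue b s c1 t s' c2)
  from IfTrue.prems IfTrue.hyps(1) obtain v where "exec M c1 s v s''" "u = v + 1"
    by (auto elim: exec_IfE)
  with IfTrue.IH show ?case by metis
next
  case (IfFalse b s c2 t s' c1)
  from IfFalse.prems IfFalse.hyps(1) obtain v where "exec M c2 s v s''" "u = v + 1"
    by (auto elim: exec_IfE)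
  with IfFalse.IH show ?case by metis
next
  case (WhileFalse b s c)
  from WhileFalse.prems WhileFalse.hyps show ?case by (auto elim: exec_WhileE)
next
  case (WhileTrue b s c t1 s1 t2 s2)
  from WhileTrue.prems WhileTrue.hyps(1) obtain u1 v u2
    where "exec M c s u1 v" "exec M (While b c) v u2 s''" "u = u1 + u2 + 1"
    by (auto elim: exec_WhileE)
  with WhileTrue.IH show ?case by metis
qed


section \<open>Path reporting distance oracles\<close>

text \<open>
  The point set is presented as an array \<open>ps\<close> of its points, in arbitrary order.  Cells \<open>2 * k\<close> and
  \<open>2 * k + 1\<close> initially hold the coordinates of point \<open>ps ! k\<close>, and register \<open>0\<close> the number of points.
  Afterwards points are referred to by their index in \<open>ps\<close>.
\<close>

definition input_state :: "(real^2) list \<Rightarrow> state" where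
  "input_state ps =
     ((\<lambda>i. if i = 0 then real (length ps) else 0),
      (\<lambda>a. if a < 2 * length ps
           then (if even a then ps ! (a div 2) $ 1 else ps ! (a div 2) $ 2) else 0))"

text \<open>From address \<open>b\<close> on, before address \<open>n\<close>, the memory contains the list of the edges \<open>E\<close> of a
  tree on the points \<open>ps\<close>, each as the pair of indices of its end points.\<close>

definition stores_edges :: "(nat \<Rightarrow> real) \<Rightarrow> nat \<Rightarrow> nat \<Rightarrow> 'a list \<Rightarrow> 'a set set \<Rightarrow> bool" where
  "stores_edges h b n ps E \<longleftrightarrow>
     (\<exists>es :: (nat \<times> nat) list.
        length es = length ps - 1 \<and> b + 2 * length es \<le> n \<and>
        (\<forall>(i, j) \<in> set es. i < length ps \<and> j < length ps) \<and>
        (\<forall>k < length es. h (b + 2 * k) = real (fst (es ! k)) \<and>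
                         h (b + 2 * k + 1) = real (snd (es ! k))) \<and>
        E = (\<lambda>(i, j). {ps ! i, ps ! j}) ` set es)"

text \<open>From address \<open>b\<close> on, the memory contains the vertices of the path \<open>\<pi>\<close>, as indices.\<close>

definition stores_path :: "(nat \<Rightarrow> real) \<Rightarrow> nat \<Rightarrow> 'a list \<Rightarrow> 'a list \<Rightarrow> bool" where
  "stores_path h b ps \<pi> \<longleftrightarrow>
     (\<forall>k < length \<pi>. \<exists>i < length ps. h (b + k) = real i \<and> \<pi> ! k = ps ! i)"

text \<open>
  The data structure occupies the cells below \<open>n\<close> of the memory \<open>D\<close>; it includes the
  two trees \<open>E1\<close> and \<open>E2\<close> and whatever additional information the query program needs.
  A query receives \<open>n\<close> and the indices of \<open>a\<close> and \<open>b\<close> in registers \<open>0\<close>, \<open>1\<close>, \<open>2\<close>.  It leaves the address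
  and the number of vertices of the output path in registers \<open>0\<close> and \<open>1\<close>.
  The other registers and the cells from \<open>n\<close> on have arbitrary contents initially (for example, left
  by earlier queries), and the data structure must be intact afterwards; so any sequence of
  queries can be answered.
\<close>

definition answers_query ::
    "com \<Rightarrow> nat \<Rightarrow> (nat \<Rightarrow> nat) \<Rightarrow> real \<Rightarrow> (real^2) list \<Rightarrow> (nat \<Rightarrow> real) \<Rightarrow> nat \<Rightarrow>
     (real^2) set set \<Rightarrow> (real^2) set set \<Rightarrow> nat \<Rightarrow> nat \<Rightarrow> bool" where
  "answers_query qry M Q s ps D n E1 E2 i j \<longleftrightarrow>
     (\<forall>r h. r 0 = real n \<and> r 1 = real i \<and> r 2 = real j \<and> (\<forall>k < n. h k = D k) \<longrightarrow>
        (\<exists>t r' h' b \<pi>.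
           exec M qry (r, h) t (r', h') \<and>
           (\<forall>k < n. h' k = D k) \<and>
           r' 0 = real b \<and> r' 1 = real (length \<pi>) \<and> b + length \<pi> \<le> M \<and>
           stores_path h' b ps \<pi> \<and>
           (is_path (set ps) E1 (ps ! i) \<pi> (ps ! j) \<or> is_path (set ps) E2 (ps ! i) \<pi> (ps ! j)) \<and>
           has_stretch s (ps ! i) \<pi> (ps ! j) \<and>
           t \<le> Q (num_edges \<pi>)))"

text \<open>
  With \<open>M\<close> memory cells, the program \<open>pre\<close> builds in at most \<open>T\<close> steps a data structure for \<open>ps\<close> and
  returns its size and the addresses of its two trees in registers \<open>0\<close>, \<open>1\<close>, \<open>2\<close>.  By
  means of this data structure, \<open>qry\<close> answers all queries, with stretch \<open>s\<close> and in time at most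
  \<open>Q\<close> of the number of edges of the output path.
\<close>

definition two_tree_oracle ::
    "com \<Rightarrow> com \<Rightarrow> nat \<Rightarrow> nat \<Rightarrow> (nat \<Rightarrow> nat) \<Rightarrow> real \<Rightarrow> (real^2) list \<Rightarrow> bool" where
  "two_tree_oracle pre qry T M Q s ps \<longleftrightarrow>
     (\<exists>t r D n b1 b2 E1 E2.
        exec M pre (input_state ps) t (r, D) \<and> t \<le> T \<and>
        r 0 = real n \<and> r 1 = real b1 \<and> r 2 = real b2 \<and> n \<le> M \<and>
        spanning_tree (set ps) E1 \<and> spanning_tree (set ps) E2 \<and>
        stores_edges D b1 n ps E1 \<and> stores_edges D b2 n ps E2 \<and>
        (\<forall>i < length ps. \<forall>j < length ps. answers_query qry M Q s ps D n E1 E2 i j))"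

end

theory Submission
  imports Defs
begin

text \<open>
  Each tree is read off a compressed quadtree.  Every subtree of the quadtree comes with a
  representative of its point set for each of the four corners of its square.  When the
  subtrees in the four quadrants of a square are merged, each of them offers the
  representative of the corner at the centre of the square; the offered point nearest to the
  centre becomes a hub and is joined to the others.  The distance in the tree of two points is then
  bounded by a multiple of the side of the square whose centre lines separate them, and also by a
  multiple of their distances to its centre.

  Two such trees, for the point set and for its image under a rotation by 45 degrees, suffice:  two points
  that are close to each other compared with both of their separating squares would lie near a
  crossing of a line of the first grid and a line of the second one, and since the grids are dyadic
  and turned by 45 degrees, such a crossing is a lattice point of the finer grid.  Comparing the sizes of
  the two separating squares tells which tree to use.

  The quadtrees are built by sorting along the Z-curve and a stack of subtrees.  The resulting
  trees are rooted by stripping leaves, and a query climbs from its two points, always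
  moving the one that was stripped first.  That the paths found are shortest in the tree follows since
  moving one end along an edge changes the length of the path found by at most the length of the edge.
\<close>

section \<open>Geometry of hub trees\<close>

text \<open>Summing the detours through hubs over all levels would be too lossy. Instead,
  \<open>good\<close> requires every walk to a representative to stay below its budget by twice the
  distance of that representative from its corner. When quadrants are merged, this corner is the
  centre; offered points at distances r and s from the centre are joined over the hub at a cost of
  at most 2r + 2s, which is what the two walks have saved. The saving must be provided anew when the
  hub becomes the representative of an empty corner, and that determines the constant
  \<open>DD\<close>. The second loss is controlled by the weight \<open>wgt\<close>, which is
  smaller near the diagonals of a square: pairs lying badly for both grids have a point near a
  diagonal, a line direction of the other grid. The product \<open>2 * DD * sqrt (389/25)\<close> is
  just below \<open>4 * sqrt 26\<close>. The machine has unit-cost arithmetic on reals of any size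
  but no bit operations and no logarithmic-time dictionary. So the level at which two coordinates
  separate is computed by a closed formula, and the sorted list is kept in a single number.\<close>

inductive conn :: "(nat \<Rightarrow> 'p::metric_space) \<Rightarrow> (nat \<times> nat) set \<Rightarrow> nat \<Rightarrow> nat \<Rightarrow> real \<Rightarrow> bool"
  for P E where
  conn_refl: "0 \<le> l \<Longrightarrow> conn P E a a l"
| conn_step: "conn P E a b l \<Longrightarrow> (b, c) \<in> E \<or> (c, b) \<in> E \<Longrightarrow> l + dist (P b) (P c) \<le> l' \<Longrightarrow>
    conn P E a c l'"

lemma conn_mono:
  assumes "conn P E a b l" "l \<le> l'" "E \<subseteq> E'"
  shows "conn P E' a b l'"
  using assms
proof (induction arbitrary: l' rule: conn.induct)
  case (conn_refl l a)
  then show ?case by (auto intro: conn.conn_refl)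
next
  case (conn_step a b l c l'')
  then have "conn P E' a b l" by auto
  then show ?case using conn_step by (auto intro!: conn.conn_step[of P E' a b l c])
qed

lemma conn_trans:
  assumes "conn P E b c l2" "conn P E a b l1"
  shows "conn P E a c (l1 + l2)"
  using assms
proof (induction arbitrary: l1 rule: conn.induct)
  case (conn_refl l b)
  then show ?case by (auto intro: conn_mono)
next
  case (conn_step b c l d l')
  then show ?case by (auto intro!: conn.conn_step[of P E a c "l1 + l" d])
qed

lemma conn_edge:
  "(a, b) \<in> E \<or> (b, a) \<in> E \<Longrightarrow> dist (P a) (P b) \<le> l \<Longrightarrow> conn P E a b l"
  by (rule conn_step[OF conn_refl[of 0]]) auto

lemma conn_sym: "conn P E a b l \<Longrightarrow> conn P E b a l"
proof (induction rule: conn.induct)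
  case (conn_refl l a)
  then show ?case by (rule conn.conn_refl)
next
  case (conn_step a b l c l')
  have "conn P E c b (dist (P b) (P c))"
    using conn_step by (intro conn_edge) (auto simp: dist_commute)
  from conn_trans[OF conn_step.IH this] show ?case
    by (rule conn_mono) (use conn_step in auto)
qed

section \<open>Squares, corners, and the weight of a point at a corner\<close>

type_synonym pt = "real \<times> real"

text \<open>The directions \<open>0, \<dots>, 3\<close> are the lower left, upper left, lower right and upper right corner
  (or quadrant) of a square, so that \<open>d\<close> and \<open>3 - d\<close> are opposite.  A square is
  given by its centre and half its side.\<close>

definition sgx :: "nat \<Rightarrow> real" where "sgx d = (if 2 \<le> d then 1 else - 1)"
definition sgy :: "nat \<Rightarrow> real" where "sgy d = (if odd d then 1 else - 1)"

definition corner :: "pt \<Rightarrow> real \<Rightarrow> nat \<Rightarrow> pt" where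
  "corner m h d = (fst m + h * sgx d, snd m + h * sgy d)"

definition in_cell :: "pt \<Rightarrow> real \<Rightarrow> pt \<Rightarrow> bool" where
  "in_cell m h p \<longleftrightarrow> \<bar>fst p - fst m\<bar> \<le> h \<and> \<bar>snd p - snd m\<bar> \<le> h"

text \<open>For \<open>0 \<le> Y \<le> X\<close> this is \<open>2 * X\<close> as long as
  \<open>2 * Y \<le> X\<close>; from there it falls linearly in \<open>Y\<close> to
  \<open>7/5 * X\<close> on the diagonal. With \<open>2 * max X Y\<close> alone, the norm
  \<open>sqrt (389/25)\<close> in \<open>wgt_sum_le\<close> would become \<open>sqrt 20\<close>, and
  \<open>2 * DD * sqrt 20\<close> exceeds \<open>4 * sqrt 26\<close>. The linear piece is limited by
  the recursion \<open>wgt_rec\<close>, which is an equality at \<open>X = h\<close>,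
  \<open>Y = h / 2\<close>.\<close>

definition wgt :: "real \<Rightarrow> real \<Rightarrow> real" where
  "wgt X Y = min (2 * max X Y) (max (13/5 * X - 6/5 * Y) (13/5 * Y - 6/5 * X))"

definition wd :: "pt \<Rightarrow> pt \<Rightarrow> real" where
  "wd p c = wgt \<bar>fst p - fst c\<bar> \<bar>snd p - snd c\<bar>"

text \<open>\<open>2 * DD = 2 * sqrt 2 + sqrt 5\<close> is the price of a hub in
  \<open>hub_bound\<close>: in a square of half side 1, a corner has distance \<open>sqrt 2\<close>
  from the centre, and two adjacent quadrants together have diameter \<open>sqrt 5\<close>.\<close>

definition DD :: real where "DD = sqrt 2 + sqrt 5 / 2"

lemma lt4: "(d::nat) < 4 \<longleftrightarrow> d = 0 \<or> d = 1 \<or> d = 2 \<or> d = 3" by auto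

lemma sg_vals: "sgx d = 1 \<or> sgx d = -1" "sgy d = 1 \<or> sgy d = -1"
  by (auto simp: sgx_def sgy_def)

lemma sg_opp: "d < 4 \<Longrightarrow> sgx (3 - d) = - sgx d" "d < 4 \<Longrightarrow> sgy (3 - d) = - sgy d"
  by (auto simp: sgx_def sgy_def lt4)

lemma sg_inj: "j < 4 \<Longrightarrow> k < 4 \<Longrightarrow> sgx j = sgx k \<Longrightarrow> sgy j = sgy k \<Longrightarrow> j = k"
  by (auto simp: sgx_def sgy_def lt4)

lemma DD_ge: "5/2 \<le> DD"
proof -
  have "7/5 \<le> sqrt (2::real)" "11/5 \<le> sqrt (5::real)"
    by (rule real_le_rsqrt, simp add: power2_eq_square)+
  then show ?thesis unfolding DD_def by simp
qed

lemma sqrt2_le: "sqrt 2 \<le> 3/2"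
  by (rule real_le_lsqrt) (auto simp: power2_eq_square)

lemma dist_pt: "dist (p::pt) q = sqrt ((fst p - fst q)\<^sup>2 + (snd p - snd q)\<^sup>2)"
  by (simp add: dist_prod_def dist_real_def)

lemma dist_pt_le:
  assumes "\<bar>fst p - fst q\<bar> \<le> u" "\<bar>snd p - snd (q::pt)\<bar> \<le> v" "u\<^sup>2 + v\<^sup>2 \<le> c\<^sup>2" "0 \<le> c"
  shows "dist p q \<le> c"
proof -
  have "(fst p - fst q)\<^sup>2 \<le> u\<^sup>2" "(snd p - snd q)\<^sup>2 \<le> v\<^sup>2"
    using assms(1,2) by (metis abs_ge_zero power2_abs power_mono)+
  then show ?thesis unfolding dist_pt using assms by (intro real_le_lsqrt) auto
qed

lemma wgt_commute: "wgt X Y = wgt Y X"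
  by (auto simp: wgt_def max.commute)

lemma wgt_ge: "0 \<le> X \<Longrightarrow> 0 \<le> Y \<Longrightarrow> 7/5 * max X Y \<le> wgt X Y"
  unfolding wgt_def min_def max_def by auto

lemma wgt_le: "wgt X Y \<le> 2 * max X Y"
  by (simp add: wgt_def)

text \<open>\<open>X\<close>, \<open>Y\<close> are the coordinate distances of a point to a corner
  of a square of half side \<open>h\<close>, and \<open>\<bar>X - h\<bar>\<close>,
  \<open>\<bar>Y - h\<bar>\<close> those to its centre; \<open>h \<le> max X Y\<close> says that the
  point is in another quadrant than the corner. As the left side never exceeds \<open>2 * h\<close>,
  only the linear pieces of \<open>wgt X Y\<close> need work, and by symmetry only one of
  them.\<close>

lemma wgt_rec:
  assumes "0 \<le> X" "X \<le> 2 * h" "0 \<le> Y" "Y \<le> 2 * h" "h \<le> max X Y"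
  shows "h + min h (wgt \<bar>X - h\<bar> \<bar>Y - h\<bar>) \<le> min (2 * h) (wgt X Y)"
proof -
  have aux: "h + min h (wgt \<bar>X - h\<bar> \<bar>Y - h\<bar>) \<le> 13/5 * X - 6/5 * Y"
    if "Y \<le> X" "h \<le> X" "0 \<le> Y" "X \<le> 2 * h" for X Y
  proof (cases "h \<le> Y")
    case True
    have "wgt \<bar>X - h\<bar> \<bar>Y - h\<bar> \<le> 13/5 * (X - h) - 6/5 * (Y - h)"
    proof -
      have e: "\<bar>X - h\<bar> = X - h" "\<bar>Y - h\<bar> = Y - h" using that True by auto
      show ?thesis
        unfolding wgt_def e using that True by (intro min.coboundedI2 max.boundedI) (simp_all add: field_simps)
    qed
    then have "min h (wgt \<bar>X - h\<bar> \<bar>Y - h\<bar>) \<le> 13/5 * (X - h) - 6/5 * (Y - h)" by simp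
    also have "\<dots> = 13/5 * X - 6/5 * Y - 7/5 * h" by (simp add: field_simps)
    finally show ?thesis using that by linarith
  next
    case False
    have w: "wgt \<bar>X - h\<bar> \<bar>Y - h\<bar> \<le> 2 * max (X - h) (h - Y)"
      using wgt_le[of "\<bar>X - h\<bar>" "\<bar>Y - h\<bar>"] that False by (simp only: abs_of_nonneg abs_of_nonpos diff_ge_0_iff_ge, simp)
    have m: "min h (wgt \<bar>X - h\<bar> \<bar>Y - h\<bar>) \<le> h" by simp
    \<comment> \<open>The cap \<open>h\<close> settles small \<open>Y\<close>, the bound
      \<open>2 * max\<close> the other two cases. The last two cases meet in \<open>X = h\<close>,
      \<open>Y = h / 2\<close>, where nothing is lost.\<close>
    consider "h - Y \<le> X - h" | "X - h \<le> h - Y" "Y \<le> h / 2" | "X - h \<le> h - Y" "h / 2 \<le> Y" by linarith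
    then show ?thesis
    proof cases
      case 1
      then have "min h (wgt \<bar>X - h\<bar> \<bar>Y - h\<bar>) \<le> 2 * X - 2 * h" using w by (simp add: max_absorb1)
      then show ?thesis using that False by linarith
    next
      case 2
      then show ?thesis using m that by linarith
    next
      case 3
      then have "min h (wgt \<bar>X - h\<bar> \<bar>Y - h\<bar>) \<le> 2 * h - 2 * Y" using w by (simp add: max_absorb2)
      then show ?thesis using that 3 by linarith
    qed
  qed
  have m: "h + min h z \<le> 2 * h" for z by simp
  have M: "2 * h \<le> 2 * max X Y" using assms(5) by linarith
  have "h + min h (wgt \<bar>X - h\<bar> \<bar>Y - h\<bar>) \<le> wgt X Y"
  proof (cases "Y \<le> X")
    case True
    then have "h \<le> X" using assms(5) by (simp only: max_absorb1)
    from aux[OF True this assms(3,2)] show ?thesis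
      unfolding wgt_def[of X Y] by (intro min.boundedI max.coboundedI1 order_trans[OF m M])
  next
    case False
    then have YX: "X \<le> Y" by simp
    then have "h \<le> Y" using assms(5) by (simp only: max_absorb2)
    from aux[OF YX this assms(1,4)] show ?thesis
      unfolding wgt_def[of X Y] wgt_commute[of "\<bar>X - h\<bar>"]
      by (intro min.boundedI max.coboundedI2 order_trans[OF m M])
  qed
  then show ?thesis by (intro min.boundedI m)
qed

lemma sqrt2_mult_le: "0 \<le> h \<Longrightarrow> sqrt 2 * h \<le> DD * h"
  by (rule mult_right_mono) (auto simp: DD_def)

section \<open>The invariant of a subtree and its passage to larger squares\<close>

definition child :: "pt \<Rightarrow> real \<Rightarrow> nat \<Rightarrow> pt" where
  "child m h k = (fst m + h / 2 * sgx k, snd m + h / 2 * sgy k)"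

text \<open>The subtracted distances are debts: a walk to a representative has to undercut its
  budget by twice the distance of the representative from its corner. At a merge that corner is the
  centre of the larger square, and the debts of two quadrants pay for the way over the hub. The
  first family of walks sharpens the second for \<open>a = R (3 - d)\<close>: its budget is
  \<open>2 * DD * (2 * h)\<close>, with the debts of both ends subtracted.\<close>

definition good :: "(nat \<Rightarrow> pt) \<Rightarrow> (nat \<times> nat) set \<Rightarrow> nat set \<Rightarrow> (nat \<Rightarrow> nat) \<Rightarrow> pt \<Rightarrow> real \<Rightarrow> bool" where
  "good P E V R m h \<longleftrightarrow>
     (\<forall>a\<in>V. in_cell m h (P a)) \<and> (\<forall>d<4. R d \<in> V) \<and>
     (\<forall>d<4. conn P E (R d) (R (3 - d))
        (4 * DD * h - 2 * dist (P (R d)) (corner m h d)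
                    - 2 * dist (P (R (3 - d))) (corner m h (3 - d)))) \<and>
     (\<forall>a\<in>V. \<forall>d<4. conn P E a (R d)
        (2 * DD * min (2 * h) (wd (P a) (corner m h d)) - 2 * dist (P (R d)) (corner m h d)))"

lemma good_mono: "good P E V R m h \<Longrightarrow> E \<subseteq> E' \<Longrightarrow> good P E' V R m h"
  unfolding good_def using conn_mono[of P E _ _ _ _ E', OF _ order_refl] by simp

lemma abs_corner1: "\<bar>p - m\<bar> \<le> h \<Longrightarrow> s = 1 \<or> s = - 1 \<Longrightarrow> \<bar>p - (m + h * s)\<bar> = h - s * (p - m)"
  for p m h s :: real
  by (elim disjE; simp; arith)

lemma abs_child1: "\<bar>p - (m + h / 2 * s)\<bar> \<le> h / 2 \<Longrightarrow> s = 1 \<or> s = - 1 \<Longrightarrow> \<bar>p - m\<bar> \<le> h \<and> 0 \<le> s * (p - m)"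
  for p m h s :: real
  unfolding abs_le_iff by (elim disjE conjE; simp only: mult_1_right mult_1_left mult_minus1 mult_minus1_right; linarith)

text \<open>The arithmetic mean is at most the quadratic mean; the slack is
  \<open>(sqrt A - sqrt B)\<^sup>2\<close>.\<close>

lemma sqrt_add_le:
  assumes "0 \<le> A" "0 \<le> B" "A + B \<le> 8 * h\<^sup>2" "0 \<le> h"
  shows "sqrt A + sqrt B \<le> 4 * h"
proof (rule power2_le_imp_le)
  have "0 \<le> (sqrt A - sqrt B)\<^sup>2" by simp
  moreover have "(sqrt A + sqrt B)\<^sup>2 + (sqrt A - sqrt B)\<^sup>2 = 2 * (A + B)"
    using assms by (simp add: power2_sum power2_diff)
  moreover have "0 \<le> d \<Longrightarrow> s + d = 2 * w \<Longrightarrow> w \<le> 8 * q \<Longrightarrow> s \<le> 16 * q" for s d w q :: real by linarith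
  ultimately have "(sqrt A + sqrt B)\<^sup>2 \<le> 16 * h\<^sup>2" using assms(3) by blast
  then show "(sqrt A + sqrt B)\<^sup>2 \<le> (4 * h)\<^sup>2" by (simp add: power_mult_distrib)
qed (use assms in simp)

lemma child_cell:
  assumes "in_cell (child m h k) (h / 2) p" "0 \<le> h"
  shows "in_cell m h p" "0 \<le> sgx k * (fst p - fst m)" "0 \<le> sgy k * (snd p - snd m)"
  using assms abs_child1[OF _ sg_vals(1)[of k]] abs_child1[OF _ sg_vals(2)[of k]]
  by (auto simp: in_cell_def child_def)

lemma child_corner_same: "corner (child m h k) (h / 2) k = corner m h k"
  by (simp add: corner_def child_def field_simps)

lemma child_corner_opp: "k < 4 \<Longrightarrow> corner (child m h k) (h / 2) (3 - k) = m"
  by (cases m) (simp add: corner_def child_def sg_opp)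

lemma abs_corner:
  assumes "in_cell m h p" "s = 1 \<or> s = - 1" "s' = 1 \<or> s' = -1"
  shows "\<bar>fst p - (fst m + h * s)\<bar> = h - s * (fst p - fst m)"
    "\<bar>snd p - (snd m + h * s')\<bar> = h - s' * (snd p - snd m)"
  using assms by (simp_all add: in_cell_def abs_corner1)

text \<open>Measuring coordinates from the corner \<open>d\<close> reduces the four corners to one
  case. \<open>k \<noteq> d\<close> means that the point is beyond a centre line in at least one
  coordinate, whence \<open>h \<le> max X Y\<close>.\<close>

lemma wd_corner:
  assumes "in_cell (child m h k) (h / 2) p" "0 \<le> h" "k < 4" "d < 4" "k \<noteq> d"
  obtains X Y where "wd p (corner m h d) = wgt X Y" "wd p m = wgt \<bar>X - h\<bar> \<bar>Y - h\<bar>"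
    "0 \<le> X" "X \<le> 2 * h" "0 \<le> Y" "Y \<le> 2 * h" "h \<le> max X Y"
proof -
  note c = child_cell[OF assms(1,2)]
  let ?t = "fst p - fst m" let ?u = "snd p - snd m"
  let ?X = "h - sgx d * ?t" let ?Y = "h - sgy d * ?u"
  have wd: "wd p (corner m h d) = wgt ?X ?Y"
    using abs_corner[OF c(1) sg_vals(1)[of d] sg_vals(2)[of d]] by (simp add: wd_def corner_def)
  have "\<bar>?X - h\<bar> = \<bar>?t\<bar>" "\<bar>?Y - h\<bar> = \<bar>?u\<bar>"
    using sg_vals[of d] by auto
  then have wm: "wd p m = wgt \<bar>?X - h\<bar> \<bar>?Y - h\<bar>" by (simp add: wd_def)
  have b: "0 \<le> ?X" "?X \<le> 2 * h" "0 \<le> ?Y" "?Y \<le> 2 * h"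
    using c(1) sg_vals(1)[of d] sg_vals(2)[of d] by (auto simp: in_cell_def abs_le_iff)
  have "sgx k \<noteq> sgx d \<or> sgy k \<noteq> sgy d" using assms sg_inj by blast
  then have "h \<le> max ?X ?Y"
    using c(2,3) sg_vals(1)[of d] sg_vals(2)[of d] sg_vals(1)[of k] sg_vals(2)[of k] by auto
  then show ?thesis using that[OF wd wm b] by blast
qed

text \<open>The recursion behind the bound on the distance to a corner of a square, for a point in
  another quadrant.\<close>

lemma wd_rec:
  assumes "in_cell (child m h k) (h / 2) p" "0 \<le> h" "k < 4" "d < 4" "k \<noteq> d"
  shows "h + min h (wd p m) \<le> min (2 * h) (wd p (corner m h d))"
  by (rule wd_corner[OF assms]) (simp only: wgt_rec)

lemma wd_far:
  assumes "in_cell (child m h k) (h / 2) p" "0 \<le> h" "k < 4" "d < 4" "k \<noteq> d"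
  shows "7/5 * h \<le> min (2 * h) (wd p (corner m h d))"
proof (rule wd_corner[OF assms])
  fix X Y assume *: "wd p (corner m h d) = wgt X Y" "0 \<le> X" "0 \<le> Y" "h \<le> max X Y"
  have "7/5 * h \<le> 7/5 * max X Y" using *(4) by linarith
  also have "\<dots> \<le> wgt X Y" using *(2,3) by (rule wgt_ge)
  finally show ?thesis using * assms(2) by (intro min.boundedI) simp_all
qed

text \<open>All walks are trivial, so the debts themselves have to fit into the budgets: the
  distances to two opposite corners add up to at most \<open>4 * h\<close>, the distance to one
  corner is at most \<open>3/2\<close> of the larger coordinate distance, and
  \<open>DD \<ge> 5/2\<close>.\<close>

lemma good_leaf:
  assumes "in_cell m h (P p)"
  shows "good P E {p} (\<lambda>_. p) m h"
proof -
  have h: "0 \<le> h" using assms by (auto simp: in_cell_def)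
  let ?t = "fst (P p) - fst m" let ?u = "snd (P p) - snd m"
  have D: "5/2 \<le> DD" by (rule DD_ge)
  have X: "conn P E p p (4 * DD * h - 2 * dist (P p) (corner m h d) - 2 * dist (P p) (corner m h (3 - d)))"
    if d: "d < 4" for d
  proof (rule conn_refl)
    let ?A = "(h - sgx d * ?t)\<^sup>2 + (h - sgy d * ?u)\<^sup>2" let ?B = "(h + sgx d * ?t)\<^sup>2 + (h + sgy d * ?u)\<^sup>2"
    have A: "dist (P p) (corner m h d) = sqrt ?A"
      using sg_vals[of d] by (auto simp: dist_pt corner_def power2_eq_square algebra_simps)
    have B: "dist (P p) (corner m h (3 - d)) = sqrt ?B"
      using sg_vals[of d] sg_opp[OF d] by (auto simp: dist_pt corner_def power2_eq_square algebra_simps)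
    have tu: "?t\<^sup>2 \<le> h\<^sup>2" "?u\<^sup>2 \<le> h\<^sup>2"
      using assms h by (auto simp: in_cell_def abs_le_square_iff[symmetric])
    have sq1: "(h - s * t)\<^sup>2 + (h + s * t)\<^sup>2 = 2 * h\<^sup>2 + 2 * t\<^sup>2" if "s = 1 \<or> s = -1" for s t :: real
      using that by (auto simp: power2_eq_square algebra_simps)
    have "?A + ?B = 4 * h\<^sup>2 + 2 * ?t\<^sup>2 + 2 * ?u\<^sup>2"
      using sq1[OF sg_vals(1)[of d], of ?t] sq1[OF sg_vals(2)[of d], of ?u] by linarith
    then have "?A + ?B \<le> 8 * h\<^sup>2" using tu by linarith
    then have "sqrt ?A + sqrt ?B \<le> 4 * h" using h by (intro sqrt_add_le) auto
    moreover have "5/2 * h \<le> DD * h" using D h by (rule mult_right_mono)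
    ultimately show "0 \<le> 4 * DD * h - 2 * dist (P p) (corner m h d) - 2 * dist (P p) (corner m h (3 - d))"
      unfolding A B using h by linarith
  qed
  have G: "conn P E p p (2 * DD * min (2 * h) (wd (P p) (corner m h d)) - 2 * dist (P p) (corner m h d))"
    if d: "d < 4" for d
  proof (rule conn_refl)
    let ?X = "\<bar>fst (P p) - fst (corner m h d)\<bar>" let ?Y = "\<bar>snd (P p) - snd (corner m h d)\<bar>"
    have XY: "?X \<le> 2 * h" "?Y \<le> 2 * h"
      using assms sg_vals(1)[of d] sg_vals(2)[of d] h
      unfolding corner_def in_cell_def fst_conv snd_conv abs_le_iff
      by (elim disjE conjE; simp only: mult_1_right mult_minus1_right; linarith)+
    have dl: "dist (P p) (corner m h d) \<le> 3/2 * max ?X ?Y"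
    proof (rule dist_pt_le)
      show "?X \<le> max ?X ?Y" "?Y \<le> max ?X ?Y" by simp_all
      have "0 \<le> M \<Longrightarrow> M\<^sup>2 + M\<^sup>2 \<le> (3/2 * M)\<^sup>2" for M :: real by (simp add: power_mult_distrib power2_eq_square)
      then show "(max ?X ?Y)\<^sup>2 + (max ?X ?Y)\<^sup>2 \<le> (3/2 * max ?X ?Y)\<^sup>2" by simp
    qed simp
    have "max ?X ?Y \<le> 2 * h" using XY by auto
    moreover have "7/5 * max ?X ?Y \<le> wd (P p) (corner m h d)" unfolding wd_def by (rule wgt_ge) auto
    moreover have "0 \<le> max ?X ?Y" by simp
    ultimately have "max ?X ?Y \<le> min (2 * h) (wd (P p) (corner m h d))" by (intro min.boundedI) linarith+
    then have "5/2 * max ?X ?Y \<le> DD * min (2 * h) (wd (P p) (corner m h d))"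
      using D by (intro mult_mono) auto
    then show "0 \<le> 2 * DD * min (2 * h) (wd (P p) (corner m h d)) - 2 * dist (P p) (corner m h d)"
      unfolding mult.assoc using dl \<open>0 \<le> max ?X ?Y\<close> by linarith
  qed
  show ?thesis unfolding good_def using assms X G by auto
qed

lemma child_corner_dist:
  assumes "0 \<le> h" "k < 4" "d < 4"
  shows "dist (corner (child m h k) (h / 2) d) (corner m h d) + dist (corner (child m h k) (h / 2) (3 - d)) (corner m h (3 - d)) \<le> 2 * h"
    "d \<noteq> k \<Longrightarrow> d \<noteq> 3 - k \<Longrightarrow> dist (corner (child m h k) (h / 2) d) (corner m h d) \<le> h"
    "dist (corner (child m h k) (h / 2) d) (corner m h d) \<le> sqrt 2 * h"
proof -
  have x: "\<bar>fst (corner (child m h k) (h / 2) d) - fst (corner m h d)\<bar> = (if sgx k = sgx d then 0 else h)"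
    "\<bar>snd (corner (child m h k) (h / 2) d) - snd (corner m h d)\<bar> = (if sgy k = sgy d then 0 else h)" for d
  proof -
    have "\<bar>m + h / 2 * s + h / 2 * s' - (m + h * s')\<bar> = (if s = s' then 0 else h)"
      if "s = 1 \<or> s = - 1" "s' = 1 \<or> s' = -1" for m s s' :: real
      using that assms(1) by (elim disjE) (simp_all add: field_simps)
    then show "\<bar>fst (corner (child m h k) (h / 2) d) - fst (corner m h d)\<bar> = (if sgx k = sgx d then 0 else h)"
      "\<bar>snd (corner (child m h k) (h / 2) d) - snd (corner m h d)\<bar> = (if sgy k = sgy d then 0 else h)"
      unfolding corner_def child_def fst_conv snd_conv using sg_vals by blast+
  qed
  show 3: "dist (corner (child m h k) (h / 2) d) (corner m h d) \<le> sqrt 2 * h" for d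
    by (rule dist_pt_le[where u = h and v = h]) (use assms x[of d] in \<open>auto simp: power_mult_distrib\<close>)
  have 2: "dist (corner (child m h k) (h / 2) d) (corner m h d) \<le> h" if "d < 4" "d \<noteq> 3 - k" for d
  proof -
    have "sgx k = sgx d \<or> sgy k = sgy d"
      using that assms(2) unfolding lt4 by (elim disjE) (simp_all add: sgx_def sgy_def)
    then show ?thesis
      using assms(1) x[of d]
      by (intro dist_pt_le[where u = "if sgx k = sgx d then 0 else h" and v = "if sgy k = sgy d then 0 else h"]) auto
  qed
  then show "d \<noteq> k \<Longrightarrow> d \<noteq> 3 - k \<Longrightarrow> dist (corner (child m h k) (h / 2) d) (corner m h d) \<le> h"
    using assms(3) by blast
  have le: "sqrt 2 * h \<le> 2 * h" using sqrt2_le assms(1) by (intro mult_right_mono) auto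
  consider "d = k" | "d = 3 - k" | "d \<noteq> k" "d \<noteq> 3 - k" by blast
  then show "dist (corner (child m h k) (h / 2) d) (corner m h d) + dist (corner (child m h k) (h / 2) (3 - d)) (corner m h (3 - d)) \<le> 2 * h"
  proof cases
    case 1
    then show ?thesis using 3[of "3 - d"] le by (simp add: child_corner_same)
  next
    case 2
    then have "3 - d = k" using assms by auto
    then show ?thesis using 3[of d] le by (simp add: child_corner_same)
  next
    case c: 3
    have "3 - d \<noteq> 3 - k" "3 - d < 4" using c assms by auto
    then show ?thesis using 2[OF assms(3) c(2)] 2[of "3 - d"] by simp
  qed
qed

lemma goodX: "good P E V R m h \<Longrightarrow> d < 4 \<Longrightarrow> conn P E (R d) (R (3 - d))
    (4 * DD * h - 2 * dist (P (R d)) (corner m h d) - 2 * dist (P (R (3 - d))) (corner m h (3 - d)))"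
  and goodG: "good P E V R m h \<Longrightarrow> a \<in> V \<Longrightarrow> d < 4 \<Longrightarrow> conn P E a (R d)
    (2 * DD * min (2 * h) (wd (P a) (corner m h d)) - 2 * dist (P (R d)) (corner m h d))"
  by (simp_all add: good_def)

text \<open>A square with only one occupied quadrant contributes no edge, so a component must keep
  the invariant when it is viewed in a larger square. The debts grow by at most twice the
  displacement of the corners, and the larger budgets cover this.\<close>

lemma good_lift:
  assumes g: "good P E V R (child m h k) (h / 2)" and h: "0 \<le> h" and k: "k < 4"
  shows "good P E V R m h"
proof -
  let ?c = "corner (child m h k) (h / 2)"
  have D: "5/2 \<le> DD" by (rule DD_ge)
  have Dh: "5/2 * h \<le> DD * h" using D h by (rule mult_right_mono)
  have V: "in_cell (child m h k) (h / 2) (P a)" if "a \<in> V" for a using g that by (simp add: good_def)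
  have tri: "dist (P i) (corner m h d) \<le> dist (P i) (?c d) + dist (?c d) (corner m h d)" for i d
    by (rule dist_triangle)
  have X: "conn P E (R d) (R (3 - d))
        (4 * DD * h - 2 * dist (P (R d)) (corner m h d)
                    - 2 * dist (P (R (3 - d))) (corner m h (3 - d)))" if d: "d < 4" for d
  proof (rule conn_mono)
    show "conn P E (R d) (R (3 - d)) (4 * DD * (h / 2) - 2 * dist (P (R d)) (?c d)
                    - 2 * dist (P (R (3 - d))) (?c (3 - d)))"
      using g d by (simp add: good_def)
    show "4 * DD * (h / 2) - 2 * dist (P (R d)) (?c d) - 2 * dist (P (R (3 - d))) (?c (3 - d))
      \<le> 4 * DD * h - 2 * dist (P (R d)) (corner m h d) - 2 * dist (P (R (3 - d))) (corner m h (3 - d))"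
      using child_corner_dist(1)[OF h k d, of m] tri[of "R d" d] tri[of "R (3 - d)" "3 - d"] Dh h by simp
  qed simp
  have G: "conn P E a (R d)
        (2 * DD * min (2 * h) (wd (P a) (corner m h d)) - 2 * dist (P (R d)) (corner m h d))"
    if a: "a \<in> V" and d: "d < 4" for a d
  proof (rule conn_mono)
    let ?l = "min h (wd (P a) (?c d))" let ?w = "min (2 * h) (wd (P a) (corner m h d))"
    show "conn P E a (R d) (2 * DD * ?l - 2 * dist (P (R d)) (?c d))"
      using g a d by (simp add: good_def)
    have "DD * ?l + dist (?c d) (corner m h d) \<le> DD * ?w"
    proof -
      consider "d = k" | "d \<noteq> k" "d = 3 - k" | "d \<noteq> k" "d \<noteq> 3 - k" by blast
      then show ?thesis
      proof cases
        case 1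
        have "?l \<le> ?w" using 1 h by (intro min.mono) (simp_all add: child_corner_same)
        then have "DD * ?l \<le> DD * ?w" using D by (intro mult_left_mono) auto
        then show ?thesis using 1 by (simp add: child_corner_same)
      next
        case 2
        have c: "?c d = m" using 2 k by (simp add: child_corner_opp)
        have "h + ?l \<le> ?w" unfolding c using wd_rec[OF V[OF a] h k d] 2 by simp
        then have "DD * (h + ?l) \<le> DD * ?w" using D by (intro mult_left_mono) auto
        moreover have "dist (?c d) (corner m h d) \<le> DD * h"
          using child_corner_dist(3)[OF h k d] sqrt2_mult_le[OF h] by (rule order_trans)
        ultimately show ?thesis by (simp only: distrib_left)
      next
        case 3
        \<comment> \<open>\<open>wd_far\<close> leaves \<open>2/5 * h\<close> above the cap
          \<open>h\<close>, and \<open>DD * 2/5 \<ge> 1\<close> covers the displacement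
          \<open>h\<close> of an adjacent corner.\<close>
        have "?l + h * 2/5 \<le> ?w" using wd_far[OF V[OF a] h k d] 3 min.cobounded1[of h "wd (P a) (?c d)"] by linarith
        then have "DD * (?l + h * 2/5) \<le> DD * ?w" using D by (intro mult_left_mono) auto
        moreover have "h \<le> DD * (h * 2/5)" using Dh by simp
        ultimately show ?thesis
          using child_corner_dist(2)[OF h k d 3, of m] by (simp only: distrib_left)
      qed
    qed
    then show "2 * DD * ?l - 2 * dist (P (R d)) (?c d) \<le> 2 * DD * ?w - 2 * dist (P (R d)) (corner m h d)"
      unfolding mult.assoc using tri[of "R d" d] by linarith
  qed simp
  show ?thesis unfolding good_def using X G child_cell(1)[OF V h] g by (simp add: good_def)
qed

text \<open>The hub \<open>b\<close> takes on the debt of the empty corner \<open>d\<close>, while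
  the offered point \<open>p\<close> of another quadrant reaches \<open>b\<close> by an edge and is
  released from its debt at the centre. If \<open>b\<close> lies opposite to \<open>d\<close>, the
  way from \<open>b\<close> over the centre to the corner costs at most
  \<open>sqrt 2 * h + dist b m\<close>, the edge at most \<open>sqrt 5 * h\<close>, and
  \<open>dist b m \<le> dist p m\<close> cancels the rest.\<close>

lemma hub_bound:
  assumes b: "in_cell (child m h kb) (h / 2) b" and p: "in_cell (child m h j) (h / 2) p"
    and h: "0 \<le> h" and lt: "kb < 4" "j < 4" "d < 4" and ne: "d \<noteq> kb" "d \<noteq> j"
    and le: "dist b m \<le> dist p m" and eq: "j = kb \<Longrightarrow> p = b"
  shows "2 * dist b (corner m h d) + dist p b - 2 * dist p m \<le> 2 * DD * h"
    "kb \<noteq> 3 - d \<Longrightarrow> dist b (corner m h d) \<le> sqrt 5 * h"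
proof -
  note cb = child_cell[OF b h] and cp = child_cell[OF p h]
  have b1: "\<bar>fst b - fst (corner m h d)\<bar> = h - sgx d * (fst b - fst m)"
    "\<bar>snd b - snd (corner m h d)\<bar> = h - sgy d * (snd b - snd m)"
    using abs_corner[OF cb(1) sg_vals(1)[of d] sg_vals(2)[of d]] by (simp_all add: corner_def)
  have m1: "\<bar>fst b - fst m\<bar> \<le> h" "\<bar>snd b - snd m\<bar> \<le> h" "\<bar>fst p - fst m\<bar> \<le> h" "\<bar>snd p - snd m\<bar> \<le> h"
    using cb(1) cp(1) by (auto simp: in_cell_def)
  have u: "h - s * t \<le> 2 * h" "s = s' \<Longrightarrow> 0 \<le> s' * t \<Longrightarrow> h - s * t \<le> h"
    if "\<bar>t\<bar> \<le> h" "s = 1 \<or> s = -1" for s s' t :: real using that by auto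
  have s5: "h\<^sup>2 + (2 * h)\<^sup>2 \<le> (sqrt 5 * h)\<^sup>2" "(2 * h)\<^sup>2 + h\<^sup>2 \<le> (sqrt 5 * h)\<^sup>2" "0 \<le> sqrt 5 * h"
    using h by (simp_all add: power_mult_distrib)
  have tri: "dist p b \<le> dist p m + dist b m" by (rule dist_triangle2)
  show adj: "dist b (corner m h d) \<le> sqrt 5 * h" if "kb \<noteq> 3 - d"
  proof -
    have "sgx kb = sgx d \<or> sgy kb = sgy d"
      using that lt(1,3) ne unfolding lt4 by (elim disjE) (simp_all add: sgx_def sgy_def)
    then show ?thesis
    proof
      assume "sgx kb = sgx d"
      then show ?thesis
        using b1 u(1)[OF m1(2) sg_vals(2)[of d]] u(2)[OF m1(1) sg_vals(1)[of d] _ cb(2)]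
        by (intro dist_pt_le[OF _ _ s5(1,3)]) simp_all
    next
      assume "sgy kb = sgy d"
      then show ?thesis
        using b1 u(1)[OF m1(1) sg_vals(1)[of d]] u(2)[OF m1(2) sg_vals(2)[of d] _ cb(3)]
        by (intro dist_pt_le[OF _ _ s5(2,3)]) simp_all
    qed
  qed
  have D: "2 * DD * h = 2 * (sqrt 2 * h) + sqrt 5 * h" unfolding DD_def by (simp add: algebra_simps)
  show "2 * dist b (corner m h d) + dist p b - 2 * dist p m \<le> 2 * DD * h"
  proof (cases "kb = 3 - d")
    case False
    \<comment> \<open>As the hub is nearest to the centre, \<open>dist p b - 2 * dist p m\<close> is
      not positive, so it remains to cover \<open>2 * sqrt 5 * h\<close>.\<close>
    have "sqrt 5 \<le> 2 * sqrt 2" by (rule real_le_lsqrt) (simp_all add: power_mult_distrib)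
    then have "sqrt 5 * h \<le> 2 * sqrt 2 * h" using h by (rule mult_right_mono)
    then show ?thesis using adj[OF False] tri le unfolding D by linarith
  next
    case True
    have mc: "dist m (corner m h d) \<le> sqrt 2 * h"
      using h sg_vals[of d] by (intro dist_pt_le[where u = h and v = h]) (auto simp: corner_def power_mult_distrib)
    have bc: "dist b (corner m h d) \<le> sqrt 2 * h + dist b m"
      using dist_triangle[of b "corner m h d" m] mc by linarith
    have "dist p b \<le> sqrt 5 * h"
    proof (cases "j = kb")
      case True
      then show ?thesis using eq h by simp
    next
      case False
      have t: "\<bar>t - t'\<bar> \<le> 2 * h" "s = s' \<Longrightarrow> s' = 1 \<or> s' = -1 \<Longrightarrow> 0 \<le> s * t \<Longrightarrow> 0 \<le> s' * t' \<Longrightarrow> \<bar>t - t'\<bar> \<le> h"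
        if "\<bar>t\<bar> \<le> h" "\<bar>t'\<bar> \<le> h" for s s' t t' :: real using that by auto
      have e: "fst p - fst b = (fst p - fst m) - (fst b - fst m)" "snd p - snd b = (snd p - snd m) - (snd b - snd m)"
        by simp_all
      \<comment> \<open>The quadrant \<open>j\<close> is neither \<open>kb\<close> nor
        \<open>d\<close>, the one opposite to \<open>kb\<close>; so it shares a side with
        \<open>kb\<close>.\<close>
      have "sgx j = sgx kb \<or> sgy j = sgy kb"
        using False True lt ne unfolding lt4 by (elim disjE) (simp_all add: sgx_def sgy_def)
      then show ?thesis
      proof
        assume "sgx j = sgx kb"
        from t(2)[OF m1(3,1) this sg_vals(1) cp(2) cb(2)] t(1)[OF m1(4,2)] show ?thesis
          unfolding e[symmetric] by (intro dist_pt_le[OF _ _ s5(1,3)])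
      next
        assume "sgy j = sgy kb"
        from t(2)[OF m1(4,2) this sg_vals(2) cp(3) cb(3)] t(1)[OF m1(3,1)] show ?thesis
          unfolding e[symmetric] by (intro dist_pt_le[OF _ _ s5(2,3)])
      qed
    qed
    then show ?thesis using bc le unfolding D by linarith
  qed
qed

text \<open>A walk between two quadrants has a part inside each of them, shortened by the debt of
  the point \<open>R k (3 - k)\<close> offered there, and at most two hub edges, which the debts
  pay. Nothing of the detour over the hub is left in the second conclusion, the bound for pairs that
  are separated by this square.\<close>

lemma hub_node:
  fixes V :: "nat \<Rightarrow> nat set" and R :: "nat \<Rightarrow> nat \<Rightarrow> nat"
  assumes K: "K \<subseteq> {..<4}" and kb: "kb \<in> K" and h: "0 \<le> h"
    and g: "\<And>k. k \<in> K \<Longrightarrow> good P E (V k) (R k) (child m h k) (h / 2)"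
    and near: "\<And>k. k \<in> K \<Longrightarrow> dist (P (R kb (3 - kb))) m \<le> dist (P (R k (3 - k))) m"
    and edge: "\<And>k. k \<in> K \<Longrightarrow> k \<noteq> kb \<Longrightarrow> (R k (3 - k), R kb (3 - kb)) \<in> E"
  shows "good P E (\<Union>k\<in>K. V k) (\<lambda>d. if d \<in> K then R d d else R kb (3 - kb)) m h"
    and "\<And>j k a b. j \<in> K \<Longrightarrow> k \<in> K \<Longrightarrow> a \<in> V j \<Longrightarrow> b \<in> V k \<Longrightarrow>
      conn P E a b (2 * DD * (min h (wd (P a) m) + min h (wd (P b) m)))"
proof -
  have D: "5/2 \<le> DD" by (rule DD_ge)
  define i where "i k = R k (3 - k)" for k
  let ?o = "\<lambda>k. R k k" let ?b = "i kb" let ?r = "\<lambda>k. dist (P (i k)) m"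
  have lt: "k < 4" if "k \<in> K" for k using K that by auto
  have cell: "in_cell (child m h k) (h / 2) (P a)" if "k \<in> K" "a \<in> V k" for k a
    using g[OF that(1)] that by (simp add: good_def)
  have RV: "R k d \<in> V k" if "k \<in> K" "d < 4" for k d using g that by (simp add: good_def)
  have icell: "in_cell (child m h k) (h / 2) (P (i k))" if "k \<in> K" for k
    unfolding i_def using that by (intro cell RV) auto
  have rb: "?r kb \<le> ?r k" if "k \<in> K" for k using near[OF that] by (simp add: i_def)
  have hub1: "conn P E (i j) ?b (dist (P (i j)) (P ?b))" if "j \<in> K" for j
  proof (cases "j = kb")
    case False
    then show ?thesis using edge[OF that] by (intro conn_edge) (auto simp: i_def)
  qed (simp add: conn_refl)
  have tri: "dist (P (i j)) (P ?b) \<le> ?r j + ?r kb" for j by (rule dist_triangle2)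
  \<comment> \<open>The edge from \<open>i j\<close> to the hub has length at most
    \<open>?r j + ?r kb \<le> 2 * ?r j\<close>, and likewise for \<open>k\<close>. These amounts are
    the debts in \<open>A\<close> and \<open>O\<close> below.\<close>
  have hub2: "conn P E (i j) (i k) (2 * ?r j + 2 * ?r k)" if "j \<in> K" "k \<in> K" for j k
    using conn_trans[OF conn_sym[OF hub1[OF that(2)]] hub1[OF that(1)]]
    by (rule conn_mono) (use tri[of j] tri[of k] rb[OF that(1)] rb[OF that(2)] in auto)
  have A: "conn P E a (i j) (2 * DD * min h (wd (P a) m) - 2 * ?r j)" if "j \<in> K" "a \<in> V j" for j a
  proof -
    have "conn P E a (R j (3 - j)) (2 * DD * min (2 * (h / 2)) (wd (P a) (corner (child m h j) (h / 2) (3 - j)))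
      - 2 * dist (P (R j (3 - j))) (corner (child m h j) (h / 2) (3 - j)))"
      using g[OF that(1)] that lt[OF that(1)] unfolding good_def by simp
    then show ?thesis using lt[OF that(1)] by (simp add: child_corner_opp i_def)
  qed
  \<comment> \<open>In its own quadrant, an offered point and the outer representative belong to
    opposite corners; this is what the first family of walks in \<open>good\<close> is for.\<close>
  have O: "conn P E (i j) (?o j) (2 * DD * h - 2 * ?r j - 2 * dist (P (?o j)) (corner m h j))" if "j \<in> K" for j
  proof -
    have "conn P E (R j (3 - j)) (R j (3 - (3 - j)))
       (4 * DD * (h / 2) - 2 * dist (P (R j (3 - j))) (corner (child m h j) (h / 2) (3 - j))
          - 2 * dist (P (R j (3 - (3 - j)))) (corner (child m h j) (h / 2) (3 - (3 - j))))"
      using lt[OF that] by (intro goodX[OF g[OF that]]) simp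
    moreover have "3 - (3 - j) = j" using lt[OF that] by simp
    ultimately show ?thesis using lt[OF that] by (simp add: child_corner_opp child_corner_same i_def mult.assoc)
  qed
  have f: "2 * dist (P ?b) (corner m h d) + dist (P (i j)) (P ?b) - 2 * ?r j \<le> 2 * DD * h"
    if "j \<in> K" "d < 4" "d \<notin> K" for j d
    by (rule hub_bound(1)[OF icell[OF kb] icell[OF that(1)] h]) (use that kb lt rb in auto)
  show pair: "conn P E a b (2 * DD * (min h (wd (P a) m) + min h (wd (P b) m)))"
    if "j \<in> K" "k \<in> K" "a \<in> V j" "b \<in> V k" for j k a b
    using conn_trans[OF conn_trans[OF conn_sym[OF A[OF that(2,4)]] hub2[OF that(1,2)]] A[OF that(1,3)]]
    by (rule conn_mono) (simp_all add: algebra_simps)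
  let ?R = "\<lambda>d. if d \<in> K then R d d else R kb (3 - kb)"
  have X0: "conn P E ?b (?o (3 - d)) (4 * DD * h - 2 * dist (P ?b) (corner m h d)
      - 2 * dist (P (?o (3 - d))) (corner m h (3 - d)))" if "d < 4" "d \<notin> K" "3 - d \<in> K" for d
    using conn_trans[OF O[OF that(3)] conn_sym[OF hub1[OF that(3)]]]
    by (rule conn_mono) (use f[OF that(3) that(1,2)] in simp_all)
  have X: "conn P E (?R d) (?R (3 - d)) (4 * DD * h - 2 * dist (P (?R d)) (corner m h d)
      - 2 * dist (P (?R (3 - d))) (corner m h (3 - d)))" if d: "d < 4" for d
  proof -
    consider "d \<in> K" "3 - d \<in> K" | "d \<notin> K" "3 - d \<in> K" | "d \<in> K" "3 - d \<notin> K" | "d \<notin> K" "3 - d \<notin> K" by blast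
    then show ?thesis
    proof cases
      case 1
      have "conn P E (?o d) (?o (3 - d)) (4 * DD * h - 2 * dist (P (?o d)) (corner m h d)
          - 2 * dist (P (?o (3 - d))) (corner m h (3 - d)))"
        using conn_trans[OF conn_trans[OF O[OF 1(2)] hub2[OF 1]] conn_sym[OF O[OF 1(1)]]]
        by (rule conn_mono) simp_all
      then show ?thesis using 1 by simp
    next
      case 2
      then show ?thesis using X0[OF d 2] by (simp add: i_def)
    next
      case 3
      have 33: "3 - (3 - d) = d" using d by simp
      have "conn P E ?b (?o d) (4 * DD * h - 2 * dist (P ?b) (corner m h (3 - d)) - 2 * dist (P (?o d)) (corner m h d))"
        using X0[of "3 - d"] 3 d unfolding 33 by simp
      from conn_sym[OF this] have "conn P E (?o d) ?b (4 * DD * h - 2 * dist (P (?o d)) (corner m h d) - 2 * dist (P ?b) (corner m h (3 - d)))"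
        by (rule conn_mono) simp_all
      then show ?thesis using 3 by (simp add: i_def)
    next
      case 4
      \<comment> \<open>Both corners are empty and the hub represents both. The walk is trivial, and
        only the two debts have to fit; the hub is in a quadrant adjacent to both.\<close>
      have ne: "kb \<noteq> d" "kb \<noteq> 3 - d" using kb 4 by auto
      have 33: "3 - (3 - d) = d" using d by simp
      have "dist (P ?b) (corner m h d) \<le> sqrt 5 * h"
        by (rule hub_bound(2)[OF icell[OF kb] icell[OF kb] h]) (use d lt kb ne in auto)
      moreover have "dist (P ?b) (corner m h (3 - d)) \<le> sqrt 5 * h"
        by (rule hub_bound(2)[OF icell[OF kb] icell[OF kb] h]) (use d lt kb ne 33 in auto)
      moreover have "sqrt 5 * h \<le> DD * h"
      proof (rule mult_right_mono[OF order_trans[OF _ D] h])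
        show "sqrt 5 \<le> 5/2" by (rule real_le_lsqrt) (simp_all add: power2_eq_square)
      qed
      ultimately have "conn P E ?b ?b (4 * DD * h - 2 * dist (P ?b) (corner m h d) - 2 * dist (P ?b) (corner m h (3 - d)))"
        by (intro conn_refl) linarith
      then show ?thesis using 4 by (simp add: i_def)
    qed
  qed
  have G: "conn P E a (?R d) (2 * DD * min (2 * h) (wd (P a) (corner m h d)) - 2 * dist (P (?R d)) (corner m h d))"
    if j: "j \<in> K" and a: "a \<in> V j" and d: "d < 4" for a j d
  proof -
    let ?w = "min (2 * h) (wd (P a) (corner m h d))"
    have D0: "0 \<le> 2 * DD" using D by simp
    have rec: "2 * DD * (h + min h (wd (P a) m)) \<le> 2 * DD * ?w" if "d \<noteq> j"
      using wd_rec[OF cell[OF j a] h lt[OF j] d] that D0 by (intro mult_left_mono) auto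
    consider "d = j" | "d \<noteq> j" "d \<in> K" | "d \<noteq> j" "d \<notin> K" by blast
    then show ?thesis
    proof cases
      case 1
      have "conn P E a (?o j) (2 * DD * min (2 * (h / 2)) (wd (P a) (corner (child m h j) (h / 2) j))
        - 2 * dist (P (?o j)) (corner (child m h j) (h / 2) j))"
        using g[OF j] a lt[OF j] unfolding good_def by simp
      then have "conn P E a (?o d) (2 * DD * min h (wd (P a) (corner m h d)) - 2 * dist (P (?o d)) (corner m h d))"
        using 1 by (simp add: child_corner_same)
      moreover have "2 * DD * min h (wd (P a) (corner m h d)) \<le> 2 * DD * ?w"
        using h D0 by (intro mult_left_mono min.mono) auto
      ultimately have "conn P E a (?o d) (2 * DD * ?w - 2 * dist (P (?o d)) (corner m h d))"
        by (elim conn_mono) auto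
      then show ?thesis using 1 j by simp
    next
      case 2
      have "conn P E a (?o d) (2 * DD * ?w - 2 * dist (P (?o d)) (corner m h d))"
        using conn_trans[OF conn_trans[OF O[OF 2(2)] hub2[OF j 2(2)]] A[OF j a]]
        by (rule conn_mono) (use rec[OF 2(1)] in \<open>simp_all add: distrib_left\<close>)
      then show ?thesis using 2 by simp
    next
      case 3
      have "conn P E a ?b (2 * DD * ?w - 2 * dist (P ?b) (corner m h d))"
        using conn_trans[OF hub1[OF j] A[OF j a]]
        by (rule conn_mono) (use rec[OF 3(1)] f[OF j d 3(2)] in \<open>simp_all add: distrib_left\<close>)
      then show ?thesis using 3 by (simp add: i_def)
    qed
  qed
  have "?R d \<in> (\<Union>k\<in>K. V k)" if "d < 4" for d
  proof (cases "d \<in> K")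
    case False
    have "R kb (3 - kb) \<in> V kb" by (rule RV[OF kb]) simp
    then show ?thesis using False kb by auto
  qed (use RV[of d d] that in auto)
  moreover have "in_cell m h (P a)" if "k \<in> K" "a \<in> V k" for k a
    using child_cell(1)[OF cell[OF that] h] .
  ultimately show "good P E (\<Union>k\<in>K. V k) ?R m h"
    unfolding good_def using X G by blast
qed

section \<open>Points separated by two lines at an angle of 45 degrees\<close>

lemma wgt_opposite:
  assumes "p * e \<le> 0"
  shows "wgt \<bar>p\<bar> \<bar>p + e\<bar> \<le> 7/5 * \<bar>p\<bar> + 2 * \<bar>e\<bar>"
proof -
  \<comment> \<open>After a change of sign, \<open>e\<close> is the amount by which the second
    coordinate is pulled from the diagonal value \<open>p\<close> towards zero and beyond. On the
    diagonal the weight is \<open>7/5 * p\<close>, and leaving it costs at most 2 per unit.\<close>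
  have aux: "wgt p \<bar>p - e\<bar> \<le> 7/5 * p + 2 * e" if "0 \<le> p" "0 \<le> e" for p e :: real
  proof (cases "e \<le> p")
    case True
    have "13/5 * p - 6/5 * (p - e) \<le> 7/5 * p + 2 * e" "13/5 * (p - e) - 6/5 * p \<le> 7/5 * p + 2 * e"
      using that by (simp_all add: field_simps)
    then show ?thesis using True unfolding wgt_def by (intro min.coboundedI2) simp
  next
    case False
    have "wgt p \<bar>p - e\<bar> \<le> 2 * max p \<bar>p - e\<bar>" by (rule wgt_le)
    also have "\<dots> \<le> 7/5 * p + 2 * e"
    proof (cases "p \<le> \<bar>p - e\<bar>")
      case True
      then have "max p \<bar>p - e\<bar> = e - p" using False by simp
      then show ?thesis using that by simp
    next
      case c: False
      then have "max p \<bar>p - e\<bar> = p" by simp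
      then show ?thesis using that False by simp
    qed
    finally show ?thesis .
  qed
  from assms consider "0 \<le> p" "e \<le> 0" | "p \<le> 0" "0 \<le> e"
    by (auto simp: mult_le_0_iff)
  then show ?thesis
  proof cases
    case 1
    then show ?thesis using aux[of p "- e"] by simp
  next
    case 2
    have "\<bar>p + e\<bar> = \<bar>- p - e\<bar>" by simp
    then show ?thesis using aux[of "- p" e] 2 by simp
  qed
qed

lemma cauchy2: "a * x + b * y \<le> sqrt (a\<^sup>2 + b\<^sup>2) * sqrt (x\<^sup>2 + y\<^sup>2)" for a b x y :: real
proof -
  have "(a * x + b * y)\<^sup>2 + (a * y - b * x)\<^sup>2 = (a\<^sup>2 + b\<^sup>2) * (x\<^sup>2 + y\<^sup>2)"
    by (simp add: power2_eq_square algebra_simps)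
  then have "(a * x + b * y)\<^sup>2 \<le> (a\<^sup>2 + b\<^sup>2) * (x\<^sup>2 + y\<^sup>2)" by (smt (verit) zero_le_power2)
  then show ?thesis by (metis real_le_rsqrt real_sqrt_mult)
qed

text \<open>Two points that are separated by two lines through the origin, with an angle of 45 degrees
  between the lines.\<close>

lemma wgt_sum_le:
  assumes "pa * pb \<le> 0" "ea * eb \<le> 0"
  shows "wgt \<bar>pa\<bar> \<bar>pa + ea\<bar> + wgt \<bar>pb\<bar> \<bar>pb + eb\<bar>
    \<le> sqrt (389/25) * sqrt ((pa - pb)\<^sup>2 + ((pa + ea) - (pb + eb))\<^sup>2)"
proof -
  have aux: "wgt \<bar>pa\<bar> \<bar>pa + ea\<bar> + wgt \<bar>pb\<bar> \<bar>pb + eb\<bar>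
    \<le> sqrt (389/25) * sqrt ((pa - pb)\<^sup>2 + ((pa + ea) - (pb + eb))\<^sup>2)"
    if p: "0 \<le> pa" "pb \<le> 0" and e: "ea * eb \<le> 0" for pa pb ea eb :: real
  proof -
    from e consider "0 \<le> ea" "eb \<le> 0" | "ea \<le> 0" "0 \<le> eb" by (auto simp: mult_le_0_iff)
    then show ?thesis
    proof cases
      case 1
      \<comment> \<open>Here the second coordinate dominates for both points and has opposite signs,
        so the weights add up to twice a coordinate difference.\<close>
      have "wgt \<bar>pa\<bar> \<bar>pa + ea\<bar> \<le> 2 * (pa + ea)" using wgt_le[of "\<bar>pa\<bar>" "\<bar>pa + ea\<bar>"] p 1 by simp
      moreover have "wgt \<bar>pb\<bar> \<bar>pb + eb\<bar> \<le> 2 * - (pb + eb)" using wgt_le[of "\<bar>pb\<bar>" "\<bar>pb + eb\<bar>"] p 1 by simp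
      ultimately have "wgt \<bar>pa\<bar> \<bar>pa + ea\<bar> + wgt \<bar>pb\<bar> \<bar>pb + eb\<bar> \<le> 0 * (pa - pb) + 2 * ((pa + ea) - (pb + eb))"
        by simp
      also have "\<dots> \<le> sqrt (0\<^sup>2 + 2\<^sup>2) * sqrt ((pa - pb)\<^sup>2 + ((pa + ea) - (pb + eb))\<^sup>2)"
        by (rule cauchy2)
      also have "\<dots> \<le> sqrt (389/25) * sqrt ((pa - pb)\<^sup>2 + ((pa + ea) - (pb + eb))\<^sup>2)"
        by (intro mult_right_mono) (simp_all only: real_sqrt_le_iff, simp_all)
      finally show ?thesis .
    next
      case 2
      have "wgt \<bar>pa\<bar> \<bar>pa + ea\<bar> \<le> 7/5 * pa + 2 * - ea"
        using wgt_opposite[of pa ea] p 2 by (simp add: mult_nonneg_nonpos)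
      moreover have "wgt \<bar>pb\<bar> \<bar>pb + eb\<bar> \<le> 7/5 * - pb + 2 * eb"
        using wgt_opposite[of pb eb] p 2 by (simp add: mult_nonpos_nonneg)
      \<comment> \<open>This is \<open>7/5 * pa - 2 * ea\<close> and its counterpart, expressed by
        the coordinates \<open>pa\<close> and \<open>pa + ea\<close>. The coefficient vector
        \<open>(17/5, -2)\<close> has squared norm \<open>389/25\<close>.\<close>
      ultimately have "wgt \<bar>pa\<bar> \<bar>pa + ea\<bar> + wgt \<bar>pb\<bar> \<bar>pb + eb\<bar> \<le> 17/5 * (pa - pb) + - 2 * ((pa + ea) - (pb + eb))"
        by (simp add: field_simps)
      also have "\<dots> \<le> sqrt ((17/5)\<^sup>2 + (- 2)\<^sup>2) * sqrt ((pa - pb)\<^sup>2 + ((pa + ea) - (pb + eb))\<^sup>2)"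
        by (rule cauchy2)
      also have "(17/5)\<^sup>2 + (- 2)\<^sup>2 = (389/25 :: real)" by (simp add: power2_eq_square)
      finally show ?thesis .
    qed
  qed
  from assms(1) consider "0 \<le> pa" "pb \<le> 0" | "pa \<le> 0" "0 \<le> pb" by (auto simp: mult_le_0_iff)
  then show ?thesis
  proof cases
    case 1
    then show ?thesis using aux assms(2) by blast
  next
    case 2
    have "(pb - pa)\<^sup>2 = (pa - pb)\<^sup>2" "((pb + eb) - (pa + ea))\<^sup>2 = ((pa + ea) - (pb + eb))\<^sup>2"
      by (simp_all only: power2_commute)
    then show ?thesis using aux[OF 2(2,1), of eb ea] assms(2) by (simp add: mult.commute add.commute)
  qed
qed

text \<open>Here the second line may be displaced by a multiple of the side of the square: if it does not
  pass through the centre, the points are at a distance comparable to the side.\<close>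

lemma two_lines:
  fixes k :: int and pa pb wa wb la lb s c h :: real
  assumes "\<bar>wa\<bar> \<le> h" "\<bar>wb\<bar> \<le> h" "pa * pb \<le> 0" "la * lb \<le> 0" "s = 1 \<or> s = - 1" "c \<noteq> 0"
    "la = c * (wa - s * pa - 2 * h * k)" "lb = c * (wb - s * pb - 2 * h * k)"
  shows "min (2 * h) (wgt \<bar>pa\<bar> \<bar>wa\<bar> + wgt \<bar>pb\<bar> \<bar>wb\<bar>)
    \<le> sqrt (389/25) * sqrt ((pa - pb)\<^sup>2 + (wa - wb)\<^sup>2)"
proof -
  \<comment> \<open>The offsets from the second line in the direction of the coordinate
    \<open>w\<close>; \<open>la\<close> and \<open>lb\<close> are these up to the factor
    \<open>c\<close>.\<close>
  define ea eb where "ea = wa - s * pa - 2 * h * k" and "eb = wb - s * pb - 2 * h * k"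
  have "(c * ea) * (c * eb) \<le> 0" using assms by (simp add: ea_def eb_def)
  then have "(c * c) * (ea * eb) \<le> 0" by (simp add: mult_ac)
  moreover have "0 < c * c" using assms(6) by (auto simp: zero_less_mult_iff linorder_neq_iff)
  ultimately have e: "ea * eb \<le> 0" by (meson mult_pos_pos not_le)
  have s2: "s * pa * (s * pb) \<le> 0" "\<bar>s * p\<bar> = \<bar>p\<bar>" for p using assms(3,5) by auto
  have s3: "(s * pa - s * pb)\<^sup>2 = (pa - pb)\<^sup>2" using assms(5) by (auto simp: power2_commute)
  show ?thesis
  proof (cases "k = 0")
    case True
    have "wgt \<bar>s * pa\<bar> \<bar>s * pa + ea\<bar> + wgt \<bar>s * pb\<bar> \<bar>s * pb + eb\<bar>
      \<le> sqrt (389/25) * sqrt ((s * pa - s * pb)\<^sup>2 + ((s * pa + ea) - (s * pb + eb))\<^sup>2)"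
      by (rule wgt_sum_le[OF s2(1) e])
    then have "wgt \<bar>pa\<bar> \<bar>wa\<bar> + wgt \<bar>pb\<bar> \<bar>wb\<bar> \<le> sqrt (389/25) * sqrt ((pa - pb)\<^sup>2 + (wa - wb)\<^sup>2)"
      unfolding s2(2) s3 ea_def eb_def using True by simp
    then show ?thesis by (rule min.coboundedI2)
  next
    case False
    have h: "0 \<le> h" using assms(1) by linarith
    have "1 \<le> \<bar>real_of_int k\<bar>" using False by linarith
    then have "2 * h * 1 \<le> 2 * h * \<bar>real_of_int k\<bar>" using h by (intro mult_left_mono) auto
    then have hk: "2 * h \<le> \<bar>2 * h * k\<bar>" using h by (simp add: abs_mult)
    have opp: "\<bar>x\<bar> + \<bar>y\<bar> = \<bar>x - y\<bar>" if "x * y \<le> 0" for x y :: real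
      using that by (auto simp: mult_le_0_iff)
    \<comment> \<open>\<open>ea + s * pa\<close> is \<open>wa - 2 * h * k\<close>, and
      \<open>\<bar>wa\<bar> \<le> h\<close>, so a line off the centre forces one of the offsets to
      be large. Offsets of the two points from the same line have opposite signs, so their absolute
      values add up to the absolute value of the difference.\<close>
    have "h \<le> \<bar>ea + s * pa\<bar>" "h \<le> \<bar>eb + s * pb\<bar>" using hk assms(1,2) unfolding ea_def eb_def by linarith+
    moreover have "\<bar>ea + s * pa\<bar> \<le> \<bar>ea\<bar> + \<bar>pa\<bar>" "\<bar>eb + s * pb\<bar> \<le> \<bar>eb\<bar> + \<bar>pb\<bar>"
      using abs_triangle_ineq[of ea "s * pa"] abs_triangle_ineq[of eb "s * pb"] by (simp_all add: s2)
    ultimately have "2 * h \<le> \<bar>ea - eb\<bar> + \<bar>pa - pb\<bar>" using opp[OF e] opp[OF assms(3)] by linarith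
    also have "ea - eb = (wa - wb) - (s * pa - s * pb)" by (simp add: ea_def eb_def)
    also have "\<bar>(wa - wb) - (s * pa - s * pb)\<bar> \<le> \<bar>wa - wb\<bar> + \<bar>pa - pb\<bar>"
      using abs_triangle_ineq4[of "wa - wb" "s * pa - s * pb"] s2(2)[of "pa - pb"] by (simp add: right_diff_distrib)
    finally have "2 * h \<le> 2 * \<bar>pa - pb\<bar> + 1 * \<bar>wa - wb\<bar>" by simp
    also have "\<dots> \<le> sqrt (2\<^sup>2 + 1\<^sup>2) * sqrt (\<bar>pa - pb\<bar>\<^sup>2 + \<bar>wa - wb\<bar>\<^sup>2)" by (rule cauchy2)
    also have "\<dots> \<le> sqrt (389/25) * sqrt ((pa - pb)\<^sup>2 + (wa - wb)\<^sup>2)"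
      unfolding power2_abs by (intro mult_right_mono) (simp_all only: real_sqrt_le_iff, simp_all)
    finally show ?thesis by (rule min.coboundedI1)
  qed
qed

definition rot :: "pt \<Rightarrow> pt" where "rot p = (fst p + snd p, snd p - fst p)"

definition separates :: "pt \<Rightarrow> pt \<Rightarrow> pt \<Rightarrow> bool" where
  "separates m p q \<longleftrightarrow> (fst p - fst m) * (fst q - fst m) \<le> 0 \<or> (snd p - snd m) * (snd q - snd m) \<le> 0"

lemma even_diff_mult:
  fixes u v w :: int
  assumes "odd u" "odd v"
  shows "\<exists>z::int. u + v - 2 * w = 2 * z" "\<exists>z::int. u - v - 2 * w = 2 * z"
  using assms by (auto elim!: oddE) presburger+

text \<open>The lattice structure enters here: a line of the coarser grid meets a line of the
  finer grid, turned by 45 degrees, only at points of the lattice of the finer one.\<close>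

lemma coarse_rotated:
  fixes u v u' v' c :: int and h :: real
  assumes m: "m = (u * h, v * h)" "m' = (u' * (2 * c * h), v' * (2 * c * h))"
    and odd: "odd u" "odd v" and sep: "separates m a b" "separates m' (rot a) (rot b)"
    and cell: "in_cell m h a" "in_cell m h b"
  shows "min (2 * h) (wd a m + wd b m) \<le> sqrt (389/25) * dist a b"
proof -
  \<comment> \<open>\<open>u\<close> and \<open>v\<close> are odd, and the half side of the coarse
    grid is the even multiple \<open>2 * c\<close> of \<open>h\<close>; hence the coarse lines miss
    the centre by multiples of \<open>2 * h\<close>, as \<open>two_lines\<close> requires.\<close>
  obtain z1 z2 z3 z4 :: int where z: "u + v - 2 * (c * u') = 2 * z1" "u - v - 2 * (c * u') = 2 * z2"
      "u + v - 2 * (c * v') = 2 * z3" "v - u - 2 * (c * v') = 2 * z4"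
    using even_diff_mult odd by metis
  have z': "u * h + v * h - u' * (2 * c * h) = 2 * h * z1" "v * h - u * h - v' * (2 * c * h) = 2 * h * z4"
    using arg_cong[OF z(1), of "\<lambda>x. real_of_int x * h"] arg_cong[OF z(4), of "\<lambda>x. real_of_int x * h"]
    by (simp_all add: algebra_simps)
  let ?pa = "fst a - u * h" and ?qa = "snd a - v * h" and ?pb = "fst b - u * h" and ?qb = "snd b - v * h"
  have c: "\<bar>?pa\<bar> \<le> h" "\<bar>?qa\<bar> \<le> h" "\<bar>?pb\<bar> \<le> h" "\<bar>?qb\<bar> \<le> h"
    using cell m by (auto simp: in_cell_def)
  have g1: "min (2 * h) (wgt \<bar>?pa\<bar> \<bar>?qa\<bar> + wgt \<bar>?pb\<bar> \<bar>?qb\<bar>) \<le> sqrt (389/25) * sqrt ((?pa - ?pb)\<^sup>2 + (?qa - ?qb)\<^sup>2)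
    \<Longrightarrow> ?thesis"
    by (simp add: wd_def m dist_pt)
  have g2: "min (2 * h) (wgt \<bar>?qa\<bar> \<bar>?pa\<bar> + wgt \<bar>?qb\<bar> \<bar>?pb\<bar>) \<le> sqrt (389/25) * sqrt ((?qa - ?qb)\<^sup>2 + (?pa - ?pb)\<^sup>2)
    \<Longrightarrow> ?thesis"
    using g1 by (simp add: wgt_commute add.commute)
  have X: "fst (rot x) - fst m' = (fst x - u * h) + (snd x - v * h) + 2 * h * z1"
    "snd (rot x) - snd m' = (snd x - v * h) - (fst x - u * h) + 2 * h * z4" for x
    unfolding z'[symmetric] by (simp_all add: rot_def m)
  from sep(2) consider "(?pa + ?qa + 2 * h * z1) * (?pb + ?qb + 2 * h * z1) \<le> 0"
    | "(?qa - ?pa + 2 * h * z4) * (?qb - ?pb + 2 * h * z4) \<le> 0"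
    unfolding separates_def X by blast
  note l2 = this
  from sep(1) consider "?pa * ?pb \<le> 0" | "?qa * ?qb \<le> 0" by (auto simp: separates_def m)
  then show ?thesis
  proof cases
    case 1
    from l2 show ?thesis
    proof cases
      case a: 1
      show ?thesis by (rule g1, rule two_lines[OF c(2,4) 1 a, of "- 1" 1 "- z1"]) simp_all
    next
      case b: 2
      show ?thesis by (rule g1, rule two_lines[OF c(2,4) 1 b, of 1 1 "- z4"]) simp_all
    qed
  next
    case 2
    from l2 show ?thesis
    proof cases
      case a: 1
      show ?thesis by (rule g2, rule two_lines[OF c(1,3) 2 a, of "- 1" 1 "- z1"]) simp_all
    next
      case b: 2
      show ?thesis by (rule g2, rule two_lines[OF c(1,3) 2 b, of 1 "- 1" "z4"]) simp_all
    qed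
  qed
qed

text \<open>The frames have changed roles, and everything is measured in rotated coordinates. There
  the vertical line through \<open>m\<close> reads \<open>X - Y = 2 * fst m\<close>, so the offset
  is an even multiple of \<open>h\<close> already when both grids have the same side:
  \<open>c * h\<close> takes the place of \<open>2 * c * h\<close>.\<close>

lemma coarse_straight:
  fixes u v u' v' c :: int and h :: real
  assumes m: "m = (u * (c * h), v * (c * h))" "m' = (u' * h, v' * h)"
    and odd: "odd u'" "odd v'" and sep: "separates m a b" "separates m' (rot a) (rot b)"
    and cell: "in_cell m' h (rot a)" "in_cell m' h (rot b)"
  shows "min (2 * h) (wd (rot a) m' + wd (rot b) m') \<le> sqrt (389/25) * dist (rot a) (rot b)"
proof -
  obtain z1 z2 z3 :: int where z: "u' - v' - 2 * (c * u) = 2 * z1" "u' + v' - 2 * (c * v) = 2 * z2"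
    using even_diff_mult odd by metis
  have z': "u' * h - v' * h - 2 * (u * (c * h)) = 2 * h * z1" "u' * h + v' * h - 2 * (v * (c * h)) = 2 * h * z2"
    using arg_cong[OF z(1), of "\<lambda>x. real_of_int x * h"] arg_cong[OF z(2), of "\<lambda>x. real_of_int x * h"]
    by (simp_all add: algebra_simps)
  let ?pa = "fst (rot a) - u' * h" and ?qa = "snd (rot a) - v' * h"
  let ?pb = "fst (rot b) - u' * h" and ?qb = "snd (rot b) - v' * h"
  have c: "\<bar>?pa\<bar> \<le> h" "\<bar>?qa\<bar> \<le> h" "\<bar>?pb\<bar> \<le> h" "\<bar>?qb\<bar> \<le> h"
    using cell m by (auto simp: in_cell_def)
  have g1: "min (2 * h) (wgt \<bar>?pa\<bar> \<bar>?qa\<bar> + wgt \<bar>?pb\<bar> \<bar>?qb\<bar>) \<le> sqrt (389/25) * sqrt ((?pa - ?pb)\<^sup>2 + (?qa - ?qb)\<^sup>2)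
    \<Longrightarrow> ?thesis"
    by (simp add: wd_def m dist_pt)
  have g2: "min (2 * h) (wgt \<bar>?qa\<bar> \<bar>?pa\<bar> + wgt \<bar>?qb\<bar> \<bar>?pb\<bar>) \<le> sqrt (389/25) * sqrt ((?qa - ?qb)\<^sup>2 + (?pa - ?pb)\<^sup>2)
    \<Longrightarrow> ?thesis"
    using g1 by (simp add: wgt_commute add.commute)
  have X: "2 * (fst x - fst m) = (fst (rot x) - u' * h) - (snd (rot x) - v' * h) + 2 * h * z1"
    "2 * (snd x - snd m) = (snd (rot x) - v' * h) + (fst (rot x) - u' * h) + 2 * h * z2" for x
    unfolding z'[symmetric] by (simp_all add: rot_def m)
  have d: "x * y \<le> 0 \<Longrightarrow> (2 * x) * (2 * y) \<le> 0" for x y :: real by simp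
  from sep(1) consider "(?pa - ?qa + 2 * h * z1) * (?pb - ?qb + 2 * h * z1) \<le> 0"
    | "(?qa + ?pa + 2 * h * z2) * (?qb + ?pb + 2 * h * z2) \<le> 0"
    unfolding separates_def X[symmetric] using d by blast
  note l2 = this
  from sep(2) consider "?pa * ?pb \<le> 0" | "?qa * ?qb \<le> 0" by (auto simp: separates_def m)
  then show ?thesis
  proof cases
    case 1
    from l2 show ?thesis
    proof cases
      case a: 1
      show ?thesis by (rule g1, rule two_lines[OF c(2,4) 1 a, of 1 "- 1" "z1"]) simp_all
    next
      case b: 2
      show ?thesis by (rule g1, rule two_lines[OF c(2,4) 1 b, of "- 1" 1 "- z2"]) simp_all
    qed
  next
    case 2
    from l2 show ?thesis
    proof cases
      case a: 1
      show ?thesis by (rule g2, rule two_lines[OF c(1,3) 2 a, of 1 1 "- z1"]) simp_all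
    next
      case b: 2
      show ?thesis by (rule g2, rule two_lines[OF c(1,3) 2 b, of "- 1" 1 "- z2"]) simp_all
    qed
  qed
qed

text \<open>Both factors nearly fill their share: \<open>(2 * DD)\<^sup>2 = 13 + 4 * sqrt 10\<close>
  is below 26, and \<open>389/25\<close> is below 16.\<close>

lemma stretch_const: "2 * DD * sqrt (389/25) \<le> 4 * sqrt 26"
proof (rule power2_le_imp_le)
  have "sqrt 2 * sqrt 5 = sqrt 10" by (simp flip: real_sqrt_mult)
  moreover have "sqrt 10 \<le> 317/100" by (rule real_le_lsqrt) (simp_all add: power2_eq_square)
  moreover have "(2 * DD)\<^sup>2 = 13 + 4 * (sqrt 2 * sqrt 5)"
    by (simp add: DD_def power2_eq_square algebra_simps)
  ultimately have "(2 * DD)\<^sup>2 \<le> 26" by simp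
  then show "(2 * DD * sqrt (389/25))\<^sup>2 \<le> (4 * sqrt 26)\<^sup>2" unfolding power_mult_distrib by simp
qed simp

section \<open>Dyadic levels\<close>

definition fl :: "int \<Rightarrow> real \<Rightarrow> int" where "fl i x = \<lfloor>x / 2 powi i\<rfloor>"

lemma powi2_Suc: "(2::real) powi (i + 1) = 2 * 2 powi i" by (simp add: power_int_add)

lemma powi2_less: "(2::real) powi i < 2 powi j \<longleftrightarrow> i < j"
  using power_int_strict_increasing[of i j "2::real"] power_int_increasing[of j i "2::real"]
  by (cases "i < j") auto

lemma powi2_le: "(2::real) powi i \<le> 2 powi j \<longleftrightarrow> i \<le> j"
  using powi2_less[of j i] by (simp add: not_less[symmetric])

lemma fl_Suc: "fl (i + 1) x = fl i x div 2"
  using floor_divide_real_eq_div[of 2 "x / 2 powi i"] by (simp add: fl_def powi2_Suc mult.commute)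

lemma fl_mono_eq:
  assumes "fl i x = fl i y" "i \<le> j"
  shows "fl j x = fl j y"
  using assms(2,1) by (induction j rule: int_ge_induct) (simp_all add: fl_Suc)

lemma fl_mono: "x \<le> y \<Longrightarrow> fl i x \<le> fl i y"
  unfolding fl_def by (intro floor_mono divide_right_mono) auto

text \<open>The side of the smallest dyadic interval that contains both numbers. A negative and a
  nonnegative number have none, which is why all points are first moved into the nonnegative
  quadrant. The value 0 for equal numbers lets the other coordinate decide in \<open>sep\<close> and
  \<open>zless\<close>.\<close>

definition lv :: "real \<Rightarrow> real \<Rightarrow> real" where
  "lv x y = (if x = y then 0 else THE s. \<exists>i. s = 2 powi i \<and> fl i x = fl i y \<and> fl (i - 1) x \<noteq> fl (i - 1) y)"

lemma lv_eqI:
  assumes "fl i x = fl i y" "fl (i - 1) x \<noteq> fl (i - 1) y"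
  shows "lv x y = 2 powi i"
proof -
  have "j = i" if "fl j x = fl j y" "fl (j - 1) x \<noteq> fl (j - 1) y" for j
  proof (cases j i rule: linorder_cases)
    case less
    then have "j \<le> i - 1" by simp
    from fl_mono_eq[OF that(1) this] assms(2) show ?thesis by contradiction
  next
    case greater
    then have "i \<le> j - 1" by simp
    from fl_mono_eq[OF assms(1) this] that(2) show ?thesis by contradiction
  qed
  note u = this
  have "(THE s. \<exists>i. s = 2 powi i \<and> fl i x = fl i y \<and> fl (i - 1) x \<noteq> fl (i - 1) y) = (2::real) powi i"
  proof (rule the_equality)
    show "\<exists>j. (2::real) powi i = 2 powi j \<and> fl j x = fl j y \<and> fl (j - 1) x \<noteq> fl (j - 1) y"
      using assms by blast
  qed (use u in blast)
  moreover have "x \<noteq> y" using assms(2) by blast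
  ultimately show ?thesis by (simp add: lv_def)
qed

lemma lv_commute: "lv x y = lv y x"
  unfolding lv_def by (intro if_cong arg_cong[where f = The] ext ex_cong1) auto

text \<open>The largest power of two that divides \<open>K\<close>.  The machine finds it without a loop:  for \<open>N = 2 ^ K\<close>,
  the number \<open>gcd K N\<close> counts the solutions of \<open>i * K + j * N = K * N\<close> with \<open>1 \<le> i \<le> N\<close> and \<open>0 \<le> j < K\<close>, which is
  a coefficient of a product of two geometric sums, hence a digit of their values at a large base.\<close>

definition lsb :: "nat \<Rightarrow> nat" where "lsb K = gcd K (2 ^ K)"

text \<open>The exponent \<open>K\<close> in the definition of \<open>lsb\<close> is large enough
  because \<open>v \<le> 2 ^ v \<le> 2 ^ v * u\<close>.\<close>

lemma lsb_mult_odd: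
  assumes "odd u"
  shows "lsb (2 ^ v * u) = 2 ^ v"
proof -
  have "u \<noteq> 0" using assms by (cases u) auto
  have "v \<le> 2 ^ v" by (simp add: less_imp_le)
  also have "(2::nat) ^ v \<le> 2 ^ v * u" using \<open>u \<noteq> 0\<close> by simp
  finally have "v \<le> 2 ^ v * u" .
  then obtain w where w: "2 ^ v * u = v + w" using le_Suc_ex by blast
  have "coprime u (2 ^ w)" using assms by simp
  then have "gcd (2 ^ v * u) (2 ^ v * 2 ^ w) = 2 ^ v" by (simp add: gcd_mult_distrib_nat[symmetric])
  then show ?thesis unfolding lsb_def w by (simp add: power_add)
qed

lemma nat_two_power_odd: "0 < (K::nat) \<Longrightarrow> \<exists>v u. K = 2 ^ v * u \<and> odd u"
proof (induction K rule: less_induct)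
  case (less K)
  show ?case
  proof (cases "odd K")
    case True
    then show ?thesis by (intro exI[of _ 0] exI[of _ K]) simp
  next
    case False
    then have "K div 2 < K" "0 < K div 2" and K: "K = 2 * (K div 2)" using less.prems by auto
    then obtain v u where "K div 2 = 2 ^ v * u" "odd u" using less.IH by blast
    then show ?thesis using K by (intro exI[of _ "Suc v"] exI[of _ u]) simp
  qed
qed

lemma fl_less_iff: "fl i x < m \<longleftrightarrow> x < m * 2 powi i" "m \<le> fl i x \<longleftrightarrow> m * 2 powi i \<le> x"
  by (simp_all add: fl_def floor_less_iff le_floor_iff pos_divide_less_eq pos_le_divide_eq)

text \<open>The level is twice the largest power of two that has a multiple in the interval from
  \<open>x\<close> (excluded) to \<open>y\<close>. Since \<open>g \<le> y - x < 2 * g\<close>, one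
  or two multiples of \<open>g\<close> lie there; the last is \<open>K1 * g\<close>, and
  \<open>E\<close> is the even one of \<open>K1 - 1\<close> and \<open>K1\<close>. So
  \<open>K\<close> is the most divisible of the candidates.\<close>

lemma level_formula:
  fixes x y g :: real and e K1 E K :: int
  assumes "0 \<le> x" "x < y" and e: "e = \<lfloor>ln (y - x) / ln 2\<rfloor>" and g: "g = 2 powi e"
    and K1: "K1 = \<lfloor>y / g\<rfloor>" and E: "E = 2 * (K1 div 2)" and K: "K = (if x < E * g then E else K1)"
  shows "1 \<le> K" "lv x y = 2 * g * lsb (nat K)"
proof -
  have g0: "0 < g" by (simp add: g)
  have l: "ln (y - x) / ln 2 = log 2 (y - x)" by (simp add: log_def)
  have "real_of_int e \<le> log 2 (y - x)" "log 2 (y - x) < real_of_int e + 1"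
    unfolding e l by linarith+
  then have "2 powr e \<le> y - x" "y - x < 2 powr (e + 1)"
    using assms(2) by (simp_all add: le_log_iff log_less_iff)
  then have gy: "g \<le> y - x" "y - x < 2 * g"
    unfolding g by (simp_all add: powr_real_of_int' powr_add)
  have K1y: "K1 * g \<le> y" "y < (K1 + 1) * g"
    using g0 unfolding K1 by (simp_all add: pos_le_divide_eq[symmetric] pos_divide_less_eq[symmetric])
  have K1x: "x < K1 * g" using gy K1y by (simp add: distrib_right)
  have EK: "E \<le> K1" "K1 \<le> E + 1" unfolding E by linarith+
  have Kg: "x < K * g" "K * g \<le> y"
  proof -
    have "E * g \<le> K1 * g" using EK(1) g0 by simp
    then show "x < K * g" "K * g \<le> y" using K1x K1y(1) unfolding K by (simp_all split: if_splits)
  qed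
  then have "0 < K * g" using assms(1) by linarith
  then show K0: "1 \<le> K" using g0 by (simp add: zero_less_mult_iff)
  obtain v u where vu: "nat K = 2 ^ v * u" "odd u" using nat_two_power_odd[of "nat K"] K0 by (auto simp del: int_nat_eq)
  have Ku: "K = 2 ^ v * int u" using vu(1) K0 by (metis int_nat_eq of_nat_mult of_nat_numeral of_nat_power order_trans zero_le_one)
  have pow: "(2::real) powi (e + int v) = 2 ^ v * g" "(2::real) powi (e + int v + 1) = 2 ^ (v + 1) * g"
    unfolding g by (simp_all add: power_int_add)
  have "fl (e + int v) x < int u" "int u \<le> fl (e + int v) y"
    unfolding fl_less_iff pow using Kg Ku by (simp_all add: mult_ac)
  then have ne: "fl (e + int v + 1 - 1) x \<noteq> fl (e + int v + 1 - 1) y" by simp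
  have "fl (e + int v + 1) x = fl (e + int v + 1) y"
  proof (rule ccontr)
    assume "fl (e + int v + 1) x \<noteq> fl (e + int v + 1) y"
    then have less: "fl (e + int v + 1) x < fl (e + int v + 1) y"
      using fl_mono[of x y "e + int v + 1"] assms(2) by simp
    \<comment> \<open>Floors differing at this level would put the multiple \<open>J * g\<close> of
      \<open>2 ^ (v + 1) * g\<close> into the interval. As \<open>J\<close> is even and at least
      \<open>K1 - 1\<close>, it is \<open>E\<close>, so \<open>K = J\<close>, which contradicts that
      \<open>u\<close> is odd.\<close>
    define J where "J = fl (e + int v + 1) y * 2 ^ (v + 1)"
    have J: "x < J * g" "J * g \<le> y"
      using less fl_less_iff(1)[of "e + int v + 1" x "fl (e + int v + 1) y"]
        fl_less_iff(2)[of "fl (e + int v + 1) y" "e + int v + 1" y] unfolding J_def pow by (simp_all add: mult_ac)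
    have "J \<le> K1" unfolding K1 using J(2) g0 by (simp add: le_floor_iff pos_le_divide_eq)
    moreover have "K1 * g < (J + 2) * g" using J(1) K1y(1) gy(2) by (simp add: distrib_right)
    then have "K1 < J + 2" using g0 by (metis mult_less_cancel_right_pos of_int_add of_int_less_iff of_int_numeral)
    moreover have "even J" unfolding J_def by simp
    ultimately have "J = E" unfolding E by presburger
    then have "K = J" using J(1) by (simp add: K)
    then have "2 ^ v * int u = 2 ^ v * (2 * fl (e + int v + 1) y)" using Ku by (simp add: J_def mult_ac)
    then have "int u = 2 * fl (e + int v + 1) y" by simp
    then have "even (int u)" by (metis dvd_triv_left)
    then show False using vu(2) by simp
  qed
  from lv_eqI[OF this ne] show "lv x y = 2 * g * lsb (nat K)"
    unfolding pow vu(1) lsb_mult_odd[OF vu(2)] by simp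
qed

text \<open>There are fewer summands than the base, so adding equal powers never produces a
  carry.\<close>

lemma coeff_sum_powers:
  fixes f :: "'a \<Rightarrow> nat"
  assumes "finite I" "card I < X"
  shows "(\<Sum>i\<in>I. X ^ f i) div X ^ E mod X = card {i \<in> I. f i = E}"
proof -
  let ?L = "{i \<in> I. f i < E}" and ?M = "{i \<in> I. f i = E}" and ?H = "{i \<in> I. E < f i}"
  have X0: "0 < X" using assms(2) by simp
  have "I = ?L \<union> (?M \<union> ?H)" by auto
  then have "(\<Sum>i\<in>I. X ^ f i) = (\<Sum>i\<in>?L \<union> (?M \<union> ?H). X ^ f i)" by simp
  also have "\<dots> = (\<Sum>i\<in>?L. X ^ f i) + ((\<Sum>i\<in>?M. X ^ f i) + (\<Sum>i\<in>?H. X ^ f i))"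
    using assms(1) by (subst sum.union_disjoint; (subst sum.union_disjoint)?) auto
  also have "(\<Sum>i\<in>?M. X ^ f i) = card ?M * X ^ E" by simp
  also have "(\<Sum>i\<in>?H. X ^ f i) = X ^ E * (X * (\<Sum>i\<in>?H. X ^ (f i - Suc E)))"
    unfolding sum_distrib_left by (intro sum.cong) (auto simp flip: power_Suc power_add)
  finally have S: "(\<Sum>i\<in>I. X ^ f i) = (\<Sum>i\<in>?L. X ^ f i) + X ^ E * (card ?M + X * (\<Sum>i\<in>?H. X ^ (f i - Suc E)))"
    by (simp add: algebra_simps)
  have "(\<Sum>i\<in>?L. X ^ f i) < X ^ E"
  proof (cases E)
    case (Suc E')
    have "(\<Sum>i\<in>?L. X ^ f i) \<le> (\<Sum>i\<in>?L. X ^ E')"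
      by (intro sum_mono power_increasing) (use X0 Suc in auto)
    also have "\<dots> \<le> card I * X ^ E'" using assms(1) by (simp add: card_mono)
    also have "\<dots> < X ^ E" using assms(2) X0 Suc by simp
    finally show ?thesis .
  qed (use X0 in simp)
  then have "(\<Sum>i\<in>I. X ^ f i) div X ^ E = card ?M + X * (\<Sum>i\<in>?H. X ^ (f i - Suc E))"
    unfolding S using X0 by (subst div_mult_self2) simp_all
  moreover have "card ?M < X" using card_mono[OF assms(1), of ?M] assms(2) by auto
  ultimately show ?thesis by simp
qed

text \<open>With \<open>K = g * a\<close>, \<open>N = g * b\<close> and coprime \<open>a\<close>,
  \<open>b\<close> the equation becomes \<open>i * a + j * b = g * a * b\<close>. Then
  \<open>b\<close> divides \<open>i\<close>, and the solutions are \<open>i = b * t\<close>,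
  \<open>j = a * (g - t)\<close> for \<open>t\<close> from 1 to \<open>g\<close>.\<close>

lemma card_pairs_gcd:
  fixes K N :: nat
  assumes "0 < K" "0 < N"
  shows "card {(i, j) \<in> {1..N} \<times> {..<K}. i * K + j * N = K * N} = gcd K N"
proof -
  define g where "g = gcd K N"
  obtain a b where ab: "K = g * a" "N = g * b" unfolding g_def by (meson dvdE gcd_dvd1 gcd_dvd2)
  have g0: "0 < g" using assms by (simp add: g_def)
  have co: "coprime a b"
  proof -
    have "g * gcd a b = gcd (g * a) (g * b)" by (rule gcd_mult_distrib_nat)
    also have "\<dots> = g * 1" unfolding ab[symmetric] by (simp add: g_def)
    finally show ?thesis using g0 by (simp only: mult_cancel1 coprime_iff_gcd_eq_1) simp
  qed
  have ab0: "0 < a" "0 < b" using assms ab by (auto intro: Nat.gr0I)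
  have "{(i, j) \<in> {1..N} \<times> {..<K}. i * K + j * N = K * N} = (\<lambda>t. (b * t, a * (g - t))) ` {1..g}"
  proof (intro equalityI subsetI)
    fix z assume "z \<in> {(i, j) \<in> {1..N} \<times> {..<K}. i * K + j * N = K * N}"
    then obtain i j where z: "z = (i, j)" "1 \<le> i" "i \<le> N" "j < K" "i * K + j * N = K * N" by auto
    have e: "i * a + j * b = g * a * b"
    proof -
      have "g * (i * a + j * b) = g * (g * a * b)" using z(5) unfolding ab by (simp add: algebra_simps)
      then show ?thesis using g0 by simp
    qed
    then have "b dvd i * a" by (metis dvd_add_left_iff dvd_triv_right)
    then have "b dvd i" using co by (simp add: coprime_commute coprime_dvd_mult_left_iff)
    then obtain t where t: "i = b * t" by (auto elim: dvdE)
    have tg: "1 \<le> t" "t \<le> g" using z(2,3) t ab ab0 by (auto intro: Nat.gr0I simp: Suc_le_eq)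
    have "b * (t * a + j) = b * (g * a)" using e t by (simp add: algebra_simps)
    then have "t * a + j = g * a" using ab0 by simp
    then have "j = a * (g - t)" by (simp add: algebra_simps diff_mult_distrib2)
    then show "z \<in> (\<lambda>t. (b * t, a * (g - t))) ` {1..g}" using z t tg by auto
  next
    fix z assume "z \<in> (\<lambda>t. (b * t, a * (g - t))) ` {1..g}"
    then obtain t where "z = (b * t, a * (g - t))" "t \<in> {1..g}" by blast
    then have t: "z = (b * t, a * (g - t))" "1 \<le> t" "t \<le> g" by simp_all
    obtain r where r: "g = t + r" using t(3) le_Suc_ex by blast
    have "1 \<le> b * t" using t ab0 by (simp add: Suc_le_eq)
    moreover have "b * t \<le> N" using t(3) ab by simp
    moreover have "a * (g - t) < K" using t ab0 g0 unfolding ab by simp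
    moreover have "b * t * K + a * (g - t) * N = K * N"
      unfolding ab r by (simp add: algebra_simps)
    ultimately show "z \<in> {(i, j) \<in> {1..N} \<times> {..<K}. i * K + j * N = K * N}" using t by auto
  qed
  moreover have "inj_on (\<lambda>t. (b * t, a * (g - t))) {1..g}" using ab0 by (auto simp: inj_on_def)
  ultimately show ?thesis by (simp add: card_image flip: g_def)
qed

lemma geometric_sums:
  fixes X :: nat and K N :: nat
  assumes "1 < X" "0 < K" "0 < N"
  shows "(\<Sum>(i, j)\<in>{1..N} \<times> {..<K}. X ^ (i * K + j * N)) =
      (real X ^ K * (real X ^ (K * N) - 1) / (real X ^ K - 1)) * ((real X ^ (K * N) - 1) / (real X ^ N - 1))"
proof -
  have "1 < real X ^ K" "1 < real X ^ N" using assms by (auto intro: one_less_power)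
  then have g: "(\<Sum>i<N. (real X ^ K) ^ i) = (real X ^ (K * N) - 1) / (real X ^ K - 1)"
    "(\<Sum>j<K. (real X ^ N) ^ j) = (real X ^ (K * N) - 1) / (real X ^ N - 1)"
    by (simp_all add: geometric_sum power_mult mult.commute[of K N] power_mult[of _ N K] flip: power_mult[of _ K N])
  have "(\<Sum>i\<in>{1..N}. (real X ^ K) ^ i) = (\<Sum>i<N. (real X ^ K) ^ Suc i)"
    using sum.atLeast1_atMost_eq[of "\<lambda>i. (real X ^ K) ^ i" N] by (simp add: lessThan_Suc_atMost)
  also have "\<dots> = real X ^ K * ((real X ^ (K * N) - 1) / (real X ^ K - 1))"
    by (simp add: g(1)[symmetric] sum_distrib_left)
  finally have s: "(\<Sum>i\<in>{1..N}. (real X ^ K) ^ i) = real X ^ K * ((real X ^ (K * N) - 1) / (real X ^ K - 1))" .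
  have "real (\<Sum>(i, j)\<in>{1..N} \<times> {..<K}. X ^ (i * K + j * N)) = (\<Sum>i\<in>{1..N}. \<Sum>j<K. (real X ^ K) ^ i * (real X ^ N) ^ j)"
    by (simp add: sum.cartesian_product power_add case_prod_unfold mult.commute flip: power_mult)
  also have "\<dots> = (\<Sum>i\<in>{1..N}. (real X ^ K) ^ i) * (\<Sum>j<K. (real X ^ N) ^ j)" by (simp add: sum_product)
  finally show ?thesis unfolding s g(2) by simp
qed

lemma lsb_formula:
  fixes K X :: nat and P q :: real
  assumes "0 < K" and X: "2 ^ K * K < X" and N: "N = 2 ^ K" and q: "q = real X ^ (K * N)"
    and P: "P = (real X ^ K * (q - 1) / (real X ^ K - 1)) * ((q - 1) / (real X ^ N - 1))"
  shows "lsb K = \<lfloor>P / q\<rfloor> - real X * \<lfloor>P / (q * real X)\<rfloor>"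
proof -
  define S where "S = (\<Sum>(i, j)\<in>{1..N} \<times> {..<K}. X ^ (i * K + j * N))"
  have "1 \<le> 2 ^ K * K" using assms(1) by (simp add: Suc_le_eq)
  then have "1 < X" using X by linarith
  then have PS: "P = real S" unfolding P q S_def using assms(1) N by (subst geometric_sums) auto
  \<comment> \<open>This is the reason for the choice of the base: there are fewer pairs than
    \<open>X\<close>, so the digit at place \<open>K * N\<close> is the number of solutions.\<close>
  have "card ({1..N} \<times> {..<K}) < X" using X N by simp
  then have "S div X ^ (K * N) mod X = card {z \<in> {1..N} \<times> {..<K}. (case z of (i, j) \<Rightarrow> i * K + j * N) = K * N}"
    unfolding S_def by (subst coeff_sum_powers[symmetric]) (auto simp: case_prod_unfold)
  also have "{z \<in> {1..N} \<times> {..<K}. (case z of (i, j) \<Rightarrow> i * K + j * N) = K * N}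
      = {(i, j) \<in> {1..N} \<times> {..<K}. i * K + j * N = K * N}" by auto
  also have "card \<dots> = gcd K N" using card_pairs_gcd[of K N] assms(1) N by simp
  finally have "lsb K = S div X ^ (K * N) mod X" by (simp add: lsb_def N)
  also have "real \<dots> = real (S div X ^ (K * N)) - real X * real (S div X ^ (K * N) div X)"
  proof -
    have "real (a mod X) = real a - real X * real (a div X)" for a
      using mod_mult_div_eq[of a X] by (metis add_diff_cancel_right' of_nat_add of_nat_mult)
    then show ?thesis .
  qed
  also have "real (S div X ^ (K * N)) = \<lfloor>P / q\<rfloor>"
    unfolding PS q using floor_divide_of_nat_eq[of S "X ^ (K * N)", where ?'a = real] by simp
  also have "real (S div X ^ (K * N) div X) = \<lfloor>P / (q * real X)\<rfloor>"
    unfolding PS q div_mult2_eq[symmetric]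
    using floor_divide_of_nat_eq[of S "X ^ (K * N) * X", where ?'a = real] by simp
  finally show ?thesis .
qed

text \<open>At a high enough level both floors are 0, at a low enough level they differ, and going
  down one level at a time must pass the change.\<close>

lemma lv_nonneg_ex:
  assumes "0 \<le> x" "0 \<le> y" "x \<noteq> y"
  shows "\<exists>i. lv x y = 2 powi i \<and> fl i x = fl i y \<and> fl (i - 1) x \<noteq> fl (i - 1) y"
proof -
  have aux: "\<exists>i. fl i x = fl i y \<and> fl (i - 1) x \<noteq> fl (i - 1) y" if xy: "0 \<le> x" "x < y" for x y
  proof (rule ccontr)
    assume no: "\<not> ?thesis"
    have one: "fl i x = fl i y \<Longrightarrow> fl (i - 1) x = fl (i - 1) y" for i using no by blast
    obtain n where n: "y < 2 ^ n" using real_arch_pow[of 2 y] by auto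
    have z: "fl (int n) t = 0" if "0 \<le> t" "t \<le> y" for t
      using that n by (simp add: fl_def floor_eq_iff divide_less_eq)
    have "fl (int n - int k) x = fl (int n - int k) y" for k
    proof (induction k)
      case 0
      then show ?case using z[of x] z[of y] that by simp
    next
      case (Suc k)
      from one[OF this] show ?case by (simp add: algebra_simps)
    qed
    moreover obtain m where "(1 / 2) ^ m < y - x" using real_arch_pow_inv[of "y - x" "1/2"] xy by auto
    then have m: "inverse (2 ^ m) < y - x" by (simp add: power_one_over inverse_eq_divide)
    moreover have "int n - int (n + m) = - int m" by simp
    ultimately have e: "fl (- int m) x = fl (- int m) y" by metis
    have "x * 2 ^ m + 1 < y * 2 ^ m" using m by (simp add: field_simps)
    moreover have "fl (- int m) t = \<lfloor>t * 2 ^ m\<rfloor>" for t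
      by (simp add: fl_def power_int_minus divide_inverse)
    then have "\<lfloor>x * 2 ^ m\<rfloor> = \<lfloor>y * 2 ^ m\<rfloor>" using e by simp
    ultimately show False by linarith
  qed
  show ?thesis
  proof (cases "x < y")
    case True
    then show ?thesis using aux[OF assms(1)] lv_eqI by blast
  next
    case False
    then have "y < x" using assms by simp
    then show ?thesis using aux[OF assms(2)] lv_eqI lv_commute by metis
  qed
qed

lemma lv_pos: "0 \<le> x \<Longrightarrow> 0 \<le> y \<Longrightarrow> x \<noteq> y \<Longrightarrow> 0 < lv x y"
  using lv_nonneg_ex[of x y] by auto

lemma lv_same: "lv x x = 0"
  by (simp add: lv_def)

section \<open>Dyadic squares and the Z-order\<close>

definition nonneg :: "pt \<Rightarrow> bool" where "nonneg p \<longleftrightarrow> 0 \<le> fst p \<and> 0 \<le> snd p"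

definition cl :: "int \<Rightarrow> pt \<Rightarrow> int \<times> int" where "cl i p = (fl i (fst p), fl i (snd p))"

definition lvl :: "pt \<Rightarrow> pt \<Rightarrow> int \<Rightarrow> bool" where
  "lvl p q i \<longleftrightarrow> cl i p = cl i q \<and> cl (i - 1) p \<noteq> cl (i - 1) q"

text \<open>The side of the smallest dyadic square that contains both points.\<close>

definition sep :: "pt \<Rightarrow> pt \<Rightarrow> real" where "sep p q = max (lv (fst p) (fst q)) (lv (snd p) (snd q))"

text \<open>The coordinate with the larger level, that is, with the higher differing bit, decides,
  and ties go to the first coordinate. Inside every square the quadrants thus come in the order 0,
  1, 2, 3.\<close>

definition zless :: "pt \<Rightarrow> pt \<Rightarrow> bool" where
  "zless p q \<longleftrightarrow> (if lv (snd p) (snd q) \<le> lv (fst p) (fst q) then fst p < fst q else snd p < snd q)"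

lemma cl_mono_eq: "cl i p = cl i q \<Longrightarrow> i \<le> j \<Longrightarrow> cl j p = cl j q"
  by (auto simp: cl_def intro: fl_mono_eq)

lemma lvl_unique: "lvl p q i \<Longrightarrow> lvl p q j \<Longrightarrow> i = j"
proof (cases i j rule: linorder_cases)
  case less
  assume "lvl p q i" "lvl p q j"
  then show ?thesis using less cl_mono_eq[of i p q "j - 1"] by (simp add: lvl_def)
next
  case greater
  assume "lvl p q i" "lvl p q j"
  then show ?thesis using greater cl_mono_eq[of j p q "i - 1"] by (simp add: lvl_def)
qed

text \<open>Both the separation and the order are read off the squares of half the separating side.\<close>

lemma lvl_ex:
  assumes "nonneg p" "nonneg q" "p \<noteq> q"
  shows "\<exists>i. lvl p q i \<and> sep p q = 2 powi i \<and>
    (zless p q \<longleftrightarrow> fl (i - 1) (fst p) < fl (i - 1) (fst q) \<or>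
      fl (i - 1) (fst p) = fl (i - 1) (fst q) \<and> fl (i - 1) (snd p) < fl (i - 1) (snd q))"
proof -
  have ord: "fl i x \<noteq> fl i y \<Longrightarrow> x < y \<longleftrightarrow> fl i x < fl i y" for i x y
    using fl_mono[of x y i] fl_mono[of y x i] by (cases x y rule: linorder_cases) auto
  have pq: "0 \<le> fst p" "0 \<le> snd p" "0 \<le> fst q" "0 \<le> snd q" using assms(1,2) by (auto simp: nonneg_def)
  have small: "fl i x = fl i y" if xy: "0 \<le> x" "0 \<le> y" "lv x y \<le> 2 powi i" for x y i
  proof (cases "x = y")
    case False
    obtain j where j: "lv x y = 2 powi j" "fl j x = fl j y" using lv_nonneg_ex[OF xy(1,2) False] by blast
    then have "j \<le> i" using xy(3) by (simp add: powi2_le)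
    then show ?thesis by (rule fl_mono_eq[OF j(2)])
  qed simp
  have small': "fl (i - 1) x = fl (i - 1) y" if xy: "0 \<le> x" "0 \<le> y" "lv x y < 2 powi i" for x y i
  proof (cases "x = y")
    case False
    obtain j where j: "lv x y = 2 powi j" "fl j x = fl j y" using lv_nonneg_ex[OF xy(1,2) False] by blast
    then have "j \<le> i - 1" using xy(3) by (simp add: powi2_less)
    then show ?thesis by (rule fl_mono_eq[OF j(2)])
  qed simp
  have eqI: "x = y" if "0 \<le> x" "0 \<le> y" "lv x y \<le> 0" for x y
    using lv_pos[OF that(1,2)] that(3) by linarith
  show ?thesis
  proof (cases "lv (snd p) (snd q) \<le> lv (fst p) (fst q)")
    case True
    have ne: "fst p \<noteq> fst q"
    proof
      assume e: "fst p = fst q"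
      then have "lv (snd p) (snd q) \<le> 0" using True by (simp add: lv_same)
      then have "snd p = snd q" by (rule eqI[OF pq(2,4)])
      then show False using e assms(3) by (simp add: prod_eq_iff)
    qed
    obtain i where i: "lv (fst p) (fst q) = 2 powi i" "fl i (fst p) = fl i (fst q)"
      "fl (i - 1) (fst p) \<noteq> fl (i - 1) (fst q)" using lv_nonneg_ex[OF pq(1,3) ne] by blast
    have s: "fl i (snd p) = fl i (snd q)" by (rule small[OF pq(2,4)]) (use True i(1) in simp)
    have "lvl p q i" unfolding lvl_def cl_def prod.inject using i(2,3) s by blast
    moreover have "sep p q = 2 powi i" unfolding sep_def using True i(1) by simp
    moreover have "zless p q \<longleftrightarrow> fst p < fst q" unfolding zless_def using True by simp
    ultimately show ?thesis using ord[OF i(3)] i(3) by blast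
  next
    case False
    have ne: "snd p \<noteq> snd q"
    proof
      assume "snd p = snd q"
      then have l: "lv (fst p) (fst q) < 0" using False by (simp add: lv_same)
      then have "fst p = fst q" by (intro eqI[OF pq(1,3)]) simp
      then show False using l by (simp add: lv_same)
    qed
    obtain i where i: "lv (snd p) (snd q) = 2 powi i" "fl i (snd p) = fl i (snd q)"
      "fl (i - 1) (snd p) \<noteq> fl (i - 1) (snd q)" using lv_nonneg_ex[OF pq(2,4) ne] by blast
    have f: "fl (i - 1) (fst p) = fl (i - 1) (fst q)" by (rule small'[OF pq(1,3)]) (use False i(1) in simp)
    have f': "fl i (fst p) = fl i (fst q)" by (rule fl_mono_eq[OF f]) simp
    have "lvl p q i" unfolding lvl_def cl_def prod.inject using i(2,3) f' by blast
    moreover have "sep p q = 2 powi i" unfolding sep_def using False i(1) by simp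
    moreover have "zless p q \<longleftrightarrow> snd p < snd q" unfolding zless_def using False by simp
    ultimately show ?thesis using ord[OF i(3)] f by (intro exI[of _ i]) simp
  qed
qed

lemma zless_irrefl: "\<not> zless p p"
  by (simp add: zless_def)

lemma zless_total:
  assumes "p \<noteq> q" "nonneg p" "nonneg q"
  shows "zless p q \<or> zless q p"
proof -
  obtain i where i: "lvl p q i" "sep p q = 2 powi i" "zless p q \<longleftrightarrow> fl (i - 1) (fst p) < fl (i - 1) (fst q) \<or>
      fl (i - 1) (fst p) = fl (i - 1) (fst q) \<and> fl (i - 1) (snd p) < fl (i - 1) (snd q)"
    using lvl_ex assms by blast
  obtain j where j: "lvl q p j" "sep q p = 2 powi j" "zless q p \<longleftrightarrow> fl (j - 1) (fst q) < fl (j - 1) (fst p) \<or>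
      fl (j - 1) (fst q) = fl (j - 1) (fst p) \<and> fl (j - 1) (snd q) < fl (j - 1) (snd p)"
    using lvl_ex[of q p] assms by blast
  have "lvl p q j" using j(1) by (auto simp: lvl_def)
  then have "j = i" using i(1) by (rule lvl_unique)
  then show ?thesis using i(1,3) j(3) by (auto simp: lvl_def cl_def)
qed

text \<open>At the larger level \<open>k\<close> of the two, both comparisons are lexicographic
  comparisons of squares of half the side, at least one of them strict. The equation for
  \<open>sep\<close> lets the separations of neighbours in the Z-order determine all others.\<close>

lemma zless_trans_sep:
  assumes "nonneg p" "nonneg q" "nonneg r" "zless p q" "zless q r"
  shows "zless p r" "sep p r = max (sep p q) (sep q r)"
proof -
  have ne: "p \<noteq> q" "q \<noteq> r" using assms(4,5) zless_irrefl by blast+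
  let ?lt = "\<lambda>i p q. fl i (fst p) < fl i (fst q) \<or> fl i (fst p) = fl i (fst q) \<and> fl i (snd p) < fl i (snd q)"
  obtain i where i: "lvl p q i" "sep p q = 2 powi i" "?lt (i - 1) p q" using lvl_ex[of p q] ne assms by blast
  obtain j where j: "lvl q r j" "sep q r = 2 powi j" "?lt (j - 1) q r" using lvl_ex[of q r] ne assms by blast
  define k where "k = max i j"
  have pq: "if i = k then ?lt (k - 1) p q else cl (k - 1) p = cl (k - 1) q"
    using i cl_mono_eq[of i p q "k - 1"] by (auto simp: k_def lvl_def)
  have qr: "if j = k then ?lt (k - 1) q r else cl (k - 1) q = cl (k - 1) r"
    using j cl_mono_eq[of j q r "k - 1"] by (auto simp: k_def lvl_def)
  have "i = k \<or> j = k" by (auto simp: k_def)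
  then have lt: "?lt (k - 1) p r" using pq qr by (auto simp: cl_def split: if_splits)
  have "cl k p = cl k r" using i(1) j(1) cl_mono_eq[of i p q k] cl_mono_eq[of j q r k] by (simp add: lvl_def k_def)
  then have l: "lvl p r k" using lt by (auto simp: lvl_def cl_def)
  have pr: "p \<noteq> r" using lt by auto
  obtain k' where k': "lvl p r k'" "sep p r = 2 powi k'" "zless p r \<longleftrightarrow> ?lt (k' - 1) p r"
    using lvl_ex[of p r] pr assms by blast
  have "k' = k" using lvl_unique k'(1) l by blast
  then show "zless p r" "sep p r = max (sep p q) (sep q r)"
    using k' lt i(2) j(2) by (auto simp: k_def max_def powi2_le)
qed

section \<open>Components of the hub tree\<close>

definition ctr :: "int \<Rightarrow> pt \<Rightarrow> pt" where
  "ctr i p = ((fl i (fst p) + 1 / 2) * 2 powi i, (fl i (snd p) + 1 / 2) * 2 powi i)"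

definition qd :: "pt \<Rightarrow> pt \<Rightarrow> nat" where
  "qd m p = (if fst m \<le> fst p then 2 else 0) + (if snd m \<le> snd p then 1 else 0)"

lemma ctr_cong: "cl i p = cl i q \<Longrightarrow> ctr i p = ctr i q"
  by (simp add: ctr_def cl_def)

lemma qd_less: "qd m p < 4"
  by (simp add: qd_def)

lemma sg_qd: "sgx (qd m p) = (if fst m \<le> fst p then 1 else -1)" "sgy (qd m p) = (if snd m \<le> snd p then 1 else -1)"
  by (auto simp: qd_def sgx_def sgy_def)

lemma fl_bounds: "fl i x * 2 powi i \<le> x" "x < (real_of_int (fl i x) + 1) * 2 powi i" for x :: real
  using fl_less_iff(2)[of "fl i x" i x] fl_less_iff(1)[of i x "fl i x + 1"] by simp_all

lemma powi2_half: "(2::real) powi i / 2 = 2 powi (i - 1)"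
  using powi2_Suc[of "i - 1"] by simp

lemma in_cell_ctr: "in_cell (ctr i p) (2 powi i / 2) p"
proof -
  have "\<bar>x - (real_of_int f + 1 / 2) * g\<bar> \<le> g / 2"
    if "real_of_int f * g \<le> x" "x < (real_of_int f + 1) * g" for f and g x :: real
    using that by (auto simp: abs_le_iff field_simps)
  from this[OF fl_bounds] show ?thesis by (simp only: in_cell_def ctr_def fst_conv snd_conv)
qed

lemma fl_half:
  "real_of_int (fl (i - 1) x) = 2 * real_of_int (fl i x) + (if (fl i x + 1 / 2) * 2 powi i \<le> x then 1 else 0)"
proof -
  have h: "(2::real) powi i = 2 * 2 powi (i - 1)" using powi2_Suc[of "i - 1"] by simp
  have f: "fl i x = fl (i - 1) x div 2" using fl_Suc[of "i - 1" x] by simp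
  have "(fl i x + 1 / 2) * 2 powi i = real_of_int (2 * fl i x + 1) * 2 powi (i - 1)"
    unfolding h by (simp add: algebra_simps)
  then have "(fl i x + 1 / 2) * 2 powi i \<le> x \<longleftrightarrow> 2 * fl i x + 1 \<le> fl (i - 1) x"
    using fl_less_iff(2)[of "2 * fl i x + 1" "i - 1" x] by simp
  then have "fl (i - 1) x = 2 * fl i x + (if (fl i x + 1 / 2) * 2 powi i \<le> x then 1 else 0)"
    unfolding f by auto
  then show ?thesis by (simp split: if_splits)
qed

lemma ctr_child: "ctr (i - 1) p = child (ctr i p) (2 powi i / 2) (qd (ctr i p) p)"
proof -
  have h: "(2::real) powi i = 2 * 2 powi (i - 1)" using powi2_Suc[of "i - 1"] by simp
  show ?thesis
    unfolding child_def sg_qd ctr_def[of "i - 1"] fl_half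
    by (simp add: ctr_def h) (simp add: algebra_simps)
qed

lemma qd_eq_iff:
  assumes "cl i p = cl i q"
  shows "qd (ctr i p) p = qd (ctr i p) q \<longleftrightarrow> cl (i - 1) p = cl (i - 1) q"
proof -
  have e: "fl i (fst p) = fl i (fst q)" "fl i (snd p) = fl i (snd q)" using assms by (auto simp: cl_def)
  have "fl (i - 1) (fst p) = fl (i - 1) (fst q) \<longleftrightarrow> (fst (ctr i p) \<le> fst p \<longleftrightarrow> fst (ctr i p) \<le> fst q)"
    unfolding of_int_eq_iff[symmetric, where ?'a = real] fl_half by (simp add: ctr_def e)
  moreover have "fl (i - 1) (snd p) = fl (i - 1) (snd q) \<longleftrightarrow> (snd (ctr i p) \<le> snd p \<longleftrightarrow> snd (ctr i p) \<le> snd q)"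
    unfolding of_int_eq_iff[symmetric, where ?'a = real] fl_half by (simp add: ctr_def e)
  ultimately show ?thesis by (auto simp: cl_def qd_def)
qed

lemma separates_lvl:
  assumes "lvl p q i"
  shows "separates (ctr i p) p q"
proof -
  have e: "fl i (fst p) = fl i (fst q)" "fl i (snd p) = fl i (snd q)" using assms by (auto simp: cl_def lvl_def)
  have "fl (i - 1) (fst p) \<noteq> fl (i - 1) (fst q) \<or> fl (i - 1) (snd p) \<noteq> fl (i - 1) (snd q)"
    using assms by (auto simp: cl_def lvl_def)
  then have "(fst (ctr i p) \<le> fst p) \<noteq> (fst (ctr i p) \<le> fst q) \<or> (snd (ctr i p) \<le> snd p) \<noteq> (snd (ctr i p) \<le> snd q)"
    unfolding of_int_eq_iff[symmetric, where ?'a = real] fl_half by (auto simp: ctr_def e split: if_splits)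
  then show ?thesis by (auto simp: separates_def mult_le_0_iff)
qed

text \<open>The invariant is demanded in every dyadic square that contains the component, since the
  square at which it will be merged next is not known when it is formed.\<close>

definition good_all :: "(nat \<Rightarrow> pt) \<Rightarrow> (nat \<times> nat) set \<Rightarrow> nat set \<Rightarrow> (nat \<Rightarrow> nat) \<Rightarrow> bool" where
  "good_all P E V R \<longleftrightarrow> (\<forall>i. \<forall>a\<in>V. (\<forall>b\<in>V. cl i (P b) = cl i (P a)) \<longrightarrow>
     good P E V R (ctr i (P a)) (2 powi i / 2))"

text \<open>The bound refers only to the square that separates the pair. It is established when this
  square is processed, and later merges only add edges.\<close>

definition pair_good :: "(nat \<Rightarrow> pt) \<Rightarrow> (nat \<times> nat) set \<Rightarrow> nat \<Rightarrow> nat \<Rightarrow> bool" where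
  "pair_good P E a b \<longleftrightarrow> (\<forall>i. lvl (P a) (P b) i \<longrightarrow>
     conn P E a b (2 * DD * min (2 powi i) (wd (P a) (ctr i (P a)) + wd (P b) (ctr i (P a)))))"

definition hub :: "(nat \<Rightarrow> pt) \<Rightarrow> (nat \<times> nat) set \<Rightarrow> nat set \<Rightarrow> (nat \<Rightarrow> nat) \<Rightarrow> bool" where
  "hub P E V R \<longleftrightarrow> (\<forall>d<4. R d \<in> V) \<and> good_all P E V R \<and> (\<forall>a\<in>V. \<forall>b\<in>V. pair_good P E a b)"

lemma hub_mono:
  assumes h: "hub P E V R" and E: "E \<subseteq> E'"
  shows "hub P E' V R"
proof -
  have "R d \<in> V" if "d < 4" for d using h that unfolding hub_def by blast
  moreover have "good P E V R (ctr i (P a)) (2 powi i / 2)" if "a \<in> V" "\<forall>b\<in>V. cl i (P b) = cl i (P a)" for i a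
    using h that unfolding hub_def good_all_def by blast
  note good_mono[OF this E]
  moreover have "conn P E a b (2 * DD * min (2 powi i) (wd (P a) (ctr i (P a)) + wd (P b) (ctr i (P a))))"
    if "a \<in> V" "b \<in> V" "lvl (P a) (P b) i" for a b i
    using h that unfolding hub_def pair_good_def by blast
  note conn_mono[OF this order_refl E]
  ultimately show ?thesis unfolding hub_def good_all_def pair_good_def by blast
qed

lemma hub_good:
  assumes "hub P E V R" "a \<in> V" "\<And>b. b \<in> V \<Longrightarrow> cl i (P b) = cl i (P a)"
  shows "good P E V R (ctr i (P a)) (2 powi i / 2)"
  using assms unfolding hub_def good_all_def by blast

lemma hub_leaf: "hub P E {p} (\<lambda>_. p)"
  using good_leaf[OF in_cell_ctr] by (simp add: hub_def good_all_def pair_good_def lvl_def)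

lemma good_cong:
  assumes "good P E V R m h" "\<And>d. d < 4 \<Longrightarrow> R d = R' d"
  shows "good P E V R' m h"
proof -
  have "R (3 - d) = R' (3 - d)" if "d < 4" for d :: nat using assms(2)[of "3 - d"] that by simp
  then show ?thesis using assms unfolding good_def by auto
qed

text \<open>The program numbers components by stack positions, whereas \<open>hub_node\<close>
  numbers them by quadrants. \<open>q\<close> translates; it is injective because different
  components lie in different squares of half the side.\<close>

lemma hub_join:
  assumes J: "l1 \<in> J" "l2 \<in> J" "l1 \<noteq> l2" and js: "js \<in> J"
    and h: "\<And>l. l \<in> J \<Longrightarrow> hub P E (V l) (R l)"
    and ctr0: "\<And>l a. l \<in> J \<Longrightarrow> a \<in> V l \<Longrightarrow> cl i (P a) = c0" "\<And>l a. l \<in> J \<Longrightarrow> a \<in> V l \<Longrightarrow> ctr i (P a) = m"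
    and same: "\<And>l a b. l \<in> J \<Longrightarrow> a \<in> V l \<Longrightarrow> b \<in> V l \<Longrightarrow> cl (i - 1) (P a) = cl (i - 1) (P b)"
    and diff: "\<And>l l' a b. l \<in> J \<Longrightarrow> l' \<in> J \<Longrightarrow> l \<noteq> l' \<Longrightarrow> a \<in> V l \<Longrightarrow> b \<in> V l' \<Longrightarrow> cl (i - 1) (P a) \<noteq> cl (i - 1) (P b)"
    and q: "\<And>l. l \<in> J \<Longrightarrow> q l = qd m (P (R l 0))"
    and near: "\<And>l. l \<in> J \<Longrightarrow> dist (P (R js (3 - q js))) m \<le> dist (P (R l (3 - q l))) m"
    and edge: "\<And>l. l \<in> J \<Longrightarrow> l \<noteq> js \<Longrightarrow> (R l (3 - q l), R js (3 - q js)) \<in> E"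
    and R': "\<And>l. l \<in> J \<Longrightarrow> R' (q l) = R l (q l)" "\<And>d. d < 4 \<Longrightarrow> d \<notin> q ` J \<Longrightarrow> R' d = R js (3 - q js)"
  shows "hub P E (\<Union>l\<in>J. V l) R'"
proof -
  let ?h = "(2::real) powi i / 2"
  have h0: "0 \<le> ?h" by simp
  have RV: "R l d \<in> V l" if "l \<in> J" "d < 4" for l d using h[OF that(1)] that(2) by (simp add: hub_def)
  have qa: "qd m (P a) = q l" if "l \<in> J" "a \<in> V l" for l a
  proof -
    have r: "R l 0 \<in> V l" by (rule RV[OF that(1)]) simp
    have "qd (ctr i (P a)) (P a) = qd (ctr i (P a)) (P (R l 0)) \<longleftrightarrow> cl (i - 1) (P a) = cl (i - 1) (P (R l 0))"
      by (rule qd_eq_iff) (simp add: ctr0(1)[OF that(1)] that r)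
    then show ?thesis using same[OF that r] ctr0(2)[OF that] q[OF that(1)] by simp
  qed
  have inj: "inj_on q J"
  proof (rule inj_onI, rule ccontr)
    fix l l' assume l: "l \<in> J" "l' \<in> J" "q l = q l'" "l \<noteq> l'"
    have r: "R l 0 \<in> V l" "R l' 0 \<in> V l'" by (rule RV; simp add: l)+
    have "qd (ctr i (P (R l 0))) (P (R l 0)) = qd (ctr i (P (R l 0))) (P (R l' 0)) \<longleftrightarrow>
      cl (i - 1) (P (R l 0)) = cl (i - 1) (P (R l' 0))"
      by (rule qd_eq_iff) (simp add: ctr0(1)[OF l(1) r(1)] ctr0(1)[OF l(2) r(2)])
    then show False using diff[OF l(1,2,4) r] l(3) by (simp add: ctr0(2)[OF l(1) r(1)] q[OF l(1)] q[OF l(2)])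
  qed
  define g where "g = inv_into J q"
  have g: "g (q l) = l" if "l \<in> J" for l using that inj by (simp add: g_def)
  have gJ: "g k \<in> J" "q (g k) = k" if "k \<in> q ` J" for k
    using that by (simp_all add: g_def inv_into_into f_inv_into_f)
  have K: "q ` J \<subseteq> {..<4}"
  proof (rule image_subsetI)
    fix l assume "l \<in> J"
    show "q l \<in> {..<4}" unfolding q[OF \<open>l \<in> J\<close>] lessThan_iff by (rule qd_less)
  qed
  have ch: "ctr (i - 1) (P a) = child m ?h (q l)" if "l \<in> J" "a \<in> V l" for l a
    using ctr_child[of i "P a"] by (simp add: ctr0(2)[OF that] qa[OF that])
  have goodc: "good P E (V (g k)) (R (g k)) (child m ?h k) (?h / 2)" if k: "k \<in> q ` J" for k
  proof -
    have r: "R (g k) 0 \<in> V (g k)" by (rule RV[OF gJ(1)[OF k]]) simp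
    have "good P E (V (g k)) (R (g k)) (ctr (i - 1) (P (R (g k) 0))) (2 powi (i - 1) / 2)"
      by (rule hub_good[OF h[OF gJ(1)[OF k]] r same[OF gJ(1)[OF k] _ r]])
    then show ?thesis using ch[OF gJ(1)[OF k] r] gJ(2)[OF k] by (simp add: powi2_half)
  qed
  have U: "(\<Union>k\<in>q ` J. V (g k)) = (\<Union>l\<in>J. V l)" using g by auto
  have node1: "good P E (\<Union>k\<in>q ` J. V (g k)) (\<lambda>d. if d \<in> q ` J then R (g d) d else R (g (q js)) (3 - q js)) m ?h"
  proof (rule hub_node(1)[OF K imageI[OF js] h0, where V = "\<lambda>k. V (g k)" and R = "\<lambda>k. R (g k)", OF goodc])
    fix k assume k: "k \<in> q ` J"
    show "dist (P (R (g (q js)) (3 - q js))) m \<le> dist (P (R (g k) (3 - k))) m"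
      using near[OF gJ(1)[OF k]] unfolding gJ(2)[OF k] g[OF js] .
  next
    fix k assume k: "k \<in> q ` J" "k \<noteq> q js"
    then have "g k \<noteq> js" using gJ(2)[OF k(1)] by auto
    from edge[OF gJ(1)[OF k(1)] this] show "(R (g k) (3 - k), R (g (q js)) (3 - q js)) \<in> E"
      unfolding gJ(2)[OF k(1)] g[OF js] .
  qed
  have node2: "conn P E a b (2 * DD * (min ?h (wd (P a) m) + min ?h (wd (P b) m)))"
    if "l \<in> J" "l' \<in> J" "a \<in> V l" "b \<in> V l'" for l l' a b
  proof (rule hub_node(2)[OF K imageI[OF js] h0, where V = "\<lambda>k. V (g k)" and R = "\<lambda>k. R (g k)", OF goodc])
    fix k assume k: "k \<in> q ` J"
    show "dist (P (R (g (q js)) (3 - q js))) m \<le> dist (P (R (g k) (3 - k))) m"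
      using near[OF gJ(1)[OF k]] unfolding gJ(2)[OF k] g[OF js] .
  next
    fix k assume k: "k \<in> q ` J" "k \<noteq> q js"
    then have "g k \<noteq> js" using gJ(2)[OF k(1)] by auto
    from edge[OF gJ(1)[OF k(1)] this] show "(R (g k) (3 - k), R (g (q js)) (3 - q js)) \<in> E"
      unfolding gJ(2)[OF k(1)] g[OF js] .
  next
    show "q l \<in> q ` J" "q l' \<in> q ` J" "a \<in> V (g (q l))" "b \<in> V (g (q l'))" using that g by auto
  qed
  have base: "good P E (\<Union>l\<in>J. V l) R' m ?h"
  proof (rule good_cong[OF node1[unfolded U]])
    fix d :: nat assume "d < 4"
    then show "(if d \<in> q ` J then R (g d) d else R (g (q js)) (3 - q js)) = R' d"
      using R'(1)[OF gJ(1), of d] gJ(2)[of d] R'(2)[of d] g[OF js] by simp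
  qed
  have R'V: "R' d \<in> (\<Union>l\<in>J. V l)" if "d < 4" for d using base that by (simp add: good_def)
  have all: "good_all P E (\<Union>l\<in>J. V l) R'"
    unfolding good_all_def
  proof (intro allI ballI impI)
    fix j a assume a: "a \<in> (\<Union>l\<in>J. V l)" "\<forall>b\<in>\<Union>l\<in>J. V l. cl j (P b) = cl j (P a)"
    \<comment> \<open>A dyadic square that contains all components has at least the side
      \<open>2 powi i\<close>, because \<open>l1\<close> and \<open>l2\<close> differ one level
      below. The larger squares are then reached by \<open>good_lift\<close>, one doubling at a
      time.\<close>
    have "i \<le> j"
    proof (rule ccontr)
      assume "\<not> i \<le> j"
      then have ji: "j \<le> i - 1" by simp
      have r: "R l1 0 \<in> V l1" "R l2 0 \<in> V l2" by (rule RV; simp add: J)+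
      have "cl j (P (R l1 0)) = cl j (P a)" "cl j (P (R l2 0)) = cl j (P a)" using a(2) r J by blast+
      then have "cl j (P (R l1 0)) = cl j (P (R l2 0))" by simp
      from cl_mono_eq[OF this ji] diff[OF J r] show False by contradiction
    qed
    then show "good P E (\<Union>l\<in>J. V l) R' (ctr j (P a)) (2 powi j / 2)"
    proof (induction j rule: int_ge_induct)
      case base
      have "ctr i (P a) = m" using ctr0(2) a(1) by blast
      then show ?case using \<open>good P E (\<Union>l\<in>J. V l) R' m ?h\<close> by simp
    next
      case (step j)
      have c: "ctr j (P a) = child (ctr (j + 1) (P a)) (2 powi (j + 1) / 2) (qd (ctr (j + 1) (P a)) (P a))"
        using ctr_child[of "j + 1" "P a"] by simp
      have h: "(2::real) powi j / 2 = 2 powi (j + 1) / 2 / 2" by (simp add: powi2_Suc)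
      show ?case by (rule good_lift[OF step.IH[unfolded c h] _ qd_less]) simp
    qed
  qed
  have pair: "pair_good P E a b" if ab: "a \<in> (\<Union>l\<in>J. V l)" "b \<in> (\<Union>l\<in>J. V l)" for a b
  proof -
    obtain l l' where l: "l \<in> J" "a \<in> V l" "l' \<in> J" "b \<in> V l'" using ab by blast
    show ?thesis
    proof (cases "l = l'")
      case True
      then show ?thesis using h[OF l(1)] l by (simp add: hub_def)
    next
      case False
      have "lvl (P a) (P b) i" using diff[OF l(1,3) False l(2,4)] ctr0(1)[OF l(1,2)] ctr0(1)[OF l(3,4)] by (simp add: lvl_def)
      then have i: "lvl (P a) (P b) j \<Longrightarrow> j = i" for j using lvl_unique by blast
      have "conn P E a b (2 * DD * min (2 powi i) (wd (P a) m + wd (P b) m))"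
      proof (rule conn_mono[OF node2[OF l(1,3,2,4)]])
        have "min ?h (wd (P a) m) + min ?h (wd (P b) m) \<le> ?h + ?h"
          by (intro add_mono) simp_all
        moreover have "min ?h (wd (P a) m) + min ?h (wd (P b) m) \<le> wd (P a) m + wd (P b) m"
          by (intro add_mono) simp_all
        ultimately have "min ?h (wd (P a) m) + min ?h (wd (P b) m) \<le> min (2 powi i) (wd (P a) m + wd (P b) m)"
          by (intro min.boundedI) simp_all
        then show "2 * DD * (min ?h (wd (P a) m) + min ?h (wd (P b) m)) \<le> 2 * DD * min (2 powi i) (wd (P a) m + wd (P b) m)"
          using DD_ge by (intro mult_left_mono) auto
      qed simp
      then show ?thesis unfolding pair_good_def using i ctr0(2)[OF l(1,2)] by auto
    qed
  qed
  show ?thesis using R'V all pair by (simp add: hub_def)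
qed

section \<open>The choice between the two frames\<close>

lemma ctr_odd: "\<exists>u v::int. odd u \<and> odd v \<and> ctr i p = (u * (2 powi i / 2), v * (2 powi i / 2))"
  by (intro exI[of _ "2 * fl i (fst p) + 1"] exI[of _ "2 * fl i (snd p) + 1"])
     (simp add: ctr_def field_simps)

text \<open>The smaller separating square is crossed by a line of a coarser grid that also separates
  the pair. On a tie the rotated tree is taken, since only \<open>coarse_straight\<close> admits
  equal sides. The second bound is measured in the rotated frame, where all lengths carry the factor
  \<open>sqrt 2\<close>.\<close>

lemma tree_choice:
  assumes n: "nonneg (PA a)" "nonneg (PA b)" "nonneg (PB a)" "nonneg (PB b)" "PA a \<noteq> PA b" "PB a \<noteq> PB b"
    and rot: "PB a = rot (PA a)" "PB b = rot (PA b)"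
    and g: "pair_good PA EA a b" "pair_good PB EB a b"
  shows "if sep (PA a) (PA b) < sep (PB a) (PB b) then conn PA EA a b (4 * sqrt 26 * dist (PA a) (PA b))
    else conn PB EB a b (4 * sqrt 26 * dist (PB a) (PB b))"
proof -
  obtain i where i: "lvl (PA a) (PA b) i" "sep (PA a) (PA b) = 2 powi i" using lvl_ex n by blast
  obtain j where j: "lvl (PB a) (PB b) j" "sep (PB a) (PB b) = 2 powi j" using lvl_ex n by blast
  let ?hA = "(2::real) powi i / 2" and ?hB = "(2::real) powi j / 2"
  let ?mA = "ctr i (PA a)" and ?mB = "ctr j (PB a)"
  note r = rot
  have cA: "ctr i (PA b) = ?mA" using i(1) ctr_cong[of i "PA a" "PA b"] by (simp add: lvl_def)
  have cB: "ctr j (PB b) = ?mB" using j(1) ctr_cong[of j "PB a" "PB b"] by (simp add: lvl_def)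
  have inA: "in_cell ?mA ?hA (PA a)" "in_cell ?mA ?hA (PA b)" using in_cell_ctr[of i "PA a"] in_cell_ctr[of i "PA b"] cA by simp_all
  have inB: "in_cell ?mB ?hB (rot (PA a))" "in_cell ?mB ?hB (rot (PA b))"
    using in_cell_ctr[of j "PB a"] in_cell_ctr[of j "PB b"] cB r by simp_all
  have sepA: "separates ?mA (PA a) (PA b)" by (rule separates_lvl[OF i(1)])
  have sepB: "separates ?mB (rot (PA a)) (rot (PA b))" using separates_lvl[OF j(1)] r by simp
  obtain u v where uv: "odd u" "odd v" "?mA = (real_of_int u * ?hA, real_of_int v * ?hA)" using ctr_odd by blast
  obtain u' v' where uv': "odd u'" "odd v'" "?mB = (real_of_int u' * ?hB, real_of_int v' * ?hB)" using ctr_odd by blast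
  have fin: "2 * DD * z \<le> 4 * sqrt 26 * x" if "z \<le> sqrt (389/25) * x" "0 \<le> x" for z x
  proof -
    have "2 * DD * z \<le> 2 * DD * (sqrt (389/25) * x)" using that(1) DD_ge by (intro mult_left_mono) auto
    also have "\<dots> = (2 * DD * sqrt (389/25)) * x" by simp
    also have "\<dots> \<le> 4 * sqrt 26 * x" using stretch_const that(2) by (rule mult_right_mono)
    finally show ?thesis .
  qed
  show ?thesis
  proof (cases "i < j")
    case True
    obtain w where w: "j = i + 1 + int w" using True by (metis zless_iff_Suc_zadd add.assoc add.commute of_nat_Suc)
    \<comment> \<open>A strict inequality of the levels supplies the even ratio \<open>2 * c\<close>
      of the sides that \<open>coarse_rotated\<close> needs.\<close>
    define c :: int where "c = 2 ^ w"
    have hB: "?hB = 2 * c * ?hA" unfolding w c_def by (simp add: power_int_add)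
    have "min (2 * ?hA) (wd (PA a) ?mA + wd (PA b) ?mA) \<le> sqrt (389/25) * dist (PA a) (PA b)"
      by (rule coarse_rotated[OF uv(3) uv'(3)[unfolded hB] uv(1,2) sepA sepB inA])
    then have "conn PA EA a b (4 * sqrt 26 * dist (PA a) (PA b))"
      using g(1)[unfolded pair_good_def, rule_format, OF i(1)] by (elim conn_mono) (intro fin, simp_all)
    then show ?thesis using True i(2) j(2) by (simp add: powi2_less)
  next
    case False
    obtain w where w: "i = j + int w" using False by (metis not_less zle_iff_zadd)
    define c :: int where "c = 2 ^ w"
    have hA: "?hA = c * ?hB" unfolding w c_def by (simp add: power_int_add)
    have "min (2 * ?hB) (wd (rot (PA a)) ?mB + wd (rot (PA b)) ?mB) \<le> sqrt (389/25) * dist (rot (PA a)) (rot (PA b))"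
      by (rule coarse_straight[OF uv(3)[unfolded hA] uv'(3) uv'(1,2) sepA sepB inB])
    then have "conn PB EB a b (4 * sqrt 26 * dist (PB a) (PB b))"
      using g(2)[unfolded pair_good_def, rule_format, OF j(1)] unfolding r
      by (elim conn_mono) (intro fin, simp_all)
    then show ?thesis using False i(2) j(2) by (simp add: powi2_less)
  qed
qed

section \<open>Structured programs with expressions and arrays\<close>

text \<open>Variable \<open>i\<close> lives in register \<open>2 * i\<close>, expressions are evaluated in the odd registers from 3 on,
  and register 1 holds the common length \<open>L\<close> of the arrays; cell \<open>i\<close> of array \<open>k\<close> has address
  \<open>k * L + i\<close>.  Array indices are kept as reals, as in the registers.\<close>

datatype exp = C int | V nat | A exp exp | Bn binop exp exp | Uo unop exp

abbreviation EAdd (infixl "\<oplus>" 65) where "x \<oplus> y \<equiv> Bn Add x y"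
abbreviation ESub (infixl "\<ominus>" 65) where "x \<ominus> y \<equiv> Bn Sub x y"
abbreviation EMul (infixl "\<otimes>" 70) where "x \<otimes> y \<equiv> Bn Mul x y"
abbreviation EDiv (infixl "\<oslash>" 70) where "x \<oslash> y \<equiv> Bn Div x y"

type_synonym vars = "nat \<Rightarrow> real"
type_synonym arrs = "real \<Rightarrow> real \<Rightarrow> real"

fun bval :: "binop \<Rightarrow> real \<Rightarrow> real \<Rightarrow> real" where
  "bval Add x y = x + y" | "bval Sub x y = x - y" | "bval Mul x y = x * y" | "bval Div x y = x / y"

fun uval :: "unop \<Rightarrow> real \<Rightarrow> real" where
  "uval Sqrt x = sqrt x" | "uval Exp x = exp x" | "uval Ln x = ln x" | "uval Floor x = of_int \<lfloor>x\<rfloor>"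

fun ev :: "exp \<Rightarrow> vars \<Rightarrow> arrs \<Rightarrow> real" where
  "ev (C c) v a = of_int c"
| "ev (V i) v a = v i"
| "ev (A k i) v a = a (ev k v a) (ev i v a)"
| "ev (Bn f x y) v a = bval f (ev x v a) (ev y v a)"
| "ev (Uo f x) v a = uval f (ev x v a)"

definition ix :: "nat \<Rightarrow> real \<Rightarrow> bool" where "ix n x \<longleftrightarrow> (\<exists>i<n. x = real i)"

fun bok :: "binop \<Rightarrow> real \<Rightarrow> bool" where
  "bok Div y \<longleftrightarrow> y \<noteq> 0" | "bok _ y \<longleftrightarrow> True"

fun uok :: "unop \<Rightarrow> real \<Rightarrow> bool" where
  "uok Sqrt x \<longleftrightarrow> 0 \<le> x" | "uok Ln x \<longleftrightarrow> 0 < x" | "uok _ x \<longleftrightarrow> True"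

fun ok :: "nat \<Rightarrow> nat \<Rightarrow> exp \<Rightarrow> vars \<Rightarrow> arrs \<Rightarrow> bool" where
  "ok L N (C c) v a \<longleftrightarrow> True"
| "ok L N (V i) v a \<longleftrightarrow> True"
| "ok L N (A k i) v a \<longleftrightarrow> ok L N k v a \<and> ok L N i v a \<and> ix N (ev k v a) \<and> ix L (ev i v a)"
| "ok L N (Bn f x y) v a \<longleftrightarrow> ok L N x v a \<and> ok L N y v a \<and> bok f (ev y v a)"
| "ok L N (Uo f x) v a \<longleftrightarrow> ok L N x v a \<and> uok f (ev x v a)"

fun ce :: "exp \<Rightarrow> nat \<Rightarrow> com" where
  "ce (C c) d = Const (2 * d + 3) c"
| "ce (V i) d = Move (2 * d + 3) (2 * i)"
| "ce (A k i) d = Seq (ce k d) (Seq (ce i (d + 1)) (Seq (Binary Mul (2 * d + 3) (2 * d + 3) 1)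
     (Seq (Binary Add (2 * d + 3) (2 * d + 3) (2 * d + 5)) (Load (2 * d + 3) (2 * d + 3)))))"
| "ce (Bn f x y) d = Seq (ce x d) (Seq (ce y (d + 1)) (Binary f (2 * d + 3) (2 * d + 3) (2 * d + 5)))"
| "ce (Uo f x) d = Seq (ce x d) (Unary f (2 * d + 3) (2 * d + 3))"

fun esz :: "exp \<Rightarrow> nat" where
  "esz (C c) = 1" | "esz (V i) = 1" | "esz (A k i) = esz k + esz i + 3"
| "esz (Bn f x y) = esz x + esz y + 1" | "esz (Uo f x) = esz x + 1"

definition rel :: "nat \<Rightarrow> nat \<Rightarrow> vars \<Rightarrow> arrs \<Rightarrow> (nat \<Rightarrow> real) \<Rightarrow> (nat \<Rightarrow> real) \<Rightarrow> bool" where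
  "rel L N v a r h \<longleftrightarrow> r 1 = real L \<and> (\<forall>i. r (2 * i) = v i) \<and>
     (\<forall>k<N. \<forall>i<L. h (k * L + i) = a (real k) (real i))"

lemma bval_ok: "bok f y \<Longrightarrow> binop_val f x y = Some (bval f x y)"
  by (cases f) auto

lemma uval_ok: "uok f x \<Longrightarrow> unop_val f x = Some (uval f x)"
  by (cases f) auto

lemma rel_temp: "rel L N v a r h \<Longrightarrow> r' 1 = r 1 \<Longrightarrow> (\<And>i. r' (2 * i) = r (2 * i)) \<Longrightarrow> rel L N v a r' h"
  by (simp add: rel_def)

lemma addr_less: "k < N \<Longrightarrow> i < L \<Longrightarrow> k * L + i < N * (L::nat)"
proof -
  assume "k < N" "i < L"
  then have "k * L + i < (k + 1) * L" "(k + 1) * L \<le> N * L" by (simp, intro mult_le_mono1, simp)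
  then show ?thesis by linarith
qed

lemma keep_upd:
  fixes r :: "nat \<Rightarrow> real"
  assumes "\<forall>j. even j \<or> j < 2 * d + 3 \<longrightarrow> r' j = r j"
  shows "\<forall>j. even j \<or> j < 2 * d + 3 \<longrightarrow> (r'(2 * d + 3 := x)) j = r j"
  using assms by (auto simp: fun_upd_def)

lemma keep_trans:
  fixes r :: "nat \<Rightarrow> real"
  assumes "\<forall>j. even j \<or> j < 2 * d + 3 \<longrightarrow> r1 j = r j" "\<forall>j. even j \<or> j < 2 * d + 5 \<longrightarrow> r2 j = r1 j"
  shows "\<forall>j. even j \<or> j < 2 * d + 3 \<longrightarrow> r2 j = r j"
proof (intro allI impI)
  fix j assume j: "even j \<or> j < 2 * d + 3"
  then have "even j \<or> j < 2 * d + 5" by linarith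
  then show "r2 j = r j" using assms j by metis
qed

lemma keep_rel:
  assumes "rel L N v a r h" "\<forall>j. even j \<or> j < 2 * d + 3 \<longrightarrow> r' j = r j"
  shows "rel L N v a r' h"
  by (rule rel_temp[OF assms(1)]) (use assms(2) in auto)

text \<open>Evaluation follows a stack discipline: code at depth \<open>d\<close> changes only odd
  registers from \<open>2 * d + 3\<close> on, so a left operand survives the evaluation of the right
  one at depth \<open>d + 1\<close>.\<close>

lemma ce_correct:
  assumes "rel L N v a r h" "ok L N e v a" "N * L \<le> M"
  shows "\<exists>r'. exec M (ce e d) (r, h) (esz e) (r', h) \<and> r' (2 * d + 3) = ev e v a \<and>
    (\<forall>j. even j \<or> j < 2 * d + 3 \<longrightarrow> r' j = r j)"
  using assms(1,2)
proof (induction e arbitrary: d r)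
  case (C c)
  have "\<forall>j. even j \<or> j < 2 * d + 3 \<longrightarrow> (r(2 * d + 3 := of_int c)) j = r j" by (rule keep_upd) simp
  then show ?case
    unfolding ce.simps esz.simps by (intro exI[of _ "r(2 * d + 3 := of_int c)"] conjI exec.Const) simp_all
next
  case (V i)
  have "\<forall>j. even j \<or> j < 2 * d + 3 \<longrightarrow> (r(2 * d + 3 := r (2 * i))) j = r j" by (rule keep_upd) simp
  moreover have "r (2 * i) = v i" using V(1) by (simp add: rel_def)
  ultimately show ?case
    unfolding ce.simps esz.simps by (intro exI[of _ "r(2 * d + 3 := r (2 * i))"] conjI exec.Move) simp_all
next
  case (Bn f x y)
  from Bn.prems have okk: "ok L N x v a" "ok L N y v a" "bok f (ev y v a)" by auto
  obtain r1 where r1: "exec M (ce x d) (r, h) (esz x) (r1, h)" "r1 (2 * d + 3) = ev x v a"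
    "\<forall>j. even j \<or> j < 2 * d + 3 \<longrightarrow> r1 j = r j" using Bn.IH(1)[OF Bn.prems(1) okk(1)] by blast
  have e: "2 * (d + 1) + 3 = 2 * d + 5" by simp
  obtain r2 where r2: "exec M (ce y (d + 1)) (r1, h) (esz y) (r2, h)"
    "r2 (2 * d + 5) = ev y v a" "\<forall>j. even j \<or> j < 2 * d + 5 \<longrightarrow> r2 j = r1 j"
    using Bn.IH(2)[OF keep_rel[OF Bn.prems(1) r1(3)] okk(2), of "d + 1"] unfolding e by blast
  have x: "r2 (2 * d + 3) = ev x v a" using r1(2) r2(3) by simp
  have "exec M (Binary f (2 * d + 3) (2 * d + 3) (2 * d + 5)) (r2, h) 1 (r2(2 * d + 3 := ev (Bn f x y) v a), h)"
    by (rule exec.Binary) (simp add: x r2(2) bval_ok[OF okk(3)])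
  note E = exec.Seq[OF r1(1) exec.Seq[OF r2(1) this]]
  show ?case
    unfolding ce.simps esz.simps add.assoc
    by (rule exI[of _ "r2(2 * d + 3 := ev (Bn f x y) v a)"], intro conjI, rule E, simp,
        rule keep_upd[OF keep_trans[OF r1(3) r2(3)]])
next
  case (Uo f x)
  from Uo.prems have okk: "ok L N x v a" "uok f (ev x v a)" by auto
  obtain r1 where r1: "exec M (ce x d) (r, h) (esz x) (r1, h)" "r1 (2 * d + 3) = ev x v a"
    "\<forall>j. even j \<or> j < 2 * d + 3 \<longrightarrow> r1 j = r j" using Uo.IH(1)[OF Uo.prems(1) okk(1)] by blast
  have "exec M (Unary f (2 * d + 3) (2 * d + 3)) (r1, h) 1 (r1(2 * d + 3 := ev (Uo f x) v a), h)"
    by (rule exec.Unary) (simp add: r1(2) uval_ok[OF okk(2)])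
  note E = exec.Seq[OF r1(1) this]
  show ?case
    unfolding ce.simps esz.simps
    by (rule exI[of _ "r1(2 * d + 3 := ev (Uo f x) v a)"], intro conjI, rule E, simp, rule keep_upd[OF r1(3)])
next
  case (A x y)
  from A.prems have okk: "ok L N x v a" "ok L N y v a" by auto
  from A.prems obtain k i where ki: "k < N" "ev x v a = real k" "i < L" "ev y v a = real i"
    by (auto simp: ix_def)
  obtain r1 where r1: "exec M (ce x d) (r, h) (esz x) (r1, h)" "r1 (2 * d + 3) = ev x v a"
    "\<forall>j. even j \<or> j < 2 * d + 3 \<longrightarrow> r1 j = r j" using A.IH(1)[OF A.prems(1) okk(1)] by blast
  have e: "2 * (d + 1) + 3 = 2 * d + 5" by simp
  obtain r2 where r2: "exec M (ce y (d + 1)) (r1, h) (esz y) (r2, h)"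
    "r2 (2 * d + 5) = ev y v a" "\<forall>j. even j \<or> j < 2 * d + 5 \<longrightarrow> r2 j = r1 j"
    using A.IH(2)[OF keep_rel[OF A.prems(1) r1(3)] okk(2), of "d + 1"] unfolding e by blast
  have keep: "\<forall>j. even j \<or> j < 2 * d + 3 \<longrightarrow> r2 j = r j" by (rule keep_trans[OF r1(3) r2(3)])
  have x: "r2 (2 * d + 3) = real k" "r2 (2 * d + 5) = real i" "r2 1 = real L"
    using r1(2) r2(2,3) keep_rel[OF A.prems(1) keep] by (simp_all add: ki rel_def)
  define r3 where "r3 = r2(2 * d + 3 := real k * real L)"
  define r4 where "r4 = r3(2 * d + 3 := real (k * L + i))"
  have e3: "exec M (Binary Mul (2 * d + 3) (2 * d + 3) 1) (r2, h) 1 (r3, h)"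
    unfolding r3_def by (rule exec.Binary) (simp only: x binop_val.simps)
  have e4: "exec M (Binary Add (2 * d + 3) (2 * d + 3) (2 * d + 5)) (r3, h) 1 (r4, h)"
    unfolding r4_def by (rule exec.Binary) (simp add: r3_def x)
  have e5: "exec M (Load (2 * d + 3) (2 * d + 3)) (r4, h) 1 (r4(2 * d + 3 := h (k * L + i)), h)"
  proof (rule exec.Load)
    show "r4 (2 * d + 3) = real (k * L + i)" by (simp add: r4_def)
    show "k * L + i < M" using addr_less[OF ki(1,3)] assms(3) by linarith
  qed
  have hv: "h (k * L + i) = a (real k) (real i)" using A.prems(1) ki by (simp add: rel_def)
  have r4: "r4(2 * d + 3 := z) = r2(2 * d + 3 := z)" for z by (simp add: r4_def r3_def)
  note E = exec.Seq[OF r1(1) exec.Seq[OF r2(1) exec.Seq[OF e3 exec.Seq[OF e4 e5[unfolded r4]]]]]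
  have t: "esz x + esz y + 3 = esz x + (esz y + (1 + (1 + 1)))" by simp
  show ?case
    unfolding ce.simps esz.simps t
    by (rule exI[of _ "r2(2 * d + 3 := h (k * L + i))"], intro conjI, rule E, simp add: hv ki, rule keep_upd[OF keep])
qed

lemma ce_at:
  assumes "rel L N v a r h" "ok L N e v a" "N * L \<le> M" "m = 2 * d + 3"
  obtains r' where "exec M (ce e d) (r, h) (esz e) (r', h)" "r' m = ev e v a"
    "\<And>j. j < m \<Longrightarrow> r' j = r j" "rel L N v a r' h"
proof -
  obtain r' where r': "exec M (ce e d) (r, h) (esz e) (r', h)" "r' m = ev e v a"
    "\<forall>j. even j \<or> j < 2 * d + 3 \<longrightarrow> r' j = r j" using ce_correct[OF assms(1-3), of d] unfolding assms(4) by blast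
  then show ?thesis using that[OF r'(1,2) _ keep_rel[OF assms(1) r'(3)]] assms(4) by blast
qed

datatype tst = Lt exp exp | Eq exp exp

datatype hcom = As nat exp | St exp exp exp | Sq hcom hcom (infixr ";;" 60) | Cd tst hcom hcom | Wh tst hcom

type_synonym hst = "vars \<times> arrs \<times> nat"

fun tok :: "nat \<Rightarrow> nat \<Rightarrow> tst \<Rightarrow> vars \<Rightarrow> arrs \<Rightarrow> bool" where
  "tok L N (Lt x y) v a \<longleftrightarrow> ok L N x v a \<and> ok L N y v a"
| "tok L N (Eq x y) v a \<longleftrightarrow> ok L N x v a \<and> ok L N y v a"

fun tv :: "tst \<Rightarrow> vars \<Rightarrow> arrs \<Rightarrow> bool" where
  "tv (Lt x y) v a \<longleftrightarrow> ev x v a < ev y v a"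
| "tv (Eq x y) v a \<longleftrightarrow> ev x v a = ev y v a"

text \<open>The third component of a state counts the iterations of loops; loops must have a bound on it,
  which makes them terminate and bounds the running time.\<close>

fun hwp :: "nat \<Rightarrow> nat \<Rightarrow> hcom \<Rightarrow> hst \<Rightarrow> (hst \<Rightarrow> bool) \<Rightarrow> bool" where
  "hwp L N (As x e) (v, a, k) Q \<longleftrightarrow> ok L N e v a \<and> Q (v(x := ev e v a), a, k)"
| "hwp L N (St p i e) (v, a, k) Q \<longleftrightarrow> ok L N p v a \<and> ok L N i v a \<and> ok L N e v a \<and>
     ix N (ev p v a) \<and> ix L (ev i v a) \<and>
     Q (v, a(ev p v a := (a (ev p v a))(ev i v a := ev e v a)), k)"
| "hwp L N (c ;; d) s Q \<longleftrightarrow> hwp L N c s (\<lambda>s. hwp L N d s Q)"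
| "hwp L N (Cd t c d) (v, a, k) Q \<longleftrightarrow> tok L N t v a \<and>
     (tv t v a \<longrightarrow> hwp L N c (v, a, k) Q) \<and> (\<not> tv t v a \<longrightarrow> hwp L N d (v, a, k) Q)"
| "hwp L N (Wh t c) s Q \<longleftrightarrow> (\<exists>I B. I s \<and> (\<forall>v a k. I (v, a, k) \<longrightarrow> k \<le> B \<and> tok L N t v a \<and>
     (tv t v a \<longrightarrow> hwp L N c (v, a, Suc k) I) \<and> (\<not> tv t v a \<longrightarrow> Q (v, a, k))))"

lemma hwp_mono: "hwp L N c s Q \<Longrightarrow> (\<And>s. Q s \<Longrightarrow> Q' s) \<Longrightarrow> hwp L N c s Q'"
proof (induction L N c s Q arbitrary: Q' rule: hwp.induct)
  case (3 L N c d s Q)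
  then show ?case by (metis hwp.simps(3))
next
  case (5 L N t c s Q)
  from 5(2) obtain I B where I: "I s" "\<forall>v a k. I (v, a, k) \<longrightarrow> k \<le> B \<and> tok L N t v a \<and>
     (tv t v a \<longrightarrow> hwp L N c (v, a, Suc k) I) \<and> (\<not> tv t v a \<longrightarrow> Q (v, a, k))" by auto
  then show ?case unfolding hwp.simps(5) using 5(3) by (intro exI[of _ I] exI[of _ B]) blast
qed auto

lemma hwp_while:
  assumes "I s" "\<And>v a k. I (v, a, k) \<Longrightarrow> k \<le> B"
    "\<And>v a k. I (v, a, k) \<Longrightarrow> tok L N t v a"
    "\<And>v a k. I (v, a, k) \<Longrightarrow> tv t v a \<Longrightarrow> hwp L N c (v, a, Suc k) I"
    "\<And>v a k. I (v, a, k) \<Longrightarrow> \<not> tv t v a \<Longrightarrow> Q (v, a, k)"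
  shows "hwp L N (Wh t c) s Q"
  unfolding hwp.simps by (rule exI[of _ I], rule exI[of _ B]) (simp add: assms)

fun ct :: "tst \<Rightarrow> com" where
  "ct (Lt x y) = Seq (ce x 0) (ce y 1)" | "ct (Eq x y) = Seq (ce x 0) (ce y 1)"

fun tr :: "tst \<Rightarrow> test" where
  "tr (Lt x y) = Less 3 5" | "tr (Eq x y) = Equal 3 5"

fun tsz :: "tst \<Rightarrow> nat" where
  "tsz (Lt x y) = esz x + esz y" | "tsz (Eq x y) = esz x + esz y"

fun cc :: "hcom \<Rightarrow> com" where
  "cc (As x e) = Seq (ce e 0) (Move (2 * x) 3)"
| "cc (St p i e) = Seq (ce p 0) (Seq (ce i 1) (Seq (ce e 2) (Seq (Binary Mul 3 3 1)
     (Seq (Binary Add 3 3 5) (Store 3 7)))))"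
| "cc (c ;; d) = Seq (cc c) (cc d)"
| "cc (Cd t c d) = Seq (ct t) (If (tr t) (cc c) (cc d))"
| "cc (Wh t c) = Seq (ct t) (While (tr t) (Seq (cc c) (ct t)))"

fun hsz :: "hcom \<Rightarrow> nat" where
  "hsz (As x e) = esz e + 1"
| "hsz (St p i e) = esz p + esz i + esz e + 3"
| "hsz (c ;; d) = hsz c + hsz d"
| "hsz (Cd t c d) = tsz t + 1 + hsz c + hsz d"
| "hsz (Wh t c) = tsz t + 1 + hsz c"

lemma ce2:
  assumes "rel L N v a r h" "ok L N x v a" "ok L N y v a" "N * L \<le> M"
  shows "\<exists>r'. exec M (Seq (ce x 0) (ce y 1)) (r, h) (esz x + esz y) (r', h) \<and> r' 3 = ev x v a \<and> r' 5 = ev y v a \<and>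
    rel L N v a r' h"
proof -
  obtain r1 where r1: "exec M (ce x 0) (r, h) (esz x) (r1, h)" "r1 3 = ev x v a" "rel L N v a r1 h"
    by (rule ce_at[OF assms(1,2,4), of 3 0]) auto
  obtain r2 where r2: "exec M (ce y 1) (r1, h) (esz y) (r2, h)" "r2 5 = ev y v a" "r2 3 = r1 3" "rel L N v a r2 h"
    by (rule ce_at[OF r1(3) assms(3,4), of 5 1]) auto
  show ?thesis using exec.Seq[OF r1(1) r2(1)] r1(2) r2(2-4) by (intro exI[of _ r2]) simp
qed

lemma ct_correct:
  assumes "rel L N v a r h" "tok L N t v a" "N * L \<le> M"
  shows "\<exists>r'. exec M (ct t) (r, h) (tsz t) (r', h) \<and> (test_val (tr t) r' \<longleftrightarrow> tv t v a) \<and> rel L N v a r' h"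
proof (cases t)
  case (Lt x y)
  then show ?thesis using ce2[OF assms(1) _ _ assms(3), of x y] assms(2) by auto
next
  case (Eq x y)
  then show ?thesis using ce2[OF assms(1) _ _ assms(3), of x y] assms(2) by auto
qed

text \<open>Between two iterations a program passes through each of its commands at most once, at a
  total cost of at most \<open>hsz c\<close>. From here on it is enough to count iterations; the
  size of the program is the only constant.\<close>

lemma hwp_sound:
  assumes "N * L \<le> M" "hwp L N c (v, a, k) Q" "rel L N v a r h"
  shows "\<exists>t r' h' v' a' k'. exec M (cc c) (r, h) t (r', h') \<and> rel L N v' a' r' h' \<and> Q (v', a', k') \<and>
    k \<le> k' \<and> t \<le> hsz c * (1 + (k' - k))"
  using assms(2,3)
proof (induction c arbitrary: v a k Q r h)
  case (As x e)
  have "ok L N e v a" using As(1) by simp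
  then obtain r1 where r1: "exec M (ce e 0) (r, h) (esz e) (r1, h)" "r1 3 = ev e v a" "rel L N v a r1 h"
    by (rule ce_at[OF As(2) _ assms(1), of e 3 0]) auto
  have odd: "(1::nat) \<noteq> 2 * x" by presburger
  have "rel L N (v(x := ev e v a)) a (r1(2 * x := r1 3)) h"
    using r1(2,3) odd by (simp add: rel_def)
  moreover have "Q (v(x := ev e v a), a, k)" using As(1) by simp
  moreover have "exec M (cc (As x e)) (r, h) (esz e + 1) (r1(2 * x := r1 3), h)"
    unfolding cc.simps by (rule exec.Seq[OF r1(1) exec.Move])
  moreover have "esz e + 1 \<le> hsz (As x e) * (1 + (k - k))" by simp
  ultimately show ?case by blast
next
  case (St p i e)
  from St(1) have okk: "ok L N p v a" "ok L N i v a" "ok L N e v a" by auto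
  obtain p' i' where pi: "p' < N" "ev p v a = real p'" "i' < L" "ev i v a = real i'"
    using St(1) by (auto simp: ix_def)
  obtain r1 where r1: "exec M (ce p 0) (r, h) (esz p) (r1, h)" "r1 3 = ev p v a" "rel L N v a r1 h"
    by (rule ce_at[OF St(2) okk(1) assms(1), of 3 0]) auto
  obtain r2 where r2: "exec M (ce i 1) (r1, h) (esz i) (r2, h)" "r2 5 = ev i v a" "r2 3 = r1 3" "rel L N v a r2 h"
    by (rule ce_at[OF r1(3) okk(2) assms(1), of 5 1]) auto
  obtain r3 where r3: "exec M (ce e 2) (r2, h) (esz e) (r3, h)" "r3 7 = ev e v a" "r3 3 = r2 3" "r3 5 = r2 5" "rel L N v a r3 h"
    by (rule ce_at[OF r2(4) okk(3) assms(1), of 7 2]) auto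
  note R3 = r3(5)
  have r3v: "r3 3 = real p'" "r3 5 = real i'" "r3 1 = real L"
    using r1 r2 r3 pi by (simp_all add: rel_def)
  define r4 where "r4 = r3(3 := real p' * real L)"
  define r5 where "r5 = r4(3 := real (p' * L + i'))"
  have e4: "exec M (Binary Mul 3 3 1) (r3, h) 1 (r4, h)"
    unfolding r4_def by (rule exec.Binary) (simp only: r3v binop_val.simps)
  have e5: "exec M (Binary Add 3 3 5) (r4, h) 1 (r5, h)"
    unfolding r5_def by (rule exec.Binary) (simp add: r3v r4_def)
  have e6: "exec M (Store 3 7) (r5, h) 1 (r5, h(p' * L + i' := r5 7))"
  proof (rule exec.Store)
    show "r5 3 = real (p' * L + i')" by (simp add: r5_def)
    show "p' * L + i' < M" using addr_less[OF pi(1,3)] assms(1) by linarith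
  qed
  have inj: "k * L + j = p' * L + i' \<longleftrightarrow> k = p' \<and> j = i'" if "j < L" for k j
  proof
    assume eq: "k * L + j = p' * L + i'"
    have "(k * L + j) div L = k" "(p' * L + i') div L = p'" using that pi(3) by auto
    then show "k = p' \<and> j = i'" using eq by auto
  qed simp
  have "r5 7 = ev e v a" using r3(2) by (simp add: r5_def r4_def)
  then have "rel L N v (a(real p' := (a (real p'))(real i' := ev e v a))) r5 (h(p' * L + i' := r5 7))"
  proof -
    have "r5 (2 * i) = r3 (2 * i)" for i
    proof -
      have "2 * i \<noteq> 3" by presburger
      then show ?thesis by (simp add: r5_def r4_def)
    qed
    then have "rel L N v a r5 h" by (intro rel_temp[OF R3]) (simp_all add: r5_def r4_def)
    then show ?thesis using \<open>r5 7 = ev e v a\<close> inj by (simp add: rel_def)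
  qed
  moreover have "Q (v, a(real p' := (a (real p'))(real i' := ev e v a)), k)" using St(1) pi by simp
  moreover have "exec M (cc (St p i e)) (r, h) (esz p + (esz i + (esz e + (1 + (1 + 1))))) (r5, h(p' * L + i' := r5 7))"
    unfolding cc.simps
    by (rule exec.Seq[OF r1(1) exec.Seq[OF r2(1) exec.Seq[OF r3(1) exec.Seq[OF e4 exec.Seq[OF e5 e6]]]]])
  moreover have "esz p + (esz i + (esz e + (1 + (1 + 1)))) \<le> hsz (St p i e) * (1 + (k - k))" by simp
  ultimately show ?case by blast
next
  case (Sq c d)
  from Sq.IH(1)[OF Sq.prems(1)[unfolded hwp.simps] Sq.prems(2)] obtain t1 r1 h1 v1 a1 k1 where
    1: "exec M (cc c) (r, h) t1 (r1, h1)" "rel L N v1 a1 r1 h1" "hwp L N d (v1, a1, k1) Q" "k \<le> k1"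
      "t1 \<le> hsz c * (1 + (k1 - k))" by blast
  from Sq.IH(2)[OF 1(3,2)] obtain t2 r2 h2 v2 a2 k2 where
    2: "exec M (cc d) (r1, h1) t2 (r2, h2)" "rel L N v2 a2 r2 h2" "Q (v2, a2, k2)" "k1 \<le> k2"
      "t2 \<le> hsz d * (1 + (k2 - k1))" by blast
  have "hsz c * (1 + (k1 - k)) \<le> hsz c * (1 + (k2 - k))" "hsz d * (1 + (k2 - k1)) \<le> hsz d * (1 + (k2 - k))"
    using 1(4) 2(4) by (intro mult_le_mono2, simp)+
  then have "t1 + t2 \<le> hsz (c ;; d) * (1 + (k2 - k))" using 1(5) 2(5) unfolding hsz.simps distrib_right by linarith
  then show ?case using exec.Seq[OF 1(1) 2(1)] 2(2,3) 1(4) 2(4)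
    by (intro exI[of _ "t1 + t2"] exI[of _ r2] exI[of _ h2] exI[of _ v2] exI[of _ a2] exI[of _ k2]) auto
next
  case (Cd t c d)
  from Cd.prems(1) have tk: "tok L N t v a" by auto
  obtain r1 where r1: "exec M (ct t) (r, h) (tsz t) (r1, h)" "test_val (tr t) r1 \<longleftrightarrow> tv t v a" "rel L N v a r1 h"
    using ct_correct[OF Cd.prems(2) tk assms(1)] by blast
  show ?case
  proof (cases "tv t v a")
    case True
    with Cd.prems(1) have "hwp L N c (v, a, k) Q" by auto
    from Cd.IH(1)[OF this r1(3)] obtain t1 r2 h1 v1 a1 k1 where
      1: "exec M (cc c) (r1, h) t1 (r2, h1)" "rel L N v1 a1 r2 h1" "Q (v1, a1, k1)" "k \<le> k1"
      "t1 \<le> hsz c * (1 + (k1 - k))" by blast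
    have "exec M (If (tr t) (cc c) (cc d)) (r1, h) (t1 + 1) (r2, h1)" by (rule exec.IfTrue) (use True r1(2) 1(1) in auto)
    moreover have "tsz t + (t1 + 1) \<le> hsz (Cd t c d) * (1 + (k1 - k))" using 1(5) by (simp add: algebra_simps)
    ultimately show ?thesis using exec.Seq[OF r1(1)] 1(2-4) by (fastforce simp del: hsz.simps)
  next
    case False
    with Cd.prems(1) have "hwp L N d (v, a, k) Q" by auto
    from Cd.IH(2)[OF this r1(3)] obtain t1 r2 h1 v1 a1 k1 where
      1: "exec M (cc d) (r1, h) t1 (r2, h1)" "rel L N v1 a1 r2 h1" "Q (v1, a1, k1)" "k \<le> k1"
      "t1 \<le> hsz d * (1 + (k1 - k))" by blast
    have "exec M (If (tr t) (cc c) (cc d)) (r1, h) (t1 + 1) (r2, h1)" by (rule exec.IfFalse) (use False r1(2) 1(1) in auto)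
    moreover have "tsz t + (t1 + 1) \<le> hsz (Cd t c d) * (1 + (k1 - k))" using 1(5) by (simp add: algebra_simps)
    ultimately show ?thesis using exec.Seq[OF r1(1)] 1(2-4) by (fastforce simp del: hsz.simps)
  qed
next
  case (Wh t c)
  from Wh.prems(1) obtain I B where I: "I (v, a, k)" "\<forall>v a k. I (v, a, k) \<longrightarrow> k \<le> B \<and> tok L N t v a \<and>
     (tv t v a \<longrightarrow> hwp L N c (v, a, Suc k) I) \<and> (\<not> tv t v a \<longrightarrow> Q (v, a, k))" by auto
  \<comment> \<open>The induction is on \<open>B - k\<close>: the body starts with the counter
    raised by one, and the invariant keeps the counter at most \<open>B\<close>.\<close>
  have loop: "\<exists>t' r' h' v' a' k'. exec M (While (tr t) (Seq (cc c) (ct t))) (r, h) t' (r', h') \<and> rel L N v' a' r' h' \<and>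
      Q (v', a', k') \<and> k \<le> k' \<and> t' \<le> (tsz t + 1 + hsz c) * (k' - k) + 1"
    if "I (v, a, k)" "rel L N v a r h" "test_val (tr t) r \<longleftrightarrow> tv t v a" for v a k r h
    using that
  proof (induction "B - k" arbitrary: v a k r h rule: less_induct)
    case less
    show ?case
    proof (cases "tv t v a")
      case False
      then have "exec M (While (tr t) (Seq (cc c) (ct t))) (r, h) 1 (r, h)" by (intro exec.WhileFalse) (use less.prems in auto)
      then show ?thesis using False I(2) less.prems
        by (intro exI[of _ 1] exI[of _ r] exI[of _ h] exI[of _ v] exI[of _ a] exI[of _ k]) auto
    next
      case True
      have "hwp L N c (v, a, Suc k) I" using I(2) less.prems(1) True by blast
      from Wh.IH[OF this less.prems(2)] obtain t1 r1 h1 v1 a1 k1 where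
        1: "exec M (cc c) (r, h) t1 (r1, h1)" "rel L N v1 a1 r1 h1" "I (v1, a1, k1)" "Suc k \<le> k1"
          "t1 \<le> hsz c * (1 + (k1 - Suc k))" by blast
      have "tok L N t v1 a1" using I(2) 1(3) by blast
      then obtain r2 where r2: "exec M (ct t) (r1, h1) (tsz t) (r2, h1)" "test_val (tr t) r2 \<longleftrightarrow> tv t v1 a1" "rel L N v1 a1 r2 h1"
        using ct_correct[OF 1(2) _ assms(1)] by blast
      have kB: "k1 \<le> B" using I(2) 1(3) by blast
      have "B - k1 < B - k" using kB 1(4) by linarith
      from less.hyps[OF this 1(3) r2(3,2)] obtain t3 r3 h3 v3 a3 k3 where
        3: "exec M (While (tr t) (Seq (cc c) (ct t))) (r2, h1) t3 (r3, h3)" "rel L N v3 a3 r3 h3" "Q (v3, a3, k3)"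
          "k1 \<le> k3" "t3 \<le> (tsz t + 1 + hsz c) * (k3 - k1) + 1" by blast
      have "exec M (While (tr t) (Seq (cc c) (ct t))) (r, h) (t1 + tsz t + t3 + 1) (r3, h3)"
        by (rule exec.WhileTrue[OF _ exec.Seq[OF 1(1) r2(1)] 3(1)]) (use True less.prems(3) in auto)
      moreover have "t1 + tsz t + t3 + 1 \<le> (tsz t + 1 + hsz c) * (k3 - k) + 1"
      proof -
        have e: "1 + (k1 - Suc k) = k1 - k" "k3 - k = (k1 - k) + (k3 - k1)" "1 \<le> k1 - k" using 1(4) 3(4) by auto
        have "(tsz t + 1) * 1 \<le> (tsz t + 1) * (k1 - k)" by (rule mult_le_mono2) fact
        moreover have "t1 \<le> hsz c * (k1 - k)" using 1(5) unfolding e(1) .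
        moreover have "(tsz t + 1 + hsz c) * (k3 - k)
            = (tsz t + 1) * (k1 - k) + hsz c * (k1 - k) + (tsz t + 1 + hsz c) * (k3 - k1)"
          unfolding e(2) by (simp only: distrib_left distrib_right)
        moreover have "T + 1 \<le> A \<Longrightarrow> t1 \<le> B \<Longrightarrow> X = A + B + C \<Longrightarrow> t3 \<le> C + 1 \<Longrightarrow> t1 + T + t3 + 1 \<le> X + 1"
          for T A B C X :: nat by linarith
        ultimately show ?thesis using 3(5) unfolding mult_1_right by blast
      qed
      moreover have "k \<le> k3" using 1(4) 3(4) by simp
      ultimately show ?thesis using 3(2,3) by blast
    qed
  qed
  have tk: "tok L N t v a" using I by blast
  obtain r1 where r1: "exec M (ct t) (r, h) (tsz t) (r1, h)" "test_val (tr t) r1 \<longleftrightarrow> tv t v a" "rel L N v a r1 h"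
    using ct_correct[OF Wh.prems(2) tk assms(1)] by blast
  from loop[OF I(1) r1(3,2)] obtain t' r' h' v' a' k' where
    2: "exec M (While (tr t) (Seq (cc c) (ct t))) (r1, h) t' (r', h')" "rel L N v' a' r' h'"
      "Q (v', a', k')" "k \<le> k'" "t' \<le> (tsz t + 1 + hsz c) * (k' - k) + 1" by blast
  have "tsz t + t' \<le> hsz (Wh t c) * (1 + (k' - k))" using 2(5) by (simp add: algebra_simps)
  then show ?case using exec.Seq[OF r1(1) 2(1)] 2(2-4)
    by (intro exI[of _ "tsz t + t'"] exI[of _ r'] exI[of _ h'] exI[of _ v'] exI[of _ a'] exI[of _ k']) auto
qed

section \<open>Rules for symbolic execution\<close>

lemma ix_of_nat [simp]: "ix n (real i) \<longleftrightarrow> i < n"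
  by (auto simp: ix_def)

lemma ix_numeral [simp]: "ix n (numeral w) \<longleftrightarrow> numeral w < n" "ix n 0 \<longleftrightarrow> 0 < n" "ix n 1 \<longleftrightarrow> 1 < n"
  using ix_of_nat[of n "numeral w"] ix_of_nat[of n 0] ix_of_nat[of n 1] by simp_all

lemma ix_Suc [simp]: "ix n (1 + real i) \<longleftrightarrow> Suc i < n" "ix n (real i + 1) \<longleftrightarrow> Suc i < n"
  using ix_of_nat[of n "Suc i"] by (simp_all add: add.commute)

lemma hwp_seq: "hwp L N c s (\<lambda>s. hwp L N d s Q) \<Longrightarrow> hwp L N (c ;; d) s Q"
  by simp

lemma hwp_as: "ok L N e v a \<Longrightarrow> ev e v a = z \<Longrightarrow> Q (v(x := z), a, k) \<Longrightarrow> hwp L N (As x e) (v, a, k) Q"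
  by simp

lemma hwp_asq:
  "ok L N e v a \<Longrightarrow> ev e v a = z \<Longrightarrow> hwp L N d (v(x := z), a, k) Q \<Longrightarrow> hwp L N (As x e ;; d) (v, a, k) Q"
  by simp

lemma hwp_cd:
  "tok L N t v a \<Longrightarrow> (tv t v a \<Longrightarrow> hwp L N c (v, a, k) Q) \<Longrightarrow> (\<not> tv t v a \<Longrightarrow> hwp L N d (v, a, k) Q) \<Longrightarrow>
    hwp L N (Cd t c d) (v, a, k) Q"
  by simp

section \<open>Computing levels\<close>

text \<open>A loop-free program for \<open>level_formula\<close> and \<open>lsb_formula\<close>, so
  levels take constant time however close the numbers are. Powers such as \<open>2 ^ K\<close> and
  \<open>X ^ (K * N)\<close> are obtained as \<open>exp\<close> of a multiple of a logarithm, and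
  therefore their size does not matter. Registers 20 and 21 hold the arguments, 22 receives the
  level.\<close>

definition lev :: hcom where "lev =
  Cd (Eq (V 20) (V 21)) (As 22 (C 0)) (
    Cd (Lt (V 20) (V 21)) (As 23 (V 20) ;; As 24 (V 21)) (As 23 (V 21) ;; As 24 (V 20)) ;;
    As 25 (Uo Exp (Uo Floor (Uo Ln (V 24 \<ominus> V 23) \<oslash> Uo Ln (C 2)) \<otimes> Uo Ln (C 2))) ;;
    As 26 (Uo Floor (V 24 \<oslash> V 25)) ;;
    As 27 (C 2 \<otimes> Uo Floor (V 26 \<oslash> C 2)) ;;
    Cd (Lt (V 23) (V 27 \<otimes> V 25)) (As 26 (V 27)) (As 26 (V 26)) ;;
    As 27 (Uo Exp (V 26 \<otimes> Uo Ln (C 2))) ;;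
    As 28 (V 27 \<otimes> V 26 \<oplus> C 1) ;;
    As 29 (Uo Exp (V 26 \<otimes> V 27 \<otimes> Uo Ln (V 28))) ;;
    As 30 (Uo Exp (V 26 \<otimes> Uo Ln (V 28))) ;;
    As 31 (Uo Exp (V 27 \<otimes> Uo Ln (V 28))) ;;
    As 27 ((V 30 \<otimes> (V 29 \<ominus> C 1) \<oslash> (V 30 \<ominus> C 1)) \<otimes> ((V 29 \<ominus> C 1) \<oslash> (V 31 \<ominus> C 1))) ;;
    As 27 (Uo Floor (V 27 \<oslash> V 29) \<ominus> V 28 \<otimes> Uo Floor (V 27 \<oslash> (V 29 \<otimes> V 28))) ;;
    As 22 (C 2 \<otimes> V 25 \<otimes> V 27))"

lemma level_value:
  fixes x y :: real
  assumes "0 \<le> x" "x < y" and g: "g = exp (of_int \<lfloor>ln (y - x) / ln 2\<rfloor> * ln 2)"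
    and K1: "K1 = real_of_int \<lfloor>y / g\<rfloor>" and E: "E = 2 * real_of_int \<lfloor>K1 / 2\<rfloor>"
    and K: "K = (if x < E * g then E else K1)" and N: "N = exp (K * ln 2)" and X: "X = N * K + 1"
    and q: "q = exp (K * N * ln X)" and a: "a = exp (K * ln X)" and b: "b = exp (N * ln X)"
    and P: "P = (a * (q - 1) / (a - 1)) * ((q - 1) / (b - 1))"
  shows "0 < X" "a \<noteq> 1" "b \<noteq> 1" "lv x y = 2 * g * (of_int \<lfloor>P / q\<rfloor> - X * of_int \<lfloor>P / (q * X)\<rfloor>)"
proof -
  let ?e = "\<lfloor>ln (y - x) / ln 2\<rfloor>" let ?k = "\<lfloor>y / g\<rfloor>"
  let ?K = "if x < real_of_int (2 * (?k div 2)) * g then 2 * (?k div 2) else ?k"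
  have g': "g = 2 powi ?e"
  proof -
    have "g = 2 powr ?e" by (simp add: g powr_def)
    then show ?thesis by (simp add: powr_real_of_int')
  qed
  have "real_of_int ?k / 2 = real_of_int ?k / real_of_int 2" by simp
  then have fl2: "\<lfloor>real_of_int ?k / 2\<rfloor> = ?k div 2" by (simp only: floor_divide_of_int_eq)
  have K': "K = real_of_int ?K" unfolding K E K1 fl2 by simp
  note lf = level_formula[OF assms(1,2) refl g' refl refl refl]
  define k where "k = nat ?K"
  have k: "0 < k" "K = real k" using lf(1) K' by (simp_all add: k_def)
  have N': "N = real (2 ^ k)" unfolding N k(2) by (simp add: exp_of_nat_mult)
  define Y where "Y = 2 ^ k * k + (1::nat)"
  have Y: "X = real Y" "2 ^ k * k < Y" unfolding X N' k(2) Y_def by simp_all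
  have Y1: "1 < real Y" unfolding Y_def using k by simp
  have exp_pow: "exp (real m * ln (real Y)) = real Y ^ m" for m using Y1 by (simp add: exp_of_nat_mult)
  have qa: "q = real Y ^ (k * 2 ^ k)" "a = real Y ^ k" "b = real Y ^ (2 ^ k)"
    unfolding q a b Y(1) N' k(2) of_nat_mult[symmetric] exp_pow by simp_all
  show "0 < X" using Y1 Y by simp
  have "1 < a" "1 < b" unfolding qa by (rule one_less_power[OF Y1], simp add: k(1))+
  then show "a \<noteq> 1" "b \<noteq> 1" by simp_all
  have "real (lsb k) = \<lfloor>P / q\<rfloor> - real Y * \<lfloor>P / (q * real Y)\<rfloor>"
    by (rule lsb_formula[OF k(1) Y(2) refl qa(1)]) (simp only: P qa)
  then show "lv x y = 2 * g * (of_int \<lfloor>P / q\<rfloor> - X * of_int \<lfloor>P / (q * X)\<rfloor>)"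
    using lf(2) unfolding Y(1) k_def[symmetric] by simp
qed

lemma hwp_lev:
  assumes "0 \<le> v 20" "0 \<le> v 21"
    and Q: "\<And>v'. (\<And>i. i < 22 \<or> 31 < i \<Longrightarrow> v' i = v i) \<Longrightarrow> v' 22 = lv (v 20) (v 21) \<Longrightarrow> Q (v', a, k)"
  shows "hwp L 19 lev (v, a, k) Q"
proof (cases "v 20 = v 21")
  case True
  then show ?thesis unfolding lev_def by (auto intro!: Q simp: lv_same)
next
  case False
  define x y where "x = min (v 20) (v 21)" and "y = max (v 20) (v 21)"
  have xy: "0 \<le> x" "x < y" "lv (v 20) (v 21) = lv x y"
    using assms(1,2) False by (auto simp: x_def y_def min_def max_def lv_commute)
  have init: "Q' (v(23 := x, 24 := y), a, k) \<Longrightarrow>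
    hwp L 19 (Cd (Lt (V 20) (V 21)) (As 23 (V 20) ;; As 24 (V 21)) (As 23 (V 21) ;; As 24 (V 20))) (v, a, k) Q'" for Q'
    using False by (auto simp: x_def y_def min_def max_def)
  define g :: real where "g = exp (of_int \<lfloor>ln (y - x) / ln 2\<rfloor> * ln 2)"
  define K1 where "K1 = real_of_int \<lfloor>y / g\<rfloor>"
  define E where "E = 2 * real_of_int \<lfloor>K1 / 2\<rfloor>"
  define K where "K = (if x < E * g then E else K1)"
  define N where "N = exp (K * ln 2)"
  define X where "X = N * K + 1"
  define q where "q = exp (K * N * ln X)"
  define a' where "a' = exp (K * ln X)"
  define b where "b = exp (N * ln X)"
  define P where "P = (a' * (q - 1) / (a' - 1)) * ((q - 1) / (b - 1))"
  note lval = level_value[OF xy(1,2) g_def K1_def E_def K_def N_def X_def q_def a'_def b_def P_def]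
  have pos: "0 < g" "0 < q" by (simp_all add: g_def q_def)
  have sel: "Q' (w(26 := K), a, k) \<Longrightarrow> hwp L 19 (Cd (Lt (V 23) (V 27 \<otimes> V 25)) (As 26 (V 27)) (As 26 (V 26))) (w, a, k) Q'"
    if "w 23 = x" "w 27 = E" "w 25 = g" "w 26 = K1" for w Q'
    using that by (auto simp: K_def)
  have Qf: "Q (w, a, k)" if "\<And>i. i < 22 \<or> 31 < i \<Longrightarrow> w i = v i"
    "w 22 = 2 * g * (of_int \<lfloor>P / q\<rfloor> - X * of_int \<lfloor>P / (q * X)\<rfloor>)" for w
    using Q[of w] that lval(4) xy(3) by simp
  let ?R = "of_int \<lfloor>P / q\<rfloor> - X * of_int \<lfloor>P / (q * X)\<rfloor>"
  show ?thesis
    unfolding lev_def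
    apply (rule hwp_cd, simp)
     apply (simp add: False)
    apply (rule hwp_seq, rule init)
    apply (rule hwp_asq[where z = g], simp add: xy(2), simp add: g_def)
    apply (rule hwp_asq[where z = K1], simp add: pos(1)[THEN less_imp_neq, symmetric], simp add: K1_def)
    apply (rule hwp_asq[where z = E], simp, simp add: E_def)
    apply (rule hwp_seq, rule sel, simp, simp, simp, simp)
    apply (rule hwp_asq[where z = N], simp, simp add: N_def)
    apply (rule hwp_asq[where z = X], simp, simp add: X_def)
    apply (rule hwp_asq[where z = q], simp add: lval(1), simp add: q_def mult.assoc)
    apply (rule hwp_asq[where z = a'], simp add: lval(1), simp add: a'_def)
    apply (rule hwp_asq[where z = b], simp add: lval(1), simp add: b_def)
    apply (rule hwp_asq[where z = P], simp add: lval(2,3), simp add: P_def)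
    apply (rule hwp_asq[where z = ?R], use pos(2) lval(1) in simp, simp)
    apply (rule hwp_as[where z = "2 * g * ?R"], simp, simp)
    apply (rule Qf, (elim disjE; simp), simp)
    done
qed

definition sepc :: "int \<Rightarrow> int \<Rightarrow> hcom" where "sepc cx cy =
  As 20 (A (C cx) (V 10)) ;; As 21 (A (C cx) (V 11)) ;; lev ;; As 12 (V 22) ;;
  As 20 (A (C cy) (V 10)) ;; As 21 (A (C cy) (V 11)) ;; lev ;; As 13 (V 22) ;;
  Cd (Lt (V 12) (V 13)) (As 14 (V 13)) (As 14 (V 12))"

definition coords :: "nat \<Rightarrow> (nat \<Rightarrow> pt) \<Rightarrow> int \<Rightarrow> int \<Rightarrow> arrs \<Rightarrow> bool" where
  "coords n P cx cy a \<longleftrightarrow> (\<forall>i<n. a (of_int cx) (real i) = fst (P i) \<and> a (of_int cy) (real i) = snd (P i) \<and> nonneg (P i))"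

lemma hwp_sepc:
  assumes c: "coords n P cx cy a" "ix 19 (of_int cx)" "ix 19 (of_int cy)" "n \<le> L"
    and ij: "i < n" "j < n" "v 10 = real i" "v 11 = real j"
    and Q: "\<And>v'. (\<And>l. l < 12 \<or> 31 < l \<or> 15 \<le> l \<and> l < 20 \<Longrightarrow> v' l = v l) \<Longrightarrow>
      v' 12 = lv (fst (P i)) (fst (P j)) \<Longrightarrow> v' 13 = lv (snd (P i)) (snd (P j)) \<Longrightarrow>
      v' 14 = sep (P i) (P j) \<Longrightarrow> Q (v', a, k)"
  shows "hwp L 19 (sepc cx cy) (v, a, k) Q"
proof -
  have p: "a (of_int cx) (real i) = fst (P i)" "a (of_int cy) (real i) = snd (P i)"
    "a (of_int cx) (real j) = fst (P j)" "a (of_int cy) (real j) = snd (P j)"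
    "0 \<le> fst (P i)" "0 \<le> snd (P i)" "0 \<le> fst (P j)" "0 \<le> snd (P j)"
    using c(1) ij by (auto simp: coords_def nonneg_def)
  have L: "i < L" "j < L" using ij c(4) by auto
  show ?thesis
    unfolding sepc_def
    apply (rule hwp_asq[where z = "fst (P i)"], simp add: c ij L, simp add: p ij)
    apply (rule hwp_asq[where z = "fst (P j)"], simp add: c ij L, simp add: p ij)
    apply (rule hwp_seq, rule hwp_lev, simp add: p, simp add: p)
    apply (rule hwp_asq, simp, rule refl)
    apply (rule hwp_asq[where z = "snd (P i)"], simp add: c ij L, simp add: p ij)
    apply (rule hwp_asq[where z = "snd (P j)"], simp add: c ij L, simp add: p ij)
    apply (rule hwp_seq, rule hwp_lev, simp add: p, simp add: p)
    apply (rule hwp_asq, simp, rule refl)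
    apply (rule hwp_cd, simp)
     apply (rule hwp_as, simp, rule refl, rule Q, elim disjE conjE; simp add: sep_def)
    apply (rule hwp_as, simp, rule refl, rule Q, elim disjE conjE; simp add: sep_def)
    done
qed

lemma hwp_stq:
  assumes "ok L N p v a" "ok L N i v a" "ok L N e v a" "ev p v a = zp" "ev i v a = zi" "ev e v a = ze"
    "ix N zp" "ix L zi" "hwp L N d (v, a(zp := (a zp)(zi := ze)), k) Q"
  shows "hwp L N (St p i e ;; d) (v, a, k) Q"
  using assms by simp

lemma hwp_st:
  assumes "ok L N p v a" "ok L N i v a" "ok L N e v a" "ev p v a = zp" "ev i v a = zi" "ev e v a = ze"
    "ix N zp" "ix L zi" "Q (v, a(zp := (a zp)(zi := ze)), k)"
  shows "hwp L N (St p i e) (v, a, k) Q"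
  using assms by simp

section \<open>Sorting\<close>

text \<open>Binary insertion takes only \<open>O(log n)\<close> steps per point if the list is stored as the
  sequence of digits of a single number.\<close>

fun enc :: "nat \<Rightarrow> nat list \<Rightarrow> nat" where
  "enc b [] = 0"
| "enc b (x # xs) = x + b * enc b xs"

lemma enc_append: "enc b (xs @ ys) = enc b xs + b ^ length xs * enc b ys"
  by (induction xs) (simp_all add: algebra_simps)

lemma enc_less: "\<forall>x\<in>set xs. x < b \<Longrightarrow> enc b xs < b ^ length xs"
proof (induction xs)
  case (Cons x xs)
  then have "x < b" "Suc (enc b xs) \<le> b ^ length xs" by auto
  then have "x + b * enc b xs < b * Suc (enc b xs)" "b * Suc (enc b xs) \<le> b * b ^ length xs"
    by (simp, intro mult_le_mono2)
  then show ?case by simp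
qed simp

lemma enc_split:
  assumes "\<forall>x\<in>set xs. x < b" "p \<le> length xs"
  shows "enc b xs = enc b (take p xs) + b ^ p * enc b (drop p xs)" "enc b xs div b ^ p = enc b (drop p xs)"
proof -
  show s: "enc b xs = enc b (take p xs) + b ^ p * enc b (drop p xs)"
    using enc_append[of b "take p xs" "drop p xs"] assms(2) by simp
  have "enc b (take p xs) < b ^ length (take p xs)"
    using assms(1) by (intro enc_less) (auto dest: in_set_takeD)
  then have "enc b (take p xs) < b ^ p" using assms(2) by simp
  then show "enc b xs div b ^ p = enc b (drop p xs)"
    unfolding s using div_mult_self2[of "b ^ p" "enc b (take p xs)" "enc b (drop p xs)"] by (metis add_0_right div_less not_less0)
qed

lemma floor_nat_div: "real_of_int \<lfloor>real m / real d\<rfloor> = real (m div d)"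
  using floor_divide_of_nat_eq[of m d, where ?'a = real] by simp

lemma enc_floor:
  assumes "\<forall>x\<in>set xs. x < b" "p \<le> length xs"
  shows "real_of_int \<lfloor>real (enc b xs) / real b ^ p\<rfloor> = real (enc b (drop p xs))"
  using floor_nat_div[of "enc b xs" "b ^ p"] enc_split(2)[OF assms] by simp

lemma enc_nth:
  assumes "\<forall>x\<in>set xs. x < b" "p < length xs"
  shows "real_of_int \<lfloor>real (enc b xs) / real b ^ p\<rfloor> - real b * real_of_int \<lfloor>real (enc b xs) / (real b ^ p * real b)\<rfloor>
    = real (xs ! p)"
proof -
  have "real b ^ p * real b = real b ^ Suc p" by simp
  then show ?thesis
    using enc_floor[OF assms(1), of p] enc_floor[OF assms(1), of "Suc p"] assms(2)
      Cons_nth_drop_Suc[OF assms(2), symmetric] by (simp del: power_Suc)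
qed

text \<open>The digits from place \<open>p\<close> on are taken out and put back one place higher,
  above the new digit.\<close>

lemma enc_insert:
  assumes "\<forall>x\<in>set xs. x < b" "p \<le> length xs"
  shows "real (enc b xs) - real (enc b (drop p xs)) * real b ^ p + real x * real b ^ p
      + real (enc b (drop p xs)) * real b ^ p * real b = real (enc b (take p xs @ x # drop p xs))"
proof -
  have "real (enc b xs) = real (enc b (take p xs)) + real b ^ p * real (enc b (drop p xs))"
    using arg_cong[OF enc_split(1)[OF assms], of real] by simp
  then show ?thesis using assms(2) by (simp add: enc_append algebra_simps)
qed

text \<open>The table of powers of the base, one more than the number of points, makes every digit
  accessible in constant time.\<close>

definition powP :: hcom where "powP =
  As 6 (V 0 \<oplus> C 1) ;; As 32 (C 0) ;; As 2 (C 1) ;;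
  Wh (Lt (V 32) (V 6)) (St (C 9) (V 32) (V 2) ;; As 2 (V 2 \<otimes> V 6) ;; As 32 (V 32 \<oplus> C 1))"

text \<open>One round of binary search. The digit at place \<open>m\<close> of a number
  \<open>s\<close> in base \<open>b\<close> is \<open>\<lfloor>s / b ^ m\<rfloor> - b * \<lfloor>s /
  b ^ (m + 1)\<rfloor>\<close>; the nested tests spell out \<open>zless\<close>.\<close>

definition searchP :: "int \<Rightarrow> int \<Rightarrow> hcom" where "searchP cx cy =
  As 5 (Uo Floor ((V 3 \<oplus> V 4) \<oslash> C 2)) ;;
  As 10 (Uo Floor (V 2 \<oslash> A (C 9) (V 5)) \<ominus> V 6 \<otimes> Uo Floor (V 2 \<oslash> (A (C 9) (V 5) \<otimes> V 6))) ;;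
  As 11 (V 32) ;; sepc cx cy ;;
  Cd (Lt (V 12) (V 13))
    (Cd (Lt (A (C cy) (V 10)) (A (C cy) (V 11))) (As 3 (V 5 \<oplus> C 1)) (As 4 (V 5)))
    (Cd (Lt (A (C cx) (V 10)) (A (C cx) (V 11))) (As 3 (V 5 \<oplus> C 1)) (As 4 (V 5)))"

definition insertP :: hcom where "insertP =
  As 7 (Uo Floor (V 2 \<oslash> A (C 9) (V 3))) ;;
  As 2 (V 2 \<ominus> V 7 \<otimes> A (C 9) (V 3) \<oplus> V 32 \<otimes> A (C 9) (V 3) \<oplus> V 7 \<otimes> A (C 9) (V 3) \<otimes> V 6) ;;
  As 32 (V 32 \<oplus> C 1)"

definition decodeP :: hcom where "decodeP =
  As 32 (C 0) ;;
  Wh (Lt (V 32) (V 0)) (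
    As 7 (Uo Floor (V 2 \<oslash> V 6)) ;;
    St (C 10) (V 32) (V 2 \<ominus> V 6 \<otimes> V 7) ;; As 2 (V 7) ;; As 32 (V 32 \<oplus> C 1))"

definition sortP :: "int \<Rightarrow> int \<Rightarrow> hcom" where "sortP cx cy =
  powP ;; As 32 (C 0) ;; As 2 (C 0) ;;
  Wh (Lt (V 32) (V 0)) (As 3 (C 0) ;; As 4 (V 32) ;; Wh (Lt (V 3) (V 4)) (searchP cx cy) ;; insertP) ;;
  decodeP"

lemma hwp_powP:
  assumes n: "v 0 = real n" "n < L"
    and Q: "\<And>v' a'. v' 0 = real n \<Longrightarrow> v' 6 = real (Suc n) \<Longrightarrow>
      (\<forall>j\<le>n. a' 9 (real j) = real (Suc n) ^ j) \<Longrightarrow> (\<forall>q. q \<noteq> 9 \<longrightarrow> a' q = a q) \<Longrightarrow> Q (v', a', k + Suc n)"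
  shows "hwp L 19 powP (v, a, k) Q"
proof -
  let ?B = "real (Suc n)"
  let ?I = "\<lambda>(v', a', k'). \<exists>i\<le>Suc n. v' 0 = real n \<and> v' 32 = real i \<and> v' 2 = ?B ^ i \<and> v' 6 = ?B \<and>
    (\<forall>j<i. a' 9 (real j) = ?B ^ j) \<and> (\<forall>q. q \<noteq> 9 \<longrightarrow> a' q = a q) \<and> k' = k + i"
  show ?thesis
    unfolding powP_def
    apply (rule hwp_asq[where z = ?B], simp, simp add: n)
    apply (rule hwp_asq[where z = "real 0"], simp, simp)
    apply (rule hwp_asq[where z = "?B ^ 0"], simp, simp)
  proof (rule hwp_while[where I = ?I and B = "k + Suc n"])
    show "?I (v(6 := ?B, 32 := real 0, 2 := ?B ^ 0), a, k)" using n by (auto intro!: exI[of _ 0])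
  next
    fix v' :: vars and a' :: arrs and k' :: nat
    assume "?I (v', a', k')" "tv (Lt (V 32) (V 6)) v' a'"
    then obtain i where i: "v' 0 = real n" "v' 32 = real i" "v' 2 = ?B ^ i" "v' 6 = ?B"
      "\<forall>j<i. a' 9 (real j) = ?B ^ j" "\<forall>q. q \<noteq> 9 \<longrightarrow> a' q = a q" "k' = k + i" "i < Suc n"
      by (simp only: prod.case tv.simps ev.simps) (elim exE conjE, simp)
    then show "hwp L 19 (St (C 9) (V 32) (V 2);; As 2 (V 2 \<otimes> V 6);; As 32 (V 32 \<oplus> C 1)) (v', a', Suc k') ?I"
      using n by (auto intro!: exI[of _ "Suc i"] simp: less_Suc_eq)
  next
    fix v' :: vars and a' :: arrs and k' :: nat
    assume "?I (v', a', k')" "\<not> tv (Lt (V 32) (V 6)) v' a'"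
    then obtain i where i: "i \<le> Suc n" "v' 0 = real n" "v' 6 = ?B" "\<not> real i < ?B"
      "\<forall>j<i. a' 9 (real j) = ?B ^ j" "\<forall>q. q \<noteq> 9 \<longrightarrow> a' q = a q" "k' = k + i"
      by (simp only: prod.case tv.simps ev.simps) (elim exE conjE, simp)
    then have e: "i = Suc n" by simp
    show "Q (v', a', k')" unfolding i(7) e by (rule Q) (use i e in \<open>auto simp del: power_Suc simp: less_Suc_eq_le\<close>)
  qed auto
qed

lemma hwp_searchP:
  assumes c: "coords n P cx cy a" "ix 19 (of_int cx)" "ix 19 (of_int cy)" "n < L"
    and pw: "\<forall>j\<le>n. a 9 (real j) = real (Suc n) ^ j"
    and xs: "set xs \<subseteq> {..<n}" "length xs \<le> n" and i: "i < n"
    and v: "v 32 = real i" "v 2 = real (enc (Suc n) xs)" "v 3 = real lo" "v 4 = real hi" "v 6 = real (Suc n)"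
    and lo: "lo < hi" "hi \<le> length xs"
    and Q: "\<And>v' m. m = (lo + hi) div 2 \<Longrightarrow> v' 0 = v 0 \<Longrightarrow> v' 32 = v 32 \<Longrightarrow> v' 2 = v 2 \<Longrightarrow> v' 6 = v 6 \<Longrightarrow>
      (if zless (P (xs ! m)) (P i) then v' 3 = real (Suc m) \<and> v' 4 = real hi else v' 3 = real lo \<and> v' 4 = real m) \<Longrightarrow>
      Q (v', a, k)"
  shows "hwp L 19 (searchP cx cy) (v, a, k) Q"
proof -
  define m where "m = (lo + hi) div 2"
  have m: "m < length xs" "lo \<le> m" "m < hi" using lo by (auto simp: m_def)
  have "xs ! m \<in> {..<n}" using xs(1) m(1) by (meson nth_mem subsetD)
  then have mn: "m \<le> n" "xs ! m < n" using xs(2) m by auto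
  have p: "a (of_int cx) (real j) = fst (P j)" "a (of_int cy) (real j) = snd (P j)" if "j < n" for j
    using c(1) that by (auto simp: coords_def)
  have fl: "real_of_int \<lfloor>(real lo + real hi) / 2\<rfloor> = real m"
    using floor_nat_div[of "lo + hi" 2] by (simp add: m_def)
  have b: "\<forall>x\<in>set xs. x < Suc n" using xs(1) by auto
  have dig: "real_of_int \<lfloor>v 2 / a 9 (real m)\<rfloor> - v 6 * real_of_int \<lfloor>v 2 / (a 9 (real m) * v 6)\<rfloor> = real (xs ! m)"
    using enc_nth[OF b m(1)] pw mn(1) v by simp
  have nz: "a 9 (real m) \<noteq> 0" "v 6 \<noteq> 0" using pw mn(1) v by simp_all
  note Q' = Q[OF m_def]
  show ?thesis
    unfolding searchP_def
    apply (rule hwp_asq[where z = "real m"], simp, simp add: v fl)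
    apply (rule hwp_asq[where z = "real (xs ! m)"], use nz mn c(4) in simp, simp add: dig)
    apply (rule hwp_asq[where z = "real i"], simp, simp add: v)
    apply (rule hwp_seq, rule hwp_sepc[where i = "xs ! m" and j = i, OF c(1-3)])
         apply (use c(4) mn i in simp_all)[5]
    subgoal for v'
      apply (rule hwp_cd, simp)
       apply (rule hwp_cd, use c mn i in simp)
        apply (rule hwp_as, simp, rule refl, rule Q', use mn i v in \<open>simp_all add: p zless_def\<close>)[1]
       apply (rule hwp_as, simp, rule refl, rule Q', use mn i v in \<open>simp_all add: p zless_def\<close>)[1]
      apply (rule hwp_cd, use c mn i in simp)
       apply (rule hwp_as, simp, rule refl, rule Q', use mn i v in \<open>simp_all add: p zless_def\<close>)[1]
      apply (rule hwp_as, simp, rule refl, rule Q', use mn i v in \<open>simp_all add: p zless_def\<close>)[1]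
      done
    done
qed

lemma hwp_decodeP:
  assumes xs: "set xs \<subseteq> {..<n}" "length xs = n" "n < L"
    and v: "v 0 = real n" "v 2 = real (enc (Suc n) xs)" "v 6 = real (Suc n)"
    and Q: "\<And>v' a'. v' 0 = real n \<Longrightarrow> (\<forall>j<n. a' 10 (real j) = real (xs ! j)) \<Longrightarrow>
      (\<forall>q. q \<noteq> 10 \<longrightarrow> a' q = a q) \<Longrightarrow> Q (v', a', k + n)"
  shows "hwp L 19 decodeP (v, a, k) Q"
proof -
  let ?B = "real (Suc n)"
  have b: "\<forall>x\<in>set xs. x < Suc n" using xs(1) by auto
  let ?I = "\<lambda>(v', a', k'). \<exists>i\<le>n. v' 0 = real n \<and> v' 32 = real i \<and> v' 2 = real (enc (Suc n) (drop i xs)) \<and> v' 6 = ?B \<and>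
    (\<forall>j<i. a' 10 (real j) = real (xs ! j)) \<and> (\<forall>q. q \<noteq> 10 \<longrightarrow> a' q = a q) \<and> k' = k + i"
  show ?thesis
    unfolding decodeP_def
    apply (rule hwp_asq[where z = "real 0"], simp, simp)
  proof (rule hwp_while[where I = ?I and B = "k + n"])
    show "?I (v(32 := real 0), a, k)" using v by (auto intro!: exI[of _ 0])
  next
    fix v' :: vars and a' :: arrs and k' :: nat
    assume "?I (v', a', k')" "tv (Lt (V 32) (V 0)) v' a'"
    then obtain i where i: "i < n" "v' 0 = real n" "v' 32 = real i" "v' 2 = real (enc (Suc n) (drop i xs))" "v' 6 = ?B"
      "\<forall>j<i. a' 10 (real j) = real (xs ! j)" "\<forall>q. q \<noteq> 10 \<longrightarrow> a' q = a q" "k' = k + i" by auto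
    have d: "drop i xs = xs ! i # drop (Suc i) xs" using i xs by (simp add: Cons_nth_drop_Suc)
    have "enc (Suc n) (drop i xs) div Suc n = enc (Suc n) (drop (Suc i) xs)"
      using enc_split(2)[of "drop i xs" "Suc n" 1] b i(1) xs(2) by (auto dest: in_set_dropD simp: d)
    then have f: "real_of_int \<lfloor>v' 2 / v' 6\<rfloor> = real (enc (Suc n) (drop (Suc i) xs))"
      using floor_nat_div[of "enc (Suc n) (drop i xs)" "Suc n"] i by simp
    have g: "v' 2 - v' 6 * real (enc (Suc n) (drop (Suc i) xs)) = real (xs ! i)"
      using i d by (simp add: algebra_simps)
    show "hwp L 19 (As 7 (Uo Floor (V 2 \<oslash> V 6)) ;; St (C 10) (V 32) (V 2 \<ominus> V 6 \<otimes> V 7) ;; As 2 (V 7) ;; As 32 (V 32 \<oplus> C 1))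
      (v', a', Suc k') ?I"
      apply (rule hwp_asq[where z = "real (enc (Suc n) (drop (Suc i) xs))"], use i in simp, simp add: f)
      apply (rule hwp_stq[where zp = 10 and zi = "real i" and ze = "real (xs ! i)"])
              apply (use i xs(3) g in simp_all)[8]
      apply (rule hwp_asq[where z = "real (enc (Suc n) (drop (Suc i) xs))"], simp, simp)
      apply (rule hwp_as[where z = "real (Suc i)"], simp, simp add: i)
      apply (use i in \<open>auto intro!: exI[of _ "Suc i"] simp del: enc.simps simp: less_Suc_eq\<close>)
      done
  next
    fix v' :: vars and a' :: arrs and k' :: nat
    assume "?I (v', a', k')" "\<not> tv (Lt (V 32) (V 0)) v' a'"
    then obtain i where i: "i \<le> n" "v' 0 = real n" "v' 32 = real i"
      "\<forall>j<i. a' 10 (real j) = real (xs ! j)" "\<forall>q. q \<noteq> 10 \<longrightarrow> a' q = a q" "k' = k + i" "n \<le> i" by auto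
    then have "i = n" by simp
    then show "Q (v', a', k')" using i by (auto intro!: Q)
  qed auto
qed

lemma sorted_insert:
  assumes "sorted_wrt R xs" "p \<le> length xs"
    "\<forall>i<p. R (xs ! i) x" "\<forall>i. p \<le> i \<and> i < length xs \<longrightarrow> R x (xs ! i)"
  shows "sorted_wrt R (take p xs @ x # drop p xs)"
proof -
  have 1: "R y x" if y: "y \<in> set (take p xs)" for y
  proof -
    obtain i where "i < length (take p xs)" "y = take p xs ! i" using y by (metis in_set_conv_nth)
    then show ?thesis using assms(3) by auto
  qed
  have 2: "R x y" if y: "y \<in> set (drop p xs)" for y
  proof -
    obtain i where i: "i < length (drop p xs)" "y = drop p xs ! i" using y by (metis in_set_conv_nth)
    then show ?thesis using assms(2) assms(4)[rule_format, of "p + i"] by simp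
  qed
  have "sorted_wrt R (take p xs @ drop p xs)" using assms(1) by simp
  then have s: "sorted_wrt R (take p xs)" "sorted_wrt R (drop p xs)" "\<forall>y\<in>set (take p xs). \<forall>z\<in>set (drop p xs). R y z"
    unfolding sorted_wrt_append by blast+
  show ?thesis unfolding sorted_wrt_append sorted_wrt.simps using s 1 2 by auto
qed

lemma hwp_bsearch:
  assumes c: "coords n P cx cy a" "ix 19 (of_int cx)" "ix 19 (of_int cy)" "n < L"
    and pw: "\<forall>j\<le>n. a 9 (real j) = real (Suc n) ^ j"
    and i: "i < n" "i < 2 ^ J" and xs: "set xs = {..<i}" "length xs = i"
    and mono: "\<And>p p'. p < p' \<Longrightarrow> p' < i \<Longrightarrow> zless (P (xs ! p)) (P (xs ! p'))"
    and tot: "\<And>j. j < i \<Longrightarrow> \<not> zless (P j) (P i) \<Longrightarrow> zless (P i) (P j)"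
    and tr: "\<And>j l m. j < n \<Longrightarrow> l < n \<Longrightarrow> m < n \<Longrightarrow> zless (P j) (P l) \<Longrightarrow> zless (P l) (P m) \<Longrightarrow> zless (P j) (P m)"
    and v: "v 32 = real i" "v 2 = real (enc (Suc n) xs)" "v 3 = real 0" "v 4 = real i" "v 6 = real (Suc n)"
    and Q: "\<And>v' lo k'. lo \<le> i \<Longrightarrow> v' 0 = v 0 \<Longrightarrow> v' 32 = v 32 \<Longrightarrow> v' 2 = v 2 \<Longrightarrow> v' 6 = v 6 \<Longrightarrow> v' 3 = real lo \<Longrightarrow>
      (\<forall>p<lo. zless (P (xs ! p)) (P i)) \<Longrightarrow> (\<forall>p. lo \<le> p \<and> p < i \<longrightarrow> zless (P i) (P (xs ! p))) \<Longrightarrow>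
      k' \<le> k + J \<Longrightarrow> Q (v', a, k')"
  shows "hwp L 19 (Wh (Lt (V 3) (V 4)) (searchP cx cy)) (v, a, k) Q"
proof -
  \<comment> \<open>\<open>d\<close> is the number of rounds still allowed: the interval is shorter
    than \<open>2 ^ d\<close>, and every round halves it while \<open>d\<close> drops by one.
    Entries below \<open>lo\<close> precede the new point, entries from \<open>hi\<close> on follow
    it.\<close>
  define W where "W lo hi d v' a' k' \<longleftrightarrow> lo \<le> hi \<and> hi \<le> i \<and> v' 0 = v 0 \<and> v' 32 = v 32 \<and> v' 2 = v 2 \<and> v' 6 = v 6 \<and>
    v' 3 = real lo \<and> v' 4 = real hi \<and> a' = a \<and> hi - lo < 2 ^ d \<and> k' + d \<le> k + J \<and>
    (\<forall>p<lo. zless (P (xs ! p)) (P i)) \<and> (\<forall>p. hi \<le> p \<and> p < i \<longrightarrow> zless (P i) (P (xs ! p)))"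
    for lo hi d k' :: nat and v' :: vars and a' :: arrs
  have xi: "xs ! p < i" if "p < i" for p
    using nth_mem[of p xs] that unfolding xs by blast
  show ?thesis
  proof (rule hwp_while[where I = "\<lambda>(v', a', k'). \<exists>lo hi d. W lo hi d v' a' k'" and B = "k + J"])
    have "W 0 i J v a k" unfolding W_def using v i by auto
    then show "case (v, a, k) of (v', a', k') \<Rightarrow> \<exists>lo hi d. W lo hi d v' a' k'" by blast
  next
    fix v' a' k' assume "case (v', a', k') of (v', a', k') \<Rightarrow> \<exists>lo hi d. W lo hi d v' a' k'"
    then show "k' \<le> k + J" by (auto simp: W_def)
  next
    fix v' :: vars and a' :: arrs and k' :: nat
    assume "case (v', a', k') of (v', a', k') \<Rightarrow> \<exists>lo hi d. W lo hi d v' a' k'" and t: "tv (Lt (V 3) (V 4)) v' a'"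
    then obtain lo hi d where "W lo hi d v' a' k'" by blast
    note s = this[unfolded W_def]
    have lh: "lo < hi" using t s by simp
    obtain d' where d: "d = Suc d'" using s lh by (cases d) auto
    have a': "a' = a" using s by blast
    show "hwp L 19 (searchP cx cy) (v', a', Suc k') (\<lambda>(v', a', k'). \<exists>lo hi d. W lo hi d v' a' k')"
      unfolding a'
    proof (rule hwp_searchP[where xs = xs and i = i and lo = lo and hi = hi and n = n and P = P])
      fix u :: vars and m
      assume m: "m = (lo + hi) div 2" and u: "u 0 = v' 0" "u 32 = v' 32" "u 2 = v' 2" "u 6 = v' 6"
        "if zless (P (xs ! m)) (P i) then u 3 = real (Suc m) \<and> u 4 = real hi else u 3 = real lo \<and> u 4 = real m"
      have mb: "lo \<le> m" "m < hi" "m < i" using lh s m by auto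
      have half: "hi - Suc m < 2 ^ d'" "m - lo < 2 ^ d'" using s lh m d by auto
      have k: "Suc k' + d' \<le> k + J" using s d by simp
      show "case (u, a, Suc k') of (v', a', k') \<Rightarrow> \<exists>lo hi d. W lo hi d v' a' k'"
      proof (cases "zless (P (xs ! m)) (P i)")
        case True
        have "zless (P (xs ! p)) (P i)" if "p < Suc m" for p
        proof (cases "p = m")
          case False
          then have "p < m" "p < i" using that mb by auto
          then show ?thesis using tr[OF _ _ _ mono[of p m] True] xi[of p] xi[of m] mb i(1) by simp
        qed (use True in simp)
        then have "W (Suc m) hi d' u a (Suc k')" unfolding W_def using u True s mb half k by auto
        then show ?thesis by blast
      next
        case False
        then have im: "zless (P i) (P (xs ! m))" by (rule tot[OF xi[OF mb(3)]])
        have "zless (P i) (P (xs ! p))" if "m \<le> p" "p < i" for p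
        proof (cases "p = m")
          case False
          then have "m < p" using that by simp
          then show ?thesis using tr[OF _ _ _ im mono[of m p]] that xi[of p] xi[of m] mb i(1) by simp
        qed (use im in simp)
        then have "W lo m d' u a (Suc k')" unfolding W_def using u False s mb half k by auto
        then show ?thesis by blast
      qed
    qed (use c pw i xs v s lh in auto)
  next
    fix v' :: vars and a' :: arrs and k' :: nat
    assume "case (v', a', k') of (v', a', k') \<Rightarrow> \<exists>lo hi d. W lo hi d v' a' k'" and t: "\<not> tv (Lt (V 3) (V 4)) v' a'"
    then obtain lo hi d where "W lo hi d v' a' k'" by blast
    note s = this[unfolded W_def]
    have "lo = hi" using t s by simp
    moreover have "a' = a" using s by blast
    ultimately show "Q (v', a', k')" using Q[of lo v' k'] s by auto
  qed simp
qed

text \<open>\<open>n < 2 ^ J\<close> limits a search to \<open>J\<close> rounds. The bound on the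
  iterations adds up the table of powers, \<open>n\<close> insertions and the decoding.\<close>

lemma hwp_sortP:
  assumes c: "coords n P cx cy a" "ix 19 (of_int cx)" "ix 19 (of_int cy)" "cx \<notin> {9, 10}" "cy \<notin> {9, 10}"
    and n: "v 0 = real n" "n < L" "n < 2 ^ J" and inj: "inj_on P {..<n}"
    and Q: "\<And>v' a' k' xs. v' 0 = real n \<Longrightarrow> set xs = {..<n} \<Longrightarrow> length xs = n \<Longrightarrow>
      sorted_wrt (\<lambda>i j. zless (P i) (P j)) xs \<Longrightarrow> (\<forall>j<n. a' 10 (real j) = real (xs ! j)) \<Longrightarrow>
      (\<forall>q. q \<noteq> 9 \<and> q \<noteq> 10 \<longrightarrow> a' q = a q) \<Longrightarrow> k' \<le> k + Suc n + n * Suc J + n \<Longrightarrow> Q (v', a', k')"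
  shows "hwp L 19 (sortP cx cy) (v, a, k) Q"
proof -
  let ?R = "\<lambda>i j. zless (P i) (P j)" and ?B = "real (Suc n)" and ?k = "k + Suc n"
  have nn: "nonneg (P j)" if "j < n" for j using c(1) that by (simp add: coords_def)
  have tot: "?R i j" if "j < i" "i < n" "\<not> ?R j i" for i j
  proof -
    have "P j \<noteq> P i" using inj_onD[OF inj, of j i] that by auto
    then show ?thesis using zless_total[of "P j" "P i"] nn that by auto
  qed
  have tr: "?R i l" if "i < n" "j < n" "l < n" "?R i j" "?R j l" for i j l
    using zless_trans_sep(1)[OF nn nn nn that(4,5)] that by blast
  show ?thesis
    unfolding sortP_def
  proof (rule hwp_seq, rule hwp_powP[where n = n], rule n, rule n)
    fix w :: vars and a1 :: arrs
    assume w: "w 0 = real n" "w 6 = ?B" and pw: "\<forall>j\<le>n. a1 9 (real j) = ?B ^ j"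
      and a1: "\<forall>q. q \<noteq> 9 \<longrightarrow> a1 q = a q"
    have c1: "coords n P cx cy a1" using c a1 by (simp add: coords_def)
    define W where "W i xs v' a' k' \<longleftrightarrow> i \<le> n \<and> v' 0 = real n \<and> v' 32 = real i \<and> v' 2 = real (enc (Suc n) xs) \<and> v' 6 = ?B \<and>
      set xs = {..<i} \<and> length xs = i \<and> sorted_wrt ?R xs \<and> a' = a1 \<and> k' \<le> ?k + i * Suc J"
      for i k' :: nat and xs and v' :: vars and a' :: arrs
    show "hwp L 19 (As 32 (C 0) ;; As 2 (C 0) ;;
      Wh (Lt (V 32) (V 0)) (As 3 (C 0) ;; As 4 (V 32) ;; Wh (Lt (V 3) (V 4)) (searchP cx cy) ;; insertP) ;; decodeP)
      (w, a1, ?k) Q"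
      apply (rule hwp_asq[where z = "real 0"], simp, simp)
      apply (rule hwp_asq[where z = "real (enc (Suc n) [])"], simp, simp)
      apply (rule hwp_seq)
    proof (rule hwp_while[where I = "\<lambda>(v', a', k'). \<exists>i xs. W i xs v' a' k'" and B = "?k + n * Suc J"])
      have "W 0 [] (w(32 := real 0, 2 := real (enc (Suc n) []))) a1 ?k" using w by (simp add: W_def)
      then show "case (w(32 := real 0, 2 := real (enc (Suc n) [])), a1, ?k) of (v', a', k') \<Rightarrow> \<exists>i xs. W i xs v' a' k'" by blast
    next
      fix v' :: vars and a' :: arrs and k' :: nat
      assume "case (v', a', k') of (v', a', k') \<Rightarrow> \<exists>i xs. W i xs v' a' k'"
      then obtain i xs where "W i xs v' a' k'" by blast
      then have "i \<le> n" "k' \<le> ?k + i * Suc J" by (simp_all add: W_def)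
      then show "k' \<le> ?k + n * Suc J" using mult_le_mono1[of i n "Suc J"] by linarith
    next
      fix v' :: vars and a' :: arrs and k' :: nat
      assume "case (v', a', k') of (v', a', k') \<Rightarrow> \<exists>i xs. W i xs v' a' k'" and t: "\<not> tv (Lt (V 32) (V 0)) v' a'"
      then obtain i xs where "W i xs v' a' k'" by blast
      note s = this[unfolded W_def]
      have i: "i = n" using t s by simp
      show "hwp L 19 decodeP (v', a', k') Q"
      proof (rule hwp_decodeP[of xs n])
        fix v'' :: vars and a'' :: arrs
        assume a: "v'' 0 = real n" "\<forall>j<n. a'' 10 (real j) = real (xs ! j)" "\<forall>q. q \<noteq> 10 \<longrightarrow> a'' q = a' q"
        have "k' + n \<le> k + Suc n + n * Suc J + n" using s i by simp
        moreover have "\<forall>q. q \<noteq> 9 \<and> q \<noteq> 10 \<longrightarrow> a'' q = a q" using a(3) s a1 by simp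
        ultimately show "Q (v'', a'', k' + n)" using Q[of v'' xs a'' "k' + n"] s i a(1,2) by blast
      qed (use s i n in simp_all)
    next
      fix v' :: vars and a' :: arrs and k' :: nat
      assume "case (v', a', k') of (v', a', k') \<Rightarrow> \<exists>i xs. W i xs v' a' k'" and t: "tv (Lt (V 32) (V 0)) v' a'"
      then obtain i xs where "W i xs v' a' k'" by blast
      note s = this[unfolded W_def]
      have i: "i < n" using t s by simp
      have a': "a' = a1" and sx: "set xs = {..<i}" "length xs = i" "sorted_wrt ?R xs" using s by blast+
      have v': "v' 0 = real n" "v' 32 = real i" "v' 2 = real (enc (Suc n) xs)" "v' 6 = ?B" using s by blast+
      show "hwp L 19 (As 3 (C 0) ;; As 4 (V 32) ;; Wh (Lt (V 3) (V 4)) (searchP cx cy) ;; insertP) (v', a', Suc k')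
        (\<lambda>(v', a', k'). \<exists>i xs. W i xs v' a' k')"
        unfolding a'
      proof (rule hwp_asq[where z = "real 0"], simp, simp, rule hwp_asq[where z = "real i"], simp, simp add: v',
          rule hwp_seq, rule hwp_bsearch[where xs = xs and i = i and n = n and P = P and J = J])
        fix v'' :: vars and lo k''
        assume q: "lo \<le> i" "v'' 0 = (v'(3 := real 0, 4 := real i)) 0" "v'' 32 = (v'(3 := real 0, 4 := real i)) 32"
          "v'' 2 = (v'(3 := real 0, 4 := real i)) 2" "v'' 6 = (v'(3 := real 0, 4 := real i)) 6" "v'' 3 = real lo"
          "\<forall>p<lo. ?R (xs ! p) i" "\<forall>p. lo \<le> p \<and> p < i \<longrightarrow> ?R i (xs ! p)" "k'' \<le> Suc k' + J"
        have v'': "v'' 0 = real n" "v'' 32 = real i" "v'' 2 = real (enc (Suc n) xs)" "v'' 6 = ?B" using q(2-5) v' by simp_all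
        define ys where "ys = take lo xs @ i # drop lo xs"
        have b: "\<forall>x\<in>set xs. x < Suc n" using sx i by auto
        have pl: "a1 9 (real lo) = ?B ^ lo" "lo < L" using pw q(1) i n(2) by auto
        have so: "sorted_wrt ?R ys" unfolding ys_def
          by (rule sorted_insert[OF sx(3)]) (use q sx(2) in simp_all)
        have "set xs = set (take lo xs) \<union> set (drop lo xs)"
          using set_append[of "take lo xs" "drop lo xs"] by simp
        then have se: "set ys = {..<Suc i}" unfolding ys_def lessThan_Suc sx(1)[symmetric] by simp
        have le: "length ys = Suc i" using q(1) sx(2) by (simp add: ys_def)
        have kk: "k'' \<le> ?k + Suc i * Suc J" using q(9) s by simp
        have fin: "case (u, a1, k'') of (v', a', k') \<Rightarrow> \<exists>i xs. W i xs v' a' k'"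
          if "u 0 = real n" "u 32 = real (Suc i)" "u 2 = real (enc (Suc n) ys)" "u 6 = ?B" for u :: vars
        proof -
          have "W (Suc i) ys u a1 k''" unfolding W_def using that so se le kk i by simp
          then show ?thesis by blast
        qed
        show "hwp L 19 insertP (v'', a1, k'') (\<lambda>(v', a', k'). \<exists>i xs. W i xs v' a' k')"
          unfolding insertP_def
          apply (rule hwp_asq[where z = "real (enc (Suc n) (drop lo xs))"], use pl q(6) in simp)
          subgoal using enc_floor[OF b, of lo] sx(2) q(1) by (simp add: v'' q(6) pl)
          apply (rule hwp_asq[where z = "real (enc (Suc n) ys)"], use pl q(6) in simp)
          subgoal using enc_insert[OF b, of lo i] sx(2) q(1) by (simp add: v'' q(6) pl ys_def)
          apply (rule hwp_as[where z = "real (Suc i)"], simp, simp add: v'')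
          apply (rule fin; simp add: v'')
          done
      next
        show "?R (xs ! p) (xs ! p')" if "p < p'" "p' < i" for p p'
          using sorted_wrt_nth_less[OF sx(3)] that sx(2) by simp
        show "i < 2 ^ J" using i n(3) by simp
        show "?R i j" if "j < i" "\<not> ?R j i" for j by (rule tot[OF that(1) i that(2)])
        show "?R j m" if "j < n" "l < n" "m < n" "?R j l" "?R l m" for j l m by (rule tr[OF that])
        show "coords n P cx cy a1" by (rule c1)
        show "\<forall>j\<le>n. a1 9 (real j) = ?B ^ j" by (rule pw)
      qed (use c n i sx v' in simp_all)
    qed simp
  qed
qed

section \<open>Building a hub tree\<close>

text \<open>Array \<open>11 + d\<close> holds the representatives of corner \<open>d\<close>. If the
  component lies in quadrant \<open>q\<close>, then \<open>14 - q\<close> addresses its corner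
  \<open>3 - q\<close>, which is at the centre, and \<open>11 + q\<close> its outer corner. All its
  points are in the same quadrant, so the representative of corner 0 can be used to find
  \<open>q\<close>. Registers 16 and 17 hold the centre.\<close>

definition quadP :: "int \<Rightarrow> int \<Rightarrow> hcom" where "quadP cx cy =
  As 10 (A (C 11) (V 6)) ;;
  Cd (Lt (A (C cx) (V 10)) (V 16)) (As 11 (C 0)) (As 11 (C 2)) ;;
  Cd (Lt (A (C cy) (V 10)) (V 17)) (As 11 (V 11)) (As 11 (V 11 \<oplus> C 1)) ;;
  As 12 (A (C 14 \<ominus> V 11) (V 6)) ;; As 13 (A (C 11 \<oplus> V 11) (V 6)) ;;
  As 14 ((A (C cx) (V 12) \<ominus> V 16) \<otimes> (A (C cx) (V 12) \<ominus> V 16) \<oplus>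
         (A (C cy) (V 12) \<ominus> V 17) \<otimes> (A (C cy) (V 12) \<ominus> V 17))"

definition reps :: "nat \<Rightarrow> nat \<Rightarrow> (nat \<Rightarrow> nat \<Rightarrow> nat) \<Rightarrow> arrs \<Rightarrow> bool" where
  "reps n c R a \<longleftrightarrow> (\<forall>j<c. \<forall>d<4. R j d < n \<and> a (11 + real d) (real j) = real (R j d))"

abbreviation qq :: "(nat \<Rightarrow> pt) \<Rightarrow> pt \<Rightarrow> (nat \<Rightarrow> nat \<Rightarrow> nat) \<Rightarrow> nat \<Rightarrow> nat" where
  "qq P m R l \<equiv> qd m (P (R l 0))"

abbreviation inn :: "(nat \<Rightarrow> pt) \<Rightarrow> pt \<Rightarrow> (nat \<Rightarrow> nat \<Rightarrow> nat) \<Rightarrow> nat \<Rightarrow> nat" where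
  "inn P m R l \<equiv> R l (3 - qq P m R l)"

lemma hwp_quadP:
  assumes c: "coords n P cx cy a" "ix 19 (of_int cx)" "ix 19 (of_int cy)" "n \<le> L" and l: "l < nc" "nc \<le> L" "v 6 = real l"
    and R: "reps n nc R a" and m: "v 16 = fst m" "v 17 = snd m"
    and Q: "\<And>v'. (\<And>i. i < 10 \<or> 14 < i \<Longrightarrow> v' i = v i) \<Longrightarrow> v' 11 = real (qq P m R l) \<Longrightarrow>
      v' 12 = real (inn P m R l) \<Longrightarrow> v' 13 = real (R l (qq P m R l)) \<Longrightarrow>
      v' 14 = (dist (P (inn P m R l)) m)\<^sup>2 \<Longrightarrow> Q (v', a, k)"
  shows "hwp L 19 (quadP cx cy) (v, a, k) Q"
proof -
  let ?q = "qq P m R l" and ?p = "R l 0" and ?i = "inn P m R l"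
  have q4: "?q < 4" by (rule qd_less)
  have rep: "R l d < n" "a (11 + real d) (real l) = real (R l d)" if "d < 4" for d
    using R l(1) that by (auto simp: reps_def)
  have lL: "l < L" using l by simp
  have p: "a (of_int cx) (real j) = fst (P j)" "a (of_int cy) (real j) = snd (P j)" if "j < n" for j
    using c(1) that by (auto simp: coords_def)
  have p0: "?p < n" "a 11 (real l) = real ?p" using rep[of 0] by simp_all
  have nL: "j < L" if "j < n" for j using that c(4) by simp
  define x where "x = (if fst (P ?p) < fst m then 0 else 2 :: real)"
  have i14: "14 - real ?q = 11 + real (3 - ?q)" using q4 by (simp add: of_nat_diff)
  have i11: "ix 19 (11 + real d)" if "d < 4" for d
    using that by (simp add: ix_def) (rule exI[of _ "11 + d"], simp)
  have in_n: "?i < n" by (rule rep) simp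
  have qv: "real ?q = x + (if snd (P ?p) < snd m then 0 else 1)"
    by (simp add: qd_def x_def not_less[symmetric])
  have dist: "(fst (P ?i) - fst m) * (fst (P ?i) - fst m) + (snd (P ?i) - snd m) * (snd (P ?i) - snd m) = (dist (P ?i) m)\<^sup>2"
    by (simp add: dist_pt power2_eq_square)
  have fin: "hwp L 19 (As 12 (A (C 14 \<ominus> V 11) (V 6)) ;; As 13 (A (C 11 \<oplus> V 11) (V 6)) ;;
      As 14 ((A (C cx) (V 12) \<ominus> V 16) \<otimes> (A (C cx) (V 12) \<ominus> V 16) \<oplus>
         (A (C cy) (V 12) \<ominus> V 17) \<otimes> (A (C cy) (V 12) \<ominus> V 17))) (w, a, k) Q"
    if w: "\<And>i. i < 10 \<or> 14 < i \<Longrightarrow> w i = v i" "w 11 = real ?q" for w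
  proof -
    have w': "w 6 = real l" "w 16 = fst m" "w 17 = snd m" using w(1) l m by simp_all
    show ?thesis
      apply (rule hwp_asq[where z = "real ?i"], simp add: w w' i14 i11 lL, simp add: w w' i14 rep)
      apply (rule hwp_asq[where z = "real (R l ?q)"], simp add: w w' i11 q4 lL, simp add: w w' rep q4)
      apply (rule hwp_as[where z = "(dist (P ?i) m)\<^sup>2"], simp add: c in_n nL, simp add: w w' p in_n dist)
      apply (rule Q, (elim disjE; simp add: w), simp_all add: w)
      done
  qed
  have mid: "hwp L 19 (Cd (Lt (A (C cy) (V 10)) (V 17)) (As 11 (V 11)) (As 11 (V 11 \<oplus> C 1)) ;;
      As 12 (A (C 14 \<ominus> V 11) (V 6)) ;; As 13 (A (C 11 \<oplus> V 11) (V 6)) ;;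
      As 14 ((A (C cx) (V 12) \<ominus> V 16) \<otimes> (A (C cx) (V 12) \<ominus> V 16) \<oplus>
         (A (C cy) (V 12) \<ominus> V 17) \<otimes> (A (C cy) (V 12) \<ominus> V 17))) (w, a, k) Q"
    if w: "\<And>i. i < 10 \<or> 14 < i \<Longrightarrow> w i = v i" "w 10 = real ?p" "w 11 = x" for w
  proof -
    have w': "w 17 = snd m" using w(1) m by simp
    show ?thesis
      apply (rule hwp_seq, rule hwp_cd, simp add: c p0 nL w)
       apply (rule hwp_as[where z = "real ?q"], simp, simp add: w w' p p0 qv, rule fin, (elim disjE; simp add: w), simp)
      apply (rule hwp_as[where z = "real ?q"], simp, simp add: w w' p p0 qv, rule fin, (elim disjE; simp add: w), simp)
      done
  qed
  show ?thesis
    unfolding quadP_def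
    apply (rule hwp_asq[where z = "real ?p"], simp add: l lL, simp add: l p0)
    apply (rule hwp_seq, rule hwp_cd, simp add: c p0 nL)
     apply (rule hwp_as[where z = x], simp, simp add: p p0 m x_def, rule mid, (elim disjE; simp), simp, simp)
    apply (rule hwp_as[where z = x], simp, simp add: p p0 m x_def, rule mid, (elim disjE; simp), simp, simp)
    done
qed

text \<open>Loop tests have no conjunction, and at the bottom of the stack the address
  \<open>V 6 \<ominus> C 1\<close> would be negative. Nested tests therefore put the condition into
  register 19.\<close>

definition flagP :: hcom where "flagP =
  Cd (Lt (C 0) (V 6)) (Cd (Eq (A (C 15) (V 6 \<ominus> C 1)) (V 5)) (As 19 (C 1)) (As 19 (C 0))) (As 19 (C 0))"

definition flag :: "arrs \<Rightarrow> real \<Rightarrow> nat \<Rightarrow> real" where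
  "flag a s l = (case l of 0 \<Rightarrow> 0 | Suc l' \<Rightarrow> if a 15 (real l') = s then 1 else 0)"

lemma hwp_flagP:
  assumes "v 6 = real l" "l \<le> L" "Q (v(19 := flag a (v 5) l), a, k)"
  shows "hwp L 19 flagP (v, a, k) Q"
  using assms by (cases l) (auto simp: flagP_def flag_def)

definition nearP :: "int \<Rightarrow> int \<Rightarrow> hcom" where "nearP cx cy =
  As 6 (V 3) ;; quadP cx cy ;; As 7 (V 12) ;; As 8 (V 14) ;; flagP ;;
  Wh (Lt (C 0) (V 19)) (
    As 6 (V 6 \<ominus> C 1) ;; quadP cx cy ;;
    Cd (Lt (V 14) (V 8)) (As 7 (V 12) ;; As 8 (V 14)) (As 7 (V 7)) ;; flagP)"

text \<open>\<open>j0\<close> is the bottom of the run to be merged: from \<open>j0\<close> up to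
  below the top the keys equal register 5, and the key under \<open>j0\<close>, if there is one,
  differs.\<close>

lemma hwp_nearP:
  assumes c: "coords n P cx cy a" "ix 19 (of_int cx)" "ix 19 (of_int cy)" "n \<le> L" and t: "t < L" "v 3 = real t"
    and R: "reps n (Suc t) R a" and m: "v 16 = fst m" "v 17 = snd m"
    and run: "j0 \<le> t" "\<And>j. j0 \<le> j \<Longrightarrow> j < t \<Longrightarrow> a 15 (real j) = v 5"
      "\<And>j. j0 = Suc j \<Longrightarrow> a 15 (real j) \<noteq> v 5"
    and Q: "\<And>v' js. (\<And>i. i < 6 \<or> i = 16 \<or> i = 17 \<or> i = 32 \<Longrightarrow> v' i = v i) \<Longrightarrow> v' 6 = real j0 \<Longrightarrow>
      js \<in> {j0..t} \<Longrightarrow> v' 7 = real (inn P m R js) \<Longrightarrow>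
      (\<forall>l\<in>{j0..t}. dist (P (inn P m R js)) m \<le> dist (P (inn P m R l)) m) \<Longrightarrow> Q (v', a, k + (t - j0))"
  shows "hwp L 19 (nearP cx cy) (v, a, k) Q"
proof -
  define W where "W l js v' a' k' \<longleftrightarrow> j0 \<le> l \<and> l \<le> t \<and> (\<forall>i. i < 6 \<or> i = 16 \<or> i = 17 \<or> i = 32 \<longrightarrow> v' i = v i) \<and>
    v' 6 = real l \<and> js \<in> {l..t} \<and> v' 7 = real (inn P m R js) \<and> v' 8 = (dist (P (inn P m R js)) m)\<^sup>2 \<and>
    (\<forall>j\<in>{l..t}. dist (P (inn P m R js)) m \<le> dist (P (inn P m R j)) m) \<and> a' = a \<and> k' = k + (t - l) \<and>
    v' 19 = flag a (v 5) l" for l js k' :: nat and v' :: vars and a' :: arrs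
  let ?I = "\<lambda>(v', a', k'). \<exists>l js. W l js v' a' k'"
  have flag0: "flag a (v 5) j0 = 0" using run(3) by (cases j0) (auto simp: flag_def)
  have flag1: "flag a (v 5) l = 1" if "j0 < l" "l \<le> t" for l
    using run(2)[of "l - 1"] that by (cases l) (auto simp: flag_def)
  have less: "(dist p m)\<^sup>2 < (dist q m)\<^sup>2 \<longleftrightarrow> dist p m < dist q m" for p q :: pt
    by (meson power2_le_iff_abs_le power2_less_imp_less power_strict_mono zero_le_dist zero_less_numeral)
  have start: "?I (w, a, k)" if "\<And>i. i < 6 \<or> i = 16 \<or> i = 17 \<or> i = 32 \<Longrightarrow> w i = v i" "w 6 = real t"
    "w 7 = real (inn P m R t)" "w 8 = (dist (P (inn P m R t)) m)\<^sup>2" "w 19 = flag a (v 5) t" for w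
  proof -
    have "W t t w a k" unfolding W_def using that run(1) by simp
    then show ?thesis by blast
  qed
  show ?thesis
    unfolding nearP_def
  proof (rule hwp_asq[where z = "real t"], simp, simp add: t, rule hwp_seq,
      rule hwp_quadP[OF c, where l = t and R = R and m = m], rule lessI, use t in simp, simp, rule R, simp add: m, simp add: m)
    fix w :: vars
    assume w: "\<And>i. i < 10 \<or> 14 < i \<Longrightarrow> w i = (v(6 := real t)) i" "w 12 = real (inn P m R t)"
      "w 14 = (dist (P (inn P m R t)) m)\<^sup>2"
    show "hwp L 19 (As 7 (V 12) ;; As 8 (V 14) ;; flagP ;; Wh (Lt (C 0) (V 19)) (
      As 6 (V 6 \<ominus> C 1) ;; quadP cx cy ;;
      Cd (Lt (V 14) (V 8)) (As 7 (V 12) ;; As 8 (V 14)) (As 7 (V 7)) ;; flagP)) (w, a, k) Q"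
      apply (rule hwp_asq[where z = "real (inn P m R t)"], simp, simp add: w)
      apply (rule hwp_asq[where z = "(dist (P (inn P m R t)) m)\<^sup>2"], simp, simp add: w)
      apply (rule hwp_seq, rule hwp_flagP[where l = t], simp add: w, use t in simp)
    proof (rule hwp_while[where I = ?I and B = "k + t"])
      show "?I (w(7 := real (inn P m R t), 8 := (dist (P (inn P m R t)) m)\<^sup>2,
         19 := flag a ((w(7 := real (inn P m R t), 8 := (dist (P (inn P m R t)) m)\<^sup>2)) 5) t), a, k)"
        by (rule start, (elim disjE; simp add: w), simp_all add: w)
    next
      fix v' :: vars and a' :: arrs and k' :: nat
      assume "?I (v', a', k')" and tv: "tv (Lt (C 0) (V 19)) v' a'"
      then obtain l js where "W l js v' a' k'" by blast
      note s = this[unfolded W_def]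
      have l: "j0 < l" using tv s flag0 by (cases "j0 = l") auto
      then obtain l' where l': "l = Suc l'" by (cases l) auto
      have lt: "l' < Suc t" "Suc t \<le> L" "l' \<le> L" using s l' t by auto
      have a': "a' = a" using s by blast
      have ins: "{l'..t} = insert l' {l..t}" using l' s by auto
      have v': "v' 3 = v 3" "v' 5 = v 5" "v' 16 = v 16" "v' 17 = v 17" "v' 6 = real (Suc l')" using s l' by auto
      have k: "Suc k' = k + (t - l')" using s l' by auto
      show "hwp L 19 (As 6 (V 6 \<ominus> C 1) ;; quadP cx cy ;;
         Cd (Lt (V 14) (V 8)) (As 7 (V 12) ;; As 8 (V 14)) (As 7 (V 7)) ;; flagP) (v', a', Suc k') ?I"
        unfolding a'
      proof (rule hwp_asq[where z = "real l'"], simp, simp add: v', rule hwp_seq,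
          rule hwp_quadP[OF c, where l = l' and R = R and m = m], rule lt, rule lt, simp, rule R, simp add: v' m, simp add: v' m)
        fix w :: vars
        assume w: "\<And>i. i < 10 \<or> 14 < i \<Longrightarrow> w i = (v'(6 := real l')) i" "w 12 = real (inn P m R l')"
          "w 14 = (dist (P (inn P m R l')) m)\<^sup>2"
        have w': "w 6 = real l'" "w 7 = v' 7" "w 8 = v' 8" "w 5 = v 5" using w(1) v' by simp_all
        have w'': "w i = v i" if "i < 6 \<or> i = 16 \<or> i = 17 \<or> i = 32" for i
        proof -
          have "w i = v' i" using w(1)[of i] that by auto
          then show ?thesis using s that by simp
        qed
        show "hwp L 19 (Cd (Lt (V 14) (V 8)) (As 7 (V 12) ;; As 8 (V 14)) (As 7 (V 7)) ;; flagP) (w, a, Suc k') ?I"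
        proof (rule hwp_seq, rule hwp_cd)
          assume "tv (Lt (V 14) (V 8)) w a"
          then have d: "dist (P (inn P m R l')) m < dist (P (inn P m R js)) m" using w(3) w' s by (simp add: less)
          have W: "W l' l' u a (Suc k')" if "\<And>i. i < 6 \<or> i = 16 \<or> i = 17 \<or> i = 32 \<Longrightarrow> u i = v i" "u 6 = real l'"
            "u 7 = real (inn P m R l')" "u 8 = (dist (P (inn P m R l')) m)\<^sup>2" "u 19 = flag a (v 5) l'" for u
            unfolding W_def ins using that s d l l' k by auto
          show "hwp L 19 (As 7 (V 12) ;; As 8 (V 14)) (w, a, Suc k') (\<lambda>s. hwp L 19 flagP s ?I)"
            apply (rule hwp_asq[where z = "real (inn P m R l')"], simp, simp add: w)
            apply (rule hwp_as[where z = "(dist (P (inn P m R l')) m)\<^sup>2"], simp, simp add: w)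
            apply (rule hwp_flagP[where l = l'], simp add: w', rule lt, unfold prod.case, rule exI, rule exI, rule W)
                apply ((elim disjE; simp add: w''), simp_all add: w')
            done
        next
          assume "\<not> tv (Lt (V 14) (V 8)) w a"
          then have d: "dist (P (inn P m R js)) m \<le> dist (P (inn P m R l')) m" using w(3) w' s less by (simp add: not_less[symmetric])
          have W: "W l' js u a (Suc k')" if "\<And>i. i < 6 \<or> i = 16 \<or> i = 17 \<or> i = 32 \<Longrightarrow> u i = v i" "u 6 = real l'"
            "u 7 = v' 7" "u 8 = v' 8" "u 19 = flag a (v 5) l'" for u
            unfolding W_def ins using that s d l l' k by auto
          show "hwp L 19 (As 7 (V 7)) (w, a, Suc k') (\<lambda>s. hwp L 19 flagP s ?I)"
            apply (rule hwp_as[where z = "v' 7"], simp, simp add: w')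
            apply (rule hwp_flagP[where l = l'], simp add: w', rule lt, unfold prod.case, rule exI, rule exI, rule W)
                apply ((elim disjE; simp add: w''), simp_all add: w')
            done
        qed simp
      qed
    next
      fix v' :: vars and a' :: arrs and k' :: nat
      assume "?I (v', a', k')" and tv: "\<not> tv (Lt (C 0) (V 19)) v' a'"
      then obtain l js where "W l js v' a' k'" by blast
      note s = this[unfolded W_def]
      have "\<not> j0 < l" using tv s flag1[of l] by auto
      then have l: "l = j0" using s by simp
      have "a' = a" "k' = k + (t - j0)" using s l by auto
      then show "Q (v', a', k')" using Q[of v' js] s l by blast
    next
      fix v' :: vars and a' :: arrs and k' :: nat
      assume "?I (v', a', k')"
      then show "k' \<le> k + t" by (auto simp: W_def)
    qed simp
  qed
qed

text \<open>Instead of adjacency lists only the degrees and the sums of the neighbours are stored: this is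
  enough to strip leaves.\<close>

fun dg :: "(nat \<times> nat) list \<Rightarrow> nat \<Rightarrow> nat" where
  "dg [] u = 0"
| "dg (e # es) u = (if fst e = u then 1 else 0) + (if snd e = u then 1 else 0) + dg es u"

fun sm :: "(nat \<times> nat) list \<Rightarrow> nat \<Rightarrow> nat" where
  "sm [] u = 0"
| "sm (e # es) u = (if fst e = u then snd e else 0) + (if snd e = u then fst e else 0) + sm es u"

definition degs :: "nat \<Rightarrow> (nat \<times> nat) list \<Rightarrow> arrs \<Rightarrow> bool" where
  "degs n es a \<longleftrightarrow> (\<forall>u<n. a 17 (real u) = real (dg es u) \<and> a 18 (real u) = real (sm es u))"

definition emitP :: hcom where "emitP =
  St (C 17) (V 12) (A (C 17) (V 12) \<oplus> C 1) ;; St (C 17) (V 7) (A (C 17) (V 7) \<oplus> C 1) ;;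
  St (C 18) (V 12) (A (C 18) (V 12) \<oplus> V 7) ;; St (C 18) (V 7) (A (C 18) (V 7) \<oplus> V 12)"

lemma hwp_emitP:
  assumes "v 12 = real x" "v 7 = real y" "x \<noteq> y" "x < n" "y < n" "n \<le> L" "degs n es a"
    and Q: "\<And>a'. degs n ((x, y) # es) a' \<Longrightarrow> (\<And>q. q \<noteq> 17 \<Longrightarrow> q \<noteq> 18 \<Longrightarrow> a' q = a q) \<Longrightarrow> Q (v, a', k)"
  shows "hwp L 19 emitP (v, a, k) Q"
proof -
  have d: "a 17 (real u) = real (dg es u)" "a 18 (real u) = real (sm es u)" if "u < n" for u
    using assms(7) that by (auto simp: degs_def)
  have xy: "x < L" "y < L" using assms by auto
  show ?thesis
    unfolding emitP_def
    apply (rule hwp_stq[where zp = 17 and zi = "real x" and ze = "real (dg es x + 1)"])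
            apply (simp_all add: assms xy d)[8]
    apply (rule hwp_stq[where zp = 17 and zi = "real y" and ze = "real (dg es y + 1)"])
            apply (simp_all add: assms(1-5) xy d assms(3)[symmetric])[8]
    apply (rule hwp_stq[where zp = 18 and zi = "real x" and ze = "real (sm es x + y)"])
            apply (simp_all add: assms(1-5) xy d)[8]
    apply (rule hwp_st[where zp = 18 and zi = "real y" and ze = "real (sm es y + x)"])
            apply (simp_all add: assms(1-5) xy d assms(3)[symmetric])[8]
    apply (rule Q)
     apply (simp add: degs_def d assms(3) assms(3)[symmetric])
    apply simp
    done
qed

text \<open>Array 16 is prefilled with the hub, so that corners of empty quadrants get it by
  default; it is copied to the bottom of the run only after the old representatives have been read.
  The test \<open>Eq (V 12) (V 7)\<close> recognizes the hub itself, which needs no edge.\<close>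

definition joinP :: "int \<Rightarrow> int \<Rightarrow> hcom" where "joinP cx cy =
  As 9 (V 6) ;;
  St (C 16) (C 0) (V 7) ;; St (C 16) (C 1) (V 7) ;; St (C 16) (C 2) (V 7) ;; St (C 16) (C 3) (V 7) ;;
  Wh (Lt (V 6) (V 3 \<oplus> C 1)) (
    quadP cx cy ;; St (C 16) (V 11) (V 13) ;; Cd (Eq (V 12) (V 7)) (As 7 (V 7)) emitP ;; As 6 (V 6 \<oplus> C 1)) ;;
  St (C 11) (V 9) (A (C 16) (C 0)) ;; St (C 12) (V 9) (A (C 16) (C 1)) ;;
  St (C 13) (V 9) (A (C 16) (C 2)) ;; St (C 14) (V 9) (A (C 16) (C 3)) ;; As 3 (V 9)"

lemma less4_cases: "(\<forall>d<4. Pr d) \<longleftrightarrow> Pr 0 \<and> Pr 1 \<and> Pr 2 \<and> Pr (3::nat)"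
  unfolding lt4 by auto

lemma hwp_joinP:
  assumes c: "coords n P cx cy a" "ix 19 (of_int cx)" "ix 19 (of_int cy)" "n \<le> L" "cx < 11" "cy < 11"
    and t: "t < L" "4 \<le> L" "v 3 = real t"
    and R: "reps n (Suc t) R a" and m: "v 16 = fst m" "v 17 = snd m"
    and js: "js \<in> {j0..t}" "v 6 = real j0" "v 7 = real (inn P m R js)"
    and inj: "inj_on (qq P m R) {j0..t}" "\<And>l. l \<in> {j0..t} \<Longrightarrow> l \<noteq> js \<Longrightarrow> inn P m R l \<noteq> inn P m R js"
    and dg: "degs n es a"
    and Q: "\<And>v' a' es' R''. (\<And>i. i < 6 \<and> i \<noteq> 3 \<or> i = 32 \<Longrightarrow> v' i = v i) \<Longrightarrow> v' 3 = real j0 \<Longrightarrow>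
      (\<And>q. q < 11 \<or> q = 15 \<Longrightarrow> a' q = a q) \<Longrightarrow> degs n (es' @ es) a' \<Longrightarrow> length es' = t - j0 \<Longrightarrow>
      (\<forall>l\<in>{j0..t}. l \<noteq> js \<longrightarrow> (inn P m R l, inn P m R js) \<in> set es') \<Longrightarrow>
      (\<forall>(x, y)\<in>set es'. x < n \<and> y < n \<and> x \<noteq> y) \<Longrightarrow>
      (\<forall>l\<in>{j0..t}. R'' (qq P m R l) = R l (qq P m R l)) \<Longrightarrow>
      (\<forall>d<4. d \<notin> qq P m R ` {j0..t} \<longrightarrow> R'' d = inn P m R js) \<Longrightarrow>
      reps n (Suc j0) (R(j0 := R'')) a' \<Longrightarrow> Q (v', a', k + (Suc t - j0))"
  shows "hwp L 19 (joinP cx cy) (v, a, k) Q"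
proof -
  let ?q = "qq P m R" and ?b = "inn P m R js"
  have q4: "?q l < 4" for l by (rule qd_less)
  have rep: "R j d < n" "a (11 + real d) (real j) = real (R j d)" if "j \<le> t" "d < 4" for j d
    using R that by (auto simp: reps_def)
  have bn: "?b < n" using rep(1)[of js] js(1) by simp
  have jt: "j0 \<le> t" using js(1) by auto
  \<comment> \<open>Every component passed so far has contributed one edge, except the component of
    the hub; hence the correction by one in the count of edges.\<close>
  define W where "W l es' v' a' k' \<longleftrightarrow> j0 \<le> l \<and> l \<le> Suc t \<and> (\<forall>i. i < 6 \<or> i = 16 \<or> i = 17 \<or> i = 32 \<longrightarrow> v' i = v i) \<and>
    v' 6 = real l \<and> v' 7 = real ?b \<and> v' 9 = real j0 \<and> (\<forall>q. q < 16 \<longrightarrow> a' q = a q) \<and>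
    degs n (es' @ es) a' \<and> length es' + (if js < l then 1 else 0) = l - j0 \<and>
    (\<forall>l'\<in>{j0..<l}. l' \<noteq> js \<longrightarrow> (inn P m R l', ?b) \<in> set es') \<and> (\<forall>(x, y)\<in>set es'. x < n \<and> y < n \<and> x \<noteq> y) \<and>
    (\<forall>l'\<in>{j0..<l}. a' 16 (real (?q l')) = real (R l' (?q l'))) \<and>
    (\<forall>d<4. d \<notin> ?q ` {j0..<l} \<longrightarrow> a' 16 (real d) = real ?b) \<and> k' = k + (l - j0)"
    for l k' :: nat and es' and v' :: vars and a' :: arrs
  let ?I = "\<lambda>(v', a', k'). \<exists>l es'. W l es' v' a' k'"
  let ?a0 = "a(16 := (a 16)(0 := real ?b, 1 := real ?b, 2 := real ?b, 3 := real ?b))"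
  have L: "0 < L" "Suc 0 < L" "2 < L" "3 < L" using t by auto
  have init: "hwp L 19 (St (C 16) (C 0) (V 7) ;; St (C 16) (C 1) (V 7) ;; St (C 16) (C 2) (V 7) ;; St (C 16) (C 3) (V 7) ;; c')
    (w, a, k) Q" if "w 7 = real ?b" "hwp L 19 c' (w, ?a0, k) Q" for c' w
    using that L by simp
  show ?thesis
    unfolding joinP_def
    apply (rule hwp_asq[where z = "real j0"], simp, simp add: js)
    apply (rule init, simp add: js)
    apply (rule hwp_seq)
  proof (rule hwp_while[where I = ?I and B = "k + Suc t"])
    have d0: "degs n ([] @ es) ?a0" using dg by (simp add: degs_def)
    have "W j0 [] (v(9 := real j0)) ?a0 k"
      unfolding W_def using js jt d0 by (auto simp: less4_cases)
    then show "?I (v(9 := real j0), ?a0, k)" by blast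
  next
    fix v' :: vars and a' :: arrs and k' :: nat
    assume "?I (v', a', k')" and tv: "tv (Lt (V 6) (V 3 \<oplus> C 1)) v' a'"
    then obtain l es' where "W l es' v' a' k'" by blast
    note s = this[unfolded W_def]
    have fr: "v' i = v i" if "i < 6 \<or> i = 16 \<or> i = 17 \<or> i = 32" for i using s that by blast
    have v': "v' 6 = real l" "v' 7 = real ?b" "v' 9 = real j0" "v' 3 = real t" "v' 16 = fst m" "v' 17 = snd m"
      using s fr t(3) m by simp_all
    have lt: "l \<le> t" "j0 \<le> l" using tv s v' by simp_all
    have aq: "a' q = a q" if "q < 16" for q using s that by blast
    have c': "coords n P cx cy a'" using c(1,5,6) aq by (simp add: coords_def)
    have R': "reps n (Suc t) R a'" using R aq by (auto simp: reps_def)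
    have dg': "degs n (es' @ es) a'" using s by blast
    have in_n: "inn P m R l < n" using rep(1)[OF lt(1)] by simp
    let ?a1 = "a'(16 := (a' 16)(real (?q l) := real (R l (?q l))))"
    have dg1: "degs n (es' @ es) ?a1" using dg' by (simp add: degs_def)
    have ins: "{j0..<Suc l} = insert l {j0..<l}" using lt by auto
    have qne: "?q l' \<noteq> ?q l" if "l' \<in> {j0..<l}" for l'
      using inj_onD[OF inj(1), of l' l] that lt by auto
    have new: "?I (u(6 := real (Suc l)), a2, Suc k')"
      if u: "\<And>i. i < 10 \<or> 14 < i \<Longrightarrow> u i = v' i" and a2: "\<And>q. q \<noteq> 17 \<Longrightarrow> q \<noteq> 18 \<Longrightarrow> a2 q = ?a1 q"
        and d2: "degs n (esn @ es) a2" and e2: "esn = (if l = js then es' else (inn P m R l, ?b) # es')" for u a2 esn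
    proof -
      have "W (Suc l) esn (u(6 := real (Suc l))) a2 (Suc k')"
        unfolding W_def
      proof (intro conjI)
        show "\<forall>i. i < 6 \<or> i = 16 \<or> i = 17 \<or> i = 32 \<longrightarrow> (u(6 := real (Suc l))) i = v i"
          using u fr by auto
        show "length esn + (if js < Suc l then 1 else 0) = Suc l - j0" using s e2 lt by (auto split: if_splits)
        show "\<forall>l'\<in>{j0..<Suc l}. l' \<noteq> js \<longrightarrow> (inn P m R l', ?b) \<in> set esn" unfolding ins using s e2 by auto
        show "\<forall>(x, y)\<in>set esn. x < n \<and> y < n \<and> x \<noteq> y" using s e2 in_n bn inj(2)[of l] lt by auto
        show "\<forall>l'\<in>{j0..<Suc l}. a2 16 (real (?q l')) = real (R l' (?q l'))"
          unfolding ins using s a2[of 16] qne by auto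
        show "\<forall>d<4. d \<notin> ?q ` {j0..<Suc l} \<longrightarrow> a2 16 (real d) = real ?b"
          unfolding ins using s a2[of 16] by auto
        show "\<forall>q<16. a2 q = a q" using a2 aq by auto
      qed (use s lt u v' d2 in simp_all)
      then show ?thesis by blast
    qed
    show "hwp L 19 (quadP cx cy ;; St (C 16) (V 11) (V 13) ;; Cd (Eq (V 12) (V 7)) (As 7 (V 7)) emitP ;; As 6 (V 6 \<oplus> C 1))
      (v', a', Suc k') ?I"
    proof (rule hwp_seq, rule hwp_quadP[OF c' c(2-4), where l = l and nc = "Suc t" and R = R and m = m])
      fix w :: vars
      assume w: "\<And>i. i < 10 \<or> 14 < i \<Longrightarrow> w i = v' i" "w 11 = real (?q l)" "w 12 = real (inn P m R l)"
        "w 13 = real (R l (?q l))"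
      have w': "w 6 = real l" "w 7 = real ?b" using w(1) v' by simp_all
      have qL: "?q l < L" using q4[of l] t(2) by linarith
      show "hwp L 19 (St (C 16) (V 11) (V 13) ;; Cd (Eq (V 12) (V 7)) (As 7 (V 7)) emitP ;; As 6 (V 6 \<oplus> C 1)) (w, a', Suc k') ?I"
        apply (rule hwp_stq[where zp = 16 and zi = "real (?q l)" and ze = "real (R l (?q l))"])
                apply (simp_all add: w qL)[8]
      proof (rule hwp_seq, rule hwp_cd)
        assume "tv (Eq (V 12) (V 7)) w ?a1"
        then have l: "l = js" using w(3) w' inj(2)[of l] lt by auto
        show "hwp L 19 (As 7 (V 7)) (w, ?a1, Suc k') (\<lambda>s. hwp L 19 (As 6 (V 6 \<oplus> C 1)) s ?I)"
          apply (rule hwp_as[where z = "real ?b"], simp, simp add: w')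
          apply (rule hwp_as[where z = "real (Suc l)"], simp, simp add: w')
          apply (rule new[where esn = es'])
             apply (elim disjE; simp add: w w' v')
            apply simp_all[1]
          apply (rule dg1, simp add: l)
          done
      next
        assume "\<not> tv (Eq (V 12) (V 7)) w ?a1"
        then have l: "inn P m R l \<noteq> ?b" "l \<noteq> js" using w(3) w' by auto
        show "hwp L 19 emitP (w, ?a1, Suc k') (\<lambda>s. hwp L 19 (As 6 (V 6 \<oplus> C 1)) s ?I)"
        proof (rule hwp_emitP[where x = "inn P m R l" and y = ?b and n = n and es = "es' @ es"])
          fix a2 :: arrs
          assume a2: "degs n ((inn P m R l, ?b) # es' @ es) a2" "\<And>q. q \<noteq> 17 \<Longrightarrow> q \<noteq> 18 \<Longrightarrow> a2 q = ?a1 q"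
          show "hwp L 19 (As 6 (V 6 \<oplus> C 1)) (w, a2, Suc k') ?I"
            apply (rule hwp_as[where z = "real (Suc l)"], simp, simp add: w')
            apply (rule new[where esn = "(inn P m R l, ?b) # es'"])
               apply (rule w, assumption, rule a2, assumption, assumption)
             apply (use a2(1) l in simp_all)
            done
        qed (use w w' l in_n bn c(4) dg1 in simp_all)
      qed simp
    qed (use lt t R' v' in simp_all)
  next
    fix v' :: vars and a' :: arrs and k' :: nat
    assume "?I (v', a', k')" and tv: "\<not> tv (Lt (V 6) (V 3 \<oplus> C 1)) v' a'"
    then obtain l es' where "W l es' v' a' k'" by blast
    note s = this[unfolded W_def]
    have fr: "v' i = v i" if "i < 6 \<or> i = 16 \<or> i = 17 \<or> i = 32" for i using s that by blast
    have "v' 3 = real t" using fr t(3) by simp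
    then have l: "l = Suc t" using tv s by simp
    have ran: "{j0..<Suc t} = {j0..t}" by auto
    note s = s[unfolded l ran]
    have v9: "v' 9 = real j0" using s by blast
    define R'' where "R'' d = (if d \<in> ?q ` {j0..t} then R (inv_into {j0..t} ?q d) d else ?b)" for d
    have R1: "\<forall>l\<in>{j0..t}. R'' (?q l) = R l (?q l)" using inv_into_f_f[OF inj(1)] by (simp add: R''_def)
    have R2: "\<forall>d<4. d \<notin> ?q ` {j0..t} \<longrightarrow> R'' d = ?b" by (simp add: R''_def)
    have tmp: "a' 16 (real d) = real (R'' d)" "R'' d < n" if "d < 4" for d
    proof -
      have "a' 16 (real d) = real (R'' d) \<and> R'' d < n"
      proof (cases "d \<in> ?q ` {j0..t}")
        case True
        then obtain l where l: "l \<in> {j0..t}" "d = ?q l" by blast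
        have "a' 16 (real (?q l)) = real (R l (?q l))" using s l(1) by blast
        then show ?thesis using R1 l rep(1)[of l "?q l"] q4 by simp
      next
        case False
        then have "a' 16 (real d) = real ?b" using s that by blast
        then show ?thesis using R2 False that bn by simp
      qed
      then show "a' 16 (real d) = real (R'' d)" "R'' d < n" by blast+
    qed
    have t4: "a' 16 0 = real (R'' 0)" "a' 16 1 = real (R'' 1)" "a' 16 2 = real (R'' 2)" "a' 16 3 = real (R'' 3)"
      using tmp(1)[of 0] tmp(1)[of 1] tmp(1)[of 2] tmp(1)[of 3] by simp_all
    have jL: "j0 < L" using jt t by simp
    define a2 where "a2 = a'(11 := (a' 11)(real j0 := real (R'' 0)), 12 := (a' 12)(real j0 := real (R'' 1)),
        13 := (a' 13)(real j0 := real (R'' 2)), 14 := (a' 14)(real j0 := real (R'' 3)))"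
    have "reps n (Suc j0) (R(j0 := R'')) a2"
      unfolding reps_def
    proof (intro allI impI)
      fix j d :: nat assume j: "j < Suc j0" and d: "d < 4"
      show "(R(j0 := R'')) j d < n \<and> a2 (11 + real d) (real j) = real ((R(j0 := R'')) j d)"
      proof (cases "j = j0")
        case True
        then show ?thesis using d tmp(2)[OF d] unfolding lt4 by (elim disjE) (simp_all add: a2_def)
      next
        case False
        have "a' (11 + real d) = a (11 + real d)" using s d by simp
        then have "a' (11 + real d) (real j) = real (R j d)" "R j d < n" using rep[of j d] d j jt by simp_all
        then show ?thesis using False d unfolding lt4 by (elim disjE) (simp_all add: a2_def)
      qed
    qed
    then have reps2: "reps n (Suc j0) (R(j0 := R'')) a2" .
    have degs2: "degs n (es' @ es) a2" using s by (simp add: degs_def a2_def)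
    have len2: "length es' = t - j0" using s js(1) jt by auto
    have a2q: "a2 q = a q" if "q < 11 \<or> q = 15" for q using s that by (auto simp: a2_def)
    have k2: "k' = k + (Suc t - j0)" using s by blast
    have e2: "\<forall>l\<in>{j0..t}. l \<noteq> js \<longrightarrow> (inn P m R l, ?b) \<in> set es'" "\<forall>(x, y)\<in>set es'. x < n \<and> y < n \<and> x \<noteq> y"
      using s by blast+
    have fr2: "(v'(3 := real j0)) i = v i" if "i < 6 \<and> i \<noteq> 3 \<or> i = 32" for i using that fr[of i] by auto
    have fin: "Q (v'(3 := real j0), a2, k')"
      unfolding k2 by (rule Q[OF fr2 _ a2q degs2 len2 e2 R1 R2 reps2]) simp_all
    show "hwp L 19 (St (C 11) (V 9) (A (C 16) (C 0)) ;; St (C 12) (V 9) (A (C 16) (C 1)) ;;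
      St (C 13) (V 9) (A (C 16) (C 2)) ;; St (C 14) (V 9) (A (C 16) (C 3)) ;; As 3 (V 9)) (v', a', k') Q"
      using fin v9 t4 L jL by (simp add: a2_def)
  next
    fix v' :: vars and a' :: arrs and k' :: nat
    assume "?I (v', a', k')"
    then show "k' \<le> k + Suc t" by (auto simp: W_def)
  qed simp
qed

section \<open>Blocks of the Z-sorted sequence and the stack invariant\<close>

definition zs :: "nat \<Rightarrow> (nat \<Rightarrow> pt) \<Rightarrow> nat list \<Rightarrow> bool" where
  "zs n P xs \<longleftrightarrow> set xs = {..<n} \<and> length xs = n \<and> (\<forall>i<n. nonneg (P i)) \<and>
    sorted_wrt (\<lambda>i j. zless (P i) (P j)) xs"

definition adj :: "(nat \<Rightarrow> pt) \<Rightarrow> nat list \<Rightarrow> nat \<Rightarrow> real" where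
  "adj P xs r = sep (P (xs ! r)) (P (xs ! Suc r))"

definition blk :: "nat list \<Rightarrow> (nat \<Rightarrow> nat) \<Rightarrow> nat \<Rightarrow> nat set" where
  "blk xs b j = (!) xs ` {b j..<b (Suc j)}"

lemma zs_nth: "zs n P xs \<Longrightarrow> u < w \<Longrightarrow> w < n \<Longrightarrow> zless (P (xs ! u)) (P (xs ! w))"
  using sorted_wrt_nth_less[of "\<lambda>i j. zless (P i) (P j)" xs u w] by (simp add: zs_def)

lemma zs_less: "zs n P xs \<Longrightarrow> r < n \<Longrightarrow> xs ! r < n"
  using nth_mem[of r xs] by (simp add: zs_def)

lemma zs_nonneg: "zs n P xs \<Longrightarrow> r < n \<Longrightarrow> nonneg (P (xs ! r))"
  using zs_less[of n P xs r] by (simp add: zs_def)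

lemma zs_neq: "zs n P xs \<Longrightarrow> u < w \<Longrightarrow> w < n \<Longrightarrow> P (xs ! u) \<noteq> P (xs ! w)"
  using zs_nth[of n P xs u w] zless_irrefl by metis

text \<open>By \<open>zless_trans_sep\<close>, the separation of two entries is the maximum of the
  separations of neighbours between them. The weak form decides whether points share a square of a
  given side, the strict form whether they also share a quadrant of it.\<close>

lemma zs_sep:
  assumes z: "zs n P xs" and "u < w" "w < n"
  shows "(sep (P (xs ! u)) (P (xs ! w)) \<le> s \<longleftrightarrow> (\<forall>r. u \<le> r \<and> r < w \<longrightarrow> adj P xs r \<le> s)) \<and>
    (sep (P (xs ! u)) (P (xs ! w)) < s \<longleftrightarrow> (\<forall>r. u \<le> r \<and> r < w \<longrightarrow> adj P xs r < s))"
  using assms(2,3)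
proof (induction w)
  case (Suc w)
  have split: "(\<forall>r. u \<le> r \<and> r < Suc w \<longrightarrow> Pr r) \<longleftrightarrow> (\<forall>r. u \<le> r \<and> r < w \<longrightarrow> Pr r) \<and> Pr w" for Pr
    using Suc.prems(1) by (auto simp: less_Suc_eq)
  show ?case
  proof (cases "u = w")
    case True
    then show ?thesis unfolding split by (simp add: adj_def)
  next
    case False
    then have u: "u < w" "w < n" "u < n" using Suc.prems by simp_all
    have "sep (P (xs ! u)) (P (xs ! Suc w)) = max (sep (P (xs ! u)) (P (xs ! w))) (adj P xs w)"
      unfolding adj_def
      by (rule zless_trans_sep(2)) (rule zs_nonneg[OF z] zs_nth[OF z] u Suc.prems lessI)+
    then show ?thesis unfolding split using Suc.IH[OF u(1,2)] by simp
  qed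
qed simp

lemma sep_cl:
  assumes "nonneg p" "nonneg q"
  shows "sep p q \<le> 2 powi i \<Longrightarrow> cl i p = cl i q" "sep p q < 2 powi i \<Longrightarrow> cl (i - 1) p = cl (i - 1) q"
    "p \<noteq> q \<Longrightarrow> 2 powi i \<le> sep p q \<Longrightarrow> cl (i - 1) p \<noteq> cl (i - 1) q"
proof -
  have ex: "\<exists>j. cl j p = cl j q \<and> cl (j - 1) p \<noteq> cl (j - 1) q \<and> sep p q = 2 powi j" if "p \<noteq> q"
    using lvl_ex[OF assms that] unfolding lvl_def by blast
  show "cl i p = cl i q" if s: "sep p q \<le> 2 powi i"
  proof (cases "p = q")
    case False
    then obtain j where j: "cl j p = cl j q" "sep p q = 2 powi j" using ex by blast
    then show ?thesis using s cl_mono_eq[of j p q i] by (simp add: powi2_le)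
  qed simp
  show "cl (i - 1) p = cl (i - 1) q" if s: "sep p q < 2 powi i"
  proof (cases "p = q")
    case False
    then obtain j where j: "cl j p = cl j q" "sep p q = 2 powi j" using ex by blast
    then show ?thesis using s cl_mono_eq[of j p q "i - 1"] by (simp add: powi2_less)
  qed simp
  show "cl (i - 1) p \<noteq> cl (i - 1) q" if "p \<noteq> q" and s: "2 powi i \<le> sep p q"
  proof
    assume e: "cl (i - 1) p = cl (i - 1) q"
    obtain j where j: "cl (j - 1) p \<noteq> cl (j - 1) q" "sep p q = 2 powi j" using ex[OF \<open>p \<noteq> q\<close>] by blast
    then have "i \<le> j" using s by (simp add: powi2_le)
    then show False using cl_mono_eq[OF e, of "j - 1"] j(1) by simp
  qed
qed

lemma block_of:
  fixes b :: "nat \<Rightarrow> nat"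
  assumes "b j0 \<le> r" "r < b (Suc t)" "j0 \<le> t"
  shows "\<exists>j\<in>{j0..t}. b j \<le> r \<and> r < b (Suc j)"
  using assms(3,2)
proof (induction t rule: dec_induct)
  case base
  then show ?case using assms(1) by auto
next
  case (step t)
  then show ?case by (cases "r < b (Suc t)") (auto simp: not_less intro: bexI[of _ "Suc t"])
qed

lemma bound_mono:
  fixes b :: "nat \<Rightarrow> nat"
  assumes "\<And>j. j \<le> t \<Longrightarrow> b j < b (Suc j)" "i \<le> j" "j \<le> Suc t"
  shows "b i \<le> b j"
  using assms(2,3)
proof (induction j rule: dec_induct)
  case (step j)
  then show ?case using assms(1)[of j] by simp
qed simp

text \<open>A stack of \<open>c\<close> subtrees: subtree \<open>j\<close> spans the points \<open>xs ! r\<close> with \<open>b j \<le> r < b (j + 1)\<close>, and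
  its key is the separation from the next subtree.\<close>

definition stk :: "(nat \<Rightarrow> pt) \<Rightarrow> nat list \<Rightarrow> (nat \<times> nat) set \<Rightarrow> nat \<Rightarrow> (nat \<Rightarrow> nat) \<Rightarrow> (nat \<Rightarrow> nat \<Rightarrow> nat) \<Rightarrow> arrs \<Rightarrow> bool" where
  "stk P xs E c b R a \<longleftrightarrow> b 0 = 0 \<and> (\<forall>j<c. b j < b (Suc j) \<and> hub P E (blk xs b j) (R j) \<and>
      a 15 (real j) = adj P xs (b (Suc j) - 1) \<and>
      (\<forall>r. b j \<le> r \<and> Suc r < b (Suc j) \<longrightarrow> adj P xs r < a 15 (real j))) \<and>
    (\<forall>i j. i \<le> j \<and> j < c \<longrightarrow> a 15 (real j) \<le> a 15 (real i))"

text \<open>The top component may still absorb others. \<open>\<kappa>\<close> is its prospective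
  key, normally the separation of its last point from the next point of the sequence; it is stored
  once no smaller key is left below.\<close>

definition topc :: "(nat \<Rightarrow> pt) \<Rightarrow> nat list \<Rightarrow> (nat \<times> nat) set \<Rightarrow> nat \<Rightarrow> (nat \<Rightarrow> nat) \<Rightarrow> (nat \<Rightarrow> nat \<Rightarrow> nat) \<Rightarrow> arrs \<Rightarrow> real \<Rightarrow> bool" where
  "topc P xs E t b R a \<kappa> \<longleftrightarrow> stk P xs E t b R a \<and> b t < b (Suc t) \<and> hub P E (blk xs b t) (R t) \<and>
    (\<forall>r. b t \<le> r \<and> Suc r < b (Suc t) \<longrightarrow> adj P xs r < \<kappa> \<and> (\<forall>j<t. adj P xs r < a 15 (real j)))"

lemma stk_cong:
  assumes "stk P xs E c b R a" and e: "a' 15 = a 15"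
  shows "stk P xs E c b R a'"
  using assms(1) unfolding stk_def e .

text \<open>Separations of neighbours are below \<open>2 powi i\<close> inside each component of the
  run and equal to it at the boundaries. By \<open>zs_sep\<close> the components therefore lie in
  different quadrants of one square of side \<open>2 powi i\<close>.\<close>

lemma run_cells:
  assumes z: "zs n P xs" and tp: "topc P xs E t b R a \<kappa>" and m: "b (Suc t) \<le> n" and j0: "j0 < t"
    and run: "\<forall>j. j0 \<le> j \<and> j < t \<longrightarrow> a 15 (real j) = 2 powi i"
  shows "\<And>l x y. l \<in> {j0..t} \<Longrightarrow> x \<in> blk xs b l \<Longrightarrow> y \<in> blk xs b l \<Longrightarrow> cl (i - 1) (P x) = cl (i - 1) (P y)"
    and "\<And>l l' x y. l \<in> {j0..t} \<Longrightarrow> l' \<in> {j0..t} \<Longrightarrow> l \<noteq> l' \<Longrightarrow> x \<in> blk xs b l \<Longrightarrow> y \<in> blk xs b l' \<Longrightarrow>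
      cl (i - 1) (P x) \<noteq> cl (i - 1) (P y)"
    and "\<And>l l' x y. l \<in> {j0..t} \<Longrightarrow> l' \<in> {j0..t} \<Longrightarrow> x \<in> blk xs b l \<Longrightarrow> y \<in> blk xs b l' \<Longrightarrow> cl i (P x) = cl i (P y)"
    and "\<And>r. b j0 \<le> r \<Longrightarrow> Suc r < b (Suc t) \<Longrightarrow> adj P xs r \<le> 2 powi i"
proof -
  note T = tp[unfolded topc_def stk_def]
  have lt: "b j < b (Suc j)" if "j \<le> t" for j using T that by (cases "j = t") auto
  note mono = bound_mono[of t b, OF lt]
  have bn: "b (Suc l) \<le> n" if "l \<le> t" for l using mono[of "Suc l" "Suc t"] that m by simp
  have run: "a 15 (real j) = 2 powi i" if "j0 \<le> j" "j < t" for j using run that by blast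
  have int: "adj P xs r < 2 powi i" if "l \<in> {j0..t}" "b l \<le> r" "Suc r < b (Suc l)" for l r
  proof (cases "l = t")
    case True
    then have "adj P xs r < a 15 (real j0)" using T that j0 by blast
    then show ?thesis using run[of j0] j0 by simp
  next
    case False
    then have l: "l < t" "j0 \<le> l" using that by auto
    then have "adj P xs r < a 15 (real l)" using T that by blast
    then show ?thesis using run[OF l(2,1)] by simp
  qed
  have bd: "adj P xs (b (Suc l) - 1) = 2 powi i" if "j0 \<le> l" "l < t" for l
  proof -
    have "a 15 (real l) = adj P xs (b (Suc l) - 1)" using T that(2) by blast
    then show ?thesis using run[OF that] by simp
  qed
  show le: "adj P xs r \<le> 2 powi i" if r: "b j0 \<le> r" "Suc r < b (Suc t)" for r
  proof -
    have "r < b (Suc t)" "j0 \<le> t" using r j0 by simp_all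
    then obtain j where j: "j \<in> {j0..t}" "b j \<le> r" "r < b (Suc j)" using block_of[of b j0 r t] r(1) by blast
    show ?thesis
    proof (cases "Suc r < b (Suc j)")
      case True
      then show ?thesis using int[OF j(1,2)] by simp
    next
      case False
      then have e: "r = b (Suc j) - 1" "j \<noteq> t" using j r by auto
      then show ?thesis using bd[of j] j(1) by simp
    qed
  qed
  have pos: "\<exists>u. x = xs ! u \<and> b l \<le> u \<and> u < b (Suc l) \<and> u < n \<and> b j0 \<le> u \<and> u < b (Suc t)" if l: "l \<in> {j0..t}" "x \<in> blk xs b l" for x l
  proof -
    obtain u where u: "x = xs ! u" "b l \<le> u" "u < b (Suc l)" using l(2) by (auto simp: blk_def)
    have "b j0 \<le> b l" "b (Suc l) \<le> b (Suc t)" using mono[of j0 l] mono[of "Suc l" "Suc t"] l(1) by simp_all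
    then show ?thesis using u m by (intro exI[of _ u] conjI) simp_all
  qed
  note nn = zs_nonneg[OF z]
  have near: "cl (i - 1) (P (xs ! u)) = cl (i - 1) (P (xs ! w))"
    if "l \<in> {j0..t}" "b l \<le> u" "u < w" "w < b (Suc l)" "w < n" for l u w
  proof -
    have "\<forall>r. u \<le> r \<and> r < w \<longrightarrow> adj P xs r < 2 powi i" using int[OF that(1)] that by auto
    then have "sep (P (xs ! u)) (P (xs ! w)) < 2 powi i" using zs_sep[OF z that(3,5)] by blast
    then show ?thesis by (rule sep_cl(2)[rotated 2]) (use nn that in simp_all)
  qed
  have far: "cl (i - 1) (P (xs ! u)) \<noteq> cl (i - 1) (P (xs ! w))"
    if l: "j0 \<le> l" "l < l'" "l' \<le> t" "u < b (Suc l)" "b l' \<le> w" "w < n" "b l \<le> u" for l l' u w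
  proof -
    have "b (Suc l) \<le> b l'" using mono[of "Suc l" l'] l by simp
    then have r: "u \<le> b (Suc l) - 1" "b (Suc l) - 1 < w" "u < w" using l by auto
    have "adj P xs (b (Suc l) - 1) = 2 powi i" using bd l by simp
    then have "\<not> sep (P (xs ! u)) (P (xs ! w)) < 2 powi i" using zs_sep[OF z r(3) l(6), of "2 powi i"] r(1,2) by auto
    then have "2 powi i \<le> sep (P (xs ! u)) (P (xs ! w))" by simp
    then show ?thesis by (rule sep_cl(3)[rotated 3]) (use nn zs_neq[OF z r(3) l(6)] r l(6) in simp_all)
  qed
  have wide: "cl i (P (xs ! u)) = cl i (P (xs ! w))" if "b j0 \<le> u" "u < w" "w < b (Suc t)" "w < n" for u w
  proof -
    have "\<forall>r. u \<le> r \<and> r < w \<longrightarrow> adj P xs r \<le> 2 powi i" using le that by auto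
    then have "sep (P (xs ! u)) (P (xs ! w)) \<le> 2 powi i" using zs_sep[OF z that(2,4)] by blast
    then show ?thesis by (rule sep_cl(1)[rotated 2]) (use nn that in simp_all)
  qed
  show "cl (i - 1) (P x) = cl (i - 1) (P y)" if l: "l \<in> {j0..t}" and xy: "x \<in> blk xs b l" "y \<in> blk xs b l" for l x y
  proof -
    obtain u where u: "x = xs ! u" "b l \<le> u" "u < b (Suc l)" "u < n" using pos[OF l xy(1)] by blast
    obtain w where w: "y = xs ! w" "b l \<le> w" "w < b (Suc l)" "w < n" using pos[OF l xy(2)] by blast
    show ?thesis
      unfolding u(1) w(1)
    proof (cases u w rule: linorder_cases)
      case less
      then show "cl (i - 1) (P (xs ! u)) = cl (i - 1) (P (xs ! w))" by (rule near[OF l u(2) _ w(3,4)])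
    next
      case greater
      then show "cl (i - 1) (P (xs ! u)) = cl (i - 1) (P (xs ! w))" by (rule near[OF l w(2) _ u(3,4), symmetric])
    qed (rule arg_cong[where f = "\<lambda>u. cl (i - 1) (P (xs ! u))"])
  qed
  show "cl (i - 1) (P x) \<noteq> cl (i - 1) (P y)"
    if l: "l \<in> {j0..t}" "l' \<in> {j0..t}" "l \<noteq> l'" and xy: "x \<in> blk xs b l" "y \<in> blk xs b l'" for l l' x y
  proof -
    obtain u where u: "x = xs ! u" "b l \<le> u" "u < b (Suc l)" "u < n" using pos[OF l(1) xy(1)] by blast
    obtain w where w: "y = xs ! w" "b l' \<le> w" "w < b (Suc l')" "w < n" using pos[OF l(2) xy(2)] by blast
    have b: "j0 \<le> l" "l \<le> t" "j0 \<le> l'" "l' \<le> t" using l by simp_all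
    show ?thesis
      unfolding u(1) w(1)
    proof (cases l l' rule: linorder_cases)
      case less
      then show "cl (i - 1) (P (xs ! u)) \<noteq> cl (i - 1) (P (xs ! w))" by (rule far[OF b(1) _ b(4) u(3) w(2,4) u(2)])
    next
      case greater
      then show "cl (i - 1) (P (xs ! u)) \<noteq> cl (i - 1) (P (xs ! w))" by (rule far[OF b(3) _ b(2) w(3) u(2,4) w(2), THEN not_sym])
    qed (rule notE[OF l(3)])
  qed
  show "cl i (P x) = cl i (P y)"
    if l: "l \<in> {j0..t}" "l' \<in> {j0..t}" and xy: "x \<in> blk xs b l" "y \<in> blk xs b l'" for l l' x y
  proof -
    obtain u where u: "x = xs ! u" "b j0 \<le> u" "u < b (Suc t)" "u < n" using pos[OF l(1) xy(1)] by blast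
    obtain w where w: "y = xs ! w" "b j0 \<le> w" "w < b (Suc t)" "w < n" using pos[OF l(2) xy(2)] by blast
    show ?thesis
      unfolding u(1) w(1)
    proof (cases u w rule: linorder_cases)
      case less
      then show "cl i (P (xs ! u)) = cl i (P (xs ! w))" by (rule wide[OF u(2) _ w(3,4)])
    next
      case greater
      then show "cl i (P (xs ! u)) = cl i (P (xs ! w))" by (rule wide[OF w(2) _ u(3,4), symmetric])
    qed (rule arg_cong[where f = "\<lambda>u. cl i (P (xs ! u))"])
  qed
qed

text \<open>The merged component contains separations equal to \<open>2 powi i\<close>, so the keys
  that remain below it have to be strictly larger. For this reason a whole run of equal keys is
  merged at once.\<close>

lemma merge_topc:
  assumes z: "zs n P xs" and tp: "topc P xs E t b R a \<kappa>" and m: "b (Suc t) \<le> n" and j0: "j0 < t"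
    and run: "\<forall>j. j0 \<le> j \<and> j < t \<longrightarrow> a 15 (real j) = 2 powi i" and \<kappa>: "2 powi i < \<kappa>"
    and brk: "\<And>j. j < j0 \<Longrightarrow> 2 powi i < a 15 (real j)"
    and hb: "hub P E' (\<Union>l\<in>{j0..t}. blk xs b l) R''" and E: "E \<subseteq> E'" and a': "a' 15 = a 15"
  shows "topc P xs E' j0 (b(Suc j0 := b (Suc t))) (R(j0 := R'')) a' \<kappa>"
proof -
  note T = tp[unfolded topc_def stk_def]
  have lt: "b j < b (Suc j)" if "j \<le> t" for j using T that by (cases "j = t") auto
  note mono = bound_mono[of t b, OF lt]
  let ?b = "b(Suc j0 := b (Suc t))"
  have b1: "b j0 < b (Suc t)" using lt[of j0] mono[of "Suc j0" "Suc t"] j0 by simp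
  have blk0: "blk xs ?b j = blk xs b j" if "j < j0" for j using that by (simp add: blk_def)
  have "blk xs ?b j0 = (\<Union>l\<in>{j0..t}. blk xs b l)"
  proof
    show "blk xs ?b j0 \<subseteq> (\<Union>l\<in>{j0..t}. blk xs b l)"
    proof
      fix x assume "x \<in> blk xs ?b j0"
      then obtain u where u: "x = xs ! u" "b j0 \<le> u" "u < b (Suc t)" by (auto simp: blk_def)
      then obtain l where "l \<in> {j0..t}" "b l \<le> u" "u < b (Suc l)" using block_of[of b j0 u t] j0 by auto
      then show "x \<in> (\<Union>l\<in>{j0..t}. blk xs b l)" using u(1) by (force simp: blk_def)
    qed
  next
    show "(\<Union>l\<in>{j0..t}. blk xs b l) \<subseteq> blk xs ?b j0"
    proof
      fix x assume "x \<in> (\<Union>l\<in>{j0..t}. blk xs b l)"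
      then obtain l u where u: "l \<in> {j0..t}" "x = xs ! u" "b l \<le> u" "u < b (Suc l)" by (auto simp: blk_def)
      have "b j0 \<le> b l" "b (Suc l) \<le> b (Suc t)" using mono[of j0 l] mono[of "Suc l" "Suc t"] u(1) by simp_all
      then show "x \<in> blk xs ?b j0" using u by (auto simp: blk_def)
    qed
  qed
  then have hub0: "hub P E' (blk xs ?b j0) R''" using hb by simp
  have old: "b j < b (Suc j) \<and> hub P E' (blk xs ?b j) (R j) \<and> a 15 (real j) = adj P xs (b (Suc j) - 1) \<and>
      (\<forall>r. b j \<le> r \<and> Suc r < b (Suc j) \<longrightarrow> adj P xs r < a 15 (real j))" if "j < j0" for j
  proof -
    have "j < t" using that j0 by simp
    then have "hub P E (blk xs b j) (R j)" "b j < b (Suc j)" "a 15 (real j) = adj P xs (b (Suc j) - 1)"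
      "\<forall>r. b j \<le> r \<and> Suc r < b (Suc j) \<longrightarrow> adj P xs r < a 15 (real j)" using T by blast+
    then show ?thesis using hub_mono[OF _ E] blk0[OF that] by simp
  qed
  have mono15: "a 15 (real j) \<le> a 15 (real l)" if "l \<le> j" "j < j0" for l j
  proof -
    have "j < t" using that j0 by simp
    then show ?thesis using T that(1) by blast
  qed
  have b0: "b 0 = 0" using T by blast
  have stk: "stk P xs E' j0 ?b (R(j0 := R'')) a'"
    unfolding stk_def
  proof (intro conjI allI impI)
    show "?b 0 = 0" using b0 by simp
    fix j assume j: "j < j0"
    then have "?b j = b j" "?b (Suc j) = b (Suc j)" "(R(j0 := R'')) j = R j" by simp_all
    then show "?b j < ?b (Suc j)" "hub P E' (blk xs ?b j) ((R(j0 := R'')) j)" "a' 15 (real j) = adj P xs (?b (Suc j) - 1)"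
      using old[OF j] a' by simp_all
    have o: "\<forall>r. b j \<le> r \<and> Suc r < b (Suc j) \<longrightarrow> adj P xs r < a 15 (real j)" using old[OF j] by blast
    show "adj P xs r < a' 15 (real j)" if "?b j \<le> r \<and> Suc r < ?b (Suc j)" for r using o that a' j by simp
  next
    fix l j assume "l \<le> j \<and> j < j0"
    then show "a' 15 (real j) \<le> a' 15 (real l)" using mono15 a' by simp
  qed
  have "adj P xs r \<le> 2 powi i" if "b j0 \<le> r" "Suc r < b (Suc t)" for r
    by (rule run_cells(4)[OF z tp m j0 run that])
  then have "adj P xs r < \<kappa> \<and> (\<forall>j<j0. adj P xs r < a 15 (real j))" if "b j0 \<le> r" "Suc r < b (Suc t)" for r
    using that \<kappa> brk by (meson le_less_trans)
  then show ?thesis unfolding topc_def using stk b1 hub0 a' by simp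
qed

section \<open>Merging on the stack and its amortised cost\<close>

definition edges_ok :: "nat \<Rightarrow> (nat \<times> nat) list \<Rightarrow> bool" where
  "edges_ok n es \<longleftrightarrow> (\<forall>(x, y)\<in>set es. x < n \<and> y < n \<and> x \<noteq> y)"

definition topflag :: hcom where "topflag =
  Cd (Lt (C 0) (V 3)) (Cd (Lt (A (C 15) (V 3 \<ominus> C 1)) (V 4)) (As 19 (C 1)) (As 19 (C 0))) (As 19 (C 0))"

definition tflag :: "arrs \<Rightarrow> real \<Rightarrow> nat \<Rightarrow> real" where
  "tflag a \<kappa> t = (case t of 0 \<Rightarrow> 0 | Suc t' \<Rightarrow> if a 15 (real t') < \<kappa> then 1 else 0)"

lemma tflag_cong: "a' 15 = a 15 \<Longrightarrow> tflag a' \<kappa> t = tflag a \<kappa> t"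
  by (cases t) (simp_all add: tflag_def)

lemma hwp_topflag:
  assumes "v 3 = real t" "t < L" "Q (v(19 := tflag a (v 4) t), a, k)"
  shows "hwp L 19 topflag (v, a, k) Q"
  using assms by (cases t) (auto simp: topflag_def tflag_def)

text \<open>Register 2 holds the last point scanned, which lies in the top component. Its square of
  side \<open>V 5\<close>, the key under the top, is the one to be processed, and its centre is
  obtained by rounding.\<close>

definition mergeP :: "int \<Rightarrow> int \<Rightarrow> hcom" where "mergeP cx cy =
  As 5 (A (C 15) (V 3 \<ominus> C 1)) ;;
  As 16 (Uo Floor (A (C cx) (V 2) \<oslash> V 5) \<otimes> V 5 \<oplus> V 5 \<oslash> C 2) ;;
  As 17 (Uo Floor (A (C cy) (V 2) \<oslash> V 5) \<otimes> V 5 \<oplus> V 5 \<oslash> C 2) ;;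
  nearP cx cy ;; joinP cx cy ;; topflag"

lemma key_run:
  fixes f :: "nat \<Rightarrow> real"
  assumes "0 < t"
  shows "\<exists>j0<t. (\<forall>j. j0 \<le> j \<and> j < t \<longrightarrow> f j = f (t - 1)) \<and> (\<forall>j. j0 = Suc j \<longrightarrow> f j \<noteq> f (t - 1))"
proof -
  define c where "c = f (t - 1)"
  let ?P = "\<lambda>j0. j0 < t \<and> (\<forall>j. j0 \<le> j \<and> j < t \<longrightarrow> f j = c)"
  have "j = t - 1" if "t - 1 \<le> j" "j < t" for j using that by linarith
  then have "?P (t - 1)" using assms c_def by (metis diff_less zero_less_one)
  then have "\<exists>m. ?P m \<and> (\<forall>k<m. \<not> ?P k)" using exists_least_iff[of ?P] by blast
  then obtain m where m: "?P m" "\<forall>k<m. \<not> ?P k" by blast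
  have "f j \<noteq> c" if j: "m = Suc j" for j
  proof
    assume e: "f j = c"
    have "f j' = c" if "j \<le> j' \<and> j' < t" for j'
    proof (cases "j' = j")
      case False
      then have "m \<le> j'" using that j by simp
      then show ?thesis using m(1) that by blast
    qed (use e in simp)
    moreover have "j < t" using m(1) j by simp
    ultimately show False using m(2) j by blast
  qed
  then show ?thesis using m(1) unfolding c_def by blast
qed

text \<open>Every component on the stack has a credit of 4. A merge down to \<open>j0\<close> takes
  \<open>2 * (t - j0) + 1\<close> iterations of its own and one of the surrounding loop, at most
  \<open>4 * (t - j0)\<close> in all since \<open>j0 < t\<close>; this is the credit of the
  components that disappear.\<close>

lemma hwp_mergeP:
  assumes c: "coords n P cx cy a" "ix 19 (of_int cx)" "ix 19 (of_int cy)" "n \<le> L" "4 \<le> L" "cx < 11" "cy < 11"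
    and z: "zs n P xs" and tp: "topc P xs (set es) t b R a (v 4)" and bt: "b (Suc t) \<le> n"
    and v: "v 3 = real t" "v 2 = real (xs ! (b (Suc t) - 1))" and t: "0 < t" "t < L" "a 15 (real (t - 1)) < v 4"
    and R: "reps n (Suc t) R a" and dg: "degs n es a" and eo: "edges_ok n es" "length es + Suc t = b (Suc t)"
    and Q: "\<And>v' a' k' t' b' R' es'. t' < t \<Longrightarrow> (\<And>i. i = 0 \<or> i = 2 \<or> i = 4 \<or> i = 32 \<Longrightarrow> v' i = v i) \<Longrightarrow>
      v' 3 = real t' \<Longrightarrow> v' 19 = tflag a (v 4) t' \<Longrightarrow> (\<And>q. q < 11 \<or> q = 15 \<Longrightarrow> a' q = a q) \<Longrightarrow>
      topc P xs (set es') t' b' R' a' (v 4) \<Longrightarrow> b' (Suc t') = b (Suc t) \<Longrightarrow> reps n (Suc t') R' a' \<Longrightarrow>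
      degs n es' a' \<Longrightarrow> edges_ok n es' \<Longrightarrow> length es' + Suc t' = b (Suc t) \<Longrightarrow> Suc k' + 4 * t' \<le> k + 4 * t \<Longrightarrow> Q (v', a', k')"
  shows "hwp L 19 (mergeP cx cy) (v, a, k) Q"
proof -
  note T = tp[unfolded topc_def stk_def]
  obtain j0 where j0: "j0 < t" and run: "\<And>j. j0 \<le> j \<Longrightarrow> j < t \<Longrightarrow> a 15 (real j) = a 15 (real (t - 1))"
    and brk: "\<And>j. j0 = Suc j \<Longrightarrow> a 15 (real j) \<noteq> a 15 (real (t - 1))"
    using key_run[OF t(1), of "\<lambda>j. a 15 (real j)"] by blast
  have lt: "b j < b (Suc j)" if "j \<le> t" for j using T that by (cases "j = t") auto
  note mono = bound_mono[of t b, OF lt]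
  have bpos: "b l < b (Suc l)" "b (Suc l) \<le> n" "b (Suc l) \<le> b (Suc t)" if "l \<le> t" for l
    using lt[OF that] mono[of "Suc l" "Suc t"] that bt by simp_all
  define p where "p = xs ! (b (Suc t) - 1)"
  have vp: "v 2 = real p" using v(2) by (simp only: p_def)
  have pin: "p \<in> blk xs b t" using bpos(1)[of t] unfolding p_def by (auto simp: blk_def intro!: imageI)
  have pn: "p < n" unfolding p_def by (rule zs_less[OF z]) (use bpos[of t] in simp)
  have tn: "t < n" using eo(2) bt by simp
  have "\<exists>i. a 15 (real (t - 1)) = 2 powi i"
  proof -
    let ?r = "b t - 1"
    have e: "a 15 (real (t - 1)) = adj P xs ?r" using T t(1) by (metis Suc_diff_1 diff_less zero_less_one)
    have r: "Suc ?r = b t" "b t < n" using bpos[of "t - 1"] bpos[of t] t(1) by auto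
    have "P (xs ! ?r) \<noteq> P (xs ! Suc ?r)" by (rule zs_neq[OF z]) (use r in simp_all)
    then obtain i where "sep (P (xs ! ?r)) (P (xs ! Suc ?r)) = 2 powi i"
      using lvl_ex[OF zs_nonneg[OF z] zs_nonneg[OF z], of ?r "Suc ?r"] r by auto
    then show ?thesis using e by (auto simp: adj_def)
  qed
  then obtain i where i: "a 15 (real (t - 1)) = 2 powi i" by blast
  note run = run[unfolded i] and brk = brk[unfolded i]
  have run2: "\<forall>j. j0 \<le> j \<and> j < t \<longrightarrow> a 15 (real j) = 2 powi i" using run by blast
  have brk2: "2 powi i < a 15 (real j)" if "j < j0" for j
  proof -
    obtain j' where j': "j0 = Suc j'" using \<open>j < j0\<close> by (cases j0) auto
    have mono15: "i \<le> j \<and> j < t \<longrightarrow> a 15 (real j) \<le> a 15 (real i)" for i j using T by blast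
    have "a 15 (real j') \<le> a 15 (real j)" using mono15[of j j'] j' that j0 by simp
    moreover have "a 15 (real j0) \<le> a 15 (real j')" using mono15[of j' j0] j' j0 by simp
    ultimately show ?thesis using run[of j0] j0 brk[OF j'] by simp
  qed
  note cells = run_cells[OF z tp bt j0 run2]
  let ?m = "ctr i (P p)" and ?J = "{j0..t}"
  have tJ: "t \<in> ?J" "j0 \<in> ?J" using j0 by simp_all
  have cl0: "cl i (P x) = cl i (P p)" if "l \<in> ?J" "x \<in> blk xs b l" for l x by (rule cells(3)[OF that(1) tJ(1) that(2) pin])
  have ctr0: "ctr i (P x) = ?m" if "l \<in> ?J" "x \<in> blk xs b l" for l x by (rule ctr_cong[OF cl0[OF that]])
  have hubs: "hub P (set es) (blk xs b l) (R l)" if "l \<in> ?J" for l using T that by (cases "l = t") auto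
  have RV: "R l d \<in> blk xs b l" if "l \<in> ?J" "d < 4" for l d using hubs[OF that(1)] that(2) by (simp add: hub_def)
  have inne: "inn P ?m R l \<in> blk xs b l" if "l \<in> ?J" for l by (rule RV[OF that]) simp
  have inj: "inj_on (qq P ?m R) ?J"
  proof (rule inj_onI, rule ccontr)
    fix l l' assume l: "l \<in> ?J" "l' \<in> ?J" "qq P ?m R l = qq P ?m R l'" "l \<noteq> l'"
    have r: "R l 0 \<in> blk xs b l" "R l' 0 \<in> blk xs b l'" using RV[OF l(1), of 0] RV[OF l(2), of 0] by simp_all
    have "qd (ctr i (P (R l 0))) (P (R l 0)) = qd (ctr i (P (R l 0))) (P (R l' 0)) \<longleftrightarrow> cl (i - 1) (P (R l 0)) = cl (i - 1) (P (R l' 0))"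
      by (rule qd_eq_iff) (rule cells(3)[OF l(1,2) r])
    then show False using l(3) ctr0[OF l(1) r(1)] cells(2)[OF l(1,2,4) r] by simp
  qed
  have inn_ne: "inn P ?m R l \<noteq> inn P ?m R l'" if "l \<in> ?J" "l' \<in> ?J" "l \<noteq> l'" for l l'
    using cells(2)[OF that inne[OF that(1)] inne[OF that(2)]] by auto
  let ?v = "v(5 := 2 powi i, 16 := fst ?m, 17 := snd ?m)"
  have pL: "p < L" using pn c(4) by simp
  obtain t0 where t0: "t = Suc t0" using t(1) by (cases t) auto
  have tL: "v 3 - 1 = real t0" "t0 < L" "a 15 (real t0) = 2 powi i" using v t(2) i t0 by simp_all
  have vv: "?v 3 = real t" "?v 16 = fst ?m" "?v 17 = snd ?m" using v by simp_all
  have j0t: "j0 \<le> t" using j0 by simp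
  have P: "a (of_int cx) (real p) = fst (P p)" "a (of_int cy) (real p) = snd (P p)"
    using c(1) pn by (auto simp: coords_def)
  have m1: "of_int \<lfloor>fst (P p) / 2 powi i\<rfloor> * 2 powi i + 2 powi i / 2 = fst ?m" "of_int \<lfloor>snd (P p) / 2 powi i\<rfloor> * 2 powi i + 2 powi i / 2 = snd ?m"
    by (simp_all add: ctr_def fl_def algebra_simps)
  show ?thesis
    unfolding mergeP_def
    apply (rule hwp_asq[where z = "2 powi i"], simp add: tL, simp add: tL)
    apply (rule hwp_asq[where z = "fst ?m"], simp add: vp c pL, simp add: vp P m1)
    apply (rule hwp_asq[where z = "snd ?m"], simp add: vp c pL, simp add: vp P m1)
  proof (rule hwp_seq, rule hwp_nearP[where v = ?v, OF c(1-4) t(2) vv(1) R vv(2,3) j0t])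
    fix w :: vars and js
    assume w: "\<And>i. i < 6 \<or> i = 16 \<or> i = 17 \<or> i = 32 \<Longrightarrow> w i = ?v i" "w 6 = real j0" "js \<in> ?J"
      "w 7 = real (inn P ?m R js)" "\<forall>l\<in>?J. dist (P (inn P ?m R js)) ?m \<le> dist (P (inn P ?m R l)) ?m"
    have w3: "w 3 = real t" "w 16 = fst ?m" "w 17 = snd ?m" using w(1)[of 3] w(1)[of 16] w(1)[of 17] v by simp_all
    show "hwp L 19 (joinP cx cy ;; topflag) (w, a, k + (t - j0)) Q"
    proof (rule hwp_seq, rule hwp_joinP[where v = w, OF c(1-4,6,7) t(2) c(5) w3(1) R w3(2,3) w(3,2,4) inj])
      show "inn P ?m R l \<noteq> inn P ?m R js" if "l \<in> ?J" "l \<noteq> js" for l by (rule inn_ne[OF that(1) w(3) that(2)])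
      show "degs n es a" by (rule dg)
    next
      fix u :: vars and a' :: arrs and es' R''
      assume u: "\<And>i. i < 6 \<and> i \<noteq> 3 \<or> i = 32 \<Longrightarrow> u i = w i" "u 3 = real j0" "\<And>q. q < 11 \<or> q = 15 \<Longrightarrow> a' q = a q"
        and e: "degs n (es' @ es) a'" "length es' = t - j0" "\<forall>l\<in>?J. l \<noteq> js \<longrightarrow> (inn P ?m R l, inn P ?m R js) \<in> set es'"
          "\<forall>(x, y)\<in>set es'. x < n \<and> y < n \<and> x \<noteq> y"
        and r: "\<forall>l\<in>?J. R'' (qq P ?m R l) = R l (qq P ?m R l)" "\<forall>d<4. d \<notin> qq P ?m R ` ?J \<longrightarrow> R'' d = inn P ?m R js"
          "reps n (Suc j0) (R(j0 := R'')) a'"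
      have sub: "set es \<subseteq> set (es' @ es)" by auto
      have hub: "hub P (set (es' @ es)) (\<Union>l\<in>?J. blk xs b l) R''"
      proof (rule hub_join[where i = i and m = ?m and q = "qq P ?m R" and R = R and js = js])
        show "j0 \<in> ?J" "t \<in> ?J" "j0 \<noteq> t" using j0 by simp_all
        show "js \<in> ?J" by fact
        show "hub P (set (es' @ es)) (blk xs b l) (R l)" if "l \<in> ?J" for l by (rule hub_mono[OF hubs[OF that] sub])
        show "cl i (P x) = cl i (P p)" if "l \<in> ?J" "x \<in> blk xs b l" for l x by (rule cl0[OF that])
        show "ctr i (P x) = ?m" if "l \<in> ?J" "x \<in> blk xs b l" for l x by (rule ctr0[OF that])
        show "cl (i - 1) (P x) = cl (i - 1) (P y)" if "l \<in> ?J" "x \<in> blk xs b l" "y \<in> blk xs b l" for l x y by (rule cells(1)[OF that])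
        show "cl (i - 1) (P x) \<noteq> cl (i - 1) (P y)" if "l \<in> ?J" "l' \<in> ?J" "l \<noteq> l'" "x \<in> blk xs b l" "y \<in> blk xs b l'" for l l' x y
          by (rule cells(2)[OF that])
        show "(inn P ?m R l, inn P ?m R js) \<in> set (es' @ es)" if "l \<in> ?J" "l \<noteq> js" for l using e(3) that by auto
        show "dist (P (inn P ?m R js)) ?m \<le> dist (P (inn P ?m R l)) ?m" if "l \<in> ?J" for l using w(5) that by blast
        show "R'' (qq P ?m R l) = R l (qq P ?m R l)" if "l \<in> ?J" for l using r(1) that by blast
        show "R'' d = inn P ?m R js" if "d < 4" "d \<notin> qq P ?m R ` ?J" for d using r(2) that by blast
      qed (rule refl)
      have tp': "topc P xs (set (es' @ es)) j0 (b(Suc j0 := b (Suc t))) (R(j0 := R'')) a' (v 4)"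
        by (rule merge_topc[OF z tp bt j0 run2 _ brk2 hub sub]) (use t(3) i u(3) in simp_all)
      have eo': "edges_ok n (es' @ es)" using e(4) eo(1) by (auto simp: edges_ok_def)
      have u': "u i = v i" if "i = 0 \<or> i = 2 \<or> i = 4 \<or> i = 32" for i using that u(1)[of i] w(1)[of i] by auto
      have a15: "tflag a' (v 4) j0 = tflag a (v 4) j0" by (rule tflag_cong) (simp add: u(3))
      show "hwp L 19 topflag (u, a', k + (t - j0) + (Suc t - j0)) Q"
        by (rule hwp_topflag[where t = j0], rule u(2), use j0 t(2) in simp,
            rule Q[where t' = j0 and b' = "b(Suc j0 := b (Suc t))" and R' = "R(j0 := R'')" and es' = "es' @ es"])
          (use j0 u' u(2,3) tp' r(3) e(1,2) eo' eo(2) a15 in \<open>auto simp: u'[of 4]\<close>)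
    qed
  next
    show "a 15 (real j) = (v(5 := 2 powi i, 16 := fst ?m, 17 := snd ?m)) 5" if "j0 \<le> j" "j < t" for j using run[OF that] by simp
    show "a 15 (real j) \<noteq> (v(5 := 2 powi i, 16 := fst ?m, 17 := snd ?m)) 5" if "j0 = Suc j" for j using brk[OF that] by simp
  qed
qed

lemma hwp_merges:
  assumes c: "coords n P cx cy a" "ix 19 (of_int cx)" "ix 19 (of_int cy)" "n \<le> L" "4 \<le> L" "cx < 11" "cy < 11"
    and z: "zs n P xs" and tp: "topc P xs (set es) t b R a (v 4)" and bt: "b (Suc t) = m" "m \<le> n"
    and v: "v 3 = real t" "v 2 = real (xs ! (m - 1))" "v 19 = tflag a (v 4) t" and t: "t < L"
    and R: "reps n (Suc t) R a" and dg: "degs n es a" and eo: "edges_ok n es" "length es + Suc t = m"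
    and Q: "\<And>v' a' k' t' b' R' es'. t' \<le> t \<Longrightarrow> (\<And>i. i = 0 \<or> i = 2 \<or> i = 4 \<or> i = 32 \<Longrightarrow> v' i = v i) \<Longrightarrow>
      v' 3 = real t' \<Longrightarrow> (\<And>t''. t' = Suc t'' \<Longrightarrow> v 4 \<le> a 15 (real t'')) \<Longrightarrow> (\<And>q. q < 11 \<or> q = 15 \<Longrightarrow> a' q = a q) \<Longrightarrow>
      topc P xs (set es') t' b' R' a' (v 4) \<Longrightarrow> b' (Suc t') = m \<Longrightarrow> reps n (Suc t') R' a' \<Longrightarrow>
      degs n es' a' \<Longrightarrow> edges_ok n es' \<Longrightarrow> length es' + Suc t' = m \<Longrightarrow> k' + 4 * t' \<le> k + 4 * t \<Longrightarrow> Q (v', a', k')"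
  shows "hwp L 19 (Wh (Lt (C 0) (V 19)) (mergeP cx cy)) (v, a, k) Q"
proof -
  define W where "W t' b' R' es' v' a' k' \<longleftrightarrow> t' \<le> t \<and> (\<forall>i. i = 0 \<or> i = 2 \<or> i = 4 \<or> i = 32 \<longrightarrow> v' i = v i) \<and>
      v' 3 = real t' \<and> v' 19 = tflag a (v 4) t' \<and> (\<forall>q. q < 11 \<or> q = 15 \<longrightarrow> a' q = a q) \<and>
      topc P xs (set es') t' b' R' a' (v 4) \<and> b' (Suc t') = m \<and> reps n (Suc t') R' a' \<and>
      degs n es' a' \<and> edges_ok n es' \<and> length es' + Suc t' = m \<and> k' + 4 * t' \<le> k + 4 * t"
    for t' k' :: nat and b' R' es' and v' :: vars and a' :: arrs
  let ?I = "\<lambda>(v', a', k'). \<exists>t' b' R' es'. W t' b' R' es' v' a' k'"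
  show ?thesis
  proof (rule hwp_while[where I = ?I and B = "k + 4 * t"])
    have "W t b R es v a k" unfolding W_def using assms by simp
    then show "?I (v, a, k)" by blast
  next
    fix v' :: vars and a' :: arrs and k' :: nat
    assume "?I (v', a', k')" and tv: "tv (Lt (C 0) (V 19)) v' a'"
    then obtain t' b' R' es' where "W t' b' R' es' v' a' k'" by blast
    note s = this[unfolded W_def]
    have aq: "a' q = a q" if "q < 11 \<or> q = 15" for q using s that by blast
    have fr: "v' i = v i" if "i = 0 \<or> i = 2 \<or> i = 4 \<or> i = 32" for i using s that by blast
    have "0 < tflag a (v 4) t'" using tv s by simp
    then obtain t'' where t'': "t' = Suc t''" "a 15 (real t'') < v 4" by (cases t') (auto simp: tflag_def split: if_splits)
    have v4: "v' 4 = v 4" "v' 2 = v 2" using fr by simp_all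
    show "hwp L 19 (mergeP cx cy) (v', a', Suc k') ?I"
    proof (rule hwp_mergeP[where n = n and P = P and xs = xs and t = t' and b = b' and R = R' and es = es'])
      show "coords n P cx cy a'" using c(1,6,7) aq by (simp add: coords_def)
      show "topc P xs (set es') t' b' R' a' (v' 4)" "b' (Suc t') \<le> n" "v' 3 = real t'" "v' 2 = real (xs ! (b' (Suc t') - 1))"
        "0 < t'" "t' < L" "a' 15 (real (t' - 1)) < v' 4" "reps n (Suc t') R' a'" "degs n es' a'" "edges_ok n es'"
        "length es' + Suc t' = b' (Suc t')" using s v4 v t t'' bt(2) aq[of 15] by simp_all
    next
      fix u :: vars and a2 :: arrs and k2 t2 :: nat and b2 R2 es2
      assume u: "t2 < t'" "\<And>i. i = 0 \<or> i = 2 \<or> i = 4 \<or> i = 32 \<Longrightarrow> u i = v' i" "u 3 = real t2"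
        "u 19 = tflag a' (v' 4) t2" "\<And>q. q < 11 \<or> q = 15 \<Longrightarrow> a2 q = a' q" "topc P xs (set es2) t2 b2 R2 a2 (v' 4)"
        "b2 (Suc t2) = b' (Suc t')" "reps n (Suc t2) R2 a2" "degs n es2 a2" "edges_ok n es2"
        "length es2 + Suc t2 = b' (Suc t')" "Suc k2 + 4 * t2 \<le> Suc k' + 4 * t'"
      have "tflag a' (v' 4) t2 = tflag a (v 4) t2" using tflag_cong[of a' a "v 4" t2] aq[of 15] v4 by simp
      then have "W t2 b2 R2 es2 u a2 k2" unfolding W_def using u s fr aq v4 by simp
      then show "?I (u, a2, k2)" by blast
    qed (rule c z)+
  next
    fix v' :: vars and a' :: arrs and k' :: nat
    assume "?I (v', a', k')" and tv: "\<not> tv (Lt (C 0) (V 19)) v' a'"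
    then obtain t' b' R' es' where "W t' b' R' es' v' a' k'" by blast
    note s = this[unfolded W_def]
    have "\<not> 0 < tflag a (v 4) t'" using tv s by simp
    then have "v 4 \<le> a 15 (real t'')" if "t' = Suc t''" for t'' using that by (auto simp: tflag_def split: if_splits)
    then show "Q (v', a', k')" using Q[of t' v' a' es' b' R' k'] s by blast
  next
    fix v' :: vars and a' :: arrs and k' :: nat
    assume "?I (v', a', k')"
    then show "k' \<le> k + 4 * t" by (auto simp: W_def)
  qed simp
qed

lemma hwp_for:
  assumes "Inv 0 (v, a, k)"
    and "\<And>i v a k. i < n \<Longrightarrow> Inv i (v, a, k) \<Longrightarrow> hwp L N c (v, a, Suc k) (Inv (Suc i))"
    and "\<And>i v a k. i \<le> n \<Longrightarrow> Inv i (v, a, k) \<Longrightarrow> v x = real i \<and> v y = real n \<and> k \<le> B"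
    and "\<And>s. Inv n s \<Longrightarrow> Q s"
  shows "hwp L N (Wh (Lt (V x) (V y)) c) (v, a, k) Q"
proof (rule hwp_while[where I = "\<lambda>s. \<exists>i\<le>n. Inv i s" and B = B])
  show "\<exists>i\<le>n. Inv i (v, a, k)" using assms(1) by blast
next
  fix v a k assume "\<exists>i\<le>n. Inv i (v, a, k)" "tv (Lt (V x) (V y)) v a"
  then obtain i where i: "Inv i (v, a, k)" "i < n" using assms(3) by force
  show "hwp L N c (v, a, Suc k) (\<lambda>s. \<exists>i\<le>n. Inv i s)"
    by (rule hwp_mono[OF assms(2)[OF i(2,1)]]) (use i(2) in \<open>auto intro: exI[of _ "Suc i"]\<close>)
next
  fix v a k assume "\<exists>i\<le>n. Inv i (v, a, k)" "\<not> tv (Lt (V x) (V y)) v a"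
  then obtain i where i: "Inv i (v, a, k)" "i = n" using assms(3) by force
  then show "Q (v, a, k)" using assms(4) by simp
qed (use assms(3) in auto)

lemma push_topc:
  assumes "stk P xs E c b R a" "b c = i" "a' 15 = a 15"
  shows "topc P xs E c (b(Suc c := Suc i)) (R(c := \<lambda>_. xs ! i)) a' \<kappa>"
proof -
  let ?b = "b(Suc c := Suc i)" and ?R = "R(c := \<lambda>_. xs ! i)"
  have "blk xs ?b c = {xs ! i}" using assms(2) by (auto simp: blk_def)
  then have h: "hub P E (blk xs ?b c) (?R c)" using hub_leaf by simp
  have blk0: "blk xs ?b j = blk xs b j" if "j < c" for j using that by (simp add: blk_def)
  note S = assms(1)[unfolded stk_def]
  have "stk P xs E c ?b ?R a'"
    unfolding stk_def assms(3)
  proof (intro conjI allI impI)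
    show "?b 0 = 0" using S by simp
    fix j assume j: "j < c"
    have e: "?b j = b j" "?b (Suc j) = b (Suc j)" "?R j = R j" "blk xs ?b j = blk xs b j" using j blk0 by simp_all
    show "?b j < ?b (Suc j)" unfolding e using S j by blast
    show "hub P E (blk xs ?b j) (?R j)" unfolding e using S j by blast
    show "a 15 (real j) = adj P xs (?b (Suc j) - 1)" unfolding e using S j by blast
    show "adj P xs r < a 15 (real j)" if "?b j \<le> r \<and> Suc r < ?b (Suc j)" for r using that S j unfolding e by blast
  next
    show "a 15 (real j) \<le> a 15 (real l)" if "l \<le> j \<and> j < c" for l j using S that by blast
  qed
  then show ?thesis using h assms(2) by (simp add: topc_def)
qed

text \<open>Merging has stopped because \<open>\<kappa>\<close> is at most the key below, so the
  keys stay nonincreasing towards the top.\<close>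

lemma close_topc:
  assumes "topc P xs E t b R a \<kappa>" and \<kappa>: "\<And>t'. t = Suc t' \<Longrightarrow> \<kappa> \<le> a 15 (real t')" and "\<kappa> = adj P xs (b (Suc t) - 1)"
  shows "stk P xs E (Suc t) b R (a(15 := (a 15)(real t := \<kappa>)))"
proof -
  note T = assms(1)[unfolded topc_def stk_def]
  have k: "\<kappa> \<le> a 15 (real i)" if "i < t" for i
  proof -
    obtain t' where t': "t = Suc t'" using that using \<open>i < t\<close> less_imp_Suc_add by blast
    have "a 15 (real t') \<le> a 15 (real i)" using T that t' by auto
    then show ?thesis using \<kappa>[OF t'] by simp
  qed
  have mono: "a 15 (real j) \<le> a 15 (real i)" if "i \<le> j" "j < t" for i j using T that by blast
  let ?a = "a(15 := (a 15)(real t := \<kappa>))"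
  have old: "b j < b (Suc j) \<and> hub P E (blk xs b j) (R j) \<and> a 15 (real j) = adj P xs (b (Suc j) - 1) \<and>
      (\<forall>r. b j \<le> r \<and> Suc r < b (Suc j) \<longrightarrow> adj P xs r < a 15 (real j))" if "j < t" for j using T that by blast
  have new: "b t < b (Suc t)" "hub P E (blk xs b t) (R t)" "\<forall>r. b t \<le> r \<and> Suc r < b (Suc t) \<longrightarrow> adj P xs r < \<kappa>"
    using T by blast+
  show ?thesis
    unfolding stk_def
  proof (intro conjI allI impI)
    show "b 0 = 0" using T by blast
    fix j assume "j < Suc t"
    then have j: "j = t \<or> j < t" by auto
    then show "b j < b (Suc j)" "hub P E (blk xs b j) (R j)" using old new by blast+
    show "?a 15 (real j) = adj P xs (b (Suc j) - 1)" using j old[of j] assms(3) by (elim disjE) simp_all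
    show "adj P xs r < ?a 15 (real j)" if "b j \<le> r \<and> Suc r < b (Suc j)" for r
    proof (cases "j = t")
      case True
      then show ?thesis using new(3) that by simp
    next
      case False
      then have "adj P xs r < a 15 (real j)" using old j that by blast
      then show ?thesis using False by simp
    qed
  next
    fix i j assume ij: "i \<le> j \<and> j < Suc t"
    show "?a 15 (real j) \<le> ?a 15 (real i)"
    proof (cases "j = t")
      case True
      then show ?thesis using k[of i] ij by simp
    next
      case False
      then have "j < t" "i \<noteq> t" using ij by auto
      then show ?thesis using mono[of i j] ij by simp
    qed
  qed
qed

text \<open>The last point has no successor. Its key is set to one more than the key at the bottom,
  the largest on the stack, so that everything is merged into one component.\<close>

definition scanP :: "int \<Rightarrow> int \<Rightarrow> hcom" where "scanP cx cy =
  As 32 (C 0) ;; Wh (Lt (V 32) (V 0)) (St (C 17) (V 32) (C 0) ;; St (C 18) (V 32) (C 0) ;; As 32 (V 32 \<oplus> C 1)) ;;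
  As 32 (C 0) ;; As 3 (C 0) ;;
  Wh (Lt (V 32) (V 0)) (
    As 2 (A (C 10) (V 32)) ;;
    St (C 11) (V 3) (V 2) ;; St (C 12) (V 3) (V 2) ;; St (C 13) (V 3) (V 2) ;; St (C 14) (V 3) (V 2) ;;
    Cd (Lt (V 32 \<oplus> C 1) (V 0)) (As 10 (V 2) ;; As 11 (A (C 10) (V 32 \<oplus> C 1)) ;; sepc cx cy ;; As 4 (V 14))
      (As 4 (A (C 15) (C 0) \<oplus> C 1)) ;;
    topflag ;; Wh (Lt (C 0) (V 19)) (mergeP cx cy) ;;
    St (C 15) (V 3) (V 4) ;; As 3 (V 3 \<oplus> C 1) ;; As 32 (V 32 \<oplus> C 1))"

text \<open>A point brings 5 units of time: one for its own iteration and 4 as the credit of the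
  component it starts. \<open>length es + c = i\<close> is the edge count of a forest with
  \<open>c\<close> components. For \<open>i = n\<close> only the finished tree is recorded, because
  the key stored last is artificial.\<close>

definition scan_inv :: "nat \<Rightarrow> (nat \<Rightarrow> pt) \<Rightarrow> nat list \<Rightarrow> arrs \<Rightarrow> nat \<Rightarrow> nat \<Rightarrow> hst \<Rightarrow> bool" where
  "scan_inv n P xs a0 k0 i = (\<lambda>(v, a, k). \<exists>c b R es. v 0 = real n \<and> v 32 = real i \<and> v 3 = real c \<and>
     (\<forall>q<11. a q = a0 q) \<and> degs n es a \<and> edges_ok n es \<and> k + 4 * c \<le> k0 + 5 * i \<and> length es + c = i \<and>
     (i < n \<longrightarrow> b c = i \<and> stk P xs (set es) c b R a \<and> reps n c R a) \<and>
     (i = n \<longrightarrow> c = 1 \<and> (\<exists>R. hub P (set es) {..<n} R)))"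

lemma hwp_scan_tail:
  assumes c: "coords n P cx cy a" "ix 19 (of_int cx)" "ix 19 (of_int cy)" "n \<le> L" "4 \<le> L" "cx < 11" "cy < 11"
    and z: "zs n P xs" and i: "i < n" "\<forall>q<11. a q = a0 q"
    and st: "b t = i" "stk P xs (set es) t b R a"
    and R: "reps n (Suc t) (R(t := \<lambda>_. xs ! i)) a" and dg: "degs n es a" and eo: "edges_ok n es" "length es + t = i"
    and v: "v 0 = real n" "v 32 = real i" "v 3 = real t" "v 2 = real (xs ! i)" and k: "k + 4 * t \<le> k0 + 5 * i + 1"
    and \<kappa>: "Suc i < n \<Longrightarrow> v 4 = adj P xs i" "Suc i = n \<Longrightarrow> v 4 = a 15 0 + 1"
  shows "hwp L 19 (topflag ;; Wh (Lt (C 0) (V 19)) (mergeP cx cy) ;;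
    St (C 15) (V 3) (V 4) ;; As 3 (V 3 \<oplus> C 1) ;; As 32 (V 32 \<oplus> C 1)) (v, a, k) (scan_inv n P xs a0 k0 (Suc i))"
proof (rule hwp_seq, rule hwp_topflag[where t = t], rule v)
  show tL: "t < L" using eo(2) i c(4) by simp
  let ?v = "v(19 := tflag a (v 4) t)" and ?b = "b(Suc t := Suc i)" and ?R = "R(t := \<lambda>_. xs ! i)"
  have tp: "topc P xs (set es) t ?b ?R a (?v 4)" by (rule push_topc[OF st(2,1)]) (rule refl)
  show "hwp L 19 (Wh (Lt (C 0) (V 19)) (mergeP cx cy) ;; St (C 15) (V 3) (V 4) ;; As 3 (V 3 \<oplus> C 1) ;; As 32 (V 32 \<oplus> C 1))
    (?v, a, k) (scan_inv n P xs a0 k0 (Suc i))"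
  proof (rule hwp_seq, rule hwp_merges[where v = ?v and t = t and b = ?b and R = ?R and es = es and m = "Suc i" and n = n and P = P and xs = xs])
    show "topc P xs (set es) t ?b ?R a (?v 4)" by (rule tp)
  next
    fix v' :: vars and a' :: arrs and k' t' :: nat and b' R' es'
    assume q: "t' \<le> t" "\<And>i. i = 0 \<or> i = 2 \<or> i = 4 \<or> i = 32 \<Longrightarrow> v' i = ?v i"
      "v' 3 = real t'" "\<And>t''. t' = Suc t'' \<Longrightarrow> ?v 4 \<le> a 15 (real t'')" "\<And>q. q < 11 \<or> q = 15 \<Longrightarrow> a' q = a q"
      and tp': "topc P xs (set es') t' b' R' a' (?v 4)" and b': "b' (Suc t') = Suc i" and r': "reps n (Suc t') R' a'"
      and e': "degs n es' a'" "edges_ok n es'" "length es' + Suc t' = Suc i" "k' + 4 * t' \<le> k + 4 * t"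
    have v': "v' 0 = real n" "v' 32 = real i" "v' 4 = v 4" using q(2) v by simp_all
    have tL': "t' < L" using q(1) tL by simp
    let ?a2 = "a'(15 := (a' 15)(real t' := v 4))"
    have a2: "degs n es' ?a2" "reps n (Suc t') R' ?a2" using e'(1) r' by (simp_all add: degs_def reps_def less4_cases)
    have fin: "scan_inv n P xs a0 k0 (Suc i) (w, ?a2, k')"
      if w: "w 0 = real n" "w 32 = real (Suc i)" "w 3 = real (Suc t')" for w
    proof (cases "Suc i < n")
      case True
      have "stk P xs (set es') (Suc t') b' R' ?a2"
        by (rule close_topc) (use tp' q(4,5) b' \<kappa>(1)[OF True] in simp_all)
      then show ?thesis unfolding scan_inv_def prod.case
        using w q(5) i a2 e' k b' True by (intro exI[of _ "Suc t'"] exI[of _ b'] exI[of _ R'] exI[of _ es']) simp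
    next
      case False
      then have n: "Suc i = n" using i by simp
      \<comment> \<open>Merging cannot have stopped above the bottom: the artificial key exceeds
        every key on the stack.\<close>
      have t0: "t' = 0"
      proof (rule ccontr)
        assume "t' \<noteq> 0"
        then obtain t'' where t'': "t' = Suc t''" by (cases t') auto
        then have "a 15 (real t'') \<le> a 15 (real 0)" using st(2) q(1) unfolding stk_def by (meson Suc_le_lessD le0)
        then show False using q(4)[OF t''] \<kappa>(2)[OF n] by simp
      qed
      have "b' 0 = 0" using tp' by (simp add: topc_def stk_def)
      then have "blk xs b' 0 = (!) xs ` {0..<n}" using b' n t0 by (simp add: blk_def)
      also have "\<dots> = {..<n}" using z nth_image[of n xs] by (simp add: zs_def)
      finally have "blk xs b' 0 = {..<n}" .
      then have "hub P (set es') {..<n} (R' 0)" using tp' t0 by (simp add: topc_def)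
      then show ?thesis unfolding scan_inv_def prod.case
        using w q(5) i a2 e' k b' n t0 by (intro exI[of _ "Suc t'"] exI[of _ b'] exI[of _ R'] exI[of _ es']) auto
    qed
    show "hwp L 19 (St (C 15) (V 3) (V 4) ;; As 3 (V 3 \<oplus> C 1) ;; As 32 (V 32 \<oplus> C 1)) (v', a', k') (scan_inv n P xs a0 k0 (Suc i))"
      apply (rule hwp_stq[where zp = 15 and zi = "real t'" and ze = "v 4"])
              apply (simp_all add: v' q(3) tL')[8]
      apply (rule hwp_asq[where z = "real (Suc t')"], simp, simp add: q(3))
      apply (rule hwp_as[where z = "real (Suc i)"], simp, simp add: v')
      apply (rule fin; simp add: v')
      done
  qed (use i v tL R dg eo c z in simp_all)
qed

lemma hwp_scanP:
  assumes c: "coords n P cx cy a" "ix 19 (of_int cx)" "ix 19 (of_int cy)" "n < L" "4 \<le> L" "cx < 11" "cy < 11"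
    and z: "zs n P xs" and n: "0 < n" "v 0 = real n" and o: "\<forall>j<n. a 10 (real j) = real (xs ! j)"
    and Q: "\<And>v' a' k' es R. v' 0 = real n \<Longrightarrow> (\<forall>q<11. a' q = a q) \<Longrightarrow> degs n es a' \<Longrightarrow> edges_ok n es \<Longrightarrow>
      length es + 1 = n \<Longrightarrow> hub P (set es) {..<n} R \<Longrightarrow> k' \<le> k + 6 * n \<Longrightarrow> Q (v', a', k')"
  shows "hwp L 19 (scanP cx cy) (v, a, k) Q"
proof -
  define Z where "Z i = (\<lambda>(v' :: vars, a' :: arrs, k' :: nat). v' 0 = real n \<and> v' 32 = real i \<and> k' = k + i \<and> (\<forall>q<11. a' q = a q) \<and>
    (\<forall>u<i. a' 17 (real u) = 0 \<and> a' 18 (real u) = 0))" for i and k' :: nat and v' :: vars and a' :: arrs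
  have nL: "n \<le> L" using c(4) by simp
  show ?thesis
    unfolding scanP_def
  proof (rule hwp_asq[where z = 0], simp, simp, rule hwp_seq, rule hwp_for[where n = n and Inv = Z and B = "k + n"])
    show "Z 0 (v(32 := 0), a, k)" using n by (simp add: Z_def)
    show "hwp L 19 (St (C 17) (V 32) (C 0) ;; St (C 18) (V 32) (C 0) ;; As 32 (V 32 \<oplus> C 1)) (v', a', Suc k') (Z (Suc i))"
      if "i < n" "Z i (v', a', k')" for i v' a' k'
      using that c(4) by (auto simp: Z_def less_Suc_eq)
    show "v' 32 = real i \<and> v' 0 = real n \<and> k' \<le> k + n" if "i \<le> n" "Z i (v', a', k')" for i v' a' k'
      using that by (auto simp: Z_def)
  next
    fix s assume s: "Z n s"
    obtain v1 a1 k1 where s1: "s = (v1, a1, k1)" by (cases s) auto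
    have v1: "v1 0 = real n" "k1 = k + n" "\<forall>q<11. a1 q = a q" "degs n [] a1" using s by (simp_all add: Z_def s1 degs_def)
    show "hwp L 19 (As 32 (C 0) ;; As 3 (C 0) ;; Wh (Lt (V 32) (V 0)) (
      As 2 (A (C 10) (V 32)) ;;
      St (C 11) (V 3) (V 2) ;; St (C 12) (V 3) (V 2) ;; St (C 13) (V 3) (V 2) ;; St (C 14) (V 3) (V 2) ;;
      Cd (Lt (V 32 \<oplus> C 1) (V 0)) (As 10 (V 2) ;; As 11 (A (C 10) (V 32 \<oplus> C 1)) ;; sepc cx cy ;; As 4 (V 14))
        (As 4 (A (C 15) (C 0) \<oplus> C 1)) ;;
      topflag ;; Wh (Lt (C 0) (V 19)) (mergeP cx cy) ;;
      St (C 15) (V 3) (V 4) ;; As 3 (V 3 \<oplus> C 1) ;; As 32 (V 32 \<oplus> C 1))) s Q"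
      unfolding s1
    proof (rule hwp_asq[where z = 0], simp, simp, rule hwp_asq[where z = 0], simp, simp,
        rule hwp_for[where n = n and Inv = "scan_inv n P xs a k1" and B = "k1 + 5 * n"])
      show "scan_inv n P xs a k1 0 (v1(32 := 0, 3 := 0), a1, k1)"
        unfolding scan_inv_def prod.case
        by (rule exI[of _ 0], rule exI[of _ "\<lambda>_. 0"], rule exI[of _ "\<lambda>_ _. 0"], rule exI[of _ "[]"])
          (use v1 n(1) in \<open>simp add: stk_def reps_def edges_ok_def\<close>)
      show "v' 32 = real i \<and> v' 0 = real n \<and> k' \<le> k1 + 5 * n" if "i \<le> n" "scan_inv n P xs a k1 i (v', a', k')" for i v' a' k'
        using that by (auto simp: scan_inv_def)
      show "Q s" if sc: "scan_inv n P xs a k1 n s" for s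
      proof -
        obtain v' a' k' where s': "s = (v', a', k')" by (cases s) auto
        obtain c es where q: "v' 0 = real n" "\<forall>q<11. a' q = a q" "degs n es a'" "edges_ok n es" "k' + 4 * c \<le> k1 + 5 * n"
          "length es + c = n" "n = n \<longrightarrow> c = 1 \<and> (\<exists>R. hub P (set es) {..<n} R)"
          using sc[unfolded s' scan_inv_def prod.case] by blast
        then obtain R' where "hub P (set es) {..<n} R'" by blast
        then show ?thesis unfolding s' by (rule Q[rotated 5]) (use q v1(2) in auto)
      qed
    next
      fix i v' a' k' assume i: "i < n" and "scan_inv n P xs a k1 i (v', a', k')"
      then obtain t b R es where q: "v' 0 = real n" "v' 32 = real i" "v' 3 = real t" "\<forall>q<11. a' q = a q" "degs n es a'" "edges_ok n es"
        "k' + 4 * t \<le> k1 + 5 * i" "length es + t = i" "i < n \<longrightarrow> b t = i \<and> stk P xs (set es) t b R a' \<and> reps n t R a'"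
        unfolding scan_inv_def prod.case by blast
      have st: "b t = i" "stk P xs (set es) t b R a'" "reps n t R a'" using q(9) i by blast+
      have tL: "t < L" "i < L" using q(8) i c(4) by simp_all
      define x where "x = xs ! i"
      have xn: "x < n" unfolding x_def by (rule zs_less[OF z i])
      define b1 where "b1 = a'(11 := (a' 11)(real t := real x))"
      define b2 where "b2 = b1(12 := (b1 12)(real t := real x))"
      define b3 where "b3 = b2(13 := (b2 13)(real t := real x))"
      define a2 where "a2 = b3(14 := (b3 14)(real t := real x))"
      note a2_defs = a2_def b3_def b2_def b1_def
      have a2q: "a2 q = a' q" if "q < 11 \<or> 14 < q" for q using that by (auto simp: a2_defs)
      have a2: "\<forall>q<11. a2 q = a q" "degs n es a2" using q a2q by (simp_all add: degs_def)
      have c2: "coords n P cx cy a2" using c(1,6,7) a2(1) by (simp add: coords_def)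
      have st2: "stk P xs (set es) t b R a2" by (rule stk_cong[OF st(2)]) (simp add: a2q)
      have r2: "reps n (Suc t) (R(t := \<lambda>_. xs ! i)) a2"
        using st(3) xn by (simp add: reps_def less4_cases a2_defs less_Suc_eq x_def)
      have o2: "a2 10 (real j) = real (xs ! j)" if "j < n" for j using o that a2(1) by simp
      have o1: "a 10 (real i) = real x" using o i by (simp add: x_def)
      note tail = hwp_scan_tail[OF c2 c(2,3) nL c(5-7) z i a2(1) st(1) st2 r2 a2(2) q(6,8)]
      have k2: "Suc k' + 4 * t \<le> k1 + 5 * i + 1" using q(7) by simp
      show "hwp L 19 (As 2 (A (C 10) (V 32)) ;;
        St (C 11) (V 3) (V 2) ;; St (C 12) (V 3) (V 2) ;; St (C 13) (V 3) (V 2) ;; St (C 14) (V 3) (V 2) ;;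
        Cd (Lt (V 32 \<oplus> C 1) (V 0)) (As 10 (V 2) ;; As 11 (A (C 10) (V 32 \<oplus> C 1)) ;; sepc cx cy ;; As 4 (V 14))
          (As 4 (A (C 15) (C 0) \<oplus> C 1)) ;;
        topflag ;; Wh (Lt (C 0) (V 19)) (mergeP cx cy) ;;
        St (C 15) (V 3) (V 4) ;; As 3 (V 3 \<oplus> C 1) ;; As 32 (V 32 \<oplus> C 1)) (v', a', Suc k') (scan_inv n P xs a k1 (Suc i))"
        apply (rule hwp_asq[where z = "real x"], simp add: q tL, simp add: q o1)
        apply (rule hwp_stq[where zp = 11 and zi = "real t" and ze = "real x"])
                apply (simp_all add: q tL)[8]
        apply (fold b1_def)
        apply (rule hwp_stq[where zp = 12 and zi = "real t" and ze = "real x"])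
                apply (simp_all add: q tL)[8]
        apply (fold b2_def)
        apply (rule hwp_stq[where zp = 13 and zi = "real t" and ze = "real x"])
                apply (simp_all add: q tL)[8]
        apply (fold b3_def)
        apply (rule hwp_stq[where zp = 14 and zi = "real t" and ze = "real x"])
                apply (simp_all add: q tL)[8]
        apply (fold a2_def)
        apply (rule hwp_seq)
      proof (rule hwp_cd)
        let ?w = "v'(2 := real x)"
        assume "tv (Lt (V 32 \<oplus> C 1) (V 0)) ?w a2"
        then have si: "Suc i < n" using q by simp
        have sL: "Suc i < L" using si c(4) by simp
        have xn': "xs ! Suc i < n" by (rule zs_less[OF z si])
        show "hwp L 19 (As 10 (V 2) ;; As 11 (A (C 10) (V 32 \<oplus> C 1)) ;; sepc cx cy ;; As 4 (V 14)) (?w, a2, Suc k')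
          (\<lambda>s. hwp L 19 (topflag ;; Wh (Lt (C 0) (V 19)) (mergeP cx cy) ;;
            St (C 15) (V 3) (V 4) ;; As 3 (V 3 \<oplus> C 1) ;; As 32 (V 32 \<oplus> C 1)) s (scan_inv n P xs a k1 (Suc i)))"
          apply (rule hwp_asq[where z = "real x"], simp, simp)
          apply (rule hwp_asq[where z = "real (xs ! Suc i)"], simp add: q sL)
          subgoal using o2[OF si] by (simp add: q add.commute)
          apply (rule hwp_seq, rule hwp_sepc[OF c2 c(2,3) nL xn xn'], simp, simp)
          apply (rule hwp_as, simp, rule refl)
          apply (rule tail[OF _ _ _ _ k2])
               apply (use si in \<open>simp_all add: q x_def adj_def\<close>)
          done
      next
        let ?w = "v'(2 := real x)"
        assume "\<not> tv (Lt (V 32 \<oplus> C 1) (V 0)) ?w a2"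
        then have si: "Suc i = n" using q i by simp
        show "hwp L 19 (As 4 (A (C 15) (C 0) \<oplus> C 1)) (?w, a2, Suc k')
          (\<lambda>s. hwp L 19 (topflag ;; Wh (Lt (C 0) (V 19)) (mergeP cx cy) ;;
            St (C 15) (V 3) (V 4) ;; As 3 (V 3 \<oplus> C 1) ;; As 32 (V 32 \<oplus> C 1)) s (scan_inv n P xs a k1 (Suc i)))"
          apply (rule hwp_as[where z = "a2 15 0 + 1"], use tL in simp, simp)
          apply (rule tail[OF _ _ _ _ k2])
               apply (use si in \<open>simp_all add: q x_def\<close>)
          done
      qed (simp add: q)
    qed
  qed
qed

section \<open>Rooting a tree by stripping leaves\<close>

abbreviation und :: "nat \<times> nat \<Rightarrow> nat set" where "und e \<equiv> {fst e, snd e}"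

lemma edges_ok_Cons [simp]: "edges_ok n (e # es) \<longleftrightarrow> fst e < n \<and> snd e < n \<and> fst e \<noteq> snd e \<and> edges_ok n es"
  by (auto simp: edges_ok_def)

lemma dg_zero: "dg F v = 0 \<Longrightarrow> sm F v = 0 \<and> (v, x) \<notin> set F \<and> (x, v) \<notin> set F"
  by (induction F) (auto split: if_splits)

lemma sum_dg: "edges_ok n F \<Longrightarrow> (\<Sum>u<n. dg F u) = 2 * length F"
proof (induction F)
  case (Cons e F)
  then show ?case by (simp add: sum.distrib)
qed simp

text \<open>No edge at \<open>v\<close> is left in \<open>F'\<close>, so the stored sum of the
  neighbours of a leaf is the neighbour itself; this is how the program finds
  \<open>w\<close>.\<close>

lemma leaf_edge:
  assumes "edges_ok n F" "dg F v = 1"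
  shows "\<exists>w F'. w < n \<and> w \<noteq> v \<and> v < n \<and> edges_ok n F' \<and> length F = Suc (length F') \<and>
    (\<forall>u. dg F u = dg F' u + (if u = v then 1 else 0) + (if u = w then 1 else 0)) \<and>
    (\<forall>u. sm F u = sm F' u + (if u = v then w else 0) + (if u = w then v else 0)) \<and>
    und ` set F = insert {v, w} (und ` set F') \<and> set F \<subseteq> insert (v, w) (insert (w, v) (set F'))"
  using assms
proof (induction F)
  case (Cons e F)
  show ?case
  proof (cases "dg F v = 1")
    case True
    then obtain w F' where i: "w < n" "w \<noteq> v" "v < n" "edges_ok n F'" "length F = Suc (length F')"
      "\<forall>u. dg F u = dg F' u + (if u = v then 1 else 0) + (if u = w then 1 else 0)"
      "\<forall>u. sm F u = sm F' u + (if u = v then w else 0) + (if u = w then v else 0)"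
      "und ` set F = insert {v, w} (und ` set F')" "set F \<subseteq> insert (v, w) (insert (w, v) (set F'))"
      using Cons by auto
    show ?thesis
    proof (rule exI[of _ w], rule exI[of _ "e # F'"], intro conjI)
      show "edges_ok n (e # F')" using i(4) Cons.prems(1) by simp
      show "\<forall>u. dg (e # F) u = dg (e # F') u + (if u = v then 1 else 0) + (if u = w then 1 else 0)"
        "\<forall>u. sm (e # F) u = sm (e # F') u + (if u = v then w else 0) + (if u = w then v else 0)" using i(6,7) by simp_all
      show "und ` set (e # F) = insert {v, w} (und ` set (e # F'))" unfolding list.set image_insert i(8) by (rule insert_commute)
      show "set (e # F) \<subseteq> insert (v, w) (insert (w, v) (set (e # F')))" using i(9) by auto
    qed (use i(1-3,5) in simp_all)
  next
    case False
    then have z: "dg F v = 0" "fst e = v \<or> snd e = v" using Cons.prems by (auto split: if_splits)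
    define w where "w = (if fst e = v then snd e else fst e)"
    have e: "e = (v, w) \<or> e = (w, v)" "w \<noteq> v" using z(2) Cons.prems(1) by (cases e; auto simp: w_def)+
    show ?thesis
    proof (rule exI[of _ w], rule exI[of _ F], intro conjI)
      show "w < n" "v < n" using e Cons.prems(1) by auto
      show "edges_ok n F" using Cons.prems(1) by simp
      show "\<forall>u. dg (e # F) u = dg F u + (if u = v then 1 else 0) + (if u = w then 1 else 0)"
        "\<forall>u. sm (e # F) u = sm F u + (if u = v then w else 0) + (if u = w then v else 0)" using e by (elim disjE; simp)+
      show "und ` set (e # F) = insert {v, w} (und ` set F)" using e(1) by (elim disjE) (simp_all add: insert_commute)
      show "set (e # F) \<subseteq> insert (v, w) (insert (w, v) (set F))" using e(1) by auto
    qed (use e(2) in simp_all)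
  qed
qed simp

text \<open>Each edge leads from a stripped vertex to one that is stripped later or never. List
  positions can therefore serve as labels that increase towards the root.\<close>

definition porder :: "nat \<Rightarrow> (nat \<times> nat) list \<Rightarrow> bool" where
  "porder n xs \<longleftrightarrow> distinct (map fst xs) \<and> edges_ok n xs \<and> (\<forall>j<length xs. snd (xs ! j) \<notin> fst ` set (take (Suc j) xs))"

text \<open>\<open>F\<close> are the remaining edges, and \<open>xs\<close> lists the removed leaves with their neighbours.\<close>

definition strip :: "nat \<Rightarrow> nat set set \<Rightarrow> (nat \<times> nat) list \<Rightarrow> (nat \<times> nat) list \<Rightarrow> bool" where
  "strip n S F xs \<longleftrightarrow> edges_ok n F \<and> porder n xs \<and> und ` (set F \<union> set xs) = S \<and> length F + length xs + 1 = n \<and>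
    (\<forall>v\<in>fst ` set xs. dg F v = 0) \<and>
    (\<forall>x y. x < n \<and> y < n \<and> x \<notin> fst ` set xs \<and> y \<notin> fst ` set xs \<longrightarrow> (x, y) \<in> (set F \<union> (set F)\<inverse>)\<^sup>*)"

lemma strip_step:
  assumes s: "strip n S F xs" and v: "dg F v = 1"
  shows "\<exists>w F'. w < n \<and> w \<noteq> v \<and> v < n \<and> strip n S F' (xs @ [(v, w)]) \<and> v \<notin> fst ` set xs \<and>
    (\<forall>u. dg F u = dg F' u + (if u = v then 1 else 0) + (if u = w then 1 else 0)) \<and>
    (\<forall>u. sm F u = sm F' u + (if u = v then w else 0) + (if u = w then v else 0))"
proof -
  note S = s[unfolded strip_def]
  have eF: "edges_ok n F" using S by blast
  obtain w F' where A: "w < n \<and> w \<noteq> v \<and> v < n \<and> edges_ok n F' \<and> length F = Suc (length F') \<and>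
    (\<forall>u. dg F u = dg F' u + (if u = v then 1 else 0) + (if u = w then 1 else 0)) \<and>
    (\<forall>u. sm F u = sm F' u + (if u = v then w else 0) + (if u = w then v else 0)) \<and>
    und ` set F = insert {v, w} (und ` set F') \<and> set F \<subseteq> insert (v, w) (insert (w, v) (set F'))"
    using leaf_edge[OF eF v] by (elim exE) (rule that)
  have i1: "w < n" using A by (elim conjE)
  have i2: "w \<noteq> v" using A by (elim conjE)
  have i3: "v < n" using A by (elim conjE)
  have i4: "edges_ok n F'" using A by (elim conjE)
  have i5: "length F = Suc (length F')" using A by (elim conjE)
  have d': "\<forall>u. dg F u = dg F' u + (if u = v then 1 else 0) + (if u = w then 1 else 0)" using A by (elim conjE)
  have m': "\<forall>u. sm F u = sm F' u + (if u = v then w else 0) + (if u = w then v else 0)" using A by (elim conjE)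
  have u1: "und ` set F = insert {v, w} (und ` set F')" using A by (elim conjE)
  have u2: "set F \<subseteq> insert (v, w) (insert (w, v) (set F'))" using A by (elim conjE)
  note i = i1 i2 i3 i4 i5 and u = u1 u2
  note d = d'[THEN spec] and m = m'[THEN spec]
  let ?O = "xs @ [(v, w)]" and ?E' = "set F' \<union> (set F')\<inverse>"
  have z0: "\<forall>v\<in>fst ` set xs. dg F v = 0" using S by (elim conjE)
  have conn0: "\<forall>x y. x < n \<and> y < n \<and> x \<notin> fst ` set xs \<and> y \<notin> fst ` set xs \<longrightarrow> (x, y) \<in> (set F \<union> (set F)\<inverse>)\<^sup>*"
    using S by (elim conjE)
  have z: "dg F u = 0" if "u \<in> fst ` set xs" for u by (rule bspec[OF z0 that])
  have vw: "v \<notin> fst ` set xs" "w \<notin> fst ` set xs"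
  proof -
    have "dg F v \<noteq> 0" "dg F w \<noteq> 0" using v d[of w] by simp_all
    then show "v \<notin> fst ` set xs" "w \<notin> fst ` set xs" using z[of v] z[of w] by argo+
  qed
  have v0: "dg F' v = 0" using v d[of v] i(2) by simp
  note v0' = dg_zero[OF v0]
  have po0: "porder n xs" using S by (elim conjE)
  have po: "distinct (map fst xs)" "edges_ok n xs" "\<And>j. j < length xs \<Longrightarrow> snd (xs ! j) \<notin> fst ` set (take (Suc j) xs)"
    using po0 unfolding porder_def by blast+
  have p': "porder n ?O"
    unfolding porder_def
  proof (intro conjI allI impI)
    show "distinct (map fst ?O)" using po(1) vw(1) by simp
    show "edges_ok n ?O" using po(2) i by (simp add: edges_ok_def)
    fix j assume j: "j < length ?O"
    show "snd (?O ! j) \<notin> fst ` set (take (Suc j) ?O)"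
    proof (cases "j < length xs")
      case True
      then show ?thesis using po(3)[OF True] by (simp add: nth_append)
    next
      case False
      then have "j = length xs" using j by simp
      then show ?thesis using vw i(2) by auto
    qed
  qed
  have reach: "(x, y) \<in> ?E'\<^sup>*" if xy: "(x, y) \<in> (set F \<union> (set F)\<inverse>)\<^sup>*" "x \<noteq> v" "y \<noteq> v" for x y
  proof -
    \<comment> \<open>\<open>v\<close> has no neighbour but \<open>w\<close>, so a visit to
      \<open>v\<close> can be replaced by staying at \<open>w\<close>.\<close>
    have "(x, if y = v then w else y) \<in> ?E'\<^sup>*"
      using xy(1)
    proof (induction rule: rtrancl_induct)
      case base
      then show ?case using xy(2) by simp
    next
      case (step y z)
      have "(y, z) \<in> ?E' \<or> y = v \<and> z = w \<or> y = w \<and> z = v" 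
      proof -
        have "(y, z) \<in> set F \<or> (z, y) \<in> set F" using step(2) by simp
        then show ?thesis using subsetD[OF u(2), of "(y, z)"] subsetD[OF u(2), of "(z, y)"] by auto
      qed
      then show ?case
      proof (elim disjE)
        assume e: "(y, z) \<in> ?E'"
        then have "y \<noteq> v" "z \<noteq> v" using v0'[of y] v0'[of z] by blast+
        have "(x, y) \<in> ?E'\<^sup>*" using step(3) \<open>y \<noteq> v\<close> by simp
        then have "(x, z) \<in> ?E'\<^sup>*" using e by (rule rtrancl.rtrancl_into_rtrancl)
        then show ?thesis using \<open>z \<noteq> v\<close> by simp
      qed (use step(3) i(2) in simp_all)
    qed
    then show ?thesis using xy(3) by simp
  qed
  have S': "strip n S F' ?O"
    unfolding strip_def
  proof (intro conjI)
    show "edges_ok n F'" "porder n ?O" by fact+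
    have "und ` (set F' \<union> set ?O) = insert {v, w} (und ` set F') \<union> und ` set xs" by (simp add: image_Un)
    also have "\<dots> = und ` (set F \<union> set xs)" unfolding u(1)[symmetric] image_Un ..
    finally show "und ` (set F' \<union> set ?O) = S" using S by simp
    show "length F' + length ?O + 1 = n" using S i(5) by simp
    have "dg F' u = 0" if "u \<in> fst ` set xs" for u using z[OF that] d[of u] by simp
    then show "\<forall>u\<in>fst ` set ?O. dg F' u = 0" using v0 by simp
    show "\<forall>x y. x < n \<and> y < n \<and> x \<notin> fst ` set ?O \<and> y \<notin> fst ` set ?O \<longrightarrow> (x, y) \<in> ?E'\<^sup>*"
    proof (intro allI impI)
      fix x y assume xy: "x < n \<and> y < n \<and> x \<notin> fst ` set ?O \<and> y \<notin> fst ` set ?O"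
      then have "x < n \<and> y < n \<and> x \<notin> fst ` set xs \<and> y \<notin> fst ` set xs" by auto
      then have "(x, y) \<in> (set F \<union> (set F)\<inverse>)\<^sup>*" by (rule conn0[THEN spec, THEN spec, THEN mp])
      then show "(x, y) \<in> ?E'\<^sup>*" by (rule reach) (use xy in auto)
    qed
  qed
  show ?thesis by (intro exI[of _ w] exI[of _ F'] conjI allI i(1-3) S' vw(1) d m)
qed

lemma strip_final: "strip n S [] xs \<Longrightarrow> length xs + 1 = n \<and> edges_ok n xs \<and> distinct (map fst xs) \<and>
    (\<forall>j<length xs. snd (xs ! j) \<notin> fst ` set (take (Suc j) xs))"
  unfolding strip_def porder_def list.size add_0 by (elim conjE, intro conjI)

lemma strip_length: "strip n S F xs \<Longrightarrow> length xs \<le> n"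
  by (simp only: strip_def) linarith

text \<open>Otherwise every vertex that is left would have degree at least two, which takes too many edges.\<close>

lemma strip_done:
  assumes s: "strip n S F xs" and no: "\<And>u. u < n \<Longrightarrow> dg F u \<noteq> 1"
  shows "F = []"
proof (rule ccontr)
  assume "F \<noteq> []"
  then obtain e where e: "e \<in> set F" by (cases F) auto
  note S = s[unfolded strip_def]
  have eF: "edges_ok n F" using S by blast
  let ?U = "{..<n} - fst ` set xs"
  have ends: "fst e \<in> ?U" "snd e \<in> ?U" "fst e \<noteq> snd e"
  proof -
    have nz: "dg F (fst e) \<noteq> 0" "dg F (snd e) \<noteq> 0" using dg_zero[of F] e by (metis prod.collapse)+
    show "fst e \<in> ?U" "snd e \<in> ?U" "fst e \<noteq> snd e" using nz e eF S by (auto simp: edges_ok_def)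
  qed
  have two: "2 \<le> dg F u" if u: "u \<in> ?U" for u
  proof -
    \<comment> \<open>Another vertex is left, so connectedness gives \<open>u\<close> an edge; as
      degree one is excluded, there are at least two.\<close>
    obtain z where z: "z \<in> ?U" "z \<noteq> u" using ends by metis
    have "(u, z) \<in> (set F \<union> (set F)\<inverse>)\<^sup>*" using S u z(1) by auto
    then obtain u' where "(u, u') \<in> set F \<union> (set F)\<inverse>" using z(2) by (metis converse_rtranclE)
    then have "dg F u \<noteq> 0" using dg_zero[of F u u'] by auto
    then show ?thesis using no[of u] u by simp
  qed
  have "card (fst ` set xs) = length xs"
    using S unfolding porder_def by (metis distinct_card length_map set_map)
  moreover have "fst ` set xs \<subseteq> {..<n}" using S by (auto simp: porder_def edges_ok_def)
  ultimately have U: "card ?U = n - length xs" by (simp add: card_Diff_subset)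
  have "2 * card ?U = (\<Sum>u\<in>?U. 2)" by simp
  also have "\<dots> \<le> (\<Sum>u\<in>?U. dg F u)" by (rule sum_mono) (rule two)
  also have "\<dots> \<le> (\<Sum>u<n. dg F u)" by (rule sum_mono2) auto
  also have "\<dots> = 2 * length F" by (rule sum_dg[OF eF])
  finally show False using U S by linarith
qed

section \<open>The stripping program\<close>

lemma ix_odd: "ix L (2 * real i + 1) \<longleftrightarrow> 2 * i + 1 < L"
  using ix_of_nat[of L "2 * i + 1"] by (simp only: of_nat_add of_nat_mult of_nat_numeral of_nat_1)

text \<open>Array \<open>e\<close> has the output format of a tree, and the label of a vertex is the
  position of its own edge. The parent of a vertex labelled \<open>j\<close> is then found in cell
  \<open>2 * j + 1\<close>, without a separate array of parents. The vertex that is never stripped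
  keeps the label \<open>n\<close>.\<close>

definition stored :: "nat \<Rightarrow> (nat \<times> nat) list \<Rightarrow> int \<Rightarrow> int \<Rightarrow> arrs \<Rightarrow> bool" where
  "stored n xs e l a \<longleftrightarrow> (\<forall>j<length xs. a (of_int e) (real (2 * j)) = real (fst (xs ! j)) \<and>
      a (of_int e) (real (2 * j + 1)) = real (snd (xs ! j)) \<and> a (of_int l) (real (fst (xs ! j))) = real j) \<and>
    (\<forall>u<n. u \<notin> fst ` set xs \<longrightarrow> a (of_int l) (real u) = real n)"

definition pluckP :: "int \<Rightarrow> int \<Rightarrow> hcom" where "pluckP e l =
  As 3 (A (C 18) (V 2)) ;; St (C e) (C 2 \<otimes> V 4) (V 2) ;; St (C e) (C 2 \<otimes> V 4 \<oplus> C 1) (V 3) ;; St (C l) (V 2) (V 4) ;;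
  As 4 (V 4 \<oplus> C 1) ;; St (C 17) (V 2) (C 0) ;; St (C 18) (V 2) (C 0) ;;
  St (C 17) (V 3) (A (C 17) (V 3) \<ominus> C 1) ;; St (C 18) (V 3) (A (C 18) (V 3) \<ominus> V 2) ;; As 2 (V 3)"

text \<open>Removing a leaf can turn only its neighbour into a leaf. Following this chain at once
  replaces a queue: among the vertices already passed, only the current end of the chain can be a
  leaf.\<close>

definition stripP :: "int \<Rightarrow> int \<Rightarrow> hcom" where "stripP e l =
  As 32 (C 0) ;; Wh (Lt (V 32) (V 0)) (St (C l) (V 32) (V 0) ;; As 32 (V 32 \<oplus> C 1)) ;;
  As 32 (C 0) ;; As 4 (C 0) ;;
  Wh (Lt (V 32) (V 0)) (As 2 (V 32) ;; Wh (Eq (A (C 17) (V 2)) (C 1)) (pluckP e l) ;; As 32 (V 32 \<oplus> C 1))"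

lemma hwp_pluckP:
  assumes p: "ix 19 (of_int e)" "ix 19 (of_int l)" "e \<noteq> l" "e < 17" "l < 17" and n: "2 * n \<le> L"
    and s: "strip n S F xs" and v: "dg F u = 1" "v 2 = real u" "v 4 = real (length xs)"
    and a: "degs n F a" "stored n xs e l a"
    and Q: "\<And>v' a' w F'. strip n S F' (xs @ [(u, w)]) \<Longrightarrow> w < n \<Longrightarrow> (\<And>x. x \<noteq> w \<Longrightarrow> x \<noteq> u \<Longrightarrow> dg F' x = dg F x) \<Longrightarrow> dg F' u = 0 \<Longrightarrow>
      degs n F' a' \<Longrightarrow> stored n (xs @ [(u, w)]) e l a' \<Longrightarrow> v' 2 = real w \<Longrightarrow> v' 4 = real (Suc (length xs)) \<Longrightarrow>
      (\<And>i. i \<notin> {2, 3, 4} \<Longrightarrow> v' i = v i) \<Longrightarrow> (\<And>q. q < 17 \<Longrightarrow> q \<noteq> of_int e \<Longrightarrow> q \<noteq> of_int l \<Longrightarrow> a' q = a q) \<Longrightarrow> Q (v', a', k)"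
  shows "hwp L 19 (pluckP e l) (v, a, k) Q"
proof -
  obtain w F' where w: "w < n" "w \<noteq> u" "u < n" "strip n S F' (xs @ [(u, w)])" "u \<notin> fst ` set xs"
    and d: "\<And>x. dg F x = dg F' x + (if x = u then 1 else 0) + (if x = w then 1 else 0)"
    and m: "\<And>x. sm F x = sm F' x + (if x = u then w else 0) + (if x = w then u else 0)"
    using strip_step[OF s v(1)] by blast
  let ?c = "length xs"
  have len: "length F' + Suc ?c + 1 = n" using w(4) by (simp add: strip_def)
  then have cL: "2 * ?c + 1 < L" "2 * ?c < L" "u < L" "w < L" using n w by simp_all
  have u0: "dg F' u = 0" "sm F' u = 0" using d[of u] v(1) w(2) dg_zero[of F' u] by simp_all
  have D: "a 17 (real x) = real (dg F x)" "a 18 (real x) = real (sm F x)" if "x < n" for x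
    using a(1) that by (auto simp: degs_def)
  have Du: "a 18 (real u) = real w" using D(2)[OF w(3)] m[of u] u0 w(2) by simp
  have Dw: "a 17 (real w) - 1 = real (dg F' w)" "a 18 (real w) - real u = real (sm F' w)"
    using D[OF w(1)] d[of w] m[of w] w(2) by simp_all
  have ne: "real_of_int e \<noteq> 17" "real_of_int e \<noteq> 18" "real_of_int l \<noteq> 17" "real_of_int l \<noteq> 18" "real_of_int e \<noteq> real_of_int l"
    using p by simp_all
  note ne = ne ne[symmetric]
  define a1 where "a1 = a(of_int e := (a (of_int e))(real (2 * ?c) := real u, real (2 * ?c + 1) := real w),
    of_int l := (a (of_int l))(real u := real ?c))"
  define a2 where "a2 = a1(17 := (a 17)(real u := 0, real w := real (dg F' w)),
    18 := (a 18)(real u := 0, real w := real (sm F' w)))"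
  have deg2: "degs n F' a2"
    unfolding degs_def
  proof (intro allI impI)
    fix x assume "x < n"
    then show "a2 17 (real x) = real (dg F' x) \<and> a2 18 (real x) = real (sm F' x)"
      using D[of x] d[of x] m[of x] u0 w(2) by (simp add: a2_def)
  qed
  have st2: "stored n (xs @ [(u, w)]) e l a2"
    unfolding stored_def
  proof (intro conjI allI impI)
    have ev: "a2 (of_int e) = (a (of_int e))(real (2 * ?c) := real u, real (2 * ?c + 1) := real w)"
      "a2 (of_int l) = (a (of_int l))(real u := real ?c)" using ne by (simp_all add: a2_def a1_def)
    fix j assume j: "j < length (xs @ [(u, w)])"
    have "a2 (of_int e) (real (2 * j)) = real (fst ((xs @ [(u, w)]) ! j)) \<and>
      a2 (of_int e) (real (2 * j + 1)) = real (snd ((xs @ [(u, w)]) ! j)) \<and>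
      a2 (of_int l) (real (fst ((xs @ [(u, w)]) ! j))) = real j"
    proof (cases "j < ?c")
      case True
      have o: "a (of_int e) (real (2 * j)) = real (fst (xs ! j))" "a (of_int e) (real (2 * j + 1)) = real (snd (xs ! j))"
        "a (of_int l) (real (fst (xs ! j))) = real j" using a(2) True unfolding stored_def by blast+
      have f: "fst (xs ! j) \<noteq> u" using w(5) nth_mem[OF True] by blast
      have k: "2 * j \<noteq> 2 * ?c + 1" "2 * j + 1 \<noteq> 2 * ?c" by presburger+
      have "real (2 * j) \<noteq> real (2 * ?c)" "real (2 * j) \<noteq> real (2 * ?c + 1)" "real (2 * j + 1) \<noteq> real (2 * ?c)"
        "real (2 * j + 1) \<noteq> real (2 * ?c + 1)" using True k unfolding of_nat_eq_iff by simp_all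
      moreover have "(xs @ [(u, w)]) ! j = xs ! j" using True by (simp add: nth_append)
      moreover have "real (fst (xs ! j)) \<noteq> real u" using f by simp
      ultimately show ?thesis unfolding ev by (simp only: fun_upd_apply if_False o simp_thms)
    next
      case False
      then have jc: "j = ?c" using j by simp
      have "real (2 * ?c) \<noteq> real (2 * ?c + 1)" unfolding of_nat_eq_iff by simp
      moreover have "(xs @ [(u, w)]) ! j = (u, w)" using jc by simp
      ultimately show ?thesis unfolding ev jc by (simp only: fun_upd_apply if_False if_True simp_thms fst_conv snd_conv jc refl)
    qed
    then show "a2 (of_int e) (real (2 * j)) = real (fst ((xs @ [(u, w)]) ! j))"
      "a2 (of_int e) (real (2 * j + 1)) = real (snd ((xs @ [(u, w)]) ! j))"
      "a2 (of_int l) (real (fst ((xs @ [(u, w)]) ! j))) = real j" by blast+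
  next
    fix x assume x: "x < n" "x \<notin> fst ` set (xs @ [(u, w)])"
    then have "a (of_int l) (real x) = real n" using a(2) by (simp add: stored_def)
    then show "a2 (of_int l) (real x) = real n" using x ne by (simp add: a2_def a1_def)
  qed
  show ?thesis
    unfolding pluckP_def
    apply (rule hwp_asq[where z = "real w"], use cL in \<open>simp add: v\<close>, simp add: v Du)
    apply (rule hwp_stq[where zp = "of_int e" and zi = "real (2 * ?c)" and ze = "real u"])
            apply (simp_all add: v p cL)[7]
     apply (rule iffD2[OF ix_of_nat cL(2)])
    apply (rule hwp_stq[where zp = "of_int e" and zi = "real (2 * ?c + 1)" and ze = "real w"])
            apply (simp_all add: v p cL)[7]
     apply (rule iffD2[OF ix_of_nat cL(1)])
    apply (rule hwp_stq[where zp = "of_int l" and zi = "real u" and ze = "real ?c"])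
            apply (simp_all add: v p cL)[8]
    apply (rule hwp_asq[where z = "real (Suc ?c)"], simp, simp add: v)
    apply (rule hwp_stq[where zp = 17 and zi = "real u" and ze = 0])
            apply (simp_all add: v p cL)[8]
    apply (rule hwp_stq[where zp = 18 and zi = "real u" and ze = 0])
            apply (simp_all add: v p cL)[8]
    apply (rule hwp_stq[where zp = 17 and zi = "real w" and ze = "real (dg F' w)"])
            apply (simp_all add: v p cL ne w(2) Dw)[8]
    apply (rule hwp_stq[where zp = 18 and zi = "real w" and ze = "real (sm F' w)"])
            apply (simp_all add: v p cL ne w(2) Dw)[8]
    apply (rule hwp_as[where z = "real w"], simp, simp)
    apply (rule subst[where P = "\<lambda>x. Q (_, x, _)", rotated])
     apply (rule Q[OF w(4,1) _ u0(1) deg2 st2])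
        apply (simp add: d)
       apply simp
      apply simp
     apply simp
    subgoal for q using ne by (simp add: a2_def a1_def)
    using ne w(2) apply (simp add: a2_def a1_def fun_eq_iff)
    done
qed

text \<open>\<open>u\<close> is the only vertex below \<open>i\<close> that may be a leaf, and
  \<open>u = n\<close> stands for none. Iterations are charged to visited vertices and to stripped
  ones.\<close>

definition strip_inv :: "nat \<Rightarrow> nat set set \<Rightarrow> int \<Rightarrow> int \<Rightarrow> arrs \<Rightarrow> nat \<Rightarrow> nat \<Rightarrow> nat \<Rightarrow> (nat \<times> nat) list \<Rightarrow> (nat \<times> nat) list \<Rightarrow> vars \<Rightarrow> arrs \<Rightarrow> nat \<Rightarrow> bool" where
  "strip_inv n S e l a0 k0 u i F xs v a k \<longleftrightarrow> v 0 = real n \<and> v 32 = real i \<and> v 4 = real (length xs) \<and>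
     strip n S F xs \<and> degs n F a \<and> stored n xs e l a \<and> (\<forall>q<17. q \<noteq> of_int e \<and> q \<noteq> of_int l \<longrightarrow> a q = a0 q) \<and>
     (\<forall>x<i. x \<noteq> u \<longrightarrow> dg F x \<noteq> 1) \<and> k \<le> k0 + i + length xs"

lemma strip_inv_time: "strip_inv n S e l a0 k0 u i F xs v a k \<Longrightarrow> k \<le> k0 + i + n"
  unfolding strip_inv_def using strip_length[of n S F xs] by linarith

lemma hwp_stripP:
  assumes p: "ix 19 (of_int e)" "ix 19 (of_int l)" "e \<noteq> l" "e < 17" "l < 17" and n: "2 * n \<le> L" "v 0 = real n"
    and s: "strip n S F []" and a: "degs n F a"
    and Q: "\<And>v' a' k' xs. v' 0 = real n \<Longrightarrow> strip n S [] xs \<Longrightarrow> stored n xs e l a' \<Longrightarrow>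
      (\<forall>q<17. q \<noteq> of_int e \<and> q \<noteq> of_int l \<longrightarrow> a' q = a q) \<Longrightarrow> k' \<le> k + 3 * n \<Longrightarrow> Q (v', a', k')"
  shows "hwp L 19 (stripP e l) (v, a, k) Q"
proof -
  have ne: "real_of_int e \<noteq> 17" "real_of_int e \<noteq> 18" "real_of_int l \<noteq> 17" "real_of_int l \<noteq> 18" "real_of_int e \<noteq> real_of_int l"
    using p by simp_all
  define Z where "Z i = (\<lambda>(v' :: vars, a' :: arrs, k' :: nat). v' 0 = real n \<and> v' 32 = real i \<and> k' = k + i \<and> (\<forall>q. q \<noteq> of_int l \<longrightarrow> a' q = a q) \<and>
    (\<forall>u<i. a' (of_int l) (real u) = real n))" for i and k' :: nat and v' :: vars and a' :: arrs
  have iL: "i < L" if "i < n" for i using that n by simp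
  show ?thesis
    unfolding stripP_def
  proof (rule hwp_asq[where z = 0], simp, simp, rule hwp_seq, rule hwp_for[where n = n and Inv = Z and B = "k + n"])
    show "Z 0 (v(32 := 0), a, k)" using n by (simp add: Z_def)
    show "hwp L 19 (St (C l) (V 32) (V 0) ;; As 32 (V 32 \<oplus> C 1)) (v', a', Suc k') (Z (Suc i))"
      if "i < n" "Z i (v', a', k')" for i v' a' k'
      using that iL[OF that(1)] p by (auto simp: Z_def less_Suc_eq)
    show "v' 32 = real i \<and> v' 0 = real n \<and> k' \<le> k + n" if "i \<le> n" "Z i (v', a', k')" for i v' a' k'
      using that by (auto simp: Z_def)
  next
    fix s1 assume s1: "Z n s1"
    obtain v1 a1 k1 where e1: "s1 = (v1, a1, k1)" by (cases s1) auto
    have v1: "v1 0 = real n" "k1 = k + n" "\<forall>q. q \<noteq> of_int l \<longrightarrow> a1 q = a q" "\<forall>u<n. a1 (of_int l) (real u) = real n"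
      using s1 by (simp_all add: Z_def e1)
    have a1: "degs n F a1" "stored n [] e l a1" using a v1 ne by (simp_all add: degs_def stored_def)
    let ?Inv = "\<lambda>i (v', a', k'). \<exists>F xs. strip_inv n S e l a1 k1 n i F xs v' a' k'"
    \<comment> \<open>During the inner loop vertex \<open>i\<close> already counts as visited,
      although register 32 is not advanced yet; hence the updated register inside
      \<open>strip_inv\<close>.\<close>
    let ?J = "\<lambda>i (v', a', k'). \<exists>u F xs. u < n \<and> v' 2 = real u \<and> strip_inv n S e l a1 k1 u (Suc i) F xs (v'(32 := real (Suc i))) a' k' \<and> v' 32 = real i"
    show "hwp L 19 (As 32 (C 0) ;; As 4 (C 0) ;;
      Wh (Lt (V 32) (V 0)) (As 2 (V 32) ;; Wh (Eq (A (C 17) (V 2)) (C 1)) (pluckP e l) ;; As 32 (V 32 \<oplus> C 1))) s1 Q"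
      unfolding e1
    proof (rule hwp_asq[where z = 0], simp, simp, rule hwp_asq[where z = 0], simp, simp,
        rule hwp_for[where n = n and Inv = ?Inv and B = "k1 + 2 * n"])
      have "strip_inv n S e l a1 k1 n 0 F [] (v1(32 := 0, 4 := 0)) a1 k1" using s v1 a1 by (simp add: strip_inv_def)
      then show "?Inv 0 (v1(32 := 0, 4 := 0), a1, k1)" by blast
    next
      fix i :: nat and v' :: vars and a' :: arrs and k' :: nat
      assume i: "i \<le> n" and "?Inv i (v', a', k')"
      then obtain F' xs where si: "strip_inv n S e l a1 k1 n i F' xs v' a' k'" by blast
      show "v' 32 = real i \<and> v' 0 = real n \<and> k' \<le> k1 + 2 * n"
        using strip_inv_time[OF si] si[unfolded strip_inv_def] i by linarith
    next
      fix s2 assume s2: "?Inv n s2"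
      obtain v2 a2 k2 where e2: "s2 = (v2, a2, k2)" by (cases s2) auto
      obtain F' xs where si: "strip_inv n S e l a1 k1 n n F' xs v2 a2 k2" using s2 unfolding e2 by blast
      note q = si[unfolded strip_inv_def]
      have fs: "v2 0 = real n" "strip n S F' xs" "stored n xs e l a2"
        "\<forall>q<17. q \<noteq> of_int e \<and> q \<noteq> of_int l \<longrightarrow> a2 q = a1 q" "\<forall>x<n. x \<noteq> n \<longrightarrow> dg F' x \<noteq> 1" using q by blast+
      have "dg F' u \<noteq> 1" if "u < n" for u using fs(5) that by (metis less_irrefl)
      then have F': "F' = []" by (rule strip_done[OF fs(2)])
      have k2: "k2 \<le> k + 3 * n" using strip_inv_time[OF si] v1(2) by linarith
      have a2: "\<forall>q<17. q \<noteq> of_int e \<and> q \<noteq> of_int l \<longrightarrow> a2 q = a q" using fs(4) v1(3) by metis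
      show "Q s2" unfolding e2 by (rule Q[where v' = v2 and a' = a2 and k' = k2 and xs = xs, OF fs(1) fs(2)[unfolded F'] fs(3) a2 k2])
    next
      fix i :: nat and v' :: vars and a' :: arrs and k' :: nat
      assume i: "i < n" and "?Inv i (v', a', k')"
      then obtain F' xs where "strip_inv n S e l a1 k1 n i F' xs v' a' k'" by blast
      note q = this[unfolded strip_inv_def]
      show "hwp L 19 (As 2 (V 32) ;; Wh (Eq (A (C 17) (V 2)) (C 1)) (pluckP e l) ;; As 32 (V 32 \<oplus> C 1)) (v', a', Suc k') (?Inv (Suc i))"
      proof (rule hwp_asq[where z = "real i"], simp, use q in simp, rule hwp_seq, rule hwp_while[where I = "?J i" and B = "k1 + 2 * n"])
        have "\<forall>x<Suc i. x \<noteq> i \<longrightarrow> dg F' x \<noteq> 1"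
        proof (intro allI impI)
          fix x assume "x < Suc i" "x \<noteq> i"
          then have "x < i" "x \<noteq> n" using i by simp_all
          then show "dg F' x \<noteq> 1" using q by blast
        qed
        then have "strip_inv n S e l a1 k1 i (Suc i) F' xs (v'(2 := real i, 32 := real (Suc i))) a' (Suc k')"
          unfolding strip_inv_def using q by simp
        moreover have "v' 32 = real i" using q by blast
        ultimately show "?J i (v'(2 := real i), a', Suc k')"
          unfolding prod.case using i by (intro exI[of _ i] exI[of _ F'] exI[of _ xs]) simp
      next
        fix v2 :: vars and a2 :: arrs and k2 :: nat
        assume "?J i (v2, a2, k2)"
        then obtain u F2 ys where si: "strip_inv n S e l a1 k1 u (Suc i) F2 ys (v2(32 := real (Suc i))) a2 k2" by blast
        show "k2 \<le> k1 + 2 * n" using strip_inv_time[OF si] i by linarith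
      next
        fix v2 :: vars and a2 :: arrs and k2 :: nat
        assume "?J i (v2, a2, k2)"
        then obtain u where "u < n" "v2 2 = real u" by blast
        then show "tok L 19 (Eq (A (C 17) (V 2)) (C 1)) v2 a2" using iL by simp
      next
        fix v2 :: vars and a2 :: arrs and k2 :: nat
        assume "?J i (v2, a2, k2)" and tv: "tv (Eq (A (C 17) (V 2)) (C 1)) v2 a2"
        then obtain u F2 ys where u: "u < n" "v2 2 = real u" "v2 32 = real i"
          and "strip_inv n S e l a1 k1 u (Suc i) F2 ys (v2(32 := real (Suc i))) a2 k2" by blast
        note r = this(4)[unfolded strip_inv_def]
        have st: "strip n S F2 ys" "degs n F2 a2" "stored n ys e l a2" "v2 4 = real (length ys)" "v2 0 = real n" using r by simp_all
        have d: "dg F2 u = 1" using tv st(2) u by (simp add: degs_def)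
        show "hwp L 19 (pluckP e l) (v2, a2, Suc k2) (?J i)"
        proof (rule hwp_pluckP[OF p n(1) st(1) d u(2) st(4,2,3)])
          fix v3 :: vars and a3 :: arrs and w F3
          assume t: "strip n S F3 (ys @ [(u, w)])" "w < n" "\<And>x. x \<noteq> w \<Longrightarrow> x \<noteq> u \<Longrightarrow> dg F3 x = dg F2 x" "dg F3 u = 0" "degs n F3 a3"
            "stored n (ys @ [(u, w)]) e l a3" "v3 2 = real w" "v3 4 = real (Suc (length ys))" "\<And>i. i \<notin> {2, 3, 4} \<Longrightarrow> v3 i = v2 i"
            "\<And>q. q < 17 \<Longrightarrow> q \<noteq> of_int e \<Longrightarrow> q \<noteq> of_int l \<Longrightarrow> a3 q = a2 q"
          have d3: "\<forall>x<Suc i. x \<noteq> w \<longrightarrow> dg F3 x \<noteq> 1"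
          proof (intro allI impI)
            fix x assume x: "x < Suc i" "x \<noteq> w"
            show "dg F3 x \<noteq> 1"
            proof (cases "x = u")
              case False
              then show ?thesis using t(3)[OF x(2) False] r x(1) by simp
            qed (use t(4) in simp)
          qed
          have fr: "v3 0 = real n" "v3 32 = real i" using t(9) st(5) u(3) by simp_all
          have aq: "\<forall>q<17. q \<noteq> of_int e \<and> q \<noteq> of_int l \<longrightarrow> a3 q = a1 q" using t(10) r by simp
          have "strip_inv n S e l a1 k1 w (Suc i) F3 (ys @ [(u, w)]) (v3(32 := real (Suc i))) a3 (Suc k2)"
            unfolding strip_inv_def using t(1,5,6,8) d3 fr aq r by simp
          then show "?J i (v3, a3, Suc k2)" using t(2,7) fr(2) by blast
        qed
      next
        fix v2 :: vars and a2 :: arrs and k2 :: nat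
        assume "?J i (v2, a2, k2)" and tv: "\<not> tv (Eq (A (C 17) (V 2)) (C 1)) v2 a2"
        then obtain u F2 ys where u: "u < n" "v2 2 = real u" "v2 32 = real i"
          and "strip_inv n S e l a1 k1 u (Suc i) F2 ys (v2(32 := real (Suc i))) a2 k2" by blast
        note r = this(4)[unfolded strip_inv_def]
        have "a2 17 (real u) = real (dg F2 u)" using r u(1) unfolding degs_def by blast
        then have "dg F2 u \<noteq> 1" using tv u(2) by simp
        then have "\<forall>x<Suc i. x \<noteq> n \<longrightarrow> dg F2 x \<noteq> 1" using r by blast
        then have "strip_inv n S e l a1 k1 n (Suc i) F2 ys (v2(32 := real (Suc i))) a2 k2"
          unfolding strip_inv_def using r by blast
        then show "hwp L 19 (As 32 (V 32 \<oplus> C 1)) (v2, a2, k2) (?Inv (Suc i))"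
          by (intro hwp_as[where z = "real (Suc i)"]) (simp, simp add: u(3), unfold prod.case, blast)
      qed
    qed
  qed
qed

section \<open>Paths in rooted trees\<close>

text \<open>Edges point towards larger labels; a vertex of label \<open>n\<close> is a root.\<close>

definition ptree :: "nat \<Rightarrow> (nat \<Rightarrow> nat) \<Rightarrow> (nat \<Rightarrow> nat) \<Rightarrow> bool" where
  "ptree n lb pr \<longleftrightarrow> inj_on lb {..<n} \<and> (\<forall>u<n. lb u \<le> n \<and> (lb u < n \<longrightarrow> pr u < n \<and> lb u < lb (pr u)))"

lemma ptree_up: "ptree n lb pr \<Longrightarrow> u < n \<Longrightarrow> lb u < n \<Longrightarrow> pr u < n \<and> lb u < lb (pr u) \<and> lb (pr u) \<le> n"
  by (simp add: ptree_def)

lemma ptree_le: "ptree n lb pr \<Longrightarrow> u < n \<Longrightarrow> lb u \<le> n"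
  by (simp add: ptree_def)

lemma ptree_inj: "ptree n lb pr \<Longrightarrow> u < n \<Longrightarrow> v < n \<Longrightarrow> lb u = lb v \<Longrightarrow> u = v"
  by (auto simp: ptree_def inj_on_def)

text \<open>The conditions on \<open>lb (pr a)\<close> and \<open>lb (pr b)\<close> make the
  recursion terminate for arbitrary arguments; in a \<open>ptree\<close> they hold for the end that
  moves.\<close>

function climb :: "nat \<Rightarrow> (nat \<Rightarrow> nat) \<Rightarrow> (nat \<Rightarrow> nat) \<Rightarrow> nat \<Rightarrow> nat \<Rightarrow> nat list" where
  "climb n lb pr a b = (if lb a < lb b \<and> lb a < lb (pr a) \<and> lb (pr a) \<le> n then a # climb n lb pr (pr a) b
    else if lb b < lb a \<and> lb b < lb (pr b) \<and> lb (pr b) \<le> n then climb n lb pr a (pr b) @ [b] else [a])"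
  by auto
termination by (relation "Wellfounded.measure (\<lambda>(n, lb, pr, a, b). (n - lb a) + (n - lb b))") auto

declare climb.simps [simp del]

lemma climb_same: "climb n lb pr a a = [a]"
  by (subst climb.simps) simp

lemma climb_left: "ptree n lb pr \<Longrightarrow> a < n \<Longrightarrow> b < n \<Longrightarrow> lb a < lb b \<Longrightarrow> climb n lb pr a b = a # climb n lb pr (pr a) b"
  using ptree_up[of n lb pr a] ptree_le[of n lb pr b] by (subst climb.simps) simp

lemma climb_right: "ptree n lb pr \<Longrightarrow> a < n \<Longrightarrow> b < n \<Longrightarrow> lb b < lb a \<Longrightarrow> climb n lb pr a b = climb n lb pr a (pr b) @ [b]"
  using ptree_up[of n lb pr b] ptree_le[of n lb pr a] by (subst climb.simps) simp

lemma ptree_induct: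
  assumes t: "ptree n lb pr" "a < n" "b < n"
    and same: "\<And>a. a < n \<Longrightarrow> Pr a a"
    and left: "\<And>a b. a < n \<Longrightarrow> b < n \<Longrightarrow> lb a < lb b \<Longrightarrow> pr a < n \<Longrightarrow> lb a < lb (pr a) \<Longrightarrow> Pr (pr a) b \<Longrightarrow> Pr a b"
    and right: "\<And>a b. a < n \<Longrightarrow> b < n \<Longrightarrow> lb b < lb a \<Longrightarrow> pr b < n \<Longrightarrow> lb b < lb (pr b) \<Longrightarrow> Pr a (pr b) \<Longrightarrow> Pr a b"
  shows "Pr a b"
  using t(2,3)
proof (induction "(n - lb a) + (n - lb b)" arbitrary: a b rule: less_induct)
  case less
  show ?case
  proof (cases "lb a" "lb b" rule: linorder_cases)
    case less': less
    have u: "pr a < n" "lb a < lb (pr a)" "lb (pr a) \<le> n" using ptree_up[OF t(1) less.prems(1)] ptree_le[OF t(1) less.prems(2)] less' by auto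
    show ?thesis by (rule left[OF less.prems less' u(1,2)], rule less.hyps) (use u less.prems in auto)
  next
    case greater
    have u: "pr b < n" "lb b < lb (pr b)" "lb (pr b) \<le> n" using ptree_up[OF t(1) less.prems(2)] ptree_le[OF t(1) less.prems(1)] greater by auto
    show ?thesis by (rule right[OF less.prems greater u(1,2)], rule less.hyps) (use u less.prems in auto)
  next
    case equal
    then have "a = b" by (rule ptree_inj[OF t(1) less.prems])
    then show ?thesis using same less.prems by simp
  qed
qed

text \<open>The end with the smaller label moves, and every vertex visited afterwards has a larger
  label than the vertex just left, so no vertex is repeated. The bound on the labels is what the
  induction needs for this.\<close>

lemma climb_path:
  assumes t: "ptree n lb pr" "a < n" "b < n" and E: "\<And>u. u < n \<Longrightarrow> lb u < n \<Longrightarrow> {u, pr u} \<in> E"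
  shows "is_path {..<n} E a (climb n lb pr a b) b \<and> (\<forall>x\<in>set (climb n lb pr a b). min (lb a) (lb b) \<le> lb x)"
  using t
proof (rule ptree_induct)
  show "is_path {..<n} E a (climb n lb pr a a) a \<and> (\<forall>x\<in>set (climb n lb pr a a). min (lb a) (lb a) \<le> lb x)" if "a < n" for a
    using that by (simp add: climb_same is_path_def)
next
  fix a b assume ab: "a < n" "b < n" "lb a < lb b" "pr a < n" "lb a < lb (pr a)"
    and IH: "is_path {..<n} E (pr a) (climb n lb pr (pr a) b) b \<and> (\<forall>x\<in>set (climb n lb pr (pr a) b). min (lb (pr a)) (lb b) \<le> lb x)"
  have e: "{a, pr a} \<in> E" using E[of a] ptree_le[OF t(1) ab(2)] ab by simp
  have lo: "\<forall>x\<in>set (climb n lb pr (pr a) b). lb a < lb x" using IH ab(3,5) by fastforce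
  then have "a \<notin> set (climb n lb pr (pr a) b)" by blast
  moreover have "min (lb a) (lb b) = lb a" using ab(3) by simp
  ultimately show "is_path {..<n} E a (climb n lb pr a b) b \<and> (\<forall>x\<in>set (climb n lb pr a b). min (lb a) (lb b) \<le> lb x)"
    unfolding climb_left[OF t(1) ab(1-3)] using IH e lo ab(1) by (auto simp: is_path_def successively_Cons)
next
  fix a b assume ab: "a < n" "b < n" "lb b < lb a" "pr b < n" "lb b < lb (pr b)"
    and IH: "is_path {..<n} E a (climb n lb pr a (pr b)) (pr b) \<and> (\<forall>x\<in>set (climb n lb pr a (pr b)). min (lb a) (lb (pr b)) \<le> lb x)"
  have e: "{pr b, b} \<in> E" using E[of b] ptree_le[OF t(1) ab(1)] ab by (simp add: insert_commute)
  have lo: "\<forall>x\<in>set (climb n lb pr a (pr b)). lb b < lb x" using IH ab(3,5) by fastforce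
  then have "b \<notin> set (climb n lb pr a (pr b))" by blast
  moreover have "min (lb a) (lb b) = lb b" using ab(3) by simp
  ultimately show "is_path {..<n} E a (climb n lb pr a b) b \<and> (\<forall>x\<in>set (climb n lb pr a b). min (lb a) (lb b) \<le> lb x)"
    unfolding climb_right[OF t(1) ab(1-3)] using IH e lo ab(2) by (auto simp: is_path_def successively_append_iff)
qed

lemma path_length_Cons: "path_length (x # ys) = (if ys = [] then 0 else dist x (hd ys) + path_length ys)"
  by (cases ys) (simp_all add: path_length_def)

lemma path_length_snoc: "path_length (xs @ [y]) = (if xs = [] then 0 else path_length xs + dist (last xs) y)"
proof (induction xs)
  case (Cons x xs)
  then show ?case by (cases xs) (simp_all add: path_length_Cons)
qed (simp add: path_length_def)

abbreviation clen where "clen P n lb pr a b \<equiv> path_length (map P (climb n lb pr a b))"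

lemma climb_ends:
  assumes "ptree n lb pr" "a < n" "b < n"
  shows "climb n lb pr a b \<noteq> []" "hd (climb n lb pr a b) = a" "last (climb n lb pr a b) = b"
  using climb_path[OF assms, of UNIV] by (auto simp: is_path_def)

lemma clen_left:
  assumes "ptree n lb pr" "a < n" "b < n" "lb a < lb b"
  shows "clen P n lb pr a b = dist (P a) (P (pr a)) + clen P n lb pr (pr a) b"
proof -
  have "pr a < n" using ptree_up[OF assms(1,2)] ptree_le[OF assms(1,3)] assms(4) by simp
  then show ?thesis using climb_left[OF assms] climb_ends[OF assms(1) _ assms(3), of "pr a"] by (simp add: path_length_Cons hd_map)
qed

lemma clen_right:
  assumes "ptree n lb pr" "a < n" "b < n" "lb b < lb a"
  shows "clen P n lb pr a b = clen P n lb pr a (pr b) + dist (P (pr b)) (P b)"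
proof -
  have "pr b < n" using ptree_up[OF assms(1,3)] ptree_le[OF assms(1,2)] assms(4) by simp
  then show ?thesis using climb_right[OF assms] climb_ends[OF assms(1,2), of "pr b"] by (simp add: path_length_snoc last_map)
qed

text \<open>As long as \<open>b\<close> has the smaller label, both climbs move \<open>b\<close>
  first, and the difference stays the same. After that, either \<open>a\<close> moves first and its
  climb is the other one plus the edge, or \<open>b = a\<close> and only the edge itself is to be
  compared.\<close>

lemma clen_near:
  assumes t: "ptree n lb pr" "a < n" "b < n" and a: "lb a < n"
  shows "\<bar>clen P n lb pr a b - clen P n lb pr (pr a) b\<bar> \<le> dist (P a) (P (pr a))"
proof -
  have pa: "pr a < n" "lb a < lb (pr a)" using ptree_up[OF t(1,2) a] by simp_all
  show ?thesis
    using t(3)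
  proof (induction "n - lb b" arbitrary: b rule: less_induct)
    case less
    show ?case
    proof (cases "lb a" "lb b" rule: linorder_cases)
      case l: less
      show ?thesis using clen_left[OF t(1,2) less.prems l, of P] by (simp add: clen_left l less.prems t(1,2))
    next
      case equal
      then have ab: "b = a" using ptree_inj[OF t(1) less.prems t(2)] by simp
      show ?thesis unfolding ab using clen_right[OF t(1) pa(1) t(2) pa(2), of P]
        by (simp add: climb_same path_length_Cons dist_commute)
    next
      case g: greater
      have pb: "pr b < n" "lb b < lb (pr b)" "lb (pr b) \<le> n" using ptree_up[OF t(1) less.prems] ptree_le[OF t(1,2)] g by auto
      have "lb b < lb (pr a)" using g pa(2) by simp
      then have "clen P n lb pr a b - clen P n lb pr (pr a) b = clen P n lb pr a (pr b) - clen P n lb pr (pr a) (pr b)"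
        using clen_right[OF t(1,2) less.prems g, of P] clen_right[OF t(1) pa(1) less.prems, of P] by simp
      then show ?thesis using less.hyps[OF _ pb(1)] pb g ptree_le[OF t(1,2)] by simp
    qed
  qed
qed

text \<open>The walk is followed edge by edge, starting from the trivial climb, and each edge
  lengthens the climb by at most its own length by \<open>clen_near\<close>. This stands in for the
  uniqueness of paths in a tree.\<close>

lemma clen_conn:
  assumes "conn P E a b l" and t: "ptree n lb pr" and a: "a < n"
    and E: "\<And>x y. (x, y) \<in> E \<Longrightarrow> x < n \<and> y < n \<and> (lb x < n \<and> pr x = y \<or> lb y < n \<and> pr y = x)"
  shows "clen P n lb pr b a \<le> l"
  using assms(1) a
proof (induction rule: conn.induct)
  case (conn_refl l c)
  then show ?case by (simp add: climb_same path_length_Cons)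
next
  case (conn_step a b l c l')
  have e: "b < n" "c < n" "lb b < n \<and> pr b = c \<or> lb c < n \<and> pr c = b" using conn_step.hyps(2) E by blast+
  have "\<bar>clen P n lb pr b a - clen P n lb pr c a\<bar> \<le> dist (P b) (P c)"
    using e(3)
  proof (elim disjE conjE)
    assume "lb b < n" "pr b = c"
    then show ?thesis using clen_near[OF t e(1) conn_step.prems(1), of P] by simp
  next
    assume "lb c < n" "pr c = b"
    then show ?thesis using clen_near[OF t e(2) conn_step.prems(1), of P] by (simp add: abs_minus_commute dist_commute)
  qed
  then show ?case using conn_step.IH[OF conn_step.prems] conn_step.hyps(3) by simp
qed

section \<open>Queries\<close>

definition tarr :: "nat \<Rightarrow> (nat \<Rightarrow> nat) \<Rightarrow> (nat \<Rightarrow> nat) \<Rightarrow> int \<Rightarrow> int \<Rightarrow> arrs \<Rightarrow> bool" where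
  "tarr n lb pr e l a \<longleftrightarrow> ptree n lb pr \<and> (\<forall>u<n. a (of_int l) (real u) = real (lb u) \<and>
    (lb u < n \<longrightarrow> a (of_int e) (real (2 * lb u + 1)) = real (pr u)))"

text \<open>\<open>lb\<close> and \<open>pr\<close> are decoded from the arrays. Labels below
  \<open>n\<close> are positions in a list with distinct first components, and since
  \<open>n - 1\<close> vertices are stripped, just one has label \<open>n\<close>; so labels are
  injective.\<close>

lemma stored_tree:
  assumes st: "stored n xs e l a" and s: "strip n S [] xs"
  shows "\<exists>lb pr. tarr n lb pr e l a \<and> (\<forall>x y. (x, y) \<in> set xs \<longrightarrow> x < n \<and> lb x < n \<and> pr x = y) \<and>
    (\<forall>u<n. lb u < n \<longrightarrow> (u, pr u) \<in> set xs)"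
proof -
  define lb where "lb u = nat \<lfloor>a (of_int l) (real u)\<rfloor>" for u
  define pr where "pr u = nat \<lfloor>a (of_int e) (real (2 * lb u + 1))\<rfloor>" for u
  have po: "distinct (map fst xs)" "edges_ok n xs" and
    later: "\<And>j. j < length xs \<Longrightarrow> snd (xs ! j) \<notin> fst ` set (take (Suc j) xs)" and len: "length xs + 1 = n"
    using strip_final[OF s] by blast+
  have in_n: "fst (xs ! j) < n" "snd (xs ! j) < n" if "j < length xs" for j
    using po(2) nth_mem[OF that] by (auto simp: edges_ok_def)
  have key: "a (of_int l) (real (fst (xs ! j))) = real j" "a (of_int e) (real (2 * j + 1)) = real (snd (xs ! j))"
    if "j < length xs" for j using st that unfolding stored_def by blast+
  have K: "lb (fst (xs ! j)) = j" "pr (fst (xs ! j)) = snd (xs ! j)" if "j < length xs" for j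
  proof -
    show l: "lb (fst (xs ! j)) = j" unfolding lb_def key(1)[OF that] by simp
    show "pr (fst (xs ! j)) = snd (xs ! j)" unfolding pr_def l key(2)[OF that] by simp
  qed
  have root: "a (of_int l) (real u) = real n" if "u < n" "u \<notin> fst ` set xs" for u using st that unfolding stored_def by blast
  then have root': "lb u = n" if "u < n" "u \<notin> fst ` set xs" for u unfolding lb_def using that by simp
  have dec: "(\<exists>j<length xs. u = fst (xs ! j)) \<or> u \<notin> fst ` set xs" for u by (metis imageE in_set_conv_nth)
  have two: "u = u'" if "u < n" "u' < n" "u \<notin> fst ` set xs" "u' \<notin> fst ` set xs" for u u'
  proof (rule ccontr)
    assume ne: "u \<noteq> u'"
    have "card (fst ` set xs) = length xs" using po(1) by (metis distinct_card length_map set_map)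
    then have "card (insert u (insert u' (fst ` set xs))) = length xs + 2" using that ne by simp
    moreover have "insert u (insert u' (fst ` set xs)) \<subseteq> {..<n}" using that po(2) by (auto simp: edges_ok_def)
    then have "card (insert u (insert u' (fst ` set xs))) \<le> n" using card_mono[OF finite_lessThan, of "insert u (insert u' (fst ` set xs))" n] by simp
    ultimately show False using len by simp
  qed
  have edge: "u \<in> fst ` set xs" if "u < n" "lb u < n" for u
  proof (rule ccontr)
    assume "u \<notin> fst ` set xs"
    then show False using root'[OF that(1)] that(2) by simp
  qed
  have nr: "u \<notin> fst ` set xs" if "\<not> lb u < n" for u
  proof
    assume "u \<in> fst ` set xs"
    then obtain j where j: "j < length xs" "u = fst (xs ! j)" using dec[of u] by blast
    show False using K(1)[OF j(1)] j that len by simp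
  qed
  have ex: "\<exists>j<length xs. u = fst (xs ! j)" if "u < n" "lb u < n" for u using dec[of u] edge[OF that] by blast
  have pt: "ptree n lb pr"
    unfolding ptree_def
  proof (intro conjI allI impI)
    show "inj_on lb {..<n}"
    proof (rule inj_onI)
      fix x y assume xy: "x \<in> {..<n}" "y \<in> {..<n}" "lb x = lb y"
      show "x = y"
      proof (cases "lb x < n")
        case True
        obtain j where j: "j < length xs" "x = fst (xs ! j)" using ex[of x] xy True by auto
        obtain j' where j': "j' < length xs" "y = fst (xs ! j')" using ex[of y] xy True by auto
        show ?thesis using K(1)[OF j(1)] K(1)[OF j'(1)] j j' xy(3) by simp
      next
        case False
        have "x \<notin> fst ` set xs" "y \<notin> fst ` set xs" using nr[of x] nr[of y] False xy(3) by simp_all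
        then show ?thesis using two xy by blast
      qed
    qed
    fix u assume u: "u < n"
    show "lb u \<le> n" using root'[OF u] nr[of u] by (cases "lb u < n") simp_all
    assume l: "lb u < n"
    obtain j where j: "j < length xs" "u = fst (xs ! j)" using ex[OF u l] by blast
    have p: "pr u = snd (xs ! j)" "lb u = j" using K[OF j(1)] j(2) by simp_all
    show "pr u < n" using in_n(2)[OF j(1)] p by simp
    show "lb u < lb (pr u)"
    proof (cases "pr u \<in> fst ` set xs")
      case True
      then obtain j' where j': "j' < length xs" "pr u = fst (xs ! j')" using dec[of "pr u"] by blast
      have "\<not> j' \<le> j"
      proof
        assume "j' \<le> j"
        then have "xs ! j' \<in> set (take (Suc j) xs)" using nth_mem[of j' "take (Suc j) xs"] j'(1) j(1) by simp
        then have "fst (xs ! j') \<in> fst ` set (take (Suc j) xs)" by (rule imageI)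
        then show False using later[OF j(1)] j'(2) p(1) by simp
      qed
      then show ?thesis using K(1)[OF j'(1)] j'(2) p(2) by simp
    next
      case False
      then show ?thesis using root'[OF \<open>pr u < n\<close>] l by simp
    qed
  qed
  have "tarr n lb pr e l a"
    unfolding tarr_def
  proof (intro conjI allI impI)
    fix u assume u: "u < n"
    show "a (of_int l) (real u) = real (lb u)"
    proof (cases "lb u < n")
      case True
      then obtain j where j: "j < length xs" "u = fst (xs ! j)" using ex[OF u] by blast
      show ?thesis using key(1)[OF j(1)] K(1)[OF j(1)] j(2) by simp
    next
      case False
      then have "u \<notin> fst ` set xs" using nr by blast
      then show ?thesis using root[OF u] root'[OF u] by simp
    qed
    assume "lb u < n"
    then obtain j where j: "j < length xs" "u = fst (xs ! j)" using ex[OF u] by blast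
    show "a (of_int e) (real (2 * lb u + 1)) = real (pr u)" using key(2)[OF j(1)] K[OF j(1)] j(2) by simp
  qed (rule pt)
  moreover have "x < n \<and> lb x < n \<and> pr x = y" if xy: "(x, y) \<in> set xs" for x y
  proof -
    obtain j where j: "j < length xs" "xs ! j = (x, y)" using xy by (auto simp: in_set_conv_nth)
    then show ?thesis using K[OF j(1)] in_n[OF j(1)] len by auto
  qed
  moreover have "(u, pr u) \<in> set xs" if u: "u < n" "lb u < n" for u
  proof -
    obtain j where j: "j < length xs" "u = fst (xs ! j)" using ex[OF u] by blast
    have "(u, pr u) = xs ! j" using K(2)[OF j(1)] j(2) by simp
    then show ?thesis using nth_mem[OF j(1)] by simp
  qed
  ultimately show ?thesis by blast
qed

definition holds :: "(real \<Rightarrow> real) \<Rightarrow> nat list \<Rightarrow> bool" where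
  "holds f ts \<longleftrightarrow> (\<forall>k<length ts. f (real k) = real (ts ! k))"

lemma holds_snoc: "holds f ts \<Longrightarrow> holds (f(real (length ts) := real z)) (ts @ [z])"
  by (auto simp: holds_def nth_append less_Suc_eq)

lemma holds_append: "holds f (ts @ ys) \<Longrightarrow> holds f ts"
  by (simp add: holds_def nth_append)

lemma holds_last: "holds f (ts @ [z]) \<Longrightarrow> f (real (length ts)) = real z"
  by (simp add: holds_def)

text \<open>The part of the path from the first point goes to array 9, the part from the second one
  to array 10, which is then appended in reverse. As tests are only \<open><\<close> and
  \<open>=\<close>, inequality is tested by the square of the difference. Every vertex takes at most
  two iterations.\<close>

definition climbP :: hcom where "climbP =
  As 2 (V 10) ;; As 3 (V 11) ;; As 6 (C 0) ;; As 7 (C 0) ;;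
  Wh (Lt (C 0) ((V 2 \<ominus> V 3) \<otimes> (V 2 \<ominus> V 3))) (
    Cd (Lt (A (V 5) (V 2)) (A (V 5) (V 3)))
      (St (C 9) (V 6) (V 2) ;; As 6 (V 6 \<oplus> C 1) ;; As 2 (A (V 4) (C 2 \<otimes> A (V 5) (V 2) \<oplus> C 1)))
      (St (C 10) (V 7) (V 3) ;; As 7 (V 7 \<oplus> C 1) ;; As 3 (A (V 4) (C 2 \<otimes> A (V 5) (V 3) \<oplus> C 1)))) ;;
  St (C 9) (V 6) (V 2) ;; As 6 (V 6 \<oplus> C 1) ;;
  Wh (Lt (C 0) (V 7)) (As 7 (V 7 \<ominus> C 1) ;; St (C 9) (V 6) (A (C 10) (V 7)) ;; As 6 (V 6 \<oplus> C 1))"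

lemma hwp_climbP:
  assumes p: "ix 19 (of_int e)" "ix 19 (of_int l)" "e < 9" "l < 9" and n: "2 * n \<le> L" and t: "tarr n lb pr e l a"
    and ij: "i < n" "j < n" "v 10 = real i" "v 11 = real j" and v: "v 4 = of_int e" "v 5 = of_int l"
    and \<pi>: "\<pi> = climb n lb pr i j"
    and Q: "\<And>v' a' k'. v' 0 = v 0 \<Longrightarrow> (\<forall>q<9. a' q = a q) \<Longrightarrow> v' 6 = real (length \<pi>) \<Longrightarrow> holds (a' 9) \<pi> \<Longrightarrow>
      k' \<le> k + 2 * length \<pi> \<Longrightarrow> Q (v', a', k')"
  shows "hwp L 19 climbP (v, a, k) Q"
proof -
  have pt: "ptree n lb pr" and al: "\<And>u. u < n \<Longrightarrow> a (of_int l) (real u) = real (lb u)"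
    and ae: "\<And>u. u < n \<Longrightarrow> lb u < n \<Longrightarrow> a (of_int e) (real (2 * lb u + 1)) = real (pr u)"
    using t by (auto simp: tarr_def)
  have len: "length \<pi> \<le> n"
  proof -
    have "distinct \<pi>" "set \<pi> \<subseteq> {..<n}" using climb_path[OF pt ij(1,2), of UNIV] unfolding \<pi> by (auto simp: is_path_def)
    then show ?thesis using card_mono[of "{..<n}" "set \<pi>"] distinct_card[of \<pi>] by simp
  qed
  have ne: "climb n lb pr x y \<noteq> []" if "x < n" "y < n" for x y using climb_ends[OF pt that] by blast
  have el9: "real_of_int e \<noteq> 9" "real_of_int e \<noteq> 10" "real_of_int l \<noteq> 9" "real_of_int l \<noteq> 10" using p by simp_all
  have el: "real_of_int e < 9" "real_of_int l < 9" using p by simp_all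
  define W where "W x y us ws v' a' k' \<longleftrightarrow> x < n \<and> y < n \<and> \<pi> = us @ climb n lb pr x y @ rev ws \<and> v' 2 = real x \<and> v' 3 = real y \<and>
    v' 4 = of_int e \<and> v' 5 = of_int l \<and> v' 0 = v 0 \<and> v' 6 = real (length us) \<and> v' 7 = real (length ws) \<and>
    holds (a' 9) us \<and> holds (a' 10) ws \<and> (\<forall>q<9. a' q = a q) \<and> k' = k + length us + length ws"
    for x y us ws and v' :: vars and a' :: arrs and k' :: nat
  let ?I = "\<lambda>(v', a', k'). \<exists>x y us ws. W x y us ws v' a' k'"
  define Z where "Z us ws v' a' k' \<longleftrightarrow> \<pi> = us @ rev ws \<and> v' 0 = v 0 \<and> v' 6 = real (length us) \<and> v' 7 = real (length ws) \<and>
    holds (a' 9) us \<and> holds (a' 10) ws \<and> (\<forall>q<9. a' q = a q) \<and> k' + length ws \<le> k + 2 * length \<pi>"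
    for us ws and v' :: vars and a' :: arrs and k' :: nat
  let ?K = "\<lambda>(v', a', k'). \<exists>us ws. Z us ws v' a' k'"
  show ?thesis
    unfolding climbP_def
  proof (rule hwp_asq[where z = "real i"], simp, simp add: ij, rule hwp_asq[where z = "real j"], simp, simp add: ij,
      rule hwp_asq[where z = 0], simp, simp, rule hwp_asq[where z = 0], simp, simp, rule hwp_seq,
      rule hwp_while[where I = ?I and B = "k + n"])
    have "W i j [] [] (v(2 := real i, 3 := real j, 6 := 0, 7 := 0)) a k" unfolding W_def using ij v \<pi> by (simp add: holds_def)
    then show "?I (v(2 := real i, 3 := real j, 6 := 0, 7 := 0), a, k)" by blast
  next
    fix v' :: vars and a' :: arrs and k' :: nat
    assume "?I (v', a', k')"
    then obtain x y us ws where "W x y us ws v' a' k'" by blast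
    note s = this[unfolded W_def]
    have "length us + length ws \<le> length \<pi>" using s by simp
    then show "k' \<le> k + n" using s len by linarith
  next
    fix v' :: vars and a' :: arrs and k' :: nat
    assume "?I (v', a', k')" and tv: "tv (Lt (C 0) ((V 2 \<ominus> V 3) \<otimes> (V 2 \<ominus> V 3))) v' a'"
    then obtain x y us ws where "W x y us ws v' a' k'" by blast
    note s = this[unfolded W_def]
    have xy: "x < n" "y < n" and dec: "\<pi> = us @ climb n lb pr x y @ rev ws" using s by blast+
    have v': "v' 2 = real x" "v' 3 = real y" "v' 4 = of_int e" "v' 5 = of_int l" "v' 0 = v 0" "v' 6 = real (length us)" "v' 7 = real (length ws)"
      and h: "holds (a' 9) us" "holds (a' 10) ws" and aq: "\<forall>q<9. a' q = a q" and k': "k' = k + length us + length ws" using s by blast+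
    have ll: "length us < L" "length ws < L" "x < L" "y < L"
    proof -
      have "0 < length (climb n lb pr x y)" using ne[OF xy] by simp
      moreover have "length us + length (climb n lb pr x y) + length ws = length \<pi>" using dec by simp
      ultimately show "length us < L" "length ws < L" "x < L" "y < L" using len n xy by linarith+
    qed
    have al': "a' (of_int l) (real u) = real (lb u)" if "u < n" for u using aq el al[OF that] by simp
    have ae': "a' (of_int e) (real (2 * lb u + 1)) = real (pr u)" if "u < n" "lb u < n" for u using aq el ae[OF that] by simp
    have "x \<noteq> y" using tv v' by auto
    then have lxy: "lb x \<noteq> lb y" using ptree_inj[OF pt xy] by blast
    show "hwp L 19 (Cd (Lt (A (V 5) (V 2)) (A (V 5) (V 3)))
      (St (C 9) (V 6) (V 2) ;; As 6 (V 6 \<oplus> C 1) ;; As 2 (A (V 4) (C 2 \<otimes> A (V 5) (V 2) \<oplus> C 1)))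
      (St (C 10) (V 7) (V 3) ;; As 7 (V 7 \<oplus> C 1) ;; As 3 (A (V 4) (C 2 \<otimes> A (V 5) (V 3) \<oplus> C 1)))) (v', a', Suc k') ?I"
    proof (rule hwp_cd)
      show "tok L 19 (Lt (A (V 5) (V 2)) (A (V 5) (V 3))) v' a'" using v' p ll by simp
      assume "tv (Lt (A (V 5) (V 2)) (A (V 5) (V 3))) v' a'"
      then have lt: "lb x < lb y" using v' al' xy by simp
      have lx: "lb x < n" using lt ptree_le[OF pt xy(2)] by simp
      note up = ptree_up[OF pt xy(1) lx]
      let ?a2 = "a'(9 := (a' 9)(real (length us) := real x))"
      have fin: "?I (u, ?a2, Suc k')" if u: "u 0 = v 0" "u 2 = real (pr x)" "u 3 = real y" "u 4 = of_int e" "u 5 = of_int l"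
        "u 6 = real (Suc (length us))" "u 7 = real (length ws)" for u
      proof -
        have "W (pr x) y (us @ [x]) ws u ?a2 (Suc k')"
          unfolding W_def using u up xy h aq k' dec climb_left[OF pt xy lt] holds_snoc[OF h(1), of x] by simp
        then show ?thesis by blast
      qed
      have ixe: "ix L (2 * real (lb x) + 1)" unfolding ix_odd using lx n by linarith
      have aex: "a' (of_int e) (2 * real (lb x) + 1) = real (pr x)" using ae'[OF xy(1) lx] by (simp only: of_nat_add of_nat_mult of_nat_numeral of_nat_1)
      show "hwp L 19 (St (C 9) (V 6) (V 2) ;; As 6 (V 6 \<oplus> C 1) ;; As 2 (A (V 4) (C 2 \<otimes> A (V 5) (V 2) \<oplus> C 1))) (v', a', Suc k') ?I"
        apply (rule hwp_stq[where zp = 9 and zi = "real (length us)" and ze = "real x"])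
                apply (simp_all add: v' ll)[8]
        apply (rule hwp_asq[where z = "real (Suc (length us))"], simp, simp add: v')
        apply (rule hwp_as[where z = "real (pr x)"])
          apply (use v' p ll al'[OF xy(1)] el9 ixe in simp)
         apply (use v' al'[OF xy(1)] el9 aex in simp)
        apply (rule fin; simp add: v')
        done
    next
      assume "\<not> tv (Lt (A (V 5) (V 2)) (A (V 5) (V 3))) v' a'"
      then have lt: "lb y < lb x" using v' al' xy lxy by simp
      have lx: "lb y < n" using lt ptree_le[OF pt xy(1)] by simp
      note up = ptree_up[OF pt xy(2) lx]
      let ?a2 = "a'(10 := (a' 10)(real (length ws) := real y))"
      have fin: "?I (u, ?a2, Suc k')" if u: "u 0 = v 0" "u 2 = real x" "u 3 = real (pr y)" "u 4 = of_int e" "u 5 = of_int l"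
        "u 6 = real (length us)" "u 7 = real (Suc (length ws))" for u
      proof -
        have "W x (pr y) us (ws @ [y]) u ?a2 (Suc k')"
          unfolding W_def using u up xy h aq k' dec climb_right[OF pt xy lt] holds_snoc[OF h(2), of y] by simp
        then show ?thesis by blast
      qed
      have ixe: "ix L (2 * real (lb y) + 1)" unfolding ix_odd using lx n by linarith
      have aex: "a' (of_int e) (2 * real (lb y) + 1) = real (pr y)" using ae'[OF xy(2) lx] by (simp only: of_nat_add of_nat_mult of_nat_numeral of_nat_1)
      show "hwp L 19 (St (C 10) (V 7) (V 3) ;; As 7 (V 7 \<oplus> C 1) ;; As 3 (A (V 4) (C 2 \<otimes> A (V 5) (V 3) \<oplus> C 1))) (v', a', Suc k') ?I"
        apply (rule hwp_stq[where zp = 10 and zi = "real (length ws)" and ze = "real y"])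
                apply (simp_all add: v' ll)[8]
        apply (rule hwp_asq[where z = "real (Suc (length ws))"], simp, simp add: v')
        apply (rule hwp_as[where z = "real (pr y)"])
          apply (use v' p ll al'[OF xy(2)] el9 ixe in simp)
         apply (use v' al'[OF xy(2)] el9 aex in simp)
        apply (rule fin; simp add: v')
        done
    qed
  next
    fix v' :: vars and a' :: arrs and k' :: nat
    assume "?I (v', a', k')" and tv: "\<not> tv (Lt (C 0) ((V 2 \<ominus> V 3) \<otimes> (V 2 \<ominus> V 3))) v' a'"
    then obtain x y us ws where "W x y us ws v' a' k'" by blast
    note s = this[unfolded W_def]
    have dec: "\<pi> = us @ climb n lb pr x y @ rev ws" "x < n" using s by blast+
    have v': "v' 2 = real x" "v' 3 = real y" "v' 0 = v 0" "v' 6 = real (length us)" "v' 7 = real (length ws)"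
      and h: "holds (a' 9) us" "holds (a' 10) ws" and aq: "\<forall>q<9. a' q = a q" and k': "k' = k + length us + length ws" using s by blast+
    have "real x = real y" using tv v' not_real_square_gt_zero[of "real x - real y"] by simp
    then have dec: "\<pi> = us @ x # rev ws" using dec by (simp add: climb_same)
    have uL: "length us < L" using dec len n by simp
    let ?a2 = "a'(9 := (a' 9)(real (length us) := real x))"
    have start: "?K (u, ?a2, k')" if u: "u 0 = v 0" "u 6 = real (Suc (length us))" "u 7 = real (length ws)" for u
    proof -
      have "Z (us @ [x]) ws u ?a2 k'" unfolding Z_def using u h aq k' dec holds_snoc[OF h(1), of x] by simp
      then show ?thesis by blast
    qed
    show "hwp L 19 (St (C 9) (V 6) (V 2) ;; As 6 (V 6 \<oplus> C 1) ;;
      Wh (Lt (C 0) (V 7)) (As 7 (V 7 \<ominus> C 1) ;; St (C 9) (V 6) (A (C 10) (V 7)) ;; As 6 (V 6 \<oplus> C 1))) (v', a', k') Q"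
      apply (rule hwp_stq[where zp = 9 and zi = "real (length us)" and ze = "real x"])
              apply (simp_all add: v' uL)[8]
      apply (rule hwp_asq[where z = "real (Suc (length us))"], simp, simp add: v')
    proof (rule hwp_while[where I = ?K and B = "k + 2 * length \<pi>"])
      show "?K (v'(6 := real (Suc (length us))), ?a2, k')" by (rule start) (simp_all add: v')
    next
      fix v2 :: vars and a2 :: arrs and k2 :: nat
      assume "?K (v2, a2, k2)"
      then show "k2 \<le> k + 2 * length \<pi>" by (auto simp: Z_def)
    next
      fix v2 :: vars and a2 :: arrs and k2 :: nat
      assume "?K (v2, a2, k2)" and tv: "tv (Lt (C 0) (V 7)) v2 a2"
      then obtain us ws where "Z us ws v2 a2 k2" by blast
      note z = this[unfolded Z_def]
      have "ws \<noteq> []" using tv z by auto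
      then obtain ys y where ws: "ws = ys @ [y]" by (cases ws rule: rev_exhaust) auto
      have v2: "v2 0 = v 0" "v2 6 = real (length us)" "v2 7 = real (length ys) + 1" using z ws by simp_all
      have L: "length us < L" "length ys < L"
      proof -
        have "length us + length ys + 1 = length \<pi>" using z ws by simp
        then show "length us < L" "length ys < L" using len n by linarith+
      qed
      have y: "a2 10 (real (length ys)) = real y" using z ws holds_last by blast
      let ?a3 = "a2(9 := (a2 9)(real (length us) := real y))"
      have step: "?K (u, ?a3, Suc k2)" if u: "u 0 = v 0" "u 6 = real (Suc (length us))" "u 7 = real (length ys)" for u
      proof -
        have zz: "holds (a2 9) us" "holds (a2 10) (ys @ [y])" "\<forall>q<9. a2 q = a q" "\<pi> = us @ rev (ys @ [y])"
          "k2 + length (ys @ [y]) \<le> k + 2 * length \<pi>" using z unfolding ws by blast+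
        have h1: "holds (?a3 9) (us @ [y])" using holds_snoc[OF zz(1), of y] by simp
        have h2: "holds (?a3 10) ys" using holds_append[OF zz(2)] by simp
        have q9: "\<forall>q<9. ?a3 q = a q" using zz(3) by simp
        have kk: "Suc k2 + length ys \<le> k + 2 * length \<pi>" using zz(5) by simp
        have dd: "\<pi> = (us @ [y]) @ rev ys" using zz(4) by simp
        have ll: "u 6 = real (length (us @ [y]))" using u(2) by simp
        have "Z (us @ [y]) ys u ?a3 (Suc k2)" unfolding Z_def by (intro conjI dd u(1) ll u(3) h1 h2 q9 kk)
        then show ?thesis by blast
      qed
      show "hwp L 19 (As 7 (V 7 \<ominus> C 1) ;; St (C 9) (V 6) (A (C 10) (V 7)) ;; As 6 (V 6 \<oplus> C 1)) (v2, a2, Suc k2) ?K"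
        apply (rule hwp_asq[where z = "real (length ys)"], simp, simp add: v2)
        apply (rule hwp_stq[where zp = 9 and zi = "real (length us)" and ze = "real y"])
                apply (simp_all add: v2 L y)[8]
        apply (rule hwp_as[where z = "real (Suc (length us))"], simp, simp add: v2)
        apply (rule step; simp add: v2)
        done
    next
      fix v2 :: vars and a2 :: arrs and k2 :: nat
      assume "?K (v2, a2, k2)" and tv: "\<not> tv (Lt (C 0) (V 7)) v2 a2"
      then obtain us ws where "Z us ws v2 a2 k2" by blast
      note z = this[unfolded Z_def]
      have "ws = []" using tv z by simp
      then have us: "us = \<pi>" using z by simp
      have q: "v2 0 = v 0" "\<forall>q<9. a2 q = a q" "v2 6 = real (length us)" "holds (a2 9) us" "k2 + length ws \<le> k + 2 * length \<pi>"
        using z by blast+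
      have k2: "k2 \<le> k + 2 * length \<pi>" using q(5) by linarith
      show "Q (v2, a2, k2)" by (rule Q[OF q(1,2) q(3,4)[unfolded us] k2])
    qed simp
  next
    fix v' :: vars and a' :: arrs and k' :: nat
    assume "?I (v', a', k')"
    then obtain x y us ws where "W x y us ws v' a' k'" by blast
    note s = this[unfolded W_def]
    show "tok L 19 (Lt (C 0) ((V 2 \<ominus> V 3) \<otimes> (V 2 \<ominus> V 3))) v' a'" by simp
  qed
qed

text \<open>The separating squares of the pair are recomputed from the coordinates, so the quadtrees
  need not be kept. The strict comparison is that of \<open>tree_choice\<close>.\<close>

definition queryP :: hcom where "queryP =
  sepc 1 2 ;; As 32 (V 14) ;; sepc 3 4 ;;
  Cd (Lt (V 32) (V 14)) (As 4 (C 5) ;; As 5 (C 6)) (As 4 (C 7) ;; As 5 (C 8)) ;; climbP"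

lemma hwp_queryP:
  assumes c: "coords n PA 1 2 a" "coords n PB 3 4 a" and n: "2 * n \<le> L"
    and t: "tarr n lbA prA 5 6 a" "tarr n lbB prB 7 8 a"
    and ij: "i < n" "j < n" "v 10 = real i" "v 11 = real j"
    and \<pi>: "\<pi> = (if sep (PA i) (PA j) < sep (PB i) (PB j) then climb n lbA prA i j else climb n lbB prB i j)"
    and Q: "\<And>v' a' k'. v' 0 = v 0 \<Longrightarrow> (\<forall>q<9. a' q = a q) \<Longrightarrow> v' 6 = real (length \<pi>) \<Longrightarrow> holds (a' 9) \<pi> \<Longrightarrow>
      k' \<le> k + 2 * length \<pi> \<Longrightarrow> Q (v', a', k')"
  shows "hwp L 19 queryP (v, a, k) Q"
proof -
  have nL: "n \<le> L" using n by simp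
  show ?thesis
    unfolding queryP_def
  proof (rule hwp_seq, rule hwp_sepc[OF c(1) _ _ nL ij(1,2)], simp, simp, rule ij, rule ij)
    fix w :: vars
    assume w: "\<And>l. l < 12 \<or> 31 < l \<or> 15 \<le> l \<and> l < 20 \<Longrightarrow> w l = v l" "w 14 = sep (PA i) (PA j)"
    have w10: "w 10 = real i" "w 11 = real j" "w 0 = v 0" using w(1) ij by simp_all
    show "hwp L 19 (As 32 (V 14) ;; sepc 3 4 ;;
      Cd (Lt (V 32) (V 14)) (As 4 (C 5) ;; As 5 (C 6)) (As 4 (C 7) ;; As 5 (C 8)) ;; climbP) (w, a, k) Q"
    proof (rule hwp_asq[where z = "sep (PA i) (PA j)"], simp, simp add: w, rule hwp_seq,
        rule hwp_sepc[OF c(2) _ _ nL ij(1,2)], simp, simp, simp add: w10, simp add: w10)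
      fix u :: vars
      assume u: "\<And>l. l < 12 \<or> 31 < l \<or> 15 \<le> l \<and> l < 20 \<Longrightarrow> u l = (w(32 := sep (PA i) (PA j))) l" "u 14 = sep (PB i) (PB j)"
      have u': "u 10 = real i" "u 11 = real j" "u 0 = v 0" "u 32 = sep (PA i) (PA j)" using u(1) w10 by simp_all
      show "hwp L 19 (Cd (Lt (V 32) (V 14)) (As 4 (C 5) ;; As 5 (C 6)) (As 4 (C 7) ;; As 5 (C 8)) ;; climbP) (u, a, k) Q"
      proof (rule hwp_seq, rule hwp_cd)
        assume "tv (Lt (V 32) (V 14)) u a"
        then have p: "\<pi> = climb n lbA prA i j" using \<pi> u u' by simp
        show "hwp L 19 (As 4 (C 5) ;; As 5 (C 6)) (u, a, k) (\<lambda>s. hwp L 19 climbP s Q)"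
          apply (rule hwp_asq[where z = 5], simp, simp, rule hwp_as[where z = 6], simp, simp)
          apply (rule hwp_climbP[OF _ _ _ _ n t(1) ij(1,2) _ _ _ _ p])
                  apply (simp_all add: u')[8]
          apply (rule Q; simp add: u')
          done
      next
        assume "\<not> tv (Lt (V 32) (V 14)) u a"
        then have p: "\<pi> = climb n lbB prB i j" using \<pi> u u' by simp
        show "hwp L 19 (As 4 (C 7) ;; As 5 (C 8)) (u, a, k) (\<lambda>s. hwp L 19 climbP s Q)"
          apply (rule hwp_asq[where z = 7], simp, simp, rule hwp_as[where z = 8], simp, simp)
          apply (rule hwp_climbP[OF _ _ _ _ n t(2) ij(1,2) _ _ _ _ p])
                  apply (simp_all add: u')[8]
          apply (rule Q; simp add: u')
          done
      qed simp
    qed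
  qed
qed

section \<open>Preprocessing\<close>

text \<open>Array 0 holds the input, arrays 1 to 4 the coordinates of the points in the two frames,
  arrays 5 and 7 the edges of the two trees, and arrays 6 and 8 the labels of their vertices.  The
  other arrays are scratch space, and a query writes its path to array 9.\<close>

definition prepP :: hcom where "prepP =
  As 3 (C 1) ;; As 32 (C 0) ;;
  Wh (Lt (V 32) (V 0)) (As 4 (A (C 0) (C 2 \<otimes> V 32)) ;; As 5 (A (C 0) (C 2 \<otimes> V 32 \<oplus> C 1)) ;;
    As 3 (V 3 \<oplus> V 4 \<otimes> V 4 \<oplus> V 5 \<otimes> V 5) ;; As 32 (V 32 \<oplus> C 1)) ;;
  As 32 (C 0) ;;
  Wh (Lt (V 32) (V 0)) (As 4 (A (C 0) (C 2 \<otimes> V 32)) ;; As 5 (A (C 0) (C 2 \<otimes> V 32 \<oplus> C 1)) ;;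
    St (C 1) (V 32) (V 4 \<oplus> V 3) ;; St (C 2) (V 32) (V 5 \<oplus> C 3 \<otimes> V 3) ;;
    St (C 3) (V 32) (V 4 \<oplus> V 5 \<oplus> C 4 \<otimes> V 3) ;; St (C 4) (V 32) (V 5 \<ominus> V 4 \<oplus> C 2 \<otimes> V 3) ;; As 32 (V 32 \<oplus> C 1))"

text \<open>\<open>rot\<close> maps the offset \<open>(w, 3 * w)\<close> to
  \<open>(4 * w, 2 * w)\<close>. So \<open>shB w\<close> is \<open>rot\<close> after
  \<open>shA w\<close>, and if \<open>w\<close> bounds the absolute coordinates, both frames are
  nonnegative.\<close>

definition shA :: "real \<Rightarrow> pt \<Rightarrow> pt" where "shA w p = (fst p + w, snd p + 3 * w)"

definition shB :: "real \<Rightarrow> pt \<Rightarrow> pt" where "shB w p = (fst p + snd p + 4 * w, snd p - fst p + 2 * w)"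

lemma hwp_prepP:
  assumes v: "v 0 = real n" and n: "2 * n \<le> L"
    and a: "\<forall>i<n. a 0 (real (2 * i)) = fst (X i) \<and> a 0 (real (2 * i + 1)) = snd (X i)"
    and Q: "\<And>v' a' w. v' 0 = real n \<Longrightarrow> coords n (\<lambda>i. shA w (X i)) 1 2 a' \<Longrightarrow> coords n (\<lambda>i. shB w (X i)) 3 4 a' \<Longrightarrow>
      Q (v', a', k + 2 * n)"
  shows "hwp L 19 prepP (v, a, k) Q"
proof -
  \<comment> \<open>A bound on all absolute coordinates that needs no comparisons, since
    \<open>\<bar>x\<bar> \<le> x * x + 1\<close>.\<close>
  define w where "w i = 1 + (\<Sum>j<i. fst (X j) * fst (X j) + snd (X j) * snd (X j))" for i
  define Z where "Z i = (\<lambda>(v' :: vars, a' :: arrs, k' :: nat). v' 0 = real n \<and> v' 32 = real i \<and> v' 3 = w i \<and> a' = a \<and> k' = k + i)"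
    for i and k' :: nat and v' :: vars and a' :: arrs
  define Y where "Y i = (\<lambda>(v' :: vars, a' :: arrs, k' :: nat). v' 0 = real n \<and> v' 32 = real i \<and> v' 3 = w n \<and> a' 0 = a 0 \<and> k' = k + n + i \<and>
    (\<forall>j<i. a' 1 (real j) = fst (X j) + w n \<and> a' 2 (real j) = snd (X j) + 3 * w n \<and>
      a' 3 (real j) = fst (X j) + snd (X j) + 4 * w n \<and> a' 4 (real j) = snd (X j) - fst (X j) + 2 * w n))"
    for i and k' :: nat and v' :: vars and a' :: arrs
  have xa: "a 0 (2 * real i) = fst (X i)" "a 0 (2 * real i + 1) = snd (X i)" if "i < n" for i
    using a that by (simp_all add: add.commute)
  have ixs: "ix L (2 * real i)" "ix L (2 * real i + 1)" "ix L (real i)" if "i < n" for i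
  proof -
    show "ix L (2 * real i + 1)" unfolding ix_odd using that n by linarith
    show "ix L (2 * real i)" "ix L (real i)" using ix_of_nat[of L "2 * i"] that n by simp_all
  qed
  have ws: "w (Suc i) = w i + fst (X i) * fst (X i) + snd (X i) * snd (X i)" for i by (simp add: w_def)
  have wb: "\<bar>fst (X i)\<bar> \<le> w n \<and> \<bar>snd (X i)\<bar> \<le> w n" if "i < n" for i
  proof -
    let ?s = "\<lambda>j. fst (X j) * fst (X j) + snd (X j) * snd (X j)"
    have "?s i \<le> (\<Sum>j<n. ?s j)" by (rule member_le_sum) (use that in auto)
    then have b: "fst (X i) * fst (X i) + snd (X i) * snd (X i) + 1 \<le> w n" by (simp add: w_def)
    have q: "\<bar>x\<bar> \<le> x * x + 1" for x :: real
    proof -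
      have "0 \<le> (\<bar>x\<bar> - 1) * (\<bar>x\<bar> - 1)" "\<bar>x\<bar> * \<bar>x\<bar> = x * x" by simp_all
      then have "2 * \<bar>x\<bar> \<le> x * x + 1" by (simp only: algebra_simps mult_1 mult_1_right)
      then show ?thesis by linarith
    qed
    have "0 \<le> fst (X i) * fst (X i)" "0 \<le> snd (X i) * snd (X i)" by simp_all
    then show ?thesis using b q[of "fst (X i)"] q[of "snd (X i)"] by linarith
  qed
  show ?thesis
    unfolding prepP_def
  proof (rule hwp_asq[where z = 1], simp, simp, rule hwp_asq[where z = 0], simp, simp, rule hwp_seq,
      rule hwp_for[where n = n and Inv = Z and B = "k + n"])
    show "Z 0 (v(3 := 1, 32 := 0), a, k)" using v by (simp add: Z_def w_def)
    show "v' 32 = real i \<and> v' 0 = real n \<and> k' \<le> k + n" if "i \<le> n" "Z i (v', a', k')" for i v' a' k'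
      using that by (auto simp: Z_def)
  next
    fix i v' a' k' assume i: "i < n" and "Z i (v', a', k')"
    then have z: "v' 0 = real n" "v' 32 = real i" "v' 3 = w i" "a' = a" "k' = k + i" by (simp_all add: Z_def)
    show "hwp L 19 (As 4 (A (C 0) (C 2 \<otimes> V 32)) ;; As 5 (A (C 0) (C 2 \<otimes> V 32 \<oplus> C 1)) ;;
      As 3 (V 3 \<oplus> V 4 \<otimes> V 4 \<oplus> V 5 \<otimes> V 5) ;; As 32 (V 32 \<oplus> C 1)) (v', a', Suc k') (Z (Suc i))"
      unfolding z(4)
      apply (rule hwp_asq[where z = "fst (X i)"], simp add: z ixs[OF i], simp add: z xa[OF i])
      apply (rule hwp_asq[where z = "snd (X i)"], simp add: z ixs[OF i], simp add: z xa[OF i])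
      apply (rule hwp_asq[where z = "w (Suc i)"], simp, simp add: z ws)
      apply (rule hwp_as[where z = "real (Suc i)"], simp, simp add: z)
      apply (simp add: Z_def z)
      done
  next
    fix s assume s: "Z n s"
    obtain v1 a1 k1 where e: "s = (v1, a1, k1)" by (cases s) auto
    have v1: "v1 0 = real n" "v1 3 = w n" "a1 = a" "k1 = k + n" using s by (simp_all add: Z_def e)
    show "hwp L 19 (As 32 (C 0) ;;
      Wh (Lt (V 32) (V 0)) (As 4 (A (C 0) (C 2 \<otimes> V 32)) ;; As 5 (A (C 0) (C 2 \<otimes> V 32 \<oplus> C 1)) ;;
        St (C 1) (V 32) (V 4 \<oplus> V 3) ;; St (C 2) (V 32) (V 5 \<oplus> C 3 \<otimes> V 3) ;;
        St (C 3) (V 32) (V 4 \<oplus> V 5 \<oplus> C 4 \<otimes> V 3) ;; St (C 4) (V 32) (V 5 \<ominus> V 4 \<oplus> C 2 \<otimes> V 3) ;; As 32 (V 32 \<oplus> C 1))) s Q"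
      unfolding e
    proof (rule hwp_asq[where z = 0], simp, simp, rule hwp_for[where n = n and Inv = Y and B = "k + 2 * n"])
      show "Y 0 (v1(32 := 0), a1, k1)" using v1 by (simp add: Y_def)
      show "v' 32 = real i \<and> v' 0 = real n \<and> k' \<le> k + 2 * n" if "i \<le> n" "Y i (v', a', k')" for i v' a' k'
        using that by (auto simp: Y_def)
    next
      fix i v' a' k' assume i: "i < n" and y0: "Y i (v', a', k')"
      then have z: "v' 0 = real n" "v' 32 = real i" "v' 3 = w n" "a' 0 = a 0" "k' = k + n + i" by (simp_all add: Y_def)
      have old: "\<forall>j<i. a' 1 (real j) = fst (X j) + w n \<and> a' 2 (real j) = snd (X j) + 3 * w n \<and>
        a' 3 (real j) = fst (X j) + snd (X j) + 4 * w n \<and> a' 4 (real j) = snd (X j) - fst (X j) + 2 * w n"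
        using y0 by (simp add: Y_def)
      show "hwp L 19 (As 4 (A (C 0) (C 2 \<otimes> V 32)) ;; As 5 (A (C 0) (C 2 \<otimes> V 32 \<oplus> C 1)) ;;
        St (C 1) (V 32) (V 4 \<oplus> V 3) ;; St (C 2) (V 32) (V 5 \<oplus> C 3 \<otimes> V 3) ;;
        St (C 3) (V 32) (V 4 \<oplus> V 5 \<oplus> C 4 \<otimes> V 3) ;; St (C 4) (V 32) (V 5 \<ominus> V 4 \<oplus> C 2 \<otimes> V 3) ;; As 32 (V 32 \<oplus> C 1))
        (v', a', Suc k') (Y (Suc i))"
        apply (rule hwp_asq[where z = "fst (X i)"], simp add: z ixs[OF i], simp add: z xa[OF i])
        apply (rule hwp_asq[where z = "snd (X i)"], simp add: z ixs[OF i], simp add: z xa[OF i])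
        apply (rule hwp_stq[where zp = 1 and zi = "real i" and ze = "fst (X i) + w n"])
                apply (simp_all add: z ixs[OF i, unfolded ix_of_nat])[8]
        apply (rule hwp_stq[where zp = 2 and zi = "real i" and ze = "snd (X i) + 3 * w n"])
                apply (simp_all add: z ixs[OF i, unfolded ix_of_nat])[8]
        apply (rule hwp_stq[where zp = 3 and zi = "real i" and ze = "fst (X i) + snd (X i) + 4 * w n"])
                apply (simp_all add: z ixs[OF i, unfolded ix_of_nat])[8]
        apply (rule hwp_stq[where zp = 4 and zi = "real i" and ze = "snd (X i) - fst (X i) + 2 * w n"])
                apply (simp_all add: z ixs[OF i, unfolded ix_of_nat])[8]
        apply (rule hwp_as[where z = "real (Suc i)"], simp, simp add: z)
        using old apply (simp add: Y_def z less_Suc_eq)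
        done
    next
      fix s assume s: "Y n s"
      obtain v1 a1 k1 where e: "s = (v1, a1, k1)" by (cases s) auto
      have y: "v1 0 = real n" "k1 = k + 2 * n" and c: "\<forall>j<n. a1 1 (real j) = fst (X j) + w n \<and> a1 2 (real j) = snd (X j) + 3 * w n \<and>
        a1 3 (real j) = fst (X j) + snd (X j) + 4 * w n \<and> a1 4 (real j) = snd (X j) - fst (X j) + 2 * w n"
        using s by (simp_all add: Y_def e)
      have "nonneg (shA (w n) (X i)) \<and> nonneg (shB (w n) (X i))" if "i < n" for i
        using wb[OF that] unfolding nonneg_def shA_def shB_def fst_conv snd_conv by linarith
      then have "coords n (\<lambda>i. shA (w n) (X i)) 1 2 a1" "coords n (\<lambda>i. shB (w n) (X i)) 3 4 a1"
        using c by (simp_all add: coords_def shA_def shB_def)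
      then show "Q s" unfolding e using Q[of v1 "w n" a1] y by simp
    qed
  qed
qed

definition treeP :: "int \<Rightarrow> int \<Rightarrow> int \<Rightarrow> int \<Rightarrow> hcom" where
  "treeP cx cy e l = sortP cx cy ;; scanP cx cy ;; stripP e l"

lemma conn_rtrancl: "conn P E a b l \<Longrightarrow> (a, b) \<in> (E \<union> E\<inverse>)\<^sup>*"
proof (induction rule: conn.induct)
  case (conn_step a b l c l')
  then show ?case by (auto intro: rtrancl.rtrancl_into_rtrancl)
qed simp

lemma ix_of_int: "0 \<le> c \<Longrightarrow> c < int N \<Longrightarrow> ix N (of_int c)"
  unfolding ix_def by (rule exI[of _ "nat c"]) simp

lemma hwp_treeP:
  assumes c: "coords n P cx cy a" "cx \<in> {1..4}" "cy \<in> {1..4}" and el: "e \<in> {5..8}" "l \<in> {5..8}" "e \<noteq> l"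
    and n: "v 0 = real n" "0 < n" "2 * n + 4 \<le> L" "n < 2 ^ J" and inj: "inj_on P {..<n}"
    and Q: "\<And>v' a' k' es xs. v' 0 = real n \<Longrightarrow> (\<forall>q<9. q \<noteq> of_int e \<and> q \<noteq> of_int l \<longrightarrow> a' q = a q) \<Longrightarrow>
      stored n xs e l a' \<Longrightarrow> strip n (und ` set es) [] xs \<Longrightarrow> (\<forall>i<n. \<forall>j<n. pair_good P (set es) i j) \<Longrightarrow>
      k' \<le> k + (12 * n + 1 + n * J) \<Longrightarrow> Q (v', a', k')"
  shows "hwp L 19 (treeP cx cy e l) (v, a, k) Q"
proof -
  have cc: "ix 19 (of_int cx)" "ix 19 (of_int cy)" "ix 19 (of_int e)" "ix 19 (of_int l)"
    by (rule ix_of_int; use c(2,3) el in simp)+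
  have c9: "cx \<notin> {9, 10}" "cy \<notin> {9, 10}" "cx < 11" "cy < 11" "e < 17" "l < 17" "real_of_int cx < 9" "real_of_int cy < 9"
    "real_of_int e < 9" "real_of_int l < 9" "real_of_int e \<noteq> real_of_int l" using c(2,3) el by simp_all
  have nn: "nonneg (P i)" if "i < n" for i using c(1) that by (simp add: coords_def)
  show ?thesis
    unfolding treeP_def
  proof (rule hwp_seq, rule hwp_sortP[where v = v, OF c(1) cc(1,2) c9(1,2) n(1) _ n(4) inj])
    show "n < L" using n by simp
    fix v1 :: vars and a1 :: arrs and k1 xs
    assume s: "v1 0 = real n" "set xs = {..<n}" "length xs = n" "sorted_wrt (\<lambda>i j. zless (P i) (P j)) xs"
      "\<forall>j<n. a1 10 (real j) = real (xs ! j)" "\<forall>q. q \<noteq> 9 \<and> q \<noteq> 10 \<longrightarrow> a1 q = a q" "k1 \<le> k + Suc n + n * Suc J + n"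
    have z: "zs n P xs" using s nn by (simp add: zs_def)
    have c1: "coords n P cx cy a1" using c(1) s(6) c9 by (simp add: coords_def)
    show "hwp L 19 (scanP cx cy ;; stripP e l) (v1, a1, k1) Q"
    proof (rule hwp_seq, rule hwp_scanP[where v = v1, OF c1 cc(1,2) _ _ c9(3,4) z n(2) s(1,5)])
      show "n < L" "4 \<le> L" using n by simp_all
      fix v2 :: vars and a2 :: arrs and k2 es R
      assume t: "v2 0 = real n" "\<forall>q<11. a2 q = a1 q" "degs n es a2" "edges_ok n es" "length es + 1 = n" "hub P (set es) {..<n} R" "k2 \<le> k1 + 6 * n"
      have pg: "pair_good P (set es) i j" if "i < n" "j < n" for i j using t(6) that by (simp add: hub_def)
      have st: "strip n (und ` set es) es []"
        unfolding strip_def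
      proof (intro conjI allI impI)
        fix x y assume xy: "x < n \<and> y < n \<and> x \<notin> fst ` set [] \<and> y \<notin> fst ` set []"
        show "(x, y) \<in> (set es \<union> (set es)\<inverse>)\<^sup>*"
        \<comment> \<open>Connectedness of the tree is read off the distance bounds: two distinct
          points have a level, and \<open>pair_good\<close> provides a walk there.\<close>
        proof (cases "x = y")
          case False
          then have "P x \<noteq> P y" using inj_onD[OF inj, of x y] xy by auto
          then obtain i where "lvl (P x) (P y) i" using lvl_ex[of "P x" "P y"] nn xy by blast
          then show ?thesis using pg[of x y] xy conn_rtrancl unfolding pair_good_def by blast
        qed simp
      qed (use t in \<open>simp_all add: porder_def edges_ok_def\<close>)
      show "hwp L 19 (stripP e l) (v2, a2, k2) Q"
      proof (rule hwp_stripP[where v = v2, OF cc(3,4) el(3) c9(5,6) _ t(1) st t(3)])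
        show "2 * n \<le> L" using n by simp
        fix v3 :: vars and a3 :: arrs and k3 ys
        assume r: "v3 0 = real n" "strip n (und ` set es) [] ys" "stored n ys e l a3"
          "\<forall>q<17. q \<noteq> of_int e \<and> q \<noteq> of_int l \<longrightarrow> a3 q = a2 q" "k3 \<le> k2 + 3 * n"
        have k3: "k3 \<le> k + (12 * n + 1 + n * J)" using r(5) t(7) s(7) by (simp add: algebra_simps)
        have a3: "\<forall>q<9. q \<noteq> of_int e \<and> q \<noteq> of_int l \<longrightarrow> a3 q = a q" using r(4) t(2) s(6) by simp
        show "Q (v3, a3, k3)" by (rule Q[where v' = v3 and a' = a3 and k' = k3 and es = es and xs = ys, OF r(1) a3 r(3,2) _ k3]) (use pg in blast)
      qed
    qed
  qed
qed

definition buildP :: hcom where "buildP =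
  Cd (Lt (C 0) (V 0)) (prepP ;; treeP 1 2 5 6 ;; treeP 3 4 7 8) (As 0 (V 0))"

definition built :: "nat \<Rightarrow> (nat \<Rightarrow> pt) \<Rightarrow> int \<Rightarrow> int \<Rightarrow> arrs \<Rightarrow> (nat \<times> nat) list \<Rightarrow> (nat \<times> nat) list \<Rightarrow> bool" where
  "built n P e l a es xs \<longleftrightarrow> stored n xs e l a \<and> strip n (und ` set es) [] xs \<and> (\<forall>i<n. \<forall>j<n. pair_good P (set es) i j)"

lemma hwp_buildP:
  assumes v: "v 0 = real n" "0 < n" "2 * n + 4 \<le> L" "n < 2 ^ J"
    and a: "\<forall>i<n. a 0 (real (2 * i)) = fst (X i) \<and> a 0 (real (2 * i + 1)) = snd (X i)" and inj: "inj_on X {..<n}"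
    and Q: "\<And>v' a' k' w esA xsA esB xsB. v' 0 = real n \<Longrightarrow> coords n (\<lambda>i. shA w (X i)) 1 2 a' \<Longrightarrow> coords n (\<lambda>i. shB w (X i)) 3 4 a' \<Longrightarrow>
      built n (\<lambda>i. shA w (X i)) 5 6 a' esA xsA \<Longrightarrow> built n (\<lambda>i. shB w (X i)) 7 8 a' esB xsB \<Longrightarrow>
      k' \<le> k + (26 * n + 2 + 2 * (n * J)) \<Longrightarrow> Q (v', a', k')"
  shows "hwp L 19 buildP (v, a, k) Q"
  unfolding buildP_def
proof (rule hwp_cd)
  have L: "2 * n \<le> L" using v by simp
  have iA: "inj_on (\<lambda>i. shA w (X i)) {..<n}" "inj_on (\<lambda>i. shB w (X i)) {..<n}" for w
  proof -
    have "shA w p = shA w q \<Longrightarrow> p = q" "shB w p = shB w q \<Longrightarrow> p = q" for p q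
      by (simp_all add: shA_def shB_def prod_eq_iff)
    then show "inj_on (\<lambda>i. shA w (X i)) {..<n}" "inj_on (\<lambda>i. shB w (X i)) {..<n}" using inj unfolding inj_on_def by blast+
  qed
  show "hwp L 19 (prepP ;; treeP 1 2 5 6 ;; treeP 3 4 7 8) (v, a, k) Q"
  proof (rule hwp_seq, rule hwp_prepP[where v = v and a = a and X = X, OF v(1) L a])
    fix v1 :: vars and a1 :: arrs and w
    assume c: "v1 0 = real n" "coords n (\<lambda>i. shA w (X i)) 1 2 a1" "coords n (\<lambda>i. shB w (X i)) 3 4 a1"
    show "hwp L 19 (treeP 1 2 5 6 ;; treeP 3 4 7 8) (v1, a1, k + 2 * n) Q"
    proof (rule hwp_seq, rule hwp_treeP[where v = v1, OF c(2) _ _ _ _ _ c(1) v(2-4) iA(1)])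
      fix v2 :: vars and a2 :: arrs and k2 es xs
      assume s: "v2 0 = real n" "\<forall>q<9. q \<noteq> of_int 5 \<and> q \<noteq> of_int 6 \<longrightarrow> a2 q = a1 q" "stored n xs 5 6 a2" "strip n (und ` set es) [] xs"
        "\<forall>i<n. \<forall>j<n. pair_good (\<lambda>i. shA w (X i)) (set es) i j" "k2 \<le> k + 2 * n + (12 * n + 1 + n * J)"
      have c2: "coords n (\<lambda>i. shA w (X i)) 1 2 a2" "coords n (\<lambda>i. shB w (X i)) 3 4 a2" using c(2,3) s(2) by (simp_all add: coords_def)
      show "hwp L 19 (treeP 3 4 7 8) (v2, a2, k2) Q"
      proof (rule hwp_treeP[where v = v2, OF c2(2) _ _ _ _ _ s(1) v(2-4) iA(2)])
        fix v3 :: vars and a3 :: arrs and k3 esB ys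
        assume t: "v3 0 = real n" "\<forall>q<9. q \<noteq> of_int 7 \<and> q \<noteq> of_int 8 \<longrightarrow> a3 q = a2 q" "stored n ys 7 8 a3" "strip n (und ` set esB) [] ys"
          "\<forall>i<n. \<forall>j<n. pair_good (\<lambda>i. shB w (X i)) (set esB) i j" "k3 \<le> k2 + (12 * n + 1 + n * J)"
        have c3: "coords n (\<lambda>i. shA w (X i)) 1 2 a3" "coords n (\<lambda>i. shB w (X i)) 3 4 a3" "stored n xs 5 6 a3"
          using c2 s(3) t(2) by (simp_all add: coords_def stored_def)
        show "Q (v3, a3, k3)"
          by (rule Q[where v' = v3 and a' = a3 and k' = k3 and w = w and esA = es and xsA = xs and esB = esB and xsB = ys, OF t(1) c3(1,2)])
            (use c3(3) s t in \<open>simp_all add: built_def\<close>)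
      qed simp_all
    qed simp_all
  qed
qed (use v in simp_all)

section \<open>The oracle\<close>

text \<open>On a cycle, a vertex with the smallest label would have two different neighbours, but
  every edge from it to a vertex of the cycle leads to its \<open>par\<close>.\<close>

lemma no_cycle:
  fixes lab :: "'a \<Rightarrow> nat"
  assumes E: "\<And>e. e \<in> E \<Longrightarrow> \<exists>x. e = {x, par x} \<and> lab x < lab (par x)"
  shows "\<not> is_cycle E c"
proof
  assume c: "is_cycle E c"
  then have len: "3 \<le> length c" and dis: "distinct c" and suc: "successively (\<lambda>u v. {u, v} \<in> E) c"
    and close: "{last c, hd c} \<in> E" by (auto simp: is_cycle_def)
  let ?m = "length c"
  have "c \<noteq> []" using len by auto
  then obtain x where x: "x \<in> set c" "\<And>z. z \<in> set c \<Longrightarrow> lab x \<le> lab z"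
    using ex_has_least_nat[of "\<lambda>x. x \<in> set c" "hd c" lab] by auto
  obtain i where i: "i < ?m" "c ! i = x" using x(1) by (auto simp: in_set_conv_nth)
  have nb: "c ! j = par x" if j: "j < ?m" and e: "{c ! j, x} \<in> E" for j
  proof -
    obtain y where y: "{c ! j, x} = {y, par y}" "lab y < lab (par y)" using E[OF e] by blast
    have "lab x \<le> lab (c ! j)" using x(2) nth_mem[OF j] by blast
    then have "x \<noteq> par y \<or> c ! j = par y" using y by (auto simp: doubleton_eq_iff)
    then show ?thesis using y by (auto simp: doubleton_eq_iff)
  qed
  have step: "{c ! j, c ! Suc j} \<in> E" if "Suc j < ?m" for j using suc that by (simp add: successively_conv_nth)
  have close': "{c ! (?m - 1), c ! 0} \<in> E" using close \<open>c \<noteq> []\<close> by (simp add: last_conv_nth hd_conv_nth)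
  let ?n = "if Suc i = ?m then 0 else Suc i" and ?p = "if i = 0 then ?m - 1 else i - 1"
  have n: "?n < ?m" "?p < ?m" "?n \<noteq> ?p" using i(1) len by auto
  have "{c ! ?n, x} \<in> E"
  proof (cases "Suc i = ?m")
    case True
    then have "i = ?m - 1" by simp
    then show ?thesis using close' i(2) True by (simp add: insert_commute)
  next
    case False
    then show ?thesis using step[of i] i by (simp add: insert_commute)
  qed
  moreover have "{c ! ?p, x} \<in> E"
  proof (cases "i = 0")
    case True
    then show ?thesis using close' i(2) by simp
  next
    case False
    then show ?thesis using step[of "i - 1"] i by simp
  qed
  ultimately have "c ! ?n = c ! ?p" using nb[OF n(1)] nb[OF n(2)] by simp
  then show False using nth_eq_iff_index_eq[OF dis n(1,2)] n(3) by blast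
qed

lemma path_map:
  assumes "is_path {..<n} {e. f ` e \<in> E} a \<pi> b" "inj_on f {..<n}"
  shows "is_path (f ` {..<n}) E (f a) (map f \<pi>) (f b)"
proof -
  have p: "\<pi> \<noteq> []" "hd \<pi> = a" "last \<pi> = b" "set \<pi> \<subseteq> {..<n}" "distinct \<pi>" "successively (\<lambda>u v. f ` {u, v} \<in> E) \<pi>"
    using assms(1) by (auto simp: is_path_def)
  have "inj_on f (set \<pi>)" using assms(2) p(4) by (rule inj_on_subset)
  then have "distinct (map f \<pi>)" using p(5) by (simp add: distinct_map)
  moreover have "successively (\<lambda>u v. {u, v} \<in> E) (map f \<pi>)" using p(6) by (simp add: successively_map)
  ultimately show ?thesis unfolding is_path_def using p(1-4) by (auto simp: hd_map last_map)
qed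

lemma path_length_scale:
  assumes "\<And>x y. dist (f x) (f y) = s * dist (g x) (g y)"
  shows "path_length (map f \<pi>) = s * path_length (map g \<pi>)"
proof (induction \<pi>)
  case (Cons x \<pi>)
  show ?case
  proof (cases \<pi>)
    case Nil
    then show ?thesis by (simp add: path_length_def)
  next
    case (Cons y ys)
    then show ?thesis using Cons.IH assms by (simp add: path_length_Cons distrib_left)
  qed
qed (simp add: path_length_def)

definition tree_edges :: "'a list \<Rightarrow> (nat \<times> nat) list \<Rightarrow> 'a set set" where
  "tree_edges ps xs = (\<lambda>(i, j). {ps ! i, ps ! j}) ` set xs"

text \<open>Stripping reorders and reorients the edges but keeps them as unordered pairs, so the
  walks known in \<open>es\<close> also bound the climbs in the stored tree \<open>xs\<close>. The
  path itself is stated for the original points, its length in the frame \<open>P\<close>.\<close>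

lemma built_tree:
  assumes b: "built n P e l a es xs" and n: "n = length ps" "distinct ps"
  shows "\<exists>lb pr. tarr n lb pr e l a \<and> spanning_tree (set ps) (tree_edges ps xs) \<and>
    (\<forall>i<n. \<forall>j<n. length (climb n lb pr i j) \<le> n \<and> climb n lb pr i j \<noteq> [] \<and> set (climb n lb pr i j) \<subseteq> {..<n} \<and>
      is_path (set ps) (tree_edges ps xs) (ps ! i) (map ((!) ps) (climb n lb pr i j)) (ps ! j) \<and>
      (\<forall>d. conn P (set es) i j d \<longrightarrow> clen P n lb pr i j \<le> d))"
proof -
  have st: "stored n xs e l a" and s: "strip n (und ` set es) [] xs" using b by (simp_all add: built_def)
  obtain lb pr where t: "tarr n lb pr e l a" and x1: "\<And>x y. (x, y) \<in> set xs \<Longrightarrow> x < n \<and> lb x < n \<and> pr x = y"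
    and x2: "\<And>u. u < n \<Longrightarrow> lb u < n \<Longrightarrow> (u, pr u) \<in> set xs" using stored_tree[OF st s] by blast
  have pt: "ptree n lb pr" using t by (simp add: tarr_def)
  have ss: "edges_ok n xs" "und ` set xs = und ` set es" using s by (auto simp: strip_def porder_def)
  let ?f = "(!) ps" and ?E = "tree_edges ps xs"
  have inj: "inj_on ?f {..<n}" using n by (simp add: inj_on_def nth_eq_iff_index_eq)
  have im: "?f ` {..<n} = set ps" using n(1) by (auto simp: set_conv_nth)
  have up: "{u, pr u} \<in> {e. ?f ` e \<in> ?E}" if "u < n" "lb u < n" for u
  proof -
    have "(\<lambda>(i, j). {ps ! i, ps ! j}) (u, pr u) \<in> ?E" unfolding tree_edges_def by (rule imageI[OF x2[OF that]])
    then show ?thesis by simp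
  qed
  have path: "is_path {..<n} {e. ?f ` e \<in> ?E} i (climb n lb pr i j) j" if "i < n" "j < n" for i j
    using climb_path[OF pt that, where E = "{e. ?f ` e \<in> ?E}"] up by blast
  have path': "is_path (set ps) ?E (ps ! i) (map ?f (climb n lb pr i j)) (ps ! j)" if "i < n" "j < n" for i j
    using path_map[OF path[OF that] inj] unfolding im .
  have basic: "climb n lb pr i j \<noteq> []" "set (climb n lb pr i j) \<subseteq> {..<n}" "length (climb n lb pr i j) \<le> n" if "i < n" "j < n" for i j
  proof -
    have p: "climb n lb pr i j \<noteq> []" "distinct (climb n lb pr i j)" "set (climb n lb pr i j) \<subseteq> {..<n}"
      using path[OF that] by (auto simp: is_path_def)
    have "card (set (climb n lb pr i j)) \<le> card {..<n}" by (rule card_mono) (use p(3) in simp_all)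
    then show "climb n lb pr i j \<noteq> []" "set (climb n lb pr i j) \<subseteq> {..<n}" "length (climb n lb pr i j) \<le> n"
      using p distinct_card[OF p(2)] by simp_all
  qed
  have short: "clen P n lb pr i j \<le> d" if c: "conn P (set es) i j d" and ij: "j < n" for i j d
  proof (rule clen_conn[OF conn_sym[OF c] pt ij])
    fix x y assume "(x, y) \<in> set es"
    then have "{x, y} \<in> und ` set xs" unfolding ss(2) by force
    then obtain x' y' where e: "(x', y') \<in> set xs" "{x, y} = {x', y'}" by auto
    have "x' < n \<and> y' < n" using e(1) ss(1) by (auto simp: edges_ok_def)
    then show "x < n \<and> y < n \<and> (lb x < n \<and> pr x = y \<or> lb y < n \<and> pr y = x)"
      using x1[OF e(1)] e(2) by (auto simp: doubleton_eq_iff)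
  qed
  define ixf where "ixf q = inv_into {..<n} ?f q" for q
  have ixf: "ixf (ps ! u) = u" if "u < n" for u unfolding ixf_def using inv_into_f_f[OF inj] that by simp
  have span: "spanning_tree (set ps) ?E"
    unfolding spanning_tree_def
  proof (intro conjI)
    show "?E \<subseteq> {{u, v} |u v. u \<in> set ps \<and> v \<in> set ps \<and> u \<noteq> v}"
    proof
      fix e assume "e \<in> ?E"
      then obtain i j where ij: "(i, j) \<in> set xs" "e = {ps ! i, ps ! j}" by (auto simp: tree_edges_def)
      then have "i < n" "j < n" "i \<noteq> j" using ss(1) by (auto simp: edges_ok_def)
      then have "ps ! i \<in> set ps" "ps ! j \<in> set ps" "ps ! i \<noteq> ps ! j" using n by (simp_all add: nth_eq_iff_index_eq)
      then show "e \<in> {{u, v} |u v. u \<in> set ps \<and> v \<in> set ps \<and> u \<noteq> v}" using ij(2) by blast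
    qed
    show "\<forall>u\<in>set ps. \<forall>v\<in>set ps. \<exists>\<pi>. is_path (set ps) ?E u \<pi> v"
    proof (intro ballI)
      fix u v assume "u \<in> set ps" "v \<in> set ps"
      then obtain i j where "i < n" "u = ps ! i" "j < n" "v = ps ! j" using n(1) by (auto simp: in_set_conv_nth)
      then show "\<exists>\<pi>. is_path (set ps) ?E u \<pi> v" using path' by blast
    qed
    have "\<not> is_cycle ?E c" for c
    proof (rule no_cycle[where par = "\<lambda>q. ps ! pr (ixf q)" and lab = "\<lambda>q. lb (ixf q)"])
      fix e assume "e \<in> ?E"
      then obtain i j where ij: "(i, j) \<in> set xs" "e = {ps ! i, ps ! j}" by (auto simp: tree_edges_def)
      have i: "i < n" "lb i < n" "pr i = j" using x1[OF ij(1)] by simp_all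
      have "j < n" "lb i < lb j" using ptree_up[OF pt i(1,2)] i(3) by simp_all
      then show "\<exists>x. e = {x, ps ! pr (ixf x)} \<and> lb (ixf x) < lb (ixf (ps ! pr (ixf x)))"
        using ij(2) i ixf[OF i(1)] ixf[of j] by (intro exI[of _ "ps ! i"]) simp
    qed
    then show "\<nexists>c. is_cycle ?E c" by blast
  qed
  show ?thesis
  proof (rule exI[of _ lb], rule exI[of _ pr], intro conjI allI impI)
    fix i j assume ij: "i < n" "j < n"
    show "length (climb n lb pr i j) \<le> n" "climb n lb pr i j \<noteq> []" "set (climb n lb pr i j) \<subseteq> {..<n}" by (rule basic[OF ij])+
    show "is_path (set ps) ?E (ps ! i) (map ?f (climb n lb pr i j)) (ps ! j)" by (rule path'[OF ij])
    show "clen P n lb pr i j \<le> d" if "conn P (set es) i j d" for d by (rule short[OF that ij(2)])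
  qed (rule t span)+
qed

section \<open>Memory layout and running time\<close>

definition tob :: "nat \<Rightarrow> (nat \<Rightarrow> real) \<Rightarrow> arrs" where "tob L h x y = h (nat \<lfloor>x\<rfloor> * L + nat \<lfloor>y\<rfloor>)"

lemma rel_tob: "r 1 = real L \<Longrightarrow> rel L N (\<lambda>i. r (2 * i)) (tob L h) r h"
  by (simp add: rel_def tob_def)

definition mulC :: "nat \<Rightarrow> int \<Rightarrow> com" where "mulC i k = Seq (Const 3 k) (Binary Mul i 1 3)"

lemma exec_mulC: "exec M (mulC i k) (r, h) 2 (r(3 := of_int k, i := r 1 * of_int k), h)"
proof -
  have "exec M (Binary Mul i 1 3) (r(3 := of_int k), h) 1 (r(3 := of_int k, i := r 1 * of_int k), h)"
    by (rule exec.Binary) simp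
  from exec.Seq[OF exec.Const this] show ?thesis by (simp only: mulC_def one_add_one)
qed

text \<open>The length \<open>L = 4 * n + 8\<close> gives each array room for \<open>2 * n\<close>
  coordinates or edge ends and, for tiny \<open>n\<close>, for four representatives. The result
  consists of arrays 0 to 8 and has size \<open>9 * L\<close>; queries write only beyond it.
  Register 1 is overwritten last, since the other two values are computed from it.\<close>

definition buildC :: com where "buildC =
  Seq (Const 3 4) (Seq (Binary Mul 1 0 3) (Seq (Const 3 8) (Seq (Binary Add 1 1 3)
    (Seq (cc buildP) (Seq (mulC 0 9) (Seq (mulC 2 7) (mulC 1 5)))))))"

lemma exec_buildC:
  assumes n: "r 0 = real n" and L: "L = 4 * n + 8" and hw: "\<And>v. v 0 = real n \<Longrightarrow> hwp L 19 buildP (v, tob L h, 0) Q"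
  shows "\<exists>t r' D v' a k. exec (19 * L) buildC (r, h) t (r', D) \<and> r' 0 = real (9 * L) \<and> r' 1 = real (5 * L) \<and> r' 2 = real (7 * L) \<and>
    Q (v', a, k) \<and> (\<forall>q<19. \<forall>i<L. D (q * L + i) = a (real q) (real i)) \<and> t \<le> hsz buildP * (1 + k) + 10"
proof -
  define r1 where "r1 = r(3 := of_int 4)"
  define r2 where "r2 = r1(1 := r 0 * 4)"
  define r3 where "r3 = r2(3 := of_int 8)"
  define r4 where "r4 = r3(1 := r 0 * 4 + 8)"
  have e1: "exec (19 * L) (Const 3 4) (r, h) 1 (r1, h)" unfolding r1_def by (rule exec.Const)
  have e2: "exec (19 * L) (Binary Mul 1 0 3) (r1, h) 1 (r2, h)" unfolding r2_def by (rule exec.Binary) (simp add: r1_def)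
  have e3: "exec (19 * L) (Const 3 8) (r2, h) 1 (r3, h)" unfolding r3_def by (rule exec.Const)
  have e4: "exec (19 * L) (Binary Add 1 1 3) (r3, h) 1 (r4, h)" unfolding r4_def
    by (rule exec.Binary) (simp add: r3_def r2_def)
  have r4: "r4 1 = real L" "r4 0 = real n" by (simp_all del: One_nat_def add: r4_def r3_def r2_def r1_def n L)
  have "hwp L 19 buildP (\<lambda>i. r4 (2 * i), tob L h, 0) Q" by (rule hw) (simp add: r4)
  from hwp_sound[OF order_refl this rel_tob[where r = r4 and L = L, OF r4(1)]]
  obtain t r' D v' a k where x: "exec (19 * L) (cc buildP) (r4, h) t (r', D)" "rel L 19 v' a r' D" "Q (v', a, k)"
    "t \<le> hsz buildP * (1 + (k - 0))" by blast
  have r': "r' 1 = real L" "\<forall>q<19. \<forall>i<L. D (q * L + i) = a (real q) (real i)" using x(2) by (simp_all add: rel_def)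
  note m = exec.Seq[OF exec_mulC[of "19 * L" 0 9 r' D] exec.Seq[OF exec_mulC exec_mulC]]
  have "\<exists>r''. exec (19 * L) (Seq (mulC 0 9) (Seq (mulC 2 7) (mulC 1 5))) (r', D) (2 + (2 + 2)) (r'', D) \<and>
    r'' 0 = real (9 * L) \<and> r'' 1 = real (5 * L) \<and> r'' 2 = real (7 * L)"
    by (rule exI, rule conjI, rule m) (simp del: One_nat_def add: r')
  then obtain r'' where m: "exec (19 * L) (Seq (mulC 0 9) (Seq (mulC 2 7) (mulC 1 5))) (r', D) (2 + (2 + 2)) (r'', D)"
    and r'': "r'' 0 = real (9 * L)" "r'' 1 = real (5 * L)" "r'' 2 = real (7 * L)" by blast
  note E = exec.Seq[OF e1 exec.Seq[OF e2 exec.Seq[OF e3 exec.Seq[OF e4 exec.Seq[OF x(1) m]]]]]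
  have tt: "1 + (1 + (1 + (1 + (t + (2 + (2 + 2)))))) \<le> hsz buildP * (1 + k) + 10" using x(4) by simp
  show ?thesis
    using E[folded buildC_def] r'' x(3) r'(2) tt by blast
qed

text \<open>Only the size \<open>9 * L\<close> is passed to a query, so \<open>L\<close> is
  recovered by division, after the indices have been moved to the registers of variables 10 and 11.
  Register 0 can stay as it is: \<open>9 * L\<close> is also the address of array 9 with the output
  path.\<close>

definition queryC :: com where "queryC =
  Seq (Move 20 1) (Seq (Move 22 2) (Seq (Const 3 9) (Seq (Binary Div 1 0 3) (Seq (cc queryP) (Move 1 12)))))"

lemma exec_queryC:
  assumes r: "r 0 = real (9 * L)" "r 1 = real i" "r 2 = real j" and ij: "i < n" "j < n" "2 * n \<le> L"
    and h: "\<And>q x. q < 9 \<Longrightarrow> x < L \<Longrightarrow> h (q * L + x) = a (real q) (real x)"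
    and c: "coords n PA 1 2 a" "coords n PB 3 4 a" and t: "tarr n lbA prA 5 6 a" "tarr n lbB prB 7 8 a"
    and \<pi>: "\<pi> = (if sep (PA i) (PA j) < sep (PB i) (PB j) then climb n lbA prA i j else climb n lbB prB i j)" "length \<pi> \<le> L"
  shows "\<exists>t r' h'. exec (19 * L) queryC (r, h) t (r', h') \<and> (\<forall>k<9 * L. h' k = h k) \<and> r' 0 = real (9 * L) \<and>
    r' 1 = real (length \<pi>) \<and> (\<forall>k<length \<pi>. h' (9 * L + k) = real (\<pi> ! k)) \<and> t \<le> hsz queryP * (1 + 2 * length \<pi>) + 5"
proof -
  have L0: "0 < L" using ij by simp
  define r1 where "r1 = r(20 := r 1)"
  define r2 where "r2 = r1(22 := r1 2)"
  define r3 where "r3 = r2(3 := of_int 9)"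
  define r4 where "r4 = r3(1 := real L)"
  have e1: "exec (19 * L) (Move 20 1) (r, h) 1 (r1, h)" unfolding r1_def by (rule exec.Move)
  have e2: "exec (19 * L) (Move 22 2) (r1, h) 1 (r2, h)" unfolding r2_def by (rule exec.Move)
  have e3: "exec (19 * L) (Const 3 9) (r2, h) 1 (r3, h)" unfolding r3_def by (rule exec.Const)
  have e4: "exec (19 * L) (Binary Div 1 0 3) (r3, h) 1 (r4, h)" unfolding r4_def
    by (rule exec.Binary) (simp add: r3_def r2_def r1_def r)
  have r4: "r4 1 = real L" "r4 0 = real (9 * L)" "r4 20 = real i" "r4 22 = real j"
    by (simp_all del: One_nat_def add: r4_def r3_def r2_def r1_def r)
  let ?v = "\<lambda>i. r4 (2 * i)" and ?a = "tob L h"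
  have ag: "?a (real q) (real x) = a (real q) (real x)" if "q < 9" "x < L" for q x using h[OF that] by (simp add: tob_def)
  have uL: "u < L" if "u < n" for u using that ij by simp
  have c': "coords n PA 1 2 ?a" "coords n PB 3 4 ?a"
    unfolding coords_def
  proof (safe)
    fix u assume u: "u < n"
    show "?a (of_int 1) (real u) = fst (PA u)" "?a (of_int 2) (real u) = snd (PA u)" "nonneg (PA u)"
      "?a (of_int 3) (real u) = fst (PB u)" "?a (of_int 4) (real u) = snd (PB u)" "nonneg (PB u)"
      using ag[of 1 u] ag[of 2 u] ag[of 3 u] ag[of 4 u] c u uL[OF u] by (simp_all add: coords_def)
  qed
  have tarr: "tarr n lb pr (int e) (int l) ?a" if "tarr n lb pr (int e) (int l) a" "e < 9" "l < 9" for lb pr e l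
    unfolding tarr_def
  proof (intro conjI allI impI)
    show "ptree n lb pr" using that(1) by (simp add: tarr_def)
    fix u assume u: "u < n"
    show "?a (of_int (int l)) (real u) = real (lb u)" using that(1) u ag[OF that(3) uL[OF u]] by (simp add: tarr_def)
    assume lu: "lb u < n"
    have "2 * lb u + 1 < L" using lu ij by simp
    from ag[OF that(2) this] that(1) u lu show "?a (of_int (int e)) (real (2 * lb u + 1)) = real (pr u)"
      unfolding tarr_def of_int_of_nat_eq by metis
  qed
  have t': "tarr n lbA prA 5 6 ?a" "tarr n lbB prB 7 8 ?a"
    using tarr[of lbA prA 5 6] tarr[of lbB prB 7 8] t by simp_all
  let ?Q = "\<lambda>(v', a', k'). v' 0 = real (9 * L) \<and> (\<forall>q<9. a' q = ?a q) \<and> v' 6 = real (length \<pi>) \<and> holds (a' 9) \<pi> \<and>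
      k' \<le> 2 * length \<pi>"
  have "hwp L 19 queryP (?v, ?a, 0) ?Q"
    by (rule hwp_queryP[where v = ?v, OF c' ij(3) t' ij(1,2) _ _ \<pi>(1)]) (use r4 in simp_all)
  from hwp_sound[OF order_refl this rel_tob[where r = r4 and L = L, OF r4(1)]]
  obtain t r' D v' a' k where x: "exec (19 * L) (cc queryP) (r4, h) t (r', D)" "rel L 19 v' a' r' D" "?Q (v', a', k)"
    "t \<le> hsz queryP * (1 + (k - 0))" by blast
  have q: "v' 0 = real (9 * L)" "\<forall>q<9. a' q = ?a q" "v' 6 = real (length \<pi>)" "holds (a' 9) \<pi>" "k \<le> 2 * length \<pi>" using x(3) by simp_all
  have rv: "r' (2 * i) = v' i" for i using x(2) by (simp add: rel_def)
  have D: "D (q * L + y) = a' (real q) (real y)" if "q < 19" "y < L" for q y using x(2) that by (simp add: rel_def)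
  have keep: "D k = h k" if k: "k < 9 * L" for k
  proof -
    have d: "k div L < 9" "k mod L < L" "k = k div L * L + k mod L" using k L0 by (simp_all add: less_mult_imp_div_less)
    have "D (k div L * L + k mod L) = ?a (real (k div L)) (real (k mod L))" using D[of "k div L" "k mod L"] q(2) d(1,2) by simp
    also have "\<dots> = h (k div L * L + k mod L)" by (simp add: tob_def)
    finally show ?thesis by (simp only: d(3)[symmetric])
  qed
  have out: "D (9 * L + k) = real (\<pi> ! k)" if "k < length \<pi>" for k
    using D[of 9 k] q(4) that \<pi>(2) by (simp add: holds_def)
  note E = exec.Seq[OF e1 exec.Seq[OF e2 exec.Seq[OF e3 exec.Seq[OF e4 exec.Seq[OF x(1) exec.Move[of "19 * L" 1 12]]]]]]
  have "hsz queryP * (1 + k) \<le> hsz queryP * (1 + 2 * length \<pi>)" using q(5) by (intro mult_le_mono2) simp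
  moreover have "t \<le> hsz queryP * (1 + k)" using x(4) by simp
  ultimately have tt: "1 + (1 + (1 + (1 + (t + 1)))) \<le> hsz queryP * (1 + 2 * length \<pi>) + 5" by linarith
  have r'': "(r'(1 := r' 12)) 0 = real (9 * L)" "(r'(1 := r' 12)) 1 = real (length \<pi>)" using rv[of 0] rv[of 6] q(1,3) by simp_all
  show ?thesis
    using E[folded queryC_def] keep r'' out tt by blast
qed

definition depth :: "nat \<Rightarrow> nat" where "depth n = nat \<lceil>log 2 (real n + 1)\<rceil>"

lemma less_depth: "n < 2 ^ depth n"
proof -
  have "real n + 1 = 2 powr log 2 (real n + 1)" by simp
  also have "\<dots> \<le> 2 powr real (depth n)" by (intro powr_mono) (simp_all add: depth_def)
  also have "\<dots> = 2 ^ depth n" by (simp add: powr_realpow)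
  finally have "real n < 2 ^ depth n" by linarith
  then have "real n < real (2 ^ depth n)" by simp
  then show ?thesis unfolding of_nat_less_iff .
qed

lemma build_time: "(\<lambda>n. real (c * (27 * n + 3 + 2 * (n * depth n)) + 10)) \<in> O(\<lambda>n. real n * ln (real n))"
\<comment> \<open>From \<open>n = 3\<close> on, \<open>ln n \<ge> 1\<close> and
  \<open>depth n \<le> 5 * ln n\<close>, so every term is at most a multiple of
  \<open>n * ln n\<close>.\<close>
proof (rule bigoI[where c = "40 * real c + 10"], rule eventually_sequentiallyI[of 3])
  fix n :: nat assume n: "3 \<le> n"
  have l1: "1 \<le> ln (real n)" using n exp_le by (subst ln_ge_iff) auto
  have "3 * real n \<le> real n * real n" using n by (intro mult_right_mono) simp_all
  then have "real n + 1 \<le> (real n)\<^sup>2" unfolding power2_eq_square using n by linarith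
  then have "ln (real n + 1) \<le> ln ((real n)\<^sup>2)" using n by (intro ln_mono) auto
  then have l2: "ln (real n + 1) \<le> 2 * ln (real n)" using n by (simp add: ln_realpow)
  have "log 2 (real n + 1) \<le> 4 * ln (real n)"
  proof -
    have "(1 / 2 :: real) \<le> ln 2" using ln2_ge_two_thirds by simp
    then have "4 * ln (real n) * (1 / 2) \<le> 4 * ln (real n) * ln 2" using l1 by (intro mult_left_mono) simp_all
    then have "ln (real n + 1) \<le> 4 * ln (real n) * ln 2" using l2 by linarith
    then show ?thesis by (simp add: log_def divide_le_eq)
  qed
  moreover have "real (depth n) \<le> log 2 (real n + 1) + 1"
  proof -
    have "0 \<le> log 2 (real n + 1)" by simp
    then show ?thesis unfolding depth_def by linarith
  qed
  ultimately have d: "real (depth n) \<le> 5 * ln (real n)" using l1 by linarith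
  let ?g = "real n * ln (real n)"
  have g: "real n \<le> ?g" using mult_left_mono[OF l1, of "real n"] by simp
  have nd: "real n * real (depth n) \<le> 5 * ?g" using mult_left_mono[OF d, of "real n"] by simp
  have "27 * real n + 3 + 2 * (real n * real (depth n)) \<le> 40 * ?g" using g nd n by linarith
  then have "real c * (27 * real n + 3 + 2 * (real n * real (depth n))) \<le> real c * (40 * ?g)" by (rule mult_left_mono) simp
  moreover have "1 \<le> ?g" using g n by linarith
  ultimately have "real c * (27 * real n + 3 + 2 * (real n * real (depth n))) + 10 \<le> (40 * real c + 10) * ?g"
    by (simp add: algebra_simps)
  then show "norm (real (c * (27 * n + 3 + 2 * (n * depth n)) + 10)) \<le> (40 * real c + 10) * norm (real n * ln (real n))"
    using l1 by (simp add: abs_mult)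
qed

section \<open>The oracle for a given array of points\<close>

definition xy :: "real^2 \<Rightarrow> pt" where "xy p = (p $ 1, p $ 2)"

lemma dist_xy: "dist (xy p) (xy q) = dist p q"
  by (simp add: xy_def dist_pt dist_vec_def L2_set_def UNIV_2 dist_real_def)

lemma dist_sh: "dist (shA w p) (shA w q) = 1 * dist p q" "dist (shB w p) (shB w q) = sqrt 2 * dist p q"
proof -
  show "dist (shA w p) (shA w q) = 1 * dist p q" by (simp add: dist_pt shA_def)
  have "(fst p + snd p + 4 * w - (fst q + snd q + 4 * w))\<^sup>2 + (snd p - fst p + 2 * w - (snd q - fst q + 2 * w))\<^sup>2 =
    2 * ((fst p - fst q)\<^sup>2 + (snd p - snd q)\<^sup>2)" by (simp add: power2_eq_square algebra_simps)
  then show "dist (shB w p) (shB w q) = sqrt 2 * dist p q" unfolding dist_pt shB_def fst_conv snd_conv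
    by (simp only: real_sqrt_mult)
qed

lemma oracle_nonempty:
  assumes n: "n = length ps" "0 < n" "distinct (ps :: (real^2) list)"
  shows "two_tree_oracle buildC queryC (hsz buildP * (27 * n + 3 + 2 * (n * depth n)) + 10) (19 * (4 * n + 8))
    (\<lambda>m. hsz queryP * (1 + 2 * (m + 1)) + 5) (4 * sqrt 26) ps"
proof -
  define L where "L = 4 * n + 8"
  have L: "2 * n + 4 \<le> L" "2 * n \<le> L" "n \<le> L" by (simp_all add: L_def)
  define X where "X i = xy (ps ! i)" for i
  obtain r h where rh: "input_state ps = (r, h)" by (cases "input_state ps") auto
  have r0: "r 0 = real n" and hX: "\<And>i. i < n \<Longrightarrow> h (2 * i) = fst (X i) \<and> h (2 * i + 1) = snd (X i)"
    using rh n(1) by (auto simp: input_state_def X_def xy_def)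
  have injX: "inj_on X {..<n}"
  proof (rule inj_onI)
    fix i j assume ij: "i \<in> {..<n}" "j \<in> {..<n}" "X i = X j"
    then have "dist (ps ! i) (ps ! j) = 0" using dist_xy[of "ps ! i" "ps ! j"] by (simp add: X_def)
    then show "i = j" using ij n by (simp add: nth_eq_iff_index_eq)
  qed
  have a0: "\<forall>i<n. tob L h 0 (real (2 * i)) = fst (X i) \<and> tob L h 0 (real (2 * i + 1)) = snd (X i)"
  proof (intro allI impI)
    fix i assume "i < n"
    moreover have "nat \<lfloor>real m\<rfloor> = m" for m by simp
    ultimately show "tob L h 0 (real (2 * i)) = fst (X i) \<and> tob L h 0 (real (2 * i + 1)) = snd (X i)"
      unfolding tob_def using hX by (metis add_0 floor_zero mult_zero_left nat_zero_as_int of_nat_0)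
  qed
  let ?Q = "\<lambda>(v' :: vars, a', k'). k' \<le> 26 * n + 2 + 2 * (n * depth n) \<and> (\<exists>w esA xsA esB xsB.
    coords n (\<lambda>i. shA w (X i)) 1 2 a' \<and> coords n (\<lambda>i. shB w (X i)) 3 4 a' \<and>
      built n (\<lambda>i. shA w (X i)) 5 6 a' esA xsA \<and> built n (\<lambda>i. shB w (X i)) 7 8 a' esB xsB)"
  have "hwp L 19 buildP (v, tob L h, 0) ?Q" if v: "v 0 = real n" for v
  proof (rule hwp_buildP[where v = v and a = "tob L h" and n = n and L = L and X = X and J = "depth n", OF v n(2) L(1) less_depth a0 injX])
    fix v' :: vars and a' :: arrs and k' :: nat and w esA xsA esB xsB
    assume "coords n (\<lambda>i. shA w (X i)) 1 2 a'" "coords n (\<lambda>i. shB w (X i)) 3 4 a'"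
      "built n (\<lambda>i. shA w (X i)) 5 6 a' esA xsA" "built n (\<lambda>i. shB w (X i)) 7 8 a' esB xsB"
      "k' \<le> 0 + (26 * n + 2 + 2 * (n * depth n))"
    then show "?Q (v', a', k')" unfolding prod.case by auto
  qed
  from exec_buildC[where r = r and h = h and n = n and L = L and Q = ?Q, OF r0 L_def this]
  obtain t r' D v' a k where x: "exec (19 * L) buildC (r, h) t (r', D)" "r' 0 = real (9 * L)" "r' 1 = real (5 * L)" "r' 2 = real (7 * L)"
    and Q: "?Q (v', a, k)" and D: "\<forall>q<19. \<forall>i<L. D (q * L + i) = a (real q) (real i)" and t: "t \<le> hsz buildP * (1 + k) + 10" by blast
  from Q obtain w esA xsA esB xsB where k: "k \<le> 26 * n + 2 + 2 * (n * depth n)"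
    and c: "coords n (\<lambda>i. shA w (X i)) 1 2 a" "coords n (\<lambda>i. shB w (X i)) 3 4 a"
    and bA: "built n (\<lambda>i. shA w (X i)) 5 6 a esA xsA" and bB: "built n (\<lambda>i. shB w (X i)) 7 8 a esB xsB" by auto
  let ?PA = "\<lambda>i. shA w (X i)" and ?PB = "\<lambda>i. shB w (X i)"
  have "hsz buildP * (1 + k) \<le> hsz buildP * (27 * n + 3 + 2 * (n * depth n))" using k by (intro mult_le_mono2) simp
  then have tT: "t \<le> hsz buildP * (27 * n + 3 + 2 * (n * depth n)) + 10" using t by simp
  obtain lbA prA where A: "tarr n lbA prA 5 6 a" "spanning_tree (set ps) (tree_edges ps xsA)"
    "\<And>i j. i < n \<Longrightarrow> j < n \<Longrightarrow> length (climb n lbA prA i j) \<le> n \<and> climb n lbA prA i j \<noteq> [] \<and> set (climb n lbA prA i j) \<subseteq> {..<n} \<and>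
      is_path (set ps) (tree_edges ps xsA) (ps ! i) (map ((!) ps) (climb n lbA prA i j)) (ps ! j) \<and>
      (\<forall>d. conn ?PA (set esA) i j d \<longrightarrow> clen ?PA n lbA prA i j \<le> d)"
    using built_tree[OF bA n(1,3)] by blast
  obtain lbB prB where B: "tarr n lbB prB 7 8 a" "spanning_tree (set ps) (tree_edges ps xsB)"
    "\<And>i j. i < n \<Longrightarrow> j < n \<Longrightarrow> length (climb n lbB prB i j) \<le> n \<and> climb n lbB prB i j \<noteq> [] \<and> set (climb n lbB prB i j) \<subseteq> {..<n} \<and>
      is_path (set ps) (tree_edges ps xsB) (ps ! i) (map ((!) ps) (climb n lbB prB i j)) (ps ! j) \<and>
      (\<forall>d. conn ?PB (set esB) i j d \<longrightarrow> clen ?PB n lbB prB i j \<le> d)"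
    using built_tree[OF bB n(1,3)] by blast
  have edges: "stores_edges D (q * L) (9 * L) ps (tree_edges ps xs)"
    if "stored n xs (int q) l a" "strip n S [] xs" "q < 8" for q xs l S
    unfolding stores_edges_def
  proof (intro exI[of _ xs] conjI)
    have len: "length xs + 1 = n" and ok: "edges_ok n xs" using strip_final[OF that(2)] by blast+
    show "length xs = length ps - 1" using len n(1) by simp
    have "q * L + L \<le> 9 * L" using mult_le_mono1[of "q + 1" 9 L] that(3) by simp
    then show "q * L + 2 * length xs \<le> 9 * L" using len L(2) by linarith
    show "\<forall>(i, j)\<in>set xs. i < length ps \<and> j < length ps" using ok n(1) by (auto simp: edges_ok_def)
    show "tree_edges ps xs = (\<lambda>(i, j). {ps ! i, ps ! j}) ` set xs" by (simp add: tree_edges_def)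
    show "\<forall>k<length xs. D (q * L + 2 * k) = real (fst (xs ! k)) \<and> D (q * L + 2 * k + 1) = real (snd (xs ! k))"
    proof (intro allI impI)
      fix k assume kx: "k < length xs"
      have kL: "2 * k < L" "2 * k + 1 < L" "q < 19" using kx len L(2) that(3) by linarith+
      have "D (q * L + 2 * k) = a (real q) (real (2 * k))" "D (q * L + (2 * k + 1)) = a (real q) (real (2 * k + 1))"
        using D kL by blast+
      moreover have "a (of_int (int q)) (real (2 * k)) = real (fst (xs ! k))" "a (of_int (int q)) (real (2 * k + 1)) = real (snd (xs ! k))"
        using that(1) kx unfolding stored_def by blast+
      ultimately show "D (q * L + 2 * k) = real (fst (xs ! k)) \<and> D (q * L + 2 * k + 1) = real (snd (xs ! k))"
        unfolding of_int_of_nat_eq add.assoc by simp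
    qed
  qed
  have sA: "stores_edges D (5 * L) (9 * L) ps (tree_edges ps xsA)" using edges[of xsA 5 6] bA unfolding built_def by auto
  have sB: "stores_edges D (7 * L) (9 * L) ps (tree_edges ps xsB)" using edges[of xsB 7 8] bB unfolding built_def by auto
  have query: "answers_query queryC (19 * L) (\<lambda>m. hsz queryP * (1 + 2 * (m + 1)) + 5) (4 * sqrt 26) ps D (9 * L)
      (tree_edges ps xsA) (tree_edges ps xsB) i j" if ij: "i < n" "j < n" for i j
    unfolding answers_query_def
  proof (intro allI impI)
    fix s g :: "nat \<Rightarrow> real"
    assume sg: "s 0 = real (9 * L) \<and> s 1 = real i \<and> s 2 = real j \<and> (\<forall>k<9 * L. g k = D k)"
    define \<pi> where "\<pi> = (if sep (?PA i) (?PA j) < sep (?PB i) (?PB j) then climb n lbA prA i j else climb n lbB prB i j)"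
    have p: "length \<pi> \<le> n" "\<pi> \<noteq> []" "set \<pi> \<subseteq> {..<n}" using A(3)[OF ij] B(3)[OF ij] by (simp_all add: \<pi>_def)
    have g: "g (q * L + y) = a (real q) (real y)" if "q < 9" "y < L" for q y
    proof -
      have "q * L + y < 9 * L" by (rule addr_less[OF that])
      then show ?thesis using sg D that by simp
    qed
    have pL: "length \<pi> \<le> L" using p(1) L by simp
    obtain t r' h' where e: "exec (19 * L) queryC (s, g) t (r', h')" "\<forall>k<9 * L. h' k = g k" "r' 0 = real (9 * L)"
      "r' 1 = real (length \<pi>)" "\<forall>k<length \<pi>. h' (9 * L + k) = real (\<pi> ! k)" "t \<le> hsz queryP * (1 + 2 * length \<pi>) + 5"
      using exec_queryC[where r = s and h = g and a = a, OF _ _ _ ij L(2) g c A(1) B(1) \<pi>_def pL] sg by blast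
    let ?\<pi> = "map ((!) ps) \<pi>"
    have "is_path (set ps) (tree_edges ps xsA) (ps ! i) ?\<pi> (ps ! j) \<or> is_path (set ps) (tree_edges ps xsB) (ps ! i) ?\<pi> (ps ! j)"
      using A(3)[OF ij] B(3)[OF ij] by (simp add: \<pi>_def)
    moreover have "stores_path h' (9 * L) ps ?\<pi>"
      unfolding stores_path_def
    proof (intro allI impI)
      fix k assume "k < length ?\<pi>"
      then have k: "k < length \<pi>" by simp
      have "\<pi> ! k \<in> {..<n}" using p(3) nth_mem[OF k] by blast
      then have "\<pi> ! k < length ps" using n(1) by simp
      then show "\<exists>i<length ps. h' (9 * L + k) = real i \<and> ?\<pi> ! k = ps ! i" using e(5) k by (intro exI[of _ "\<pi> ! k"]) simp
    qed
    moreover have "has_stretch (4 * sqrt 26) (ps ! i) ?\<pi> (ps ! j)"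
    proof (cases "i = j")
      case True
      then have "\<pi> = [i]" by (simp add: \<pi>_def climb_same)
      then show ?thesis by (simp add: has_stretch_def path_length_def)
    next
      case False
      then have ne: "X i \<noteq> X j" using inj_onD[OF injX] ij by auto
      have dA: "dist (?PA x) (?PA y) = 1 * dist (ps ! x) (ps ! y)" for x y unfolding dist_sh(1) X_def dist_xy ..
      have dB: "dist (?PB x) (?PB y) = sqrt 2 * dist (ps ! x) (ps ! y)" for x y unfolding dist_sh(2) X_def dist_xy ..
      have "ps ! i \<noteq> ps ! j" using ne by (auto simp: X_def)
      then have dn: "dist (ps ! i) (ps ! j) \<noteq> 0" by simp
      have neAB: "?PA i \<noteq> ?PA j" "?PB i \<noteq> ?PB j" using dA[of i j] dB[of i j] dn by auto
      have nn: "nonneg (?PA i)" "nonneg (?PA j)" "nonneg (?PB i)" "nonneg (?PB j)" using c ij by (simp_all add: coords_def)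
      have rot: "?PB u = rot (?PA u)" for u by (simp add: shA_def shB_def rot_def)
      have pg: "pair_good ?PA (set esA) i j" "pair_good ?PB (set esB) i j" using bA bB ij by (simp_all add: built_def)
      note tc = tree_choice[where PA = ?PA and PB = ?PB and a = i and b = j, OF nn neAB rot rot pg]
      show ?thesis
      proof (cases "sep (?PA i) (?PA j) < sep (?PB i) (?PB j)")
        case True
        then have "conn ?PA (set esA) i j (4 * sqrt 26 * dist (?PA i) (?PA j))" using tc by simp
        then have "clen ?PA n lbA prA i j \<le> 4 * sqrt 26 * dist (?PA i) (?PA j)" using A(3)[OF ij] by blast
        moreover have "clen ?PA n lbA prA i j = 1 * clen ((!) ps) n lbA prA i j" by (rule path_length_scale) (rule dA)
        ultimately show ?thesis using True dA[of i j] by (simp add: has_stretch_def \<pi>_def)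
      next
        case False
        then have "conn ?PB (set esB) i j (4 * sqrt 26 * dist (?PB i) (?PB j))" using tc by simp
        then have "clen ?PB n lbB prB i j \<le> 4 * sqrt 26 * dist (?PB i) (?PB j)" using B(3)[OF ij] by blast
        \<comment> \<open>The rotated frame stretches all lengths by \<open>sqrt 2\<close>; the
          factor occurs on both sides and cancels.\<close>
        moreover have "clen ?PB n lbB prB i j = sqrt 2 * clen ((!) ps) n lbB prB i j" by (rule path_length_scale) (rule dB)
        ultimately have "sqrt 2 * clen ((!) ps) n lbB prB i j \<le> sqrt 2 * (4 * sqrt 26 * dist (ps ! i) (ps ! j))"
          using dB[of i j] by (simp only: mult.left_commute mult.assoc)
        then have "clen ((!) ps) n lbB prB i j \<le> 4 * sqrt 26 * dist (ps ! i) (ps ! j)" by (rule mult_left_le_imp_le) simp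
        then show ?thesis using False by (simp add: has_stretch_def \<pi>_def)
      qed
    qed
    moreover have "t \<le> hsz queryP * (1 + 2 * (num_edges ?\<pi> + 1)) + 5"
    proof -
      have "num_edges ?\<pi> + 1 = length \<pi>" using p(2) by (cases \<pi>) (simp_all add: num_edges_def)
      then show ?thesis using e(6) by (simp only:)
    qed
    moreover have "9 * L + length ?\<pi> \<le> 19 * L" using pL by simp
    moreover have "\<forall>k<9 * L. h' k = D k" using e(2) sg by simp
    moreover have "r' 1 = real (length ?\<pi>)" using e(4) by simp
    ultimately show "\<exists>t r' h' b \<pi>.
           exec (19 * L) queryC (s, g) t (r', h') \<and> (\<forall>k<9 * L. h' k = D k) \<and>
           r' 0 = real b \<and> r' 1 = real (length \<pi>) \<and> b + length \<pi> \<le> 19 * L \<and> stores_path h' b ps \<pi> \<and>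
           (is_path (set ps) (tree_edges ps xsA) (ps ! i) \<pi> (ps ! j) \<or> is_path (set ps) (tree_edges ps xsB) (ps ! i) \<pi> (ps ! j)) \<and>
           has_stretch (4 * sqrt 26) (ps ! i) \<pi> (ps ! j) \<and> t \<le> hsz queryP * (1 + 2 * (num_edges \<pi> + 1)) + 5"
      using e(1,3) by blast
  qed
  show ?thesis
    unfolding two_tree_oracle_def rh L_def[symmetric]
  proof (intro exI conjI)
    show "exec (19 * L) buildC (r, h) t (r', D)" by (rule x(1))
    show "\<forall>i<length ps. \<forall>j<length ps. answers_query queryC (19 * L) (\<lambda>m. hsz queryP * (1 + 2 * (m + 1)) + 5) (4 * sqrt 26) ps D (9 * L)
      (tree_edges ps xsA) (tree_edges ps xsB) i j" using query n(1) by simp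
    show "9 * L \<le> 19 * L" by simp
  qed (rule x tT A B sA sB)+
qed

text \<open>The bounds are those of \<open>oracle_nonempty\<close> at \<open>n = 0\<close>. No query
  arises, and a tree without vertices has an empty list of edges.\<close>

lemma oracle_empty:
  "two_tree_oracle buildC queryC (hsz buildP * 3 + 10) (19 * 8) Q s ([] :: (real^2) list)"
proof -
  obtain r h where rh: "input_state [] = (r, h)" by (cases "input_state []") auto
  have r0: "r 0 = real 0" using rh by (auto simp: input_state_def)
  let ?Q = "(\<lambda>(v', a', k'). k' = 0) :: hst \<Rightarrow> bool"
  have hw: "hwp 8 19 buildP (v, tob 8 h, 0) ?Q" if "v 0 = real 0" for v
    using that by (simp add: buildP_def)
  have L8: "8 = 4 * 0 + (8 :: nat)" by simp
  from exec_buildC[where r = r and h = h and n = 0 and L = 8 and Q = ?Q, OF r0 L8 hw]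
  obtain t r' D v' a k where x: "exec (19 * 8) buildC (r, h) t (r', D)" "r' 0 = real (9 * 8)" "r' 1 = real (5 * 8)" "r' 2 = real (7 * 8)"
    and q: "?Q (v', a, k)" and t: "t \<le> hsz buildP * (1 + k) + 10" by blast
  have "k = 0" using q by simp
  note t = this t
  have st: "spanning_tree (set ([] :: (real^2) list)) {}" by (auto simp: spanning_tree_def is_cycle_def)
  have se: "stores_edges D (b * 8) (9 * 8) ([] :: (real^2) list) {}" if "b < 9" for b using that by (simp add: stores_edges_def)
  have tt: "t \<le> hsz buildP * 3 + 10" using t by simp
  show ?thesis
    unfolding two_tree_oracle_def rh
    by (rule exI[of _ t], rule exI[of _ r'], rule exI[of _ D], rule exI[of _ "9 * 8"], rule exI[of _ "5 * 8"], rule exI[of _ "7 * 8"],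
        rule exI[of _ "{}"], rule exI[of _ "{}"]) (use x tt st se[of 5] se[of 7] in simp)
qed

theorem theorem3p2:
  shows "\<exists>(pre :: com) (qry :: com) (T :: nat \<Rightarrow> nat) (M :: nat \<Rightarrow> nat) (Q :: nat \<Rightarrow> nat).
    (\<lambda>n. real (T n)) \<in> O(\<lambda>n. real n * ln (real n)) \<and>
    (\<lambda>n. real (M n)) \<in> O(\<lambda>n. real n) \<and>
    (\<lambda>m. real (Q m)) \<in> O(\<lambda>m. real m) \<and>
    (\<forall>P :: (real^2) set. finite P \<longrightarrow>
      (\<forall>ps. set ps = P \<and> distinct ps \<longrightarrow>
        two_tree_oracle pre qry (T (card P)) (M (card P)) Q (4 * sqrt 26) ps))"
proof -
  let ?T = "\<lambda>n. hsz buildP * (27 * n + 3 + 2 * (n * depth n)) + 10"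
  let ?M = "\<lambda>n. 19 * (4 * n + 8)"
  let ?Q = "\<lambda>m. hsz queryP * (1 + 2 * (m + 1)) + 5"
  have M: "(\<lambda>n. real (?M n)) \<in> O(\<lambda>n. real n)"
    by (rule bigoI[where c = 228], rule eventually_sequentiallyI[of 1]) simp
  have Q: "(\<lambda>m. real (?Q m)) \<in> O(\<lambda>m. real m)"
  proof (rule bigoI[where c = "5 * real (hsz queryP) + 5"], rule eventually_sequentiallyI[of 1])
    fix m :: nat assume m: "1 \<le> m"
    then have "hsz queryP * (1 + 2 * (m + 1)) \<le> hsz queryP * (5 * m)" by (intro mult_le_mono2) simp
    moreover have "5 \<le> 5 * m" using m by simp
    ultimately have "?Q m \<le> hsz queryP * (5 * m) + 5 * m" by (rule add_mono)
    also have "\<dots> = (5 * hsz queryP + 5) * m" by (simp add: algebra_simps)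
    finally have "?Q m \<le> (5 * hsz queryP + 5) * m" .
    then have "real (?Q m) \<le> real ((5 * hsz queryP + 5) * m)" by (rule of_nat_mono)
    then show "norm (real (?Q m)) \<le> (5 * real (hsz queryP) + 5) * norm (real m)" by simp
  qed
  have main: "two_tree_oracle buildC queryC (?T (card P)) (?M (card P)) ?Q (4 * sqrt 26) ps" if "set ps = P" "distinct ps" for P and ps :: "(real^2) list"
  proof -
    have card: "card P = length ps" using that distinct_card by blast
    show ?thesis
    proof (cases "length ps = 0")
      case True
      then show ?thesis unfolding card using oracle_empty by simp
    next
      case False
      then show ?thesis unfolding card using oracle_nonempty[OF refl _ that(2)] by simp
    qed
  qed
  show ?thesis
  proof (rule exI[of _ buildC], rule exI[of _ queryC], rule exI[of _ ?T], rule exI[of _ ?M], rule exI[of _ ?Q], intro conjI allI impI)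
    show "two_tree_oracle buildC queryC (?T (card P)) (?M (card P)) ?Q (4 * sqrt 26) ps" if "set ps = P \<and> distinct ps" for P ps
      using main that by blast
  qed (rule build_time M Q)+
qed

end
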